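(* Let $A^\epsilon(x)=\{a_1\chi_{\omega_{A^\epsilon}}(x)+a_2(1-\chi_{\omega_{A^\epsilon}}(x))\}I$ with $\chi_{\omega_{A^\epsilon}}\rightharpoonup\theta_A$ in $L^\infty(\Omega)$ weak*, and $A^\epsilon\xrightarrow{H}A^{*}$ in $\Omega$. Let $B^\epsilon(x)=b(x)I\in\mathcal{M}(b_1,b_2;\Omega)$, with $b\in L^\infty(\Omega)$ independent of $\epsilon$, converge to $B^{\#}$ relative to $A^\epsilon$. Then for almost every $x\in\Omega$, $$\mathrm{tr}\left\{b(x)\,(a_2I-A^{*}(x))\,(a_2B^{\#}(x)-b(x)A^{*}(x))^{-1}\,(a_2I-A^{*}(x))\right\}\le N\,\theta_A(x)\,(a_2-a_1).$$
   Context: $\Omega\subset\mathbb{R}^N$ is a bounded open set, $0<a_1<a_2<\infty$, $0<b_1\le b_2<\infty$; $\omega_{A^\epsilon}\subset\Omega$ are measurable sets, $\chi_\omega$ denotes a characteristic function, and $0\le\theta_A(x)\le 1$ a.e. in $\Omega$. $\mathcal{M}(\alpha,\beta;\Omega)$ is the set of measurable real symmetric $N\times N$ matrix fields $A(x)$ on $\Omega$ with $(A(x)\xi,\xi)\ge\alpha|\xi|^2$ and $|A(x)\xi|\le\beta|\xi|$ for all $\xi\in\mathbb{R}^N$, a.e. $x$. A test sequence for $A^\epsilon$ is a sequence $u^\epsilon\rightharpoonup u$ weakly in $H^1(\Omega)$ with $-\mathrm{div}(A^\epsilon\nabla u^\epsilon)$ strongly convergent in $H^{-1}(\Omega)$.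 $A^\epsilon\xrightarrow{H}A^{*}$ means $A^\epsilon\nabla u^\epsilon\rightharpoonup A^{*}\nabla u$ weakly in $L^2(\Omega)$ for all such test sequences. $B^\epsilon$ converges to $B^{\#}$ relative to $A^\epsilon$ (written $B^\epsilon\xrightarrow{A^\epsilon}B^{\#}$) means $B^\epsilon\nabla u^\epsilon\cdot\nabla u^\epsilon\rightharpoonup B^{\#}\nabla u\cdot\nabla u$ in $\mathcal{D}'(\Omega)$ for all such test sequences.
   Formalization: H-convergence is read with test sequences along subsequences too and with A* in some M(α,β;Ω); with whole sequences only the claim fails (laminates alternating on a fat Cantor product). B^# is taken symmetric in L^∞; where θ_A=0 the undefined inverse is multiplied by 0. *)

theory Defs
  imports "HOL-Analysis.Analysis"
begin

section \<open>Test functions and Lebesgue spaces\<close>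

definition partial_deriv :: "'n \<Rightarrow> (real^'n \<Rightarrow> real) \<Rightarrow> real^'n \<Rightarrow> real" where
  "partial_deriv i f x = frechet_derivative f (at x) (axis i 1)"

primrec C_k :: "nat \<Rightarrow> (real^'n \<Rightarrow> real) \<Rightarrow> bool" where
  "C_k 0 f \<longleftrightarrow> continuous_on UNIV f"
| "C_k (Suc k) f \<longleftrightarrow> (\<forall>x. f differentiable (at x)) \<and> (\<forall>i. C_k k (partial_deriv i f))"

definition test_functions :: "(real^'n) set \<Rightarrow> (real^'n \<Rightarrow> real) set" where
  "test_functions \<Omega> =
     {\<phi>. (\<forall>k. C_k k \<phi>) \<and> compact (closure {x. \<phi> x \<noteq> 0}) \<and> closure {x. \<phi> x \<noteq> 0} \<subseteq> \<Omega>}"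

text \<open>Elements of the Lebesgue and Sobolev spaces are represented by functions, not by
  almost-everywhere classes; their values outside \<open>\<Omega>\<close> are irrelevant.\<close>

definition L1 :: "'a::euclidean_space set \<Rightarrow> ('a \<Rightarrow> real) set" where
  "L1 \<Omega> = {f. integrable (lebesgue_on \<Omega>) f}"

definition L1_loc :: "'a::euclidean_space set \<Rightarrow> ('a \<Rightarrow> real) set" where
  "L1_loc \<Omega> = {f. \<forall>K. compact K \<and> K \<subseteq> \<Omega> \<longrightarrow> integrable (lebesgue_on K) f}"

definition L2 :: "'a::euclidean_space set \<Rightarrow> ('a \<Rightarrow> 'b::euclidean_space) set" where
  "L2 \<Omega> = {f. f \<in> borel_measurable (lebesgue_on \<Omega>) \<and>
               integrable (lebesgue_on \<Omega>) (\<lambda>x. (norm (f x))\<^sup>2)}"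

definition Linf :: "'a::euclidean_space set \<Rightarrow> ('a \<Rightarrow> 'b::euclidean_space) set" where
  "Linf \<Omega> = {f. f \<in> borel_measurable (lebesgue_on \<Omega>) \<and>
                 (\<exists>C. AE x in lebesgue_on \<Omega>. norm (f x) \<le> C)}"

definition L2_inner ::
  "'a::euclidean_space set \<Rightarrow> ('a \<Rightarrow> 'b::euclidean_space) \<Rightarrow> ('a \<Rightarrow> 'b) \<Rightarrow> real" where
  "L2_inner \<Omega> f g = (LINT x|lebesgue_on \<Omega>. f x \<bullet> g x)"

definition L2_weakly_converges ::
  "'a::euclidean_space set \<Rightarrow> (nat \<Rightarrow> 'a \<Rightarrow> 'b::euclidean_space) \<Rightarrow> ('a \<Rightarrow> 'b) \<Rightarrow> bool" where
  "L2_weakly_converges \<Omega> f f0 \<longleftrightarrow>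
     (\<forall>n. f n \<in> L2 \<Omega>) \<and> f0 \<in> L2 \<Omega> \<and>
     (\<forall>g\<in>L2 \<Omega>. (\<lambda>n. L2_inner \<Omega> (f n) g) \<longlonglongrightarrow> L2_inner \<Omega> f0 g)"

definition Linf_weak_star_converges ::
  "'a::euclidean_space set \<Rightarrow> (nat \<Rightarrow> 'a \<Rightarrow> real) \<Rightarrow> ('a \<Rightarrow> real) \<Rightarrow> bool" where
  "Linf_weak_star_converges \<Omega> f f0 \<longleftrightarrow>
     (\<forall>n. f n \<in> Linf \<Omega>) \<and> f0 \<in> Linf \<Omega> \<and>
     (\<forall>g\<in>L1 \<Omega>. (\<lambda>n. LINT x|lebesgue_on \<Omega>. f n x * g x)
                   \<longlonglongrightarrow> (LINT x|lebesgue_on \<Omega>. f0 x * g x))"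

definition distr_converges ::
  "(real^'n) set \<Rightarrow> (nat \<Rightarrow> real^'n \<Rightarrow> real) \<Rightarrow> (real^'n \<Rightarrow> real) \<Rightarrow> bool" where
  "distr_converges \<Omega> f f0 \<longleftrightarrow>
     (\<forall>n. f n \<in> L1_loc \<Omega>) \<and> f0 \<in> L1_loc \<Omega> \<and>
     (\<forall>\<phi>\<in>test_functions \<Omega>. (\<lambda>n. LINT x|lebesgue_on \<Omega>. f n x * \<phi> x)
                              \<longlonglongrightarrow> (LINT x|lebesgue_on \<Omega>. f0 x * \<phi> x))"

section \<open>Sobolev spaces\<close>

definition has_weak_gradient ::
  "(real^'n) set \<Rightarrow> (real^'n \<Rightarrow> real) \<Rightarrow> (real^'n \<Rightarrow> real^'n) \<Rightarrow> bool" where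
  "has_weak_gradient \<Omega> u G \<longleftrightarrow>
     (\<forall>\<phi>\<in>test_functions \<Omega>. \<forall>i.
        (LINT x|lebesgue_on \<Omega>. u x * partial_deriv i \<phi> x) =
        - (LINT x|lebesgue_on \<Omega>. G x $ i * \<phi> x))"

definition H1 :: "(real^'n) set \<Rightarrow> (real^'n \<Rightarrow> real) set" where
  "H1 \<Omega> = {u. u \<in> L2 \<Omega> \<and> (\<exists>G\<in>L2 \<Omega>. has_weak_gradient \<Omega> u G)}"

text \<open>The weak gradient is determined only up to null sets; all uses below are insensitive
  to the choice of representative.\<close>

definition weak_grad :: "(real^'n) set \<Rightarrow> (real^'n \<Rightarrow> real) \<Rightarrow> real^'n \<Rightarrow> real^'n" where
  "weak_grad \<Omega> u = (SOME G. G \<in> L2 \<Omega> \<and> has_weak_gradient \<Omega> u G)"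

definition H1_inner :: "(real^'n) set \<Rightarrow> (real^'n \<Rightarrow> real) \<Rightarrow> (real^'n \<Rightarrow> real) \<Rightarrow> real" where
  "H1_inner \<Omega> u v = L2_inner \<Omega> u v + L2_inner \<Omega> (weak_grad \<Omega> u) (weak_grad \<Omega> v)"

definition H1_norm :: "(real^'n) set \<Rightarrow> (real^'n \<Rightarrow> real) \<Rightarrow> real" where
  "H1_norm \<Omega> u = sqrt (H1_inner \<Omega> u u)"

definition H1_weakly_converges ::
  "(real^'n) set \<Rightarrow> (nat \<Rightarrow> real^'n \<Rightarrow> real) \<Rightarrow> (real^'n \<Rightarrow> real) \<Rightarrow> bool" where
  "H1_weakly_converges \<Omega> u u0 \<longleftrightarrow>
     (\<forall>n. u n \<in> H1 \<Omega>) \<and> u0 \<in> H1 \<Omega> \<and>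
     (\<forall>v\<in>H1 \<Omega>. (\<lambda>n. H1_inner \<Omega> (u n) v) \<longlonglongrightarrow> H1_inner \<Omega> u0 v)"

definition H10 :: "(real^'n) set \<Rightarrow> (real^'n \<Rightarrow> real) set" where
  "H10 \<Omega> = {v \<in> H1 \<Omega>. \<exists>\<phi>. (\<forall>k::nat. \<phi> k \<in> test_functions \<Omega>) \<and>
                 (\<lambda>k. H1_norm \<Omega> (\<lambda>x. v x - \<phi> k x)) \<longlonglongrightarrow> 0}"

text \<open>\<open>H\<^sup>-\<^sup>1\<close> is the dual of \<open>H\<^sup>1\<^sub>0\<close>; only the values of a functional on \<^term>\<open>H10 \<Omega>\<close> matter.\<close>

definition Hm1 :: "(real^'n) set \<Rightarrow> ((real^'n \<Rightarrow> real) \<Rightarrow> real) set" where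
  "Hm1 \<Omega> = {F. (\<forall>u\<in>H10 \<Omega>. \<forall>v\<in>H10 \<Omega>. F (\<lambda>x. u x + v x) = F u + F v) \<and>
                (\<forall>c. \<forall>v\<in>H10 \<Omega>. F (\<lambda>x. c * v x) = c * F v) \<and>
                (\<exists>C. \<forall>v\<in>H10 \<Omega>. \<bar>F v\<bar> \<le> C * H1_norm \<Omega> v)}"

definition Hm1_norm :: "(real^'n) set \<Rightarrow> ((real^'n \<Rightarrow> real) \<Rightarrow> real) \<Rightarrow> real" where
  "Hm1_norm \<Omega> F = (SUP v\<in>{v \<in> H10 \<Omega>. H1_norm \<Omega> v \<le> 1}. \<bar>F v\<bar>)"

definition Hm1_convergent ::
  "(real^'n) set \<Rightarrow> (nat \<Rightarrow> (real^'n \<Rightarrow> real) \<Rightarrow> real) \<Rightarrow> bool" where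
  "Hm1_convergent \<Omega> F \<longleftrightarrow>
     (\<forall>n. F n \<in> Hm1 \<Omega>) \<and>
     (\<exists>f\<in>Hm1 \<Omega>. (\<lambda>n. Hm1_norm \<Omega> (\<lambda>v. F n v - f v)) \<longlonglongrightarrow> 0)"

text \<open>The distribution \<open>- div q\<close> of a square-integrable field \<open>q\<close>, as an element of \<open>H\<^sup>-\<^sup>1\<close>.\<close>

definition neg_div ::
  "(real^'n) set \<Rightarrow> (real^'n \<Rightarrow> real^'n) \<Rightarrow> (real^'n \<Rightarrow> real) \<Rightarrow> real" where
  "neg_div \<Omega> q v = L2_inner \<Omega> q (weak_grad \<Omega> v)"

section \<open>H-convergence and relative convergence\<close>

type_synonym 'n matrix_field = "real^'n \<Rightarrow> real^'n^'n"

definition mat_class :: "real \<Rightarrow> real \<Rightarrow> (real^'n) set \<Rightarrow> 'n matrix_field set" where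
  "mat_class \<alpha> \<beta> \<Omega> =
     {A. A \<in> borel_measurable (lebesgue_on \<Omega>) \<and>
         (AE x in lebesgue_on \<Omega>. transpose (A x) = A x \<and>
            (\<forall>\<xi>. (A x *v \<xi>) \<bullet> \<xi> \<ge> \<alpha> * (norm \<xi>)\<^sup>2 \<and> norm (A x *v \<xi>) \<le> \<beta> * norm \<xi>))}"

definition test_sequence ::
  "(real^'n) set \<Rightarrow> (nat \<Rightarrow> 'n matrix_field) \<Rightarrow> (nat \<Rightarrow> real^'n \<Rightarrow> real) \<Rightarrow> (real^'n \<Rightarrow> real) \<Rightarrow> bool"
  where
  "test_sequence \<Omega> A u u0 \<longleftrightarrow>
     H1_weakly_converges \<Omega> u u0 \<and>
     Hm1_convergent \<Omega> (\<lambda>n. neg_div \<Omega> (\<lambda>x. A n x *v weak_grad \<Omega> (u n) x))"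

text \<open>The parameter tends to zero along a sequence indexed by \<open>nat\<close>. As usual in homogenization,
  test sequences for H-convergence may be taken along subsequences. With whole sequences
  only, a sequence alternating between two microstructures that differ on a totally disconnected
  set of positive measure may have so few test sequences that the limit is not determined
  there. Since \<open>A\<^sup>*\<close> belongs to some class \<open>mat_class \<alpha> \<beta> \<Omega>\<close> with \<open>\<alpha> > 0\<close>, the notion below
  agrees with Murat-Tartar H-convergence.\<close>

definition H_converges ::
  "(real^'n) set \<Rightarrow> (nat \<Rightarrow> 'n matrix_field) \<Rightarrow> 'n matrix_field \<Rightarrow> bool" where
  "H_converges \<Omega> A Astar \<longleftrightarrow>
     (\<exists>\<alpha> \<beta>. 0 < \<alpha> \<and> \<alpha> \<le> \<beta> \<and> Astar \<in> mat_class \<alpha> \<beta> \<Omega>) \<and>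
     (\<forall>r u u0. strict_mono r \<longrightarrow> test_sequence \<Omega> (\<lambda>k. A (r k)) u u0 \<longrightarrow>
        L2_weakly_converges \<Omega> (\<lambda>k x. A (r k) x *v weak_grad \<Omega> (u k) x)
                               (\<lambda>x. Astar x *v weak_grad \<Omega> u0 x))"

text \<open>No subsequences are needed here: if \<open>A\<close> H-converges, every test sequence along a subsequence
  has the same local limits as the restriction of a whole test sequence. Symmetry
  of \<open>B\<^sup>#\<close> is a normalisation, as \<open>B\<^sup>#\<nabla>u \<bullet> \<nabla>u\<close> sees only the symmetric part.\<close>

definition converges_relative ::
  "(real^'n) set \<Rightarrow> (nat \<Rightarrow> 'n matrix_field) \<Rightarrow> (nat \<Rightarrow> 'n matrix_field) \<Rightarrow> 'n matrix_field \<Rightarrow> bool"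
  where
  "converges_relative \<Omega> A B Bsharp \<longleftrightarrow>
     Bsharp \<in> Linf \<Omega> \<and> (AE x in lebesgue_on \<Omega>. transpose (Bsharp x) = Bsharp x) \<and>
     (\<forall>u u0. test_sequence \<Omega> A u u0 \<longrightarrow>
        distr_converges \<Omega>
          (\<lambda>n x. (B n x *v weak_grad \<Omega> (u n) x) \<bullet> weak_grad \<Omega> (u n) x)
          (\<lambda>x. (Bsharp x *v weak_grad \<Omega> u0 x) \<bullet> weak_grad \<Omega> u0 x))"

definition two_phase :: "real \<Rightarrow> real \<Rightarrow> (real^'n) set \<Rightarrow> 'n matrix_field" where
  "two_phase a1 a2 \<omega> x =
     (a1 * indicat_real \<omega> x + a2 * (1 - indicat_real \<omega> x)) *\<^sub>R mat 1"

end

theory Submission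
  imports Defs "HOL-Complex_Analysis.Great_Picard" "HOL-Computational_Algebra.Polynomial"
begin

text \<open>For a test function \<open>\<phi>\<close> let \<open>u\<^sup>\<epsilon> \<in> H\<^sup>1\<^sub>0(\<Omega>)\<close> solve \<open>div (A\<^sup>\<epsilon> \<nabla>u\<^sup>\<epsilon>) = div (A\<^sup>* \<nabla>\<phi>)\<close>. By H-convergence this is a test
  sequence with limit \<open>\<phi>\<close>. Write \<open>A\<^sup>\<epsilon> = a\<^sup>\<epsilon> I\<close>. Since \<open>a\<^sub>1 \<le> a\<^sup>\<epsilon> \<le> a\<^sub>2\<close>, both \<open>b (a\<^sub>2 - a\<^sup>\<epsilon>) |\<nabla>u\<^sup>\<epsilon> - \<eta>|\<^sup>2\<close> and
  \<open>b (a\<^sup>\<epsilon> - a\<^sub>1) |\<nabla>u\<^sup>\<epsilon> - \<eta>|\<^sup>2\<close> are nonnegative. The energies \<open>a\<^sup>\<epsilon> |\<nabla>u\<^sup>\<epsilon>|\<^sup>2\<close> and \<open>b |\<nabla>u\<^sup>\<epsilon>|\<^sup>2\<close> converge only as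
  distributions, while \<open>b\<close> is merely bounded; the products with \<open>b\<close> converge as well because \<open>|\<nabla>u\<^sup>\<epsilon>|\<^sup>2\<close> is locally
  equi-integrable (Caccioppoli's inequality and a stopping-time argument). In the limit, with
  \<open>M = a\<^sub>2 B\<^sup># - b A\<^sup>*\<close> and \<open>P = a\<^sub>2 I - A\<^sup>*\<close>, the first quantity gives, almost everywhere and for all \<open>\<xi>, \<eta>\<close>,
  \<open>M \<xi> \<bullet> \<xi> - 2 b P \<xi> \<bullet> \<eta> + b \<theta>\<^sub>A (a\<^sub>2 - a\<^sub>1) |\<eta>|\<^sup>2 \<ge> 0\<close>. The second one shows that \<open>M\<close> is invertible where
  \<open>\<theta>\<^sub>A > 0\<close>; then \<open>\<xi> = b M\<^sup>-\<^sup>1 P \<eta>\<close>, summed over an orthonormal basis of vectors \<open>\<eta>\<close>, is the claim. Where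
  \<open>\<theta>\<^sub>A = 0\<close> the first inequality forces \<open>P = 0\<close>.\<close>

section \<open>Minimisation and weak compactness in Hilbert spaces\<close>

text \<open>All \<open>u\<^sup>\<epsilon>\<close> solve equations with one and the same right-hand
  side, so strong convergence in H^-1 is free; only the weak limit must be identified, and the
  ellipticity of \<open>Astar\<close> does that. The obstacle is the class of weights: nonnegativity
  almost everywhere is read off by testing with indicators of arbitrary measurable sets times
  \<open>b\<close>, whereas relative convergence and the div-curl argument give limits against
  smooth weights only. Since the coefficients are merely measurable, regularity of solutions is no
  help; Caccioppoli's inequality alone yields an L log L type decay of the squared gradient, and
  this serves in place of a better integrability exponent. The two nonnegative quantities are the
  cases (s, t) = (-1, a2) and (1, -a1) of one expression with the factor s a + t, so the limit
  passage is done once. Gradients of test functions must finally reach every vector at almost every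
  point outside one null set: affine functions times a bump, with parameters in a countable dense
  set, achieve this.\<close>

lemma linear_le_quadratic_imp_zero:
  fixes p q :: real
  assumes "\<And>t. 0 \<le> t * p + t\<^sup>2 * q"
  shows "p = 0"
proof (rule ccontr)
  assume "p \<noteq> 0"
  \<comment> \<open>With r = |q| + 1, this choice gives t p + t^2 |q| = - p^2 / r + p^2 (r - 1) /
    r^2 = - p^2 / r^2.\<close>
  define t where "t = - p / (\<bar>q\<bar> + 1)"
  define r where "r = \<bar>q\<bar> + 1"
  have r: "0 < r" "\<bar>q\<bar> = r - 1" by (auto simp: r_def)
  have "t * p + t\<^sup>2 * q \<le> t * p + t\<^sup>2 * \<bar>q\<bar>"
    by (simp add: mult_left_mono)
  also have "\<dots> = - (p\<^sup>2 / r\<^sup>2)"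
    unfolding t_def r_def[symmetric] r(2) using r(1) by (simp add: field_simps power2_eq_square)
  also have "\<dots> < 0"
    using \<open>p \<noteq> 0\<close> r by simp
  finally show False
    using assms[of t] by simp
qed

text \<open>A minimising sequence of \<open>a v v - 2 F v\<close> on \<open>S\<close> is Cauchy by the parallelogram law.\<close>

lemma coercive_minimiser:
  fixes a :: "'a::{real_inner,complete_space} \<Rightarrow> 'a \<Rightarrow> real"
  assumes a: "bounded_bilinear a" and sym: "\<And>u v. a u v = a v u"
    and S: "subspace S" and \<alpha>: "0 < \<alpha>" "\<And>v. v \<in> S \<Longrightarrow> \<alpha> * (norm v)\<^sup>2 \<le> a v v"
    and F_add: "\<And>u v. u \<in> S \<Longrightarrow> v \<in> S \<Longrightarrow> F (u + v) = F u + F v"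
    and F_scale: "\<And>c v. v \<in> S \<Longrightarrow> F (c *\<^sub>R v) = c * F v"
    and F_bound: "\<And>v. v \<in> S \<Longrightarrow> \<bar>F v\<bar> \<le> C * norm v"
  obtains u where "u \<in> closure S" "\<And>v. v \<in> S \<Longrightarrow> a u v = F v"
proof -
  interpret bounded_bilinear a by fact
  define J where "J v = a v v - 2 * F v" for v
  have "0 \<in> S" using S by (rule subspace_0)
  \<comment> \<open>Completing the square in \<open>norm v\<close>: coercivity beats the linear
    term.\<close>
  have lower: "- (C\<^sup>2 / \<alpha>) \<le> J v" if "v \<in> S" for v
  proof -
    have "0 \<le> (\<alpha> * norm v - C)\<^sup>2 / \<alpha>" using \<alpha> by simp
    also have "\<dots> = \<alpha> * (norm v)\<^sup>2 - 2 * (C * norm v) + C\<^sup>2 / \<alpha>"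
      using \<alpha> by (simp add: power2_eq_square field_simps)
    finally show ?thesis
      unfolding J_def using \<alpha>(2)[OF that] F_bound[OF that] by (simp add: abs_le_iff)
  qed
  define m where "m = Inf (J ` S)"
  have bdd: "bdd_below (J ` S)" using lower by (auto intro!: bdd_belowI)
  have m_le: "m \<le> J v" if "v \<in> S" for v
    unfolding m_def using bdd that by (auto intro: cInf_lower)
  have "\<exists>v\<in>S. J v < m + 1 / real (Suc k)" for k
  proof -
    have "Inf (J ` S) < m + 1 / real (Suc k)" unfolding m_def by simp
    then show ?thesis using cInf_lessD[of "J ` S"] \<open>0 \<in> S\<close> by blast
  qed
  then obtain v where vS: "\<And>k. v k \<in> S" and vJ: "\<And>k. J (v k) < m + 1 / real (Suc k)" by metis
  have par: "\<alpha> * (norm (x - y))\<^sup>2 \<le> 2 * (J x - m) + 2 * (J y - m)" if "x \<in> S" "y \<in> S" for x y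
  proof -
    let ?h = "(1/2) *\<^sub>R (x + y)"
    have h: "?h \<in> S" using S that by (simp add: subspace_add subspace_scale)
    have "F ?h = (F x + F y) / 2"
      using that S by (simp add: F_scale F_add subspace_add del: scaleR_add_right)
    then have "J ?h = (a x x + 2 * a x y + a y y) / 4 - (F x + F y)"
      using sym[of y x]
      by (simp add: J_def add_left add_right scaleR_left scaleR_right field_simps)
    moreover have "a (x - y) (x - y) = a x x - 2 * a x y + a y y"
      using sym[of y x] by (simp add: diff_left diff_right)
    moreover have "\<alpha> * (norm (x - y))\<^sup>2 \<le> a (x - y) (x - y)"
      using that S by (intro \<alpha>(2)) (simp add: subspace_diff)
    ultimately show ?thesis
      using m_le[OF h] by (simp add: J_def field_simps)
  qed
  have "Cauchy v"
  proof (rule metric_CauchyI)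
    fix e :: real assume "0 < e"
    then have "0 < \<alpha> * e\<^sup>2 / 4" using \<alpha> by simp
    then obtain M where M: "inverse (real (Suc M)) < \<alpha> * e\<^sup>2 / 4"
      using reals_Archimedean by blast
    have small: "J (v k) - m < \<alpha> * e\<^sup>2 / 4" if "k \<ge> M" for k
    proof -
      have "1 / real (Suc k) \<le> inverse (real (Suc M))" using that by (simp add: divide_simps)
      then show ?thesis using vJ[of k] M by linarith
    qed
    have "dist (v i) (v j) < e" if "i \<ge> M" "j \<ge> M" for i j
    proof -
      have "\<alpha> * (norm (v i - v j))\<^sup>2 < \<alpha> * e\<^sup>2"
        using par[OF vS vS, of i j] small[OF that(1)] small[OF that(2)] by (simp add: field_simps)
      then have "(norm (v i - v j))\<^sup>2 < e\<^sup>2" using \<alpha> by simp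
      then show ?thesis using \<open>0 < e\<close> by (simp add: dist_norm power_less_imp_less_base)
    qed
    then show "\<exists>M. \<forall>i\<ge>M. \<forall>j\<ge>M. dist (v i) (v j) < e" by blast
  qed
  \<comment> \<open>\<open>S\<close> may fail to be closed and \<open>F\<close> is controlled on
    \<open>S\<close> only, so \<open>u\<close> lies in the closure and the equation is obtained as a
    limit along \<open>v\<close>, never by evaluating \<open>J u\<close>.\<close>
  then obtain u where u: "v \<longlonglongrightarrow> u" using Cauchy_convergent_iff convergent_def by blast
  have "u \<in> closure S" using u vS closure_sequential by blast
  moreover have "a u z = F z" if z: "z \<in> S" for z
  proof -
    \<comment> \<open>First variation: comparing \<open>J (v k + t z)\<close> with the near-infimum
      \<open>J (v k)\<close> leaves an error 1 / (k + 1), which vanishes in the limit; both signs of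
      \<open>t\<close> then force the linear coefficient to be zero.\<close>
    have "0 \<le> t * (2 * (a u z - F z)) + t\<^sup>2 * a z z" for t
    proof -
      have "0 \<le> 1 / real (Suc k) + t * (2 * (a (v k) z - F z)) + t\<^sup>2 * a z z" for k
      proof -
        have "v k + t *\<^sub>R z \<in> S" using S z vS by (simp add: subspace_add subspace_scale)
        from m_le[OF this] vJ[of k] show ?thesis
          using sym[of z "v k"] S z vS
          by (simp add: J_def F_add F_scale subspace_scale add_left add_right scaleR_left scaleR_right
              power2_eq_square algebra_simps)
      qed
      moreover have "(\<lambda>k. 1 / real (Suc k) + t * (2 * (a (v k) z - F z)) + t\<^sup>2 * a z z)
          \<longlonglongrightarrow> 0 + t * (2 * (a u z - F z)) + t\<^sup>2 * a z z"
        by (intro tendsto_intros tendsto u LIMSEQ_Suc[OF lim_1_over_n])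
      ultimately show ?thesis using LIMSEQ_le_const by fastforce
    qed
    then show ?thesis using linear_le_quadratic_imp_zero by fastforce
  qed
  ultimately show thesis using that by blast
qed

lemma subspace_closure_approx:
  fixes S :: "'a::real_normed_vector set"
  assumes "x \<in> closure S" "0 < e"
  obtains y where "y \<in> S" "norm (x - y) < e"
proof -
  obtain y where "y \<in> S" "dist y x < e"
    using assms unfolding closure_approachable by blast
  then show thesis by (intro that[of y]) (auto simp: dist_norm norm_minus_commute)
qed

text \<open>A diagonal extraction handles the countably many vectors of the sequence itself, hence
  their span. Every other vector is seen by the sequence only through its projection onto the closed
  span, so no separability of the space enters.\<close>

lemma bounded_weakly_convergent_subseq:
  fixes x :: "nat \<Rightarrow> 'a::{real_inner,complete_space}"
  assumes bound: "\<And>n. norm (x n) \<le> C"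
  obtains r y where "strict_mono r" "y \<in> closure (span (range x))"
    "\<And>z. (\<lambda>n. inner (x (r n)) z) \<longlonglongrightarrow> inner y z"
proof -
  have C: "0 \<le> C" using bound[of 0] norm_ge_zero order_trans by blast
  have "norm (inner (x n) z) \<le> C * C" if "z \<in> range x" for n z
  proof -
    have "norm (inner (x n) z) \<le> norm (x n) * norm z" using Cauchy_Schwarz_ineq2 by simp
    also have "\<dots> \<le> C * C" using that bound C by (intro mult_mono) auto
    finally show ?thesis .
  qed
  then obtain r where r: "strict_mono r"
    and lim: "\<And>z. z \<in> range x \<Longrightarrow> \<exists>l. (\<lambda>n. inner (x (r n)) z) \<longlonglongrightarrow> l"
    using function_convergent_subsequence[of "range x" "\<lambda>n z. inner (x n) z"] by (metis countable_image uncountable_infinite countableI_type)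
  let ?S = "span (range x)"
  have conv: "convergent (\<lambda>n. inner (x (r n)) z)" if "z \<in> ?S" for z
  proof (rule span_induct[OF that])
    show "subspace {z. convergent (\<lambda>n. inner (x (r n)) z)}"
      by (auto simp: subspace_def inner_add_right convergent_const
          intro!: convergent_add convergent_mult[OF convergent_const])
  qed (use lim in \<open>auto simp: convergent_def\<close>)
  define F where "F z = lim (\<lambda>n. inner (x (r n)) z)" for z
  have F: "(\<lambda>n. inner (x (r n)) z) \<longlonglongrightarrow> F z" if "z \<in> ?S" for z
    unfolding F_def using conv[OF that] by (simp add: convergent_LIMSEQ_iff)
  have Fb: "\<bar>F z\<bar> \<le> C * norm z" if "z \<in> ?S" for z
  proof (rule LIMSEQ_le_const2[OF tendsto_rabs[OF F[OF that]]])
    have "\<bar>inner (x (r n)) z\<bar> \<le> C * norm z" for n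
      using Cauchy_Schwarz_ineq2[of "x (r n)" z] mult_right_mono[OF bound[of "r n"], of "norm z"] by simp
    then show "\<exists>N. \<forall>n\<ge>N. \<bar>inner (x (r n)) z\<bar> \<le> C * norm z" by blast
  qed
  have Fadd: "F (u + v) = F u + F v" if "u \<in> ?S" "v \<in> ?S" for u v
    using tendsto_add[OF F F, OF that] F[OF span_add[OF that]] by (simp add: inner_add_right LIMSEQ_unique)
  have Fsc: "F (c *\<^sub>R v) = c * F v" if "v \<in> ?S" for c v
    using tendsto_mult_left[OF F, OF that, of c] F[OF span_scale[OF that], of c]
    by (simp add: LIMSEQ_unique)
  \<comment> \<open>Riesz representation of the limit functional: the minimiser for the inner
    product, which is coercive with constant 1.\<close>
  obtain y where y: "y \<in> closure ?S" "\<And>v. v \<in> ?S \<Longrightarrow> inner y v = F v"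
    using coercive_minimiser[OF bounded_bilinear_inner inner_commute subspace_span, of 1 "range x" F C]
      Fadd Fsc Fb by (auto simp: power2_norm_eq_inner)
  have "(\<lambda>n. inner (x (r n)) z) \<longlonglongrightarrow> inner y z" for z
  proof -
    \<comment> \<open>\<open>p\<close> is the orthogonal projection of \<open>z\<close> onto the
      closed span, again obtained as a minimiser.\<close>
    obtain p where p: "p \<in> closure ?S" "\<And>v. v \<in> ?S \<Longrightarrow> inner p v = inner z v"
      using coercive_minimiser[OF bounded_bilinear_inner inner_commute subspace_span, of 1 "range x" "inner z" "norm z"]
      by (auto simp: power2_norm_eq_inner inner_add_right Cauchy_Schwarz_ineq2)
    have orth: "inner w z = inner w p" if "w \<in> closure ?S" for w
    proof -
      have "closed {w. inner w z = inner w p}"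
        by (intro closed_Collect_eq continuous_intros)
      moreover have "?S \<subseteq> {w. inner w z = inner w p}" using p by (auto simp: inner_commute)
      ultimately show ?thesis using that closure_minimal by blast
    qed
    have xz: "inner (x n) z = inner (x n) p" for n
      by (intro orth) (meson closure_subset rangeI span_base subsetD)
    show ?thesis
      unfolding xz orth[OF y(1)]
    proof (rule LIMSEQ_I)
      fix e :: real assume "0 < e"
      \<comment> \<open>\<open>D\<close> bounds the sequence and its limit, so replacing
        \<open>p\<close> by a nearby \<open>v\<close> in the span costs at most e / 3 for each of
        them.\<close>
      define D where "D = C + norm y + 1"
      have D: "0 < D" "C \<le> D" "norm y \<le> D" using C by (auto simp: D_def add_nonneg_pos add_increasing)
      obtain v where v: "v \<in> ?S" "norm (p - v) < e / (3 * D)"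
        using subspace_closure_approx[OF p(1), of "e / (3 * D)"] \<open>0 < e\<close> D by auto
      have close: "\<bar>inner w p - inner w v\<bar> \<le> e / 3" if "norm w \<le> D" for w
      proof -
        have "\<bar>inner w (p - v)\<bar> \<le> norm w * norm (p - v)" by (rule Cauchy_Schwarz_ineq2)
        also have "\<dots> \<le> D * (e / (3 * D))" using that v D by (intro mult_mono) auto
        finally show ?thesis using D by (simp add: inner_diff_right)
      qed
      obtain N where N: "\<And>n. n \<ge> N \<Longrightarrow> norm (inner (x (r n)) v - inner y v) < e / 3"
        using LIMSEQ_D[OF F[OF v(1)], of "e/3"] \<open>0 < e\<close> y(2)[OF v(1)] by auto
      have "norm (inner (x (r n)) p - inner y p) < e" if "n \<ge> N" for n
        using N[OF that] close[of "x (r n)"] close[of y] D bound[of "r n"] unfolding real_norm_def by linarith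
      then show "\<exists>N. \<forall>n\<ge>N. norm (inner (x (r n)) p - inner y p) < e" by blast
    qed
  qed
  then show thesis using that r y(1) by blast
qed

section \<open>The Hilbert space of square-integrable functions\<close>

text \<open>The measure is a parameter because both \<open>lebesgue_on \<Omega>\<close> (for
  \<open>L2\<close>) and \<open>lebesgue\<close> (for the Hilbert space below) occur.\<close>

definition sq_integrable :: "'a measure \<Rightarrow> ('a \<Rightarrow> 'b::euclidean_space) \<Rightarrow> bool" where
  "sq_integrable M f \<longleftrightarrow> f \<in> borel_measurable M \<and> integrable M (\<lambda>x. (norm (f x))\<^sup>2)"

lemma L2_iff: "f \<in> L2 \<Omega> \<longleftrightarrow> sq_integrable (lebesgue_on \<Omega>) f"
  by (simp add: L2_def sq_integrable_def)

lemma sq_integrableD [dest]: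
  "sq_integrable M f \<Longrightarrow> f \<in> borel_measurable M"
  "sq_integrable M f \<Longrightarrow> integrable M (\<lambda>x. (norm (f x))\<^sup>2)"
  by (auto simp: sq_integrable_def)

lemma sq_integrable_bound:
  assumes g: "sq_integrable M g" and f: "f \<in> borel_measurable M"
    and le: "AE x in M. norm (f x) \<le> C * norm (g x)"
  shows "sq_integrable M f"
proof -
  have "integrable M (\<lambda>x. (norm (f x))\<^sup>2)"
  proof (rule Bochner_Integration.integrable_bound[of M "\<lambda>x. C\<^sup>2 * (norm (g x))\<^sup>2"])
    show "integrable M (\<lambda>x. C\<^sup>2 * (norm (g x))\<^sup>2)"
      using g by (auto simp: sq_integrable_def)
    show "(\<lambda>x. (norm (f x))\<^sup>2) \<in> borel_measurable M" using f by measurable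
    show "AE x in M. norm ((norm (f x))\<^sup>2) \<le> norm (C\<^sup>2 * (norm (g x))\<^sup>2)"
      using le
    proof eventually_elim
      case (elim x)
      then have "(norm (f x))\<^sup>2 \<le> (C * norm (g x))\<^sup>2" by (intro power_mono) auto
      then show ?case by (simp add: power_mult_distrib)
    qed
  qed
  with f show ?thesis by (simp add: sq_integrable_def)
qed

lemma sq_integrable_zero [simp]: "sq_integrable M (\<lambda>x. 0)"
  by (simp add: sq_integrable_def)

lemma norm_add_sq_le: "(norm (a + b :: 'a::real_normed_vector))\<^sup>2 \<le> 2 * (norm a)\<^sup>2 + 2 * (norm b)\<^sup>2"
proof -
  have "(norm (a + b))\<^sup>2 \<le> (norm a + norm b)\<^sup>2" by (intro power_mono norm_triangle_ineq) auto
  also have "\<dots> \<le> 2 * (norm a)\<^sup>2 + 2 * (norm b)\<^sup>2"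
    using sum_squares_bound[of "norm a" "norm b"] by (simp add: power2_sum)
  finally show ?thesis .
qed

lemma sq_integrable_add:
  assumes "sq_integrable M f" "sq_integrable M g"
  shows "sq_integrable M (\<lambda>x. f x + g x)"
proof -
  have "integrable M (\<lambda>x. (norm (f x + g x))\<^sup>2)"
  proof (rule Bochner_Integration.integrable_bound[of M "\<lambda>x. 2 * (norm (f x))\<^sup>2 + 2 * (norm (g x))\<^sup>2"])
    show "integrable M (\<lambda>x. 2 * (norm (f x))\<^sup>2 + 2 * (norm (g x))\<^sup>2)"
      using assms by (auto simp: sq_integrable_def)
    show "(\<lambda>x. (norm (f x + g x))\<^sup>2) \<in> borel_measurable M"
      using assms[THEN sq_integrableD(1)] by measurable
  qed (auto simp: norm_add_sq_le)
  then show ?thesis using assms by (auto simp: sq_integrable_def)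
qed

lemma sq_integrable_scaleR:
  "sq_integrable M f \<Longrightarrow> sq_integrable M (\<lambda>x. c *\<^sub>R f x)"
  by (rule sq_integrable_bound[where C="\<bar>c\<bar>"]) auto

lemma sq_integrable_minus: "sq_integrable M f \<Longrightarrow> sq_integrable M (\<lambda>x. - f x)"
  using sq_integrable_scaleR[of M f "-1"] by simp

lemma sq_integrable_diff:
  "sq_integrable M f \<Longrightarrow> sq_integrable M g \<Longrightarrow> sq_integrable M (\<lambda>x. f x - g x)"
  using sq_integrable_add[of M f "\<lambda>x. - g x"] sq_integrable_minus[of M g] by simp

lemma integrable_inner_sq:
  assumes "sq_integrable M f" "sq_integrable M g"
  shows "integrable M (\<lambda>x. f x \<bullet> g x)"
proof (rule Bochner_Integration.integrable_bound[of M "\<lambda>x. (norm (f x))\<^sup>2 + (norm (g x))\<^sup>2"])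
  show "integrable M (\<lambda>x. (norm (f x))\<^sup>2 + (norm (g x))\<^sup>2)"
    using assms by (auto simp: sq_integrable_def)
  show "(\<lambda>x. f x \<bullet> g x) \<in> borel_measurable M"
    using assms[THEN sq_integrableD(1)] by measurable
  have "norm (f x \<bullet> g x) \<le> norm ((norm (f x))\<^sup>2 + (norm (g x))\<^sup>2)" for x
    using Cauchy_Schwarz_ineq2[of "f x" "g x"] sum_squares_bound[of "norm (f x)" "norm (g x)"]
      mult_nonneg_nonneg[of "norm (f x)" "norm (g x)"]
    by simp
  then show "AE x in M. norm (f x \<bullet> g x) \<le> norm ((norm (f x))\<^sup>2 + (norm (g x))\<^sup>2)" by simp
qed

\<comment> \<open>A type cannot depend on \<open>\<Omega>\<close>, so the Hilbert space is taken on
  the whole space and fields on \<open>\<Omega>\<close> are extended by zero. The relation is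
  partial: functions that are not square-integrable lie outside its domain.\<close>
quotient_type (overloaded) ('a, 'b) l2 = "'a::euclidean_space \<Rightarrow> 'b::euclidean_space" / partial:
  "\<lambda>f g. sq_integrable lebesgue f \<and> sq_integrable lebesgue g \<and> (AE x in lebesgue. f x = g x)"
proof (rule part_equivpI)
  show "\<exists>f::'a \<Rightarrow> 'b. sq_integrable lebesgue f \<and> sq_integrable lebesgue f \<and> (AE x in lebesgue. f x = f x)"
    by (intro exI[of _ "\<lambda>x. 0"]) simp
qed (auto simp: symp_def transp_def elim: AE_mp)

instantiation l2 :: (euclidean_space, euclidean_space) real_vector
begin

lift_definition zero_l2 :: "('a, 'b) l2" is "\<lambda>x. 0" by simp
lift_definition plus_l2 :: "('a, 'b) l2 \<Rightarrow> ('a, 'b) l2 \<Rightarrow> ('a, 'b) l2" is "\<lambda>f g x. f x + g x"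
  by (auto intro: sq_integrable_add)
lift_definition minus_l2 :: "('a, 'b) l2 \<Rightarrow> ('a, 'b) l2 \<Rightarrow> ('a, 'b) l2" is "\<lambda>f g x. f x - g x"
  by (auto intro: sq_integrable_diff)
lift_definition uminus_l2 :: "('a, 'b) l2 \<Rightarrow> ('a, 'b) l2" is "\<lambda>f x. - f x"
  by (auto intro: sq_integrable_minus)
lift_definition scaleR_l2 :: "real \<Rightarrow> ('a, 'b) l2 \<Rightarrow> ('a, 'b) l2" is "\<lambda>c f x. c *\<^sub>R f x"
  by (auto intro: sq_integrable_scaleR)
instance
proof
  fix a b c :: "('a, 'b) l2" and s t :: real
  show "a + b + c = a + (b + c)" by transfer (auto simp: add.assoc intro!: sq_integrable_add)
  show "a + b = b + a" by transfer (auto simp: add.commute intro!: sq_integrable_add)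
  show "0 + a = a" by transfer auto
  show "- a + a = 0" by transfer (auto)
  show "a - b = a + - b" by transfer (auto intro!: sq_integrable_diff)
  show "s *\<^sub>R (a + b) = s *\<^sub>R a + s *\<^sub>R b"
    by transfer (auto simp: scaleR_add_right intro!: sq_integrable_add sq_integrable_scaleR)
  show "(s + t) *\<^sub>R a = s *\<^sub>R a + t *\<^sub>R a"
    by transfer (auto simp: scaleR_add_left intro!: sq_integrable_add sq_integrable_scaleR)
  show "s *\<^sub>R t *\<^sub>R a = (s * t) *\<^sub>R a" by transfer (auto intro!: sq_integrable_scaleR)
  show "1 *\<^sub>R a = a" by transfer auto
qed

end

instantiation l2 :: (euclidean_space, euclidean_space) real_inner
begin

lift_definition inner_l2 :: "('a, 'b) l2 \<Rightarrow> ('a, 'b) l2 \<Rightarrow> real" is "\<lambda>f g. LINT x|lebesgue. f x \<bullet> g x"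
proof (goal_cases)
  case (1 f f' g g')
  then have [measurable]: "f \<in> borel_measurable lebesgue" "f' \<in> borel_measurable lebesgue"
    "g \<in> borel_measurable lebesgue" "g' \<in> borel_measurable lebesgue" by auto
  show ?case using 1 by (intro integral_cong_AE) auto
qed
definition norm_l2 :: "('a, 'b) l2 \<Rightarrow> real" where "norm_l2 x = sqrt (inner x x)"
definition sgn_l2 :: "('a, 'b) l2 \<Rightarrow> ('a, 'b) l2" where "sgn_l2 x = x /\<^sub>R norm x"
definition dist_l2 :: "('a, 'b) l2 \<Rightarrow> ('a, 'b) l2 \<Rightarrow> real" where "dist_l2 x y = norm (x - y)"
definition uniformity_l2 :: "(('a, 'b) l2 \<times> ('a, 'b) l2) filter" where
  "uniformity_l2 = (INF e\<in>{0<..}. principal {(x, y). dist x y < e})"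
definition open_l2 :: "('a, 'b) l2 set \<Rightarrow> bool" where
  "open_l2 U = (\<forall>x\<in>U. eventually (\<lambda>(x', y). x' = x \<longrightarrow> y \<in> U) uniformity)"

instance
proof
  fix a b c :: "('a, 'b) l2" and s :: real and U :: "('a, 'b) l2 set"
  show "inner a b = inner b a" by transfer (simp add: inner_commute)
  show "inner (a + b) c = inner a c + inner b c"
    by transfer (simp add: inner_add_left integrable_inner_sq)
  show "inner (s *\<^sub>R a) b = s * inner a b" by transfer simp
  show "0 \<le> inner a a" by transfer (simp add: Bochner_Integration.integral_nonneg)
  show "inner a a = 0 \<longleftrightarrow> a = 0"
  proof transfer
    fix f :: "'a \<Rightarrow> 'b"
    assume f: "sq_integrable lebesgue f \<and> sq_integrable lebesgue f \<and> (AE x in lebesgue. f x = f x)"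
    then have "(LINT x|lebesgue. f x \<bullet> f x) = 0 \<longleftrightarrow> (AE x in lebesgue. f x \<bullet> f x = 0)"
      by (intro integral_nonneg_eq_0_iff_AE integrable_inner_sq) auto
    then show "(LINT x|lebesgue. f x \<bullet> f x) = 0 \<longleftrightarrow>
        sq_integrable lebesgue f \<and> sq_integrable lebesgue (\<lambda>x. 0::'b) \<and> (AE x in lebesgue. f x = 0)"
      using f by auto
  qed
  show "norm a = sqrt (inner a a)" by (simp add: norm_l2_def)
  show "sgn a = a /\<^sub>R norm a" by (simp add: sgn_l2_def)
  show "dist a b = norm (a - b)" by (simp add: dist_l2_def)
  show "uniformity = (INF e\<in>{0<..}. principal {(x :: ('a, 'b) l2, y). dist x y < e})"
    by (rule uniformity_l2_def)
  show "open U = (\<forall>x\<in>U. \<forall>\<^sub>F (x', y) in uniformity. x' = x \<longrightarrow> y \<in> U)" by (rule open_l2_def)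
qed

end

lemma rep_l2_sq: "sq_integrable lebesgue (rep_l2 X)"
  using Quotient_rep_reflp[OF Quotient_l2, of X] by simp

lemma rep_l2_measurable [measurable]: "rep_l2 X \<in> borel_measurable lebesgue"
  using rep_l2_sq[of X] by auto

lemma rep_l2_abs: "sq_integrable lebesgue f \<Longrightarrow> AE x in lebesgue. rep_l2 (abs_l2 f) x = f x"
  using Quotient_rep_abs[OF Quotient_l2, of f] by simp

lemma abs_rep_l2 [simp]: "abs_l2 (rep_l2 X) = X"
  by (rule Quotient_abs_rep[OF Quotient_l2])

lemma abs_l2_eqI:
  "sq_integrable lebesgue f \<Longrightarrow> sq_integrable lebesgue g \<Longrightarrow> AE x in lebesgue. f x = g x \<Longrightarrow> abs_l2 f = abs_l2 g"
  using Quotient_rel_abs[OF Quotient_l2, of f g] by simp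

lemma inner_abs_l2:
  "sq_integrable lebesgue f \<Longrightarrow> sq_integrable lebesgue g \<Longrightarrow>
    inner (abs_l2 f) (abs_l2 g) = (LINT x|lebesgue. f x \<bullet> g x)"
  by (rule inner_l2.abs_eq) simp_all

lemma inner_l2_eq: "inner X Y = (LINT x|lebesgue. rep_l2 X x \<bullet> rep_l2 Y x)"
  using inner_abs_l2[OF rep_l2_sq rep_l2_sq, of X Y] by simp

lemma norm_l2_sq: "(norm X)\<^sup>2 = (LINT x|lebesgue. (norm (rep_l2 X x))\<^sup>2)"
  by (simp add: power2_norm_eq_inner inner_l2_eq)

lemma norm_l2_sq_nn: "ennreal ((norm X)\<^sup>2) = (\<integral>\<^sup>+x. ennreal ((norm (rep_l2 X x))\<^sup>2) \<partial>lebesgue)"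
  unfolding norm_l2_sq using rep_l2_sq[of X]
  by (intro nn_integral_eq_integral[symmetric]) auto

lemma norm_abs_l2_sq:
  "sq_integrable lebesgue f \<Longrightarrow> (norm (abs_l2 f))\<^sup>2 = (LINT x|lebesgue. (norm (f x))\<^sup>2)"
  by (simp add: power2_norm_eq_inner inner_abs_l2)

lemma abs_l2_add:
  "sq_integrable lebesgue f \<Longrightarrow> sq_integrable lebesgue g \<Longrightarrow> abs_l2 f + abs_l2 g = abs_l2 (\<lambda>x. f x + g x)"
  by (rule plus_l2.abs_eq) simp_all

lemma abs_l2_diff:
  "sq_integrable lebesgue f \<Longrightarrow> sq_integrable lebesgue g \<Longrightarrow> abs_l2 f - abs_l2 g = abs_l2 (\<lambda>x. f x - g x)"
  by (rule minus_l2.abs_eq) simp_all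

lemma abs_l2_scaleR:
  "sq_integrable lebesgue f \<Longrightarrow> c *\<^sub>R abs_l2 f = abs_l2 (\<lambda>x. c *\<^sub>R f x)"
  by (rule scaleR_l2.abs_eq) simp_all

lemma rep_l2_add: "AE x in lebesgue. rep_l2 (X + Y) x = rep_l2 X x + rep_l2 Y x"
  using rep_l2_abs[OF sq_integrable_add[OF rep_l2_sq rep_l2_sq], of X Y]
    abs_l2_add[OF rep_l2_sq rep_l2_sq, of X Y] by simp

lemma rep_l2_diff: "AE x in lebesgue. rep_l2 (X - Y) x = rep_l2 X x - rep_l2 Y x"
  using rep_l2_abs[OF sq_integrable_diff[OF rep_l2_sq rep_l2_sq], of X Y]
    abs_l2_diff[OF rep_l2_sq rep_l2_sq, of X Y] by simp

lemma rep_l2_scaleR: "AE x in lebesgue. rep_l2 (c *\<^sub>R X) x = c *\<^sub>R rep_l2 X x"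
  using rep_l2_abs[OF sq_integrable_scaleR[OF rep_l2_sq], of c X] abs_l2_scaleR[OF rep_l2_sq, of c X] by simp

text \<open>If \<open>\<integral> |f\<^sub>k\<^sub>+\<^sub>1 - f\<^sub>k|\<^sup>2 \<le> 4\<^sup>-\<^sup>k\<close> then \<open>\<Sum> 2\<^sup>k |f\<^sub>k\<^sub>+\<^sub>1 - f\<^sub>k|\<^sup>2\<close> is integrable, hence almost everywhere
  \<open>|f\<^sub>k\<^sub>+\<^sub>1 - f\<^sub>k|\<close> is dominated by a geometric series.\<close>

lemma AE_convergent_of_fast_Cauchy:
  fixes f :: "nat \<Rightarrow> 'a \<Rightarrow> 'b::euclidean_space"
  assumes [measurable]: "\<And>k. f k \<in> borel_measurable M"
    and le: "\<And>k. (\<integral>\<^sup>+x. ennreal ((norm (f (Suc k) x - f k x))\<^sup>2) \<partial>M) \<le> ennreal ((1/4)^k)"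
  shows "AE x in M. convergent (\<lambda>k. f k x)"
proof -
  define d where "d k x = norm (f (Suc k) x - f k x)" for k x
  have [measurable]: "d k \<in> borel_measurable M" for k
    unfolding d_def by measurable
  have "(\<integral>\<^sup>+x. (\<Sum>k. ennreal (2^k * (d k x)\<^sup>2)) \<partial>M) = (\<Sum>k. \<integral>\<^sup>+x. ennreal (2^k * (d k x)\<^sup>2) \<partial>M)"
    by (rule nn_integral_suminf) measurable
  also have "\<dots> \<le> (\<Sum>k. ennreal ((1/2)^k))"
  proof (intro suminf_le allI summableI)
    fix k
    have "(\<integral>\<^sup>+x. ennreal (2^k * (d k x)\<^sup>2) \<partial>M) = ennreal (2^k) * (\<integral>\<^sup>+x. ennreal ((d k x)\<^sup>2) \<partial>M)"
      by (subst nn_integral_cmult[symmetric]) (auto simp: ennreal_mult'' )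
    also have "\<dots> \<le> ennreal (2^k) * ennreal ((1/4)^k)"
      using le[of k] by (intro mult_left_mono) (auto simp: d_def)
    also have "\<dots> = ennreal ((2 * (1/4))^k)"
      unfolding power_mult_distrib by (rule ennreal_mult[symmetric]) simp_all
    also have "\<dots> = ennreal ((1/2)^k)" by simp
    finally show "(\<integral>\<^sup>+x. ennreal (2^k * (d k x)\<^sup>2) \<partial>M) \<le> ennreal ((1/2)^k)" .
  qed
  also have "\<dots> = ennreal (\<Sum>k. (1/2)^k)"
    by (intro suminf_ennreal2) (auto intro: summable_geometric)
  also have "\<dots> < \<infinity>" by simp
  finally have "AE x in M. (\<Sum>k. ennreal (2^k * (d k x)\<^sup>2)) \<noteq> \<infinity>"
    by (intro nn_integral_noteq_infinite) auto
  then show ?thesis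
  proof eventually_elim
    case (elim x)
    define D where "D = enn2real (\<Sum>k. ennreal (2^k * (d k x)\<^sup>2))"
    have D: "(\<Sum>k. ennreal (2^k * (d k x)\<^sup>2)) = ennreal D" "0 \<le> D"
      using elim by (auto simp: D_def top.not_eq_extremum)
    have bound: "d k x \<le> sqrt D * (1 / sqrt 2)^k" for k
    proof -
      have "(\<Sum>k\<in>{k}. ennreal (2^k * (d k x)\<^sup>2)) \<le> (\<Sum>k. ennreal (2^k * (d k x)\<^sup>2))"
        by (rule sum_le_suminf) (rule summableI | simp)+
      then have "ennreal (2^k * (d k x)\<^sup>2) \<le> ennreal D" unfolding D(1) by simp
      then have "2^k * (d k x)\<^sup>2 \<le> D" using D(2) by (simp only: ennreal_le_iff)
      then have "sqrt (2^k * (d k x)\<^sup>2) \<le> sqrt D" by simp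
      then have "sqrt 2 ^ k * d k x \<le> sqrt D" by (simp add: real_sqrt_mult real_sqrt_power d_def)
      then show ?thesis by (simp add: power_divide field_simps)
    qed
    have "summable (\<lambda>k. f (Suc k) x - f k x)"
    proof (rule summable_comparison_test'[where N=0])
      show "summable (\<lambda>k. sqrt D * (1 / sqrt 2)^k)"
        by (intro summable_mult summable_geometric) (simp add: real_sqrt_gt_1_iff)
      show "norm (f (Suc k) x - f k x) \<le> sqrt D * (1 / sqrt 2)^k" for k
        using bound[of k] by (simp add: d_def)
    qed
    then have "convergent (\<lambda>n. \<Sum>k<n. f (Suc k) x - f k x)" by (simp add: summable_iff_convergent)
    moreover have "(\<Sum>k<n. f (Suc k) x - f k x) = f n x - f 0 x" for n
      by (rule sum_lessThan_telescope)
    ultimately have "convergent (\<lambda>n. f n x - f 0 x)" by simp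
    then show ?case by (simp add: convergent_diff_const_right_iff)
  qed
qed

lemma power_half_sq: "((1/2)^k)\<^sup>2 = (1/4 :: real)^k"
  by (induction k) (auto simp: power_mult_distrib power2_eq_square)

instance l2 :: (euclidean_space, euclidean_space) complete_space
proof
  fix X :: "nat \<Rightarrow> ('a, 'b) l2"
  assume X: "Cauchy X"
  have "\<exists>N. \<forall>m\<ge>N. \<forall>n\<ge>N. norm (X m - X n) < (1/2)^k" for k
    using CauchyD[OF X, of "(1/2)^k"] by simp
  then obtain N where N: "\<And>k m n. m \<ge> N k \<Longrightarrow> n \<ge> N k \<Longrightarrow> norm (X m - X n) < (1/2)^k" by metis
  \<comment> \<open>Summing the thresholds makes the indices nondecreasing while keeping
    \<open>r k\<close> above \<open>N k\<close>.\<close>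
  define r where "r k = (\<Sum>j\<le>k. N j)" for k
  have rN: "r k \<ge> N k" for k
    unfolding r_def by (rule member_le_sum) auto
  have r_mono: "r k \<le> r m" if "k \<le> m" for k m
    unfolding r_def using that by (intro sum_mono2) auto
  define f where "f k = rep_l2 (X (r k))" for k
  have [measurable]: "f k \<in> borel_measurable lebesgue" for k unfolding f_def by measurable
  have diff: "(\<integral>\<^sup>+x. ennreal ((norm (f k x - f m x))\<^sup>2) \<partial>lebesgue) = ennreal ((norm (X (r k) - X (r m)))\<^sup>2)" for k m
    unfolding norm_l2_sq_nn f_def
    by (intro nn_integral_cong_AE) (use rep_l2_diff[of "X (r k)" "X (r m)"] in eventually_elim, simp)
  have le4: "(\<integral>\<^sup>+x. ennreal ((norm (f k x - f m x))\<^sup>2) \<partial>lebesgue) \<le> ennreal ((1/4)^k)" if "m \<ge> k" for k m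
  proof -
    have "norm (X (r k) - X (r m)) \<le> (1/2)^k"
      using N[of k "r k" "r m"] rN[of k] r_mono[OF that] by simp
    then have "(norm (X (r k) - X (r m)))\<^sup>2 \<le> ((1/2)^k)\<^sup>2" by (intro power_mono) auto
    then show ?thesis unfolding diff power_half_sq by (rule ennreal_leI)
  qed
  have "AE x in lebesgue. convergent (\<lambda>k. f k x)"
    using le4[of k "Suc k" for k] by (intro AE_convergent_of_fast_Cauchy) (auto simp: norm_minus_commute)
  then have lim: "AE x in lebesgue. (\<lambda>k. f k x) \<longlonglongrightarrow> lim (\<lambda>k. f k x)"
    by eventually_elim (simp add: convergent_LIMSEQ_iff)
  define g where "g x = lim (\<lambda>k. f k x)" for x
  have [measurable]: "g \<in> borel_measurable lebesgue" unfolding g_def by measurable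
  \<comment> \<open>Fatou's lemma in the second index transfers the bound \<open>4^-k\<close> to the
    distance from the almost everywhere limit.\<close>
  have close: "(\<integral>\<^sup>+x. ennreal ((norm (f k x - g x))\<^sup>2) \<partial>lebesgue) \<le> ennreal ((1/4)^k)" for k
  proof -
    have "(\<integral>\<^sup>+x. ennreal ((norm (f k x - g x))\<^sup>2) \<partial>lebesgue)
        = (\<integral>\<^sup>+x. liminf (\<lambda>m. ennreal ((norm (f k x - f m x))\<^sup>2)) \<partial>lebesgue)"
    proof (intro nn_integral_cong_AE, use lim in eventually_elim)
      fix x assume "(\<lambda>k. f k x) \<longlonglongrightarrow> lim (\<lambda>k. f k x)"
      then have "(\<lambda>m. ennreal ((norm (f k x - f m x))\<^sup>2)) \<longlonglongrightarrow> ennreal ((norm (f k x - g x))\<^sup>2)"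
        unfolding g_def by (intro tendsto_intros)
      then show "ennreal ((norm (f k x - g x))\<^sup>2) = liminf (\<lambda>m. ennreal ((norm (f k x - f m x))\<^sup>2))"
        by (rule lim_imp_Liminf[OF sequentially_bot, symmetric])
    qed
    also have "\<dots> \<le> liminf (\<lambda>m. \<integral>\<^sup>+x. ennreal ((norm (f k x - f m x))\<^sup>2) \<partial>lebesgue)"
      by (intro nn_integral_liminf) measurable
    also have "\<dots> \<le> ennreal ((1/4)^k)"
      by (intro Liminf_le) (use le4 in \<open>auto simp: eventually_sequentially\<close>)
    finally show ?thesis .
  qed
  have fg: "sq_integrable lebesgue (\<lambda>x. f k x - g x)" for k
  proof -
    have "(\<integral>\<^sup>+x. ennreal ((norm (f k x - g x))\<^sup>2) \<partial>lebesgue) < \<infinity>"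
      using close[of k] by (rule le_less_trans) simp
    then have "integrable lebesgue (\<lambda>x. (norm (f k x - g x))\<^sup>2)"
      by (intro integrableI_nonneg) auto
    then show ?thesis by (simp add: sq_integrable_def)
  qed
  have g: "sq_integrable lebesgue g"
    using sq_integrable_diff[OF rep_l2_sq[of "X (r 0)"] fg[of 0, unfolded f_def]] by simp
  have Xg: "norm (X (r k) - abs_l2 g) \<le> (1/2)^k" for k
  proof -
    have "X (r k) - abs_l2 g = abs_l2 (\<lambda>x. f k x - g x)"
      using abs_l2_diff[OF rep_l2_sq g, of "X (r k)"] by (simp add: f_def)
    then have "ennreal ((norm (X (r k) - abs_l2 g))\<^sup>2) = (\<integral>\<^sup>+x. ennreal ((norm (f k x - g x))\<^sup>2) \<partial>lebesgue)"
      by (simp only: norm_abs_l2_sq[OF fg] nn_integral_eq_integral[OF sq_integrableD(2)[OF fg]] zero_le_power2 AE_I2)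
    with close[of k] have "ennreal ((norm (X (r k) - abs_l2 g))\<^sup>2) \<le> ennreal (((1/2)^k)\<^sup>2)"
      by (simp only: power_half_sq)
    then have "(norm (X (r k) - abs_l2 g))\<^sup>2 \<le> ((1/2)^k)\<^sup>2"
      by (simp only: ennreal_le_iff zero_le_power2)
    then show ?thesis by (rule power2_le_imp_le) simp
  qed
  have "X \<longlonglongrightarrow> abs_l2 g"
  proof (rule LIMSEQ_I)
    fix e :: real assume "0 < e"
    then obtain k where k: "(1/2)^k < e / 2" using real_arch_pow_inv[of "e/2" "1/2"] by auto
    have "norm (X n - abs_l2 g) < e" if "n \<ge> N k" for n
      using N[OF that rN] Xg[of k] k norm_triangle_ineq[of "X n - X (r k)" "X (r k) - abs_l2 g"] by simp
    then show "\<exists>N. \<forall>n\<ge>N. norm (X n - abs_l2 g) < e" by blast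
  qed
  then show "convergent X" by (auto simp: convergent_def)
qed

section \<open>Smooth functions and test functions\<close>

definition smooth :: "(real^'n \<Rightarrow> real) \<Rightarrow> bool" where
  "smooth f \<longleftrightarrow> (\<forall>k. C_k k f)"

definition grad :: "(real^'n \<Rightarrow> real) \<Rightarrow> real^'n \<Rightarrow> real^'n" where
  "grad f x = (\<chi> i. partial_deriv i f x)"

lemma C_k_SucD: "C_k (Suc k) f \<Longrightarrow> C_k k f"
proof (induction k arbitrary: f)
  case 0
  then show ?case
    by (auto intro!: differentiable_imp_continuous_on simp: differentiable_on_def)
next
  case (Suc k)
  have "C_k k (partial_deriv i f)" for i
    using Suc.prems by (intro Suc.IH) (simp del: C_k.simps(1))
  then show ?case using Suc.prems by simp
qed

lemma partial_deriv_eq: "(f has_derivative f') (at x) \<Longrightarrow> partial_deriv i f x = f' (axis i 1)"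
  unfolding partial_deriv_def by (simp add: frechet_derivative_at[symmetric])

lemma has_derivative_grad:
  assumes "f differentiable (at x)"
  shows "(f has_derivative (\<lambda>h. grad f x \<bullet> h)) (at x)"
proof -
  let ?D = "frechet_derivative f (at x)"
  have D: "(f has_derivative ?D) (at x)" using assms by (simp add: frechet_derivative_works)
  then interpret bounded_linear ?D by (rule has_derivative_bounded_linear)
  have "?D h = grad f x \<bullet> h" for h
  proof -
    have "?D h = ?D (\<Sum>i\<in>UNIV. h $ i *\<^sub>R axis i 1)" by (simp add: basis_expansion flip: scalar_mult_eq_scaleR)
    also have "\<dots> = (\<Sum>i\<in>UNIV. h $ i * ?D (axis i 1))" by (simp add: sum scaleR)
    also have "\<dots> = grad f x \<bullet> h"
      by (simp add: grad_def inner_vec_def partial_deriv_def mult.commute)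
    finally show ?thesis .
  qed
  then have "?D = (\<lambda>h. grad f x \<bullet> h)" by auto
  with D show ?thesis by simp
qed

lemma grad_eqI:
  assumes "(f has_derivative (\<lambda>h. v \<bullet> h)) (at x)"
  shows "grad f x = v"
  by (simp add: grad_def partial_deriv_eq[OF assms] inner_axis vec_eq_iff)

lemma partial_deriv_grad: "partial_deriv i f x = grad f x $ i"
  by (simp add: grad_def)

lemma C_k_const: "C_k k (\<lambda>x. c)"
proof (induction k arbitrary: c)
  case (Suc k)
  have "partial_deriv i (\<lambda>x. c) = (\<lambda>x::real^'a. 0)" for i
    by (rule ext, subst partial_deriv_eq[OF has_derivative_const]) simp
  then show ?case using Suc by simp
qed simp

lemma C_k_add: "C_k k f \<Longrightarrow> C_k k g \<Longrightarrow> C_k k (\<lambda>x. f x + g x)"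
proof (induction k arbitrary: f g)
  case 0
  then show ?case by (auto intro: continuous_on_add)
next
  case (Suc k)
  have "partial_deriv i (\<lambda>x. f x + g x) = (\<lambda>x. partial_deriv i f x + partial_deriv i g x)" for i
  proof
    fix x
    have "((\<lambda>x. f x + g x) has_derivative (\<lambda>h. grad f x \<bullet> h + grad g x \<bullet> h)) (at x)"
      using Suc.prems by (intro has_derivative_add has_derivative_grad) auto
    from partial_deriv_eq[OF this, of i]
    show "partial_deriv i (\<lambda>x. f x + g x) x = partial_deriv i f x + partial_deriv i g x"
      by (simp add: grad_def inner_axis)
  qed
  then show ?case using Suc by auto
qed

lemma C_k_mult: "C_k k f \<Longrightarrow> C_k k g \<Longrightarrow> C_k k (\<lambda>x. f x * g x)"
proof (induction k arbitrary: f g)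
  case 0
  then show ?case by (auto intro: continuous_on_mult)
next
  case (Suc k)
  have "partial_deriv i (\<lambda>x. f x * g x) = (\<lambda>x. f x * partial_deriv i g x + partial_deriv i f x * g x)" for i
  proof
    fix x
    have "((\<lambda>x. f x * g x) has_derivative (\<lambda>h. f x * (grad g x \<bullet> h) + (grad f x \<bullet> h) * g x)) (at x)"
      using Suc.prems by (intro has_derivative_mult has_derivative_grad) auto
    from partial_deriv_eq[OF this, of i]
    show "partial_deriv i (\<lambda>x. f x * g x) x = f x * partial_deriv i g x + partial_deriv i f x * g x"
      by (simp add: grad_def inner_axis)
  qed
  moreover have "C_k k (\<lambda>x. f x * partial_deriv i g x + partial_deriv i f x * g x)" for i
    using Suc.prems C_k_SucD[OF Suc.prems(1)] C_k_SucD[OF Suc.prems(2)]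
    by (intro C_k_add Suc.IH) auto
  ultimately show ?case using Suc.prems by auto
qed

lemma smooth_const [simp]: "smooth (\<lambda>x. c)" by (simp add: smooth_def C_k_const)
lemma smooth_add: "smooth f \<Longrightarrow> smooth g \<Longrightarrow> smooth (\<lambda>x. f x + g x)"
  by (simp add: smooth_def C_k_add)
lemma smooth_mult: "smooth f \<Longrightarrow> smooth g \<Longrightarrow> smooth (\<lambda>x. f x * g x)"
  by (simp add: smooth_def C_k_mult)
lemma smooth_diff: "smooth f \<Longrightarrow> smooth g \<Longrightarrow> smooth (\<lambda>x. f x - g x)"
  using smooth_add[of f "\<lambda>x. (-1) * g x"] smooth_mult[of "\<lambda>x. -1" g] by simp

lemma smooth_partial_deriv: "smooth f \<Longrightarrow> smooth (partial_deriv i f)"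
  unfolding smooth_def using C_k.simps(2) by blast

lemma smooth_differentiable: "smooth f \<Longrightarrow> f differentiable (at x)"
  unfolding smooth_def using C_k.simps(2) by blast

lemma smooth_continuous: "smooth f \<Longrightarrow> continuous_on S f"
  by (meson C_k.simps(1) continuous_on_subset smooth_def top_greatest)

lemma smooth_grad_continuous: "smooth f \<Longrightarrow> continuous_on S (grad f)"
  unfolding grad_def by (intro continuous_on_vec_lambda smooth_continuous smooth_partial_deriv)

lemma smooth_bounded_linear:
  assumes "bounded_linear f"
  shows "smooth f"
proof -
  have d: "(f has_derivative f) (at x)" for x using assms by (rule bounded_linear_imp_has_derivative)
  have "C_k k f" for k
  proof (cases k)
    case 0
    then show ?thesis using assms by (simp add: linear_continuous_on)
  next
    case (Suc m)
    have "partial_deriv i f = (\<lambda>x. f (axis i 1))" for i using partial_deriv_eq[OF d] by auto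
    then show ?thesis using Suc d by (auto simp: C_k_const differentiable_def)
  qed
  then show ?thesis by (simp add: smooth_def)
qed

lemma smooth_real_polynomial_function: "real_polynomial_function p \<Longrightarrow> smooth p"
  by (induction rule: real_polynomial_function.induct)
     (auto intro: smooth_bounded_linear smooth_add smooth_mult)

lemma smooth_inner: "smooth (\<lambda>x. v \<bullet> x)"
  by (rule smooth_bounded_linear) (rule bounded_linear_inner_right)

lemma smooth_sum: "finite I \<Longrightarrow> (\<And>i. i \<in> I \<Longrightarrow> smooth (f i)) \<Longrightarrow> smooth (\<lambda>x. \<Sum>i\<in>I. f i x)"
  by (induction I rule: finite_induct) (auto intro: smooth_add)

lemma grad_mult:
  "smooth f \<Longrightarrow> smooth g \<Longrightarrow> grad (\<lambda>x. f x * g x) x = f x *\<^sub>R grad g x + g x *\<^sub>R grad f x"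
  by (rule grad_eqI)
     (rule has_derivative_eq_rhs[OF has_derivative_mult[OF has_derivative_grad has_derivative_grad]],
       auto simp: smooth_differentiable inner_add_left)

lemma grad_add:
  "smooth f \<Longrightarrow> smooth g \<Longrightarrow> grad (\<lambda>x. f x + g x) x = grad f x + grad g x"
  by (rule grad_eqI)
     (rule has_derivative_eq_rhs[OF has_derivative_add[OF has_derivative_grad has_derivative_grad]],
       auto simp: smooth_differentiable inner_add_left)

lemma grad_const [simp]: "grad (\<lambda>x. c) x = 0"
  by (rule grad_eqI) simp

lemma grad_cmult: "smooth f \<Longrightarrow> grad (\<lambda>x. c * f x) x = c *\<^sub>R grad f x"
  using grad_mult[of "\<lambda>x. c" f x] by simp

lemma grad_diff:
  "smooth f \<Longrightarrow> smooth g \<Longrightarrow> grad (\<lambda>x. f x - g x) x = grad f x - grad g x"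
  using grad_add[of f "\<lambda>x. (-1) * g x" x] smooth_mult[of "\<lambda>x. -1" g] grad_cmult[of g "-1" x] by simp

lemma grad_inner [simp]: "grad (\<lambda>x. v \<bullet> x) x = v"
  by (rule grad_eqI) (auto intro!: derivative_eq_intros)

subsection \<open>Bump functions\<close>

text \<open>The polynomial factor closes the family under differentiation: the derivative of p(1/t)
  exp(-1/t) is q(1/t) exp(-1/t) with q = X^2 (p - p'). Smoothness is then an induction that never
  leaves the family.\<close>

definition flat_exp :: "real poly \<Rightarrow> real \<Rightarrow> real" where
  "flat_exp p t = (if 0 < t then poly p (inverse t) * exp (- inverse t) else 0)"

lemma tendsto_poly_mult_exp_minus: "((\<lambda>s::real. poly p s * exp (- s)) \<longlongrightarrow> 0) at_top"
proof -
  have "((\<lambda>s::real. \<Sum>i\<le>degree p. coeff p i * (s ^ i / exp s)) \<longlongrightarrow> (\<Sum>i\<le>degree p. coeff p i * 0)) at_top"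
    by (intro tendsto_sum tendsto_mult tendsto_const tendsto_power_div_exp_0)
  moreover have "poly p s * exp (- s) = (\<Sum>i\<le>degree p. coeff p i * (s ^ i / exp s))" for s :: real
    by (simp add: poly_altdef sum_distrib_right exp_minus divide_inverse mult.assoc)
  ultimately show ?thesis by simp
qed

lemma flat_exp_deriv:
  "(flat_exp p has_field_derivative flat_exp ([:0, 0, 1:] * (p - pderiv p)) t) (at t)"
proof (cases t "0::real" rule: linorder_cases)
  case less
  have "((\<lambda>t::real. 0::real) has_field_derivative 0) (at t)" by simp
  then have "(flat_exp p has_field_derivative 0) (at t)"
    by (rule has_field_derivative_transform_within_open[of _ _ _ "{..<0}"]) (use less in \<open>auto simp: flat_exp_def\<close>)
  then show ?thesis using less by (simp add: flat_exp_def)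
next
  case greater
  have "((\<lambda>t. poly p (inverse t) * exp (- inverse t)) has_field_derivative
      (poly ([:0, 0, 1:] * (p - pderiv p)) (inverse t) * exp (- inverse t))) (at t)"
    using greater
    by (auto intro!: derivative_eq_intros DERIV_chain2[OF poly_DERIV]
        simp: algebra_simps power2_eq_square)
  then have "(flat_exp p has_field_derivative
      (poly ([:0, 0, 1:] * (p - pderiv p)) (inverse t) * exp (- inverse t))) (at t)"
    by (rule has_field_derivative_transform_within_open[of _ _ _ "{0<..}"]) (use greater in \<open>auto simp: flat_exp_def\<close>)
  then show ?thesis using greater by (simp add: flat_exp_def)
next
  case equal
  have "((\<lambda>h. flat_exp p h / h) \<longlongrightarrow> 0) (at_left 0)"
    by (rule tendsto_eventually) (auto simp: flat_exp_def eventually_at_left_field intro: exI[of _ "-1"])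
  \<comment> \<open>Substituting s = 1 / h turns the difference quotient at the origin into s p(s)
    exp(-s), which explains \<open>pCons 0 p\<close>.\<close>
  moreover have "((\<lambda>h. flat_exp p h / h) \<longlongrightarrow> 0) (at_right 0)"
    unfolding filterlim_at_right_to_top
  proof (rule Lim_transform_eventually[OF tendsto_poly_mult_exp_minus[of "pCons 0 p"]])
    show "\<forall>\<^sub>F s in at_top. poly (pCons 0 p) s * exp (- s) = flat_exp p (inverse s) / inverse s"
      using eventually_gt_at_top[of 0] by eventually_elim (simp add: flat_exp_def field_simps)
  qed
  ultimately have "((\<lambda>h. flat_exp p h / h) \<longlongrightarrow> 0) (at 0)" by (rule filterlim_split_at)
  then show ?thesis using equal by (simp add: has_field_derivative_iff flat_exp_def)
qed

lemma smooth_flat_exp_compose: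
  assumes "smooth P"
  shows "smooth (\<lambda>x. flat_exp p (P x))"
proof -
  have der: "((\<lambda>x. flat_exp p (P x)) has_derivative
      (\<lambda>h. flat_exp ([:0, 0, 1:] * (p - pderiv p)) (P x) * (grad P x \<bullet> h))) (at x)" for p x
    using has_derivative_compose[OF has_derivative_grad[OF smooth_differentiable[OF assms]]
        flat_exp_deriv[unfolded has_field_derivative_def]]
    by (simp add: mult.commute)
  have "C_k k (\<lambda>x. flat_exp p (P x))" for k
  proof (induction k arbitrary: p)
    case 0
    show ?case unfolding C_k.simps using der
      by (meson continuous_at_imp_continuous_on has_derivative_continuous)
  next
    case (Suc k)
    have "partial_deriv i (\<lambda>x. flat_exp p (P x)) =
        (\<lambda>x. flat_exp ([:0, 0, 1:] * (p - pderiv p)) (P x) * partial_deriv i P x)" for i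
      using partial_deriv_eq[OF der] by (auto simp: partial_deriv_grad inner_axis)
    moreover have "C_k k (\<lambda>x. flat_exp ([:0, 0, 1:] * (p - pderiv p)) (P x) * partial_deriv i P x)" for i
      using Suc smooth_partial_deriv[OF assms, of i] by (intro C_k_mult) (auto simp: smooth_def)
    moreover have "(\<lambda>x. flat_exp p (P x)) differentiable (at x)" for x
      using der unfolding differentiable_def by blast
    ultimately show ?case by simp
  qed
  then show ?thesis by (simp add: smooth_def)
qed

text \<open>The squared distance keeps the formula smooth at the centre and
  \<open>flat_exp 1\<close> cuts it off smoothly at the sphere. There is no normalisation: what
  counts is positivity exactly on the ball and the bound 1.\<close>

definition bump :: "real^'n \<Rightarrow> real \<Rightarrow> real^'n \<Rightarrow> real" where
  "bump c r x = flat_exp 1 (r\<^sup>2 - (norm (x - c))\<^sup>2)"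

lemma smooth_norm_sq: "smooth (\<lambda>x::real^'n. (norm (x - c))\<^sup>2)"
proof -
  have "smooth (\<lambda>x::real^'n. \<Sum>i\<in>UNIV. (axis i 1 \<bullet> x - c $ i) * (axis i 1 \<bullet> x - c $ i))"
    by (intro smooth_sum smooth_mult smooth_diff smooth_inner smooth_const) simp
  moreover have "(norm (x - c))\<^sup>2 = (\<Sum>i\<in>UNIV. (axis i 1 \<bullet> x - c $ i) * (axis i 1 \<bullet> x - c $ i))" for x :: "real^'n"
    unfolding inner_axis' power2_norm_eq_inner by (simp add: inner_vec_def)
  ultimately show ?thesis by presburger
qed

lemma smooth_bump: "smooth (bump c r)"
  unfolding bump_def by (intro smooth_flat_exp_compose smooth_diff smooth_norm_sq smooth_const)

lemma bump_nonneg: "0 \<le> bump c r x" and bump_le1: "bump c r x \<le> 1"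
  by (auto simp: bump_def flat_exp_def)

lemma bump_pos_iff: "0 < r \<Longrightarrow> 0 < bump c r x \<longleftrightarrow> x \<in> ball c r"
  using power2_less_imp_less[of "norm (x - c)" r] power_strict_mono[of "norm (x - c)" r 2]
  by (auto simp: bump_def flat_exp_def dist_norm norm_minus_commute)

lemma bump_eq_0: "0 < r \<Longrightarrow> x \<notin> ball c r \<Longrightarrow> bump c r x = 0"
  using bump_pos_iff[of r c x] bump_nonneg[of c r x] by linarith

subsection \<open>Test functions\<close>

lemma test_functionI:
  assumes "smooth \<phi>" "compact K" "K \<subseteq> \<Omega>" "\<And>x. x \<notin> K \<Longrightarrow> \<phi> x = 0"
  shows "\<phi> \<in> test_functions \<Omega>"
proof -
  have "closure {x. \<phi> x \<noteq> 0} \<subseteq> K"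
    using assms(2,4) by (intro closure_minimal) (auto intro: compact_imp_closed)
  moreover from this have "compact (closure {x. \<phi> x \<noteq> 0})"
    using assms(2) by (metis closed_closure compact_Int_closed inf.absorb2)
  ultimately show ?thesis using assms by (auto simp: test_functions_def smooth_def)
qed

lemma test_functionE:
  assumes "\<phi> \<in> test_functions \<Omega>"
  obtains K where "smooth \<phi>" "compact K" "K \<subseteq> \<Omega>" "\<And>x. x \<notin> K \<Longrightarrow> \<phi> x = 0" "\<And>x. x \<notin> K \<Longrightarrow> grad \<phi> x = 0"
proof
  let ?K = "closure {x. \<phi> x \<noteq> 0}"
  show "smooth \<phi>" "compact ?K" "?K \<subseteq> \<Omega>" using assms by (auto simp: test_functions_def smooth_def)
  show "\<phi> x = 0" if "x \<notin> ?K" for x using that closure_subset by force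
  show "grad \<phi> x = 0" if "x \<notin> ?K" for x
  proof (rule grad_eqI)
    have "((\<lambda>x. 0) has_derivative (\<lambda>h. 0 \<bullet> h)) (at x)" by simp
    then show "(\<phi> has_derivative (\<lambda>h. 0 \<bullet> h)) (at x)"
      by (rule has_derivative_transform_within_open[of _ _ _ _ "- ?K"])
         (use that closure_subset[of "{x. \<phi> x \<noteq> 0}"] in \<open>auto\<close>)
  qed
qed

lemma test_function_smooth: "\<phi> \<in> test_functions \<Omega> \<Longrightarrow> smooth \<phi>"
  by (auto simp: test_functions_def smooth_def)

lemma test_function_outside: "\<phi> \<in> test_functions \<Omega> \<Longrightarrow> x \<notin> \<Omega> \<Longrightarrow> \<phi> x = 0"
  "\<phi> \<in> test_functions \<Omega> \<Longrightarrow> x \<notin> \<Omega> \<Longrightarrow> grad \<phi> x = 0"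
  by (auto elim!: test_functionE)

lemma test_function_add:
  assumes "\<phi> \<in> test_functions \<Omega>" "\<psi> \<in> test_functions \<Omega>"
  shows "(\<lambda>x. \<phi> x + \<psi> x) \<in> test_functions \<Omega>"
proof -
  obtain K L where "smooth \<phi>" "compact K" "K \<subseteq> \<Omega>" "\<And>x. x \<notin> K \<Longrightarrow> \<phi> x = 0"
    "smooth \<psi>" "compact L" "L \<subseteq> \<Omega>" "\<And>x. x \<notin> L \<Longrightarrow> \<psi> x = 0"
    using assms by (metis test_functionE)
  then show ?thesis by (intro test_functionI[of _ "K \<union> L"] smooth_add) auto
qed

lemma test_function_mult:
  assumes "\<phi> \<in> test_functions \<Omega>" "smooth \<psi>"
  shows "(\<lambda>x. \<psi> x * \<phi> x) \<in> test_functions \<Omega>"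
proof -
  obtain K where "smooth \<phi>" "compact K" "K \<subseteq> \<Omega>" "\<And>x. x \<notin> K \<Longrightarrow> \<phi> x = 0"
    using assms by (metis test_functionE)
  then show ?thesis using assms by (intro test_functionI[of _ "K"] smooth_mult) auto
qed

lemma test_function_cmult: "\<phi> \<in> test_functions \<Omega> \<Longrightarrow> (\<lambda>x. c * \<phi> x) \<in> test_functions \<Omega>"
  by (rule test_function_mult) simp_all

lemma test_function_zero [simp]: "(\<lambda>x. 0) \<in> test_functions \<Omega>"
  by (rule test_functionI[of _ "{}"]) auto

lemma test_function_bump: "0 < r \<Longrightarrow> cball c r \<subseteq> \<Omega> \<Longrightarrow> bump c r \<in> test_functions \<Omega>"
  by (rule test_functionI[OF smooth_bump compact_cball]) (auto intro: bump_eq_0)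

lemma continuous_measurable_lebesgue:
  fixes f :: "'a::euclidean_space \<Rightarrow> 'b::euclidean_space"
  assumes "continuous_on UNIV f"
  shows "f \<in> borel_measurable lebesgue"
  using borel_measurable_continuous_onI[OF assms] by (simp add: measurable_completion)

lemma integrable_continuous_compact_support:
  fixes f :: "'a::euclidean_space \<Rightarrow> 'b::euclidean_space"
  assumes "continuous_on UNIV f" "compact K" "\<And>x. x \<notin> K \<Longrightarrow> f x = 0"
  shows "integrable lebesgue f"
proof -
  have "bounded (f ` K)"
    using assms by (intro compact_imp_bounded compact_continuous_image) (auto intro: continuous_on_subset)
  then obtain B where B: "\<And>x. x \<in> K \<Longrightarrow> norm (f x) \<le> B" by (auto simp: bounded_iff)
  show ?thesis
  proof (rule Bochner_Integration.integrable_bound[of _ "\<lambda>x. B * indicat_real K x"])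
    have "integrable lebesgue (indicat_real K)"
      using lmeasurable_compact[OF assms(2)] by (simp add: lmeasurable_iff_integrable)
    then show "integrable lebesgue (\<lambda>x. B * indicat_real K x)" by (rule integrable_mult_right)
    show "AE x in lebesgue. norm (f x) \<le> norm (B * indicat_real K x)"
      using B assms(3) by (intro AE_I2) (force simp: indicator_def)
  qed (rule continuous_measurable_lebesgue[OF assms(1)])
qed

lemma lebesgue_integral_translation:
  fixes f :: "'a::euclidean_space \<Rightarrow> real"
  assumes "f \<in> borel_measurable borel"
  shows "(LINT x|lebesgue. f (x + c)) = (LINT x|lebesgue. f x)"
proof -
  have "(LINT x|lebesgue. f (x + c)) = (LINT x|lborel. f (c + x))"
    using assms by (subst integral_completion) (auto simp: add.commute)
  also have "\<dots> = (LINT x|distr lborel borel ((+) c). f x)"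
    using assms by (subst integral_distr) auto
  also have "\<dots> = (LINT x|lebesgue. f x)"
    using assms by (simp add: lborel_distr_plus integral_completion)
  finally show ?thesis .
qed

text \<open>The difference quotients integrate to zero by translation invariance.\<close>

lemma integral_partial_deriv_zero:
  fixes \<phi> :: "real^'n \<Rightarrow> real"
  assumes \<phi>: "\<phi> \<in> test_functions \<Omega>"
  shows "(LINT x|lebesgue. partial_deriv i \<phi> x) = 0"
proof -
  obtain K where K: "smooth \<phi>" "compact K" "\<And>x. x \<notin> K \<Longrightarrow> \<phi> x = 0" "\<And>x. x \<notin> K \<Longrightarrow> grad \<phi> x = 0"
    using \<phi> by (auto elim: test_functionE)
  obtain R where R: "K \<subseteq> cball 0 R"
    using compact_imp_bounded[OF K(2)] by (auto simp: bounded_iff subset_iff)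
  define e where "e = (axis i 1 :: real^'n)"
  have "bounded (grad \<phi> ` K)"
    using K by (intro compact_imp_bounded compact_continuous_image smooth_grad_continuous)
  then obtain B0 where B0: "\<And>x. x \<in> K \<Longrightarrow> norm (grad \<phi> x) \<le> B0" by (auto simp: bounded_iff)
  define B where "B = max B0 0"
  have B: "norm (grad \<phi> x) \<le> B" for x using B0[of x] K(4)[of x] by (cases "x \<in> K") (auto simp: B_def)
  \<comment> \<open>The Lipschitz bound supplies the integrable majorant of the difference
    quotients.\<close>
  have lip: "\<bar>\<phi> x - \<phi> y\<bar> \<le> B * norm (x - y)" for x y
  proof -
    have "norm (\<phi> x - \<phi> y) \<le> B * norm (x - y)"
    proof (rule differentiable_bound[of UNIV])
      show "(\<phi> has_derivative (\<lambda>h. grad \<phi> x \<bullet> h)) (at x within UNIV)" for x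
        using K(1) by (simp add: has_derivative_grad smooth_differentiable)
      show "onorm (\<lambda>h. grad \<phi> x \<bullet> h) \<le> B" for x
      proof (rule onorm_le)
        fix h
        have "norm (grad \<phi> x \<bullet> h) \<le> norm (grad \<phi> x) * norm h" by (simp add: Cauchy_Schwarz_ineq2)
        also have "\<dots> \<le> B * norm h" using B[of x] by (simp add: mult_right_mono)
        finally show "norm (grad \<phi> x \<bullet> h) \<le> B * norm h" .
      qed
    qed auto
    then show ?thesis by simp
  qed
  define h where "h n = inverse (real (Suc n))" for n
  \<comment> \<open>Steps of length at most 1 keep the shifted supports within the ball of radius
    \<open>R + 1\<close> that carries the majorant.\<close>
  have h: "h n > 0" "h n \<le> 1" for n by (auto simp: h_def inverse_le_1_iff)
  have h0: "h \<longlonglongrightarrow> 0" unfolding h_def by (rule LIMSEQ_inverse_real_of_nat)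
  define s where "s n x = (\<phi> (x + h n *\<^sub>R e) - \<phi> x) / h n" for n x
  have e: "norm e = 1" by (simp add: e_def)
  have cont: "continuous_on UNIV \<phi>" using K(1) by (rule smooth_continuous)
  then have borel: "\<phi> \<in> borel_measurable borel" by (rule borel_measurable_continuous_onI)
  have int: "integrable lebesgue \<phi>" by (rule integrable_continuous_compact_support[OF cont K(2,3)])
  have int': "integrable lebesgue (\<lambda>x. \<phi> (x + c))" for c
    by (rule integrable_continuous_compact_support[of _ "(\<lambda>x. x - c) ` K"])
       (auto intro!: continuous_intros continuous_on_compose2[OF cont] compact_continuous_image K(2) K(3)
          simp: image_iff algebra_simps)
  have "(LINT x|lebesgue. s n x) = 0" for n
    unfolding s_def using int int' lebesgue_integral_translation[OF borel] by simp
  moreover have "(\<lambda>n. LINT x|lebesgue. s n x) \<longlonglongrightarrow> (LINT x|lebesgue. partial_deriv i \<phi> x)"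
  proof (rule integral_dominated_convergence[where w="\<lambda>x. B * indicat_real (cball 0 (R + 1)) x"])
    show "partial_deriv i \<phi> \<in> borel_measurable lebesgue"
      by (intro continuous_measurable_lebesgue smooth_continuous smooth_partial_deriv K)
    show "s n \<in> borel_measurable lebesgue" for n
      unfolding s_def
      by (intro continuous_measurable_lebesgue continuous_intros continuous_on_compose2[OF cont])
         (use h(1)[of n] in auto)
    have "integrable lebesgue (indicat_real (cball 0 (R + 1) :: (real^'n) set))"
      using lmeasurable_cball by (simp add: lmeasurable_iff_integrable)
    then show "integrable lebesgue (\<lambda>x. B * indicat_real (cball 0 (R + 1) :: (real^'n) set) x)"
      by (rule integrable_mult_right)
    show "AE x in lebesgue. (\<lambda>n. s n x) \<longlonglongrightarrow> partial_deriv i \<phi> x"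
    proof (rule AE_I2)
      fix x
      have "((\<lambda>t. \<phi> (x + t *\<^sub>R e)) has_derivative (\<lambda>t. grad \<phi> (x + 0 *\<^sub>R e) \<bullet> (t *\<^sub>R e))) (at 0)"
        by (rule has_derivative_compose[of "\<lambda>t. x + t *\<^sub>R e" "\<lambda>t. t *\<^sub>R e"])
           (auto intro!: derivative_eq_intros has_derivative_grad smooth_differentiable K)
      then have "((\<lambda>t. \<phi> (x + t *\<^sub>R e)) has_field_derivative partial_deriv i \<phi> x) (at 0)"
        by (simp add: has_field_derivative_def partial_deriv_grad e_def inner_axis mult_commute_abs)
      then have "((\<lambda>t. (\<phi> (x + t *\<^sub>R e) - \<phi> x) / t) \<longlongrightarrow> partial_deriv i \<phi> x) (at 0)"
        by (simp add: has_field_derivative_iff)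
      moreover have "filterlim h (at 0) sequentially"
        using h0 h(1) by (auto simp: filterlim_at less_imp_neq[symmetric])
      ultimately show "(\<lambda>n. s n x) \<longlonglongrightarrow> partial_deriv i \<phi> x"
        unfolding s_def by (rule filterlim_compose)
    qed
    show "AE x in lebesgue. norm (s n x) \<le> B * indicat_real (cball 0 (R + 1)) x" for n
    proof (rule AE_I2)
      fix x
      show "norm (s n x) \<le> B * indicat_real (cball 0 (R + 1)) x"
      proof (cases "x \<in> cball 0 (R + 1)")
        case True
        have "norm (s n x) \<le> B * norm (h n *\<^sub>R e) / h n"
          using divide_right_mono[OF lip[of "x + h n *\<^sub>R e" x], of "h n"] h(1)[of n] by (simp add: s_def)
        then show ?thesis using True h(1)[of n] e by simp
      next
        case False
        have "norm x \<le> norm (x + h n *\<^sub>R e) + norm (h n *\<^sub>R e)"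
          using norm_triangle_ineq4[of "x + h n *\<^sub>R e" "h n *\<^sub>R e"] by simp
        then have "norm x \<le> norm (x + h n *\<^sub>R e) + 1"
          using h[of n] e by simp
        with False have "x + h n *\<^sub>R e \<notin> K" "x \<notin> K" using R by (auto simp: subset_iff)
        then show ?thesis using False K(3) by (simp add: s_def)
      qed
    qed
  qed
  ultimately show ?thesis by (simp add: LIMSEQ_const_iff)
qed

lemma test_function_grad_integrable:
  assumes "\<phi> \<in> test_functions \<Omega>"
  shows "integrable lebesgue \<phi>" "sq_integrable lebesgue \<phi>" "sq_integrable lebesgue (grad \<phi>)"
    "\<exists>B. \<forall>x. \<bar>\<phi> x\<bar> \<le> B \<and> norm (grad \<phi> x) \<le> B"
proof -
  obtain K where K: "smooth \<phi>" "compact K" "\<And>x. x \<notin> K \<Longrightarrow> \<phi> x = 0" "\<And>x. x \<notin> K \<Longrightarrow> grad \<phi> x = 0"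
    using assms by (auto elim: test_functionE)
  note c = smooth_continuous[OF K(1)] smooth_grad_continuous[OF K(1)]
  show "integrable lebesgue \<phi>"
    by (rule integrable_continuous_compact_support[OF c(1) K(2,3)])
  show "sq_integrable lebesgue \<phi>"
    unfolding sq_integrable_def
    by (intro conjI continuous_measurable_lebesgue integrable_continuous_compact_support[OF _ K(2)] continuous_intros c)
       (simp add: K)
  show "sq_integrable lebesgue (grad \<phi>)"
    unfolding sq_integrable_def
    by (intro conjI continuous_measurable_lebesgue integrable_continuous_compact_support[OF _ K(2)] continuous_intros c)
       (simp add: K)
  have "bounded (grad \<phi> ` K)"
    using K by (intro compact_imp_bounded compact_continuous_image c)
  moreover have "bounded (\<phi> ` K)"
    using K by (intro compact_imp_bounded compact_continuous_image c)
  ultimately obtain B1 B2 where B: "\<And>x. x \<in> K \<Longrightarrow> norm (grad \<phi> x) \<le> B1" "\<And>x. x \<in> K \<Longrightarrow> \<bar>\<phi> x\<bar> \<le> B2"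
    by (auto simp: bounded_iff)
  have "\<bar>\<phi> x\<bar> \<le> \<bar>B1\<bar> + \<bar>B2\<bar> \<and> norm (grad \<phi> x) \<le> \<bar>B1\<bar> + \<bar>B2\<bar>" for x
    using B[of x] K(3,4)[of x] by (cases "x \<in> K") auto
  then show "\<exists>B. \<forall>x. \<bar>\<phi> x\<bar> \<le> B \<and> norm (grad \<phi> x) \<le> B" by blast
qed

lemma integral_by_parts_test:
  fixes \<phi> \<psi> :: "real^'n \<Rightarrow> real"
  assumes "\<phi> \<in> test_functions \<Omega>" "smooth \<psi>"
  shows "(LINT x|lebesgue. \<psi> x * partial_deriv i \<phi> x) = - (LINT x|lebesgue. partial_deriv i \<psi> x * \<phi> x)"
proof -
  obtain K where K: "smooth \<phi>" "compact K" "\<And>x. x \<notin> K \<Longrightarrow> \<phi> x = 0" "\<And>x. x \<notin> K \<Longrightarrow> grad \<phi> x = 0"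
    using assms by (auto elim: test_functionE)
  have "integrable lebesgue (\<lambda>x. \<psi> x * partial_deriv i \<phi> x)"
    by (intro integrable_continuous_compact_support[OF smooth_continuous[OF smooth_mult] K(2)]
        smooth_partial_deriv assms K(1)) (simp add: partial_deriv_grad K(4))
  moreover have "integrable lebesgue (\<lambda>x. partial_deriv i \<psi> x * \<phi> x)"
    by (intro integrable_continuous_compact_support[OF smooth_continuous[OF smooth_mult] K(2)]
        smooth_partial_deriv assms K(1)) (simp add: K(3))
  moreover have "partial_deriv i (\<lambda>x. \<psi> x * \<phi> x) x = \<psi> x * partial_deriv i \<phi> x + partial_deriv i \<psi> x * \<phi> x" for x
    using K(1) assms(2) by (simp add: partial_deriv_grad grad_mult)
  ultimately show ?thesis
    using integral_partial_deriv_zero[OF test_function_mult[OF assms], of i] by simp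
qed

subsection \<open>Approximation by polynomials and the fundamental lemma\<close>

text \<open>A measurable function is almost everywhere a limit of continuous ones; these are
  truncated to [-C, C] and replaced by Weierstrass polynomials on \<open>K\<close> with error 1 / (n
  + 1). Polynomials are smooth everywhere but bounded only on \<open>K\<close>, so later uses
  multiply them by a bump.\<close>

lemma smooth_approx_bounded_measurable:
  fixes w :: "real^'n \<Rightarrow> real"
  assumes w: "w \<in> borel_measurable lebesgue" and C: "\<And>x. \<bar>w x\<bar> \<le> C" and K: "compact K"
  obtains p where "\<And>n. smooth (p n)" "\<And>n x. x \<in> K \<Longrightarrow> \<bar>p n x\<bar> \<le> C + 1"
    "AE x in lebesgue. x \<in> K \<longrightarrow> (\<lambda>n. p n x) \<longlonglongrightarrow> w x"
proof -
  have "w measurable_on UNIV"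
    using w by (intro lebesgue_measurable_imp_measurable_on) auto
  then obtain N g where N: "negligible N" and g: "\<And>n. continuous_on UNIV (g n)"
    "\<And>x. x \<notin> N \<Longrightarrow> (\<lambda>n. g n x) \<longlonglongrightarrow> w x"
    unfolding measurable_on_def by auto
  define c where "c n x = max (- C) (min C (g n x))" for n x
  have cc: "continuous_on K (c n)" for n
    unfolding c_def using g(1) by (intro continuous_intros) (auto intro: continuous_on_subset)
  have "\<exists>p. real_polynomial_function p \<and> (\<forall>x\<in>K. \<bar>c n x - p x\<bar> < inverse (real (Suc n)))" for n
    using Stone_Weierstrass_real_polynomial_function[OF K cc, of "inverse (real (Suc n))" n] by (metis inverse_positive_iff_positive of_nat_0_less_iff zero_less_Suc)
  then obtain p where p: "\<And>n. real_polynomial_function (p n)"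
    "\<And>n x. x \<in> K \<Longrightarrow> \<bar>c n x - p n x\<bar> < inverse (real (Suc n))" by metis
  have "0 \<le> C" using C[of 0] by linarith
  show thesis
  proof
    show "smooth (p n)" for n by (rule smooth_real_polynomial_function) (rule p)
    show "\<bar>p n x\<bar> \<le> C + 1" if "x \<in> K" for n x
    proof -
      have "\<bar>c n x\<bar> \<le> C" using \<open>0 \<le> C\<close> by (auto simp: c_def)
      moreover have "inverse (real (Suc n)) \<le> 1" by (auto simp: inverse_le_1_iff)
      ultimately show ?thesis using p(2)[OF that, of n] by linarith
    qed
    have "AE x in lebesgue. x \<notin> N"
      using N by (simp add: negligible_iff_null_sets AE_not_in)
    then show "AE x in lebesgue. x \<in> K \<longrightarrow> (\<lambda>n. p n x) \<longlonglongrightarrow> w x"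
    proof eventually_elim
      case (elim x)
      have "(\<lambda>n. c n x) \<longlonglongrightarrow> max (- C) (min C (w x))"
        unfolding c_def using g(2)[OF elim] by (intro tendsto_intros)
      moreover have "max (- C) (min C (w x)) = w x" using C[of x] by auto
      ultimately have c: "(\<lambda>n. c n x) \<longlonglongrightarrow> w x" by simp
      show ?case
      proof
        assume "x \<in> K"
        have "(\<lambda>n. c n x - p n x) \<longlonglongrightarrow> 0"
          by (rule Lim_null_comparison[OF _ LIMSEQ_inverse_real_of_nat])
             (use p(2)[OF \<open>x \<in> K\<close>] in \<open>auto intro!: always_eventually less_imp_le\<close>)
        from tendsto_diff[OF c this] show "(\<lambda>n. p n x) \<longlonglongrightarrow> w x" by simp
      qed
    qed
  qed
qed

text \<open>Lindelof reduces an almost everywhere statement on \<open>\<Omega>\<close> to countably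
  many balls whose closures lie in \<open>\<Omega>\<close>, each of which carries a bump
  function.\<close>

lemma AE_open_from_balls:
  fixes \<Omega> :: "'a::euclidean_space set"
  assumes \<Omega>: "open \<Omega>"
    and P: "\<And>c r. 0 < r \<Longrightarrow> cball c r \<subseteq> \<Omega> \<Longrightarrow> AE x in lebesgue. x \<in> ball c r \<longrightarrow> P x"
  shows "AE x in lebesgue. x \<in> \<Omega> \<longrightarrow> P x"
proof -
  let ?F = "{ball c r | c r. 0 < r \<and> cball c r \<subseteq> \<Omega>}"
  obtain F where F: "F \<subseteq> ?F" "countable F" "\<Union>F = \<Union>?F"
    by (rule Lindelof[of ?F]) auto
  have "\<Omega> \<subseteq> \<Union>?F"
  proof
    fix x assume "x \<in> \<Omega>"
    then obtain e where "0 < e" "cball x e \<subseteq> \<Omega>" using \<Omega> open_contains_cball by blast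
    then show "x \<in> \<Union>?F" by (auto intro!: exI[of _ "ball x e"])
  qed
  moreover have "AE x in lebesgue. \<forall>B\<in>F. x \<in> B \<longrightarrow> P x"
    using F P by (subst AE_ball_countable) auto
  ultimately show ?thesis using F(3) by (auto elim!: eventually_mono)
qed

text \<open>Smooth approximations of \<open>sgn d\<close>, multiplied by a bump, are admissible
  tests; dominated convergence turns their vanishing integrals into the vanishing of the integral of
  |d| times the bump.\<close>

lemma fundamental_lemma:
  fixes d :: "real^'n \<Rightarrow> real"
  assumes \<Omega>: "open \<Omega>" and d: "integrable lebesgue d"
    and zero: "\<And>\<phi>. \<phi> \<in> test_functions \<Omega> \<Longrightarrow> (LINT x|lebesgue. d x * \<phi> x) = 0"
  shows "AE x in lebesgue. x \<in> \<Omega> \<longrightarrow> d x = 0"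
proof (rule AE_open_from_balls[OF \<Omega>])
  fix c r assume r: "0 < r" "cball c r \<subseteq> \<Omega>"
  let ?\<psi> = "bump c r"
  have [measurable]: "d \<in> borel_measurable lebesgue" using d by auto
  have [measurable]: "?\<psi> \<in> borel_measurable lebesgue"
    by (intro continuous_measurable_lebesgue smooth_continuous smooth_bump)
  have "\<bar>sgn (d x)\<bar> \<le> 1" for x by (simp add: abs_sgn_eq)
  then obtain p where p: "\<And>n. smooth (p n)" "\<And>n x. x \<in> cball c r \<Longrightarrow> \<bar>p n x\<bar> \<le> 1 + 1"
    "AE x in lebesgue. x \<in> cball c r \<longrightarrow> (\<lambda>n. p n x) \<longlonglongrightarrow> sgn (d x)"
    using smooth_approx_bounded_measurable[of "\<lambda>x. sgn (d x)" 1 "cball c r"] by auto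
  have [measurable]: "p n \<in> borel_measurable lebesgue" for n
    by (intro continuous_measurable_lebesgue smooth_continuous p)
  have out: "?\<psi> x = 0" if "x \<notin> cball c r" for x using that r bump_eq_0[of r x c] by auto
  have "(\<lambda>n. LINT x|lebesgue. d x * (p n x * ?\<psi> x)) \<longlonglongrightarrow> (LINT x|lebesgue. d x * (sgn (d x) * ?\<psi> x))"
  proof (rule integral_dominated_convergence[where w="\<lambda>x. 2 * \<bar>d x\<bar>"])
    show "integrable lebesgue (\<lambda>x. 2 * \<bar>d x\<bar>)" using d by auto
    show "AE x in lebesgue. (\<lambda>n. d x * (p n x * ?\<psi> x)) \<longlonglongrightarrow> d x * (sgn (d x) * ?\<psi> x)"
      using p(3)
    proof eventually_elim
      case (elim x)
      then show ?case using out[of x] by (cases "x \<in> cball c r") (auto intro!: tendsto_intros)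
    qed
    have "\<bar>d x\<bar> * (\<bar>p n x\<bar> * ?\<psi> x) \<le> 2 * \<bar>d x\<bar>" for n x
    proof (cases "x \<in> cball c r")
      case True
      have "\<bar>p n x\<bar> * ?\<psi> x \<le> 2 * 1"
        using p(2)[OF True, of n] by (intro mult_mono) (auto simp: bump_le1 bump_nonneg)
      then have "\<bar>d x\<bar> * (\<bar>p n x\<bar> * ?\<psi> x) \<le> \<bar>d x\<bar> * 2" by (intro mult_left_mono) auto
      then show ?thesis by simp
    qed (simp add: out)
    then show "AE x in lebesgue. norm (d x * (p n x * ?\<psi> x)) \<le> 2 * \<bar>d x\<bar>" for n
      by (simp add: abs_mult bump_nonneg)
  qed auto
  moreover have "(LINT x|lebesgue. d x * (p n x * ?\<psi> x)) = 0" for n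
    by (intro zero test_function_mult test_function_bump r p)
  ultimately have "(LINT x|lebesgue. d x * (sgn (d x) * ?\<psi> x)) = 0" by (simp add: LIMSEQ_const_iff)
  moreover have "d x * (sgn (d x) * ?\<psi> x) = \<bar>d x\<bar> * ?\<psi> x" for x by (simp add: abs_sgn mult.assoc)
  ultimately have "(LINT x|lebesgue. \<bar>d x\<bar> * ?\<psi> x) = 0" by simp
  moreover have "integrable lebesgue (\<lambda>x. \<bar>d x\<bar> * ?\<psi> x)"
    by (rule Bochner_Integration.integrable_bound[OF d])
       (auto simp: abs_mult bump_nonneg bump_le1 mult_left_le)
  ultimately have "AE x in lebesgue. \<bar>d x\<bar> * ?\<psi> x = 0"
    by (subst (asm) integral_nonneg_eq_0_iff_AE) (auto simp: bump_nonneg)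
  then show "AE x in lebesgue. x \<in> ball c r \<longrightarrow> d x = 0"
    by (rule eventually_mono) (use bump_pos_iff[OF r(1), of c] in force)
qed

subsection \<open>Pointwise operators\<close>

lemma borel_measurable_vec_nth_I:
  fixes f :: "'a \<Rightarrow> real^'n"
  assumes "f \<in> borel_measurable M"
  shows "(\<lambda>x. f x $ i) \<in> borel_measurable M"
  using borel_measurable_inner[OF assms borel_measurable_const[of "axis i 1"]] by (simp add: inner_axis)

text \<open>Multiplication by a bounded measurable field of linear maps. Measurability is required
  after composition with measurable functions, and the bound must hold at every point; coefficients
  known only almost everywhere are first replaced by bounded representatives.\<close>

definition pointwise_op :: "('a::euclidean_space \<Rightarrow> 'b::euclidean_space \<Rightarrow> 'c::euclidean_space) \<Rightarrow> bool" where
  "pointwise_op T \<longleftrightarrow> (\<forall>x. linear (T x)) \<and>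
     (\<forall>f\<in>borel_measurable lebesgue. (\<lambda>x. T x (f x)) \<in> borel_measurable lebesgue) \<and>
     (\<exists>C. \<forall>x v. norm (T x v) \<le> C * norm v)"

lemma pointwise_opD:
  assumes "pointwise_op T"
  shows "linear (T x)" "f \<in> borel_measurable lebesgue \<Longrightarrow> (\<lambda>x. T x (f x)) \<in> borel_measurable lebesgue"
  using assms unfolding pointwise_op_def by simp_all

lemma pointwise_opE:
  assumes "pointwise_op T"
  obtains C where "0 \<le> C" "\<And>x v. norm (T x v) \<le> C * norm v"
proof -
  obtain C where C: "\<forall>x v. norm (T x v) \<le> C * norm v"
    using assms unfolding pointwise_op_def by (elim conjE exE)
  have "norm (T x v) \<le> \<bar>C\<bar> * norm v" for x v
    using order.trans[OF C[rule_format, of x v] mult_right_mono[of C "\<bar>C\<bar>" "norm v"]] by simp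
  then show thesis using that[of "\<bar>C\<bar>"] by simp
qed

lemma pointwise_opI:
  assumes "\<And>x. linear (T x)"
    and "\<And>f. f \<in> borel_measurable lebesgue \<Longrightarrow> (\<lambda>x. T x (f x)) \<in> borel_measurable lebesgue"
    and "\<And>x v. norm (T x v) \<le> C * norm v"
  shows "pointwise_op T"
  unfolding pointwise_op_def using assms(1,2) by (intro conjI allI ballI exI[of _ C] assms(3)) simp_all

definition mulop :: "('a::euclidean_space \<Rightarrow> 'b::euclidean_space \<Rightarrow> 'c::euclidean_space) \<Rightarrow> ('a, 'b) l2 \<Rightarrow> ('a, 'c) l2" where
  "mulop T X = abs_l2 (\<lambda>x. T x (rep_l2 X x))"

lemma pointwise_op_sq:
  assumes "pointwise_op T" "sq_integrable lebesgue f"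
  shows "sq_integrable lebesgue (\<lambda>x. T x (f x))"
proof -
  obtain C where C: "\<And>x v. norm (T x v) \<le> C * norm v" using pointwise_opE[OF assms(1)] by metis
  have "(\<lambda>x. T x (f x)) \<in> borel_measurable lebesgue"
    by (rule pointwise_opD(2)[OF assms(1)]) (rule sq_integrableD(1)[OF assms(2)])
  then show ?thesis by (rule sq_integrable_bound[OF assms(2), where C=C]) (simp add: C)
qed

lemma rep_mulop:
  "pointwise_op T \<Longrightarrow> AE x in lebesgue. rep_l2 (mulop T X) x = T x (rep_l2 X x)"
  unfolding mulop_def by (rule rep_l2_abs[OF pointwise_op_sq[OF _ rep_l2_sq]])

lemma abs_l2_zero: "abs_l2 (\<lambda>x. 0) = 0"
  by (rule zero_l2.abs_eq[symmetric])

lemma rep_l2_zero: "AE x in lebesgue. rep_l2 0 x = 0"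
  using rep_l2_abs[OF sq_integrable_zero] by (simp add: abs_l2_zero)

lemma l2_eqI: "AE x in lebesgue. rep_l2 X x = rep_l2 Y x \<Longrightarrow> X = Y"
  using abs_l2_eqI[OF rep_l2_sq rep_l2_sq, of X Y] by simp

lemma mulop_abs:
  assumes T: "pointwise_op T" and f: "sq_integrable lebesgue f"
  shows "mulop T (abs_l2 f) = abs_l2 (\<lambda>x. T x (f x))"
  unfolding mulop_def
proof (rule abs_l2_eqI)
  show "AE x in lebesgue. T x (rep_l2 (abs_l2 f) x) = T x (f x)"
    using rep_l2_abs[OF f] by eventually_elim simp
qed (rule pointwise_op_sq[OF T f] pointwise_op_sq[OF T rep_l2_sq])+

lemma norm_mulop_le:
  assumes T: "pointwise_op T" and C: "\<And>x v. norm (T x v) \<le> C * norm v" "0 \<le> C"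
  shows "norm (mulop T X) \<le> C * norm X"
proof (rule power2_le_imp_le)
  have "(norm (mulop T X))\<^sup>2 = (LINT x|lebesgue. (norm (T x (rep_l2 X x)))\<^sup>2)"
    unfolding mulop_def by (rule norm_abs_l2_sq[OF pointwise_op_sq[OF T rep_l2_sq]])
  also have "\<dots> \<le> (LINT x|lebesgue. C\<^sup>2 * (norm (rep_l2 X x))\<^sup>2)"
  proof (rule integral_mono)
    show "integrable lebesgue (\<lambda>x. (norm (T x (rep_l2 X x)))\<^sup>2)"
      using pointwise_op_sq[OF T rep_l2_sq] by (rule sq_integrableD)
    show "integrable lebesgue (\<lambda>x. C\<^sup>2 * (norm (rep_l2 X x))\<^sup>2)"
      by (rule integrable_mult_right, rule sq_integrableD(2)[OF rep_l2_sq])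
    show "(norm (T x (rep_l2 X x)))\<^sup>2 \<le> C\<^sup>2 * (norm (rep_l2 X x))\<^sup>2" for x
      unfolding power_mult_distrib[symmetric] by (intro power_mono C) simp
  qed
  also have "\<dots> = (C * norm X)\<^sup>2" by (simp add: norm_l2_sq power_mult_distrib)
  finally show "(norm (mulop T X))\<^sup>2 \<le> (C * norm X)\<^sup>2" .
qed (use C in simp)

lemma bounded_linear_mulop:
  assumes T: "pointwise_op T"
  shows "bounded_linear (mulop T)"
proof -
  note lin = pointwise_opD(1)[OF T]
  obtain C where C: "0 \<le> C" "\<And>x v. norm (T x v) \<le> C * norm v" using pointwise_opE[OF T] by metis
  show ?thesis
  proof
    show "mulop T (X + Y) = mulop T X + mulop T Y" for X Y
    proof (rule l2_eqI)
      show "AE x in lebesgue. rep_l2 (mulop T (X + Y)) x = rep_l2 (mulop T X + mulop T Y) x"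
        using rep_mulop[OF T, of "X + Y"] rep_mulop[OF T, of X] rep_mulop[OF T, of Y]
          rep_l2_add[of X Y] rep_l2_add[of "mulop T X" "mulop T Y"]
        by eventually_elim (simp add: linear_add[OF lin])
    qed
    show "mulop T (c *\<^sub>R X) = c *\<^sub>R mulop T X" for c X
    proof (rule l2_eqI)
      show "AE x in lebesgue. rep_l2 (mulop T (c *\<^sub>R X)) x = rep_l2 (c *\<^sub>R mulop T X) x"
        using rep_mulop[OF T, of "c *\<^sub>R X"] rep_mulop[OF T, of X]
          rep_l2_scaleR[of c X] rep_l2_scaleR[of c "mulop T X"]
        by eventually_elim (simp add: linear_scale[OF lin])
    qed
    show "\<exists>K. \<forall>X. norm (mulop T X) \<le> norm X * K"
      using norm_mulop_le[OF T C(2,1)] by (intro exI[of _ C]) (simp add: mult.commute)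
  qed
qed

lemma pointwise_op_const:
  assumes "linear L"
  shows "pointwise_op (\<lambda>_::'a::euclidean_space. L :: 'b::euclidean_space \<Rightarrow> 'c::euclidean_space)"
proof -
  have bl: "bounded_linear L" using assms by (simp add: linear_conv_bounded_linear)
  then obtain K where "\<And>v. norm (L v) \<le> norm v * K" using bounded_linear.bounded by blast
  moreover have "(\<lambda>x. L (f x)) \<in> borel_measurable M" if "f \<in> borel_measurable M" for f and M :: "'a measure"
    using that borel_measurable_continuous_onI[OF linear_continuous_on[OF bl]] by (rule measurable_compose)
  ultimately show ?thesis
    using assms by (intro pointwise_opI[where C=K]) (simp_all add: mult.commute)
qed

lemma pointwise_op_scale:
  assumes [measurable]: "a \<in> borel_measurable lebesgue" and a: "\<And>x. \<bar>a x\<bar> \<le> C"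
  shows "pointwise_op (\<lambda>x v. a x *\<^sub>R v)"
proof (rule pointwise_opI[where C=C])
  show "norm (a x *\<^sub>R v) \<le> C * norm v" for x v using a[of x] by (simp add: mult_right_mono)
  show "linear ((*\<^sub>R) (a x))" for x by (rule linearI) (simp_all add: scaleR_right_distrib scaleR_left_commute)
qed measurable

lemma pointwise_op_fst: "pointwise_op (\<lambda>x. fst)" and pointwise_op_snd: "pointwise_op (\<lambda>x. snd)"
  by (rule pointwise_op_const; simp add: linear_fst linear_snd)+

text \<open>A pair-valued class stands for a function together with its gradient; \<open>fn\<close>
  and \<open>gr\<close> read off the two parts.\<close>

definition fn :: "('a::euclidean_space, 'b::euclidean_space \<times> 'c::euclidean_space) l2 \<Rightarrow> ('a, 'b) l2" where
  "fn = mulop (\<lambda>_. fst)"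
definition gr :: "('a::euclidean_space, 'b::euclidean_space \<times> 'c::euclidean_space) l2 \<Rightarrow> ('a, 'c) l2" where
  "gr = mulop (\<lambda>_. snd)"

lemma bounded_linear_fn: "bounded_linear fn" and bounded_linear_gr: "bounded_linear gr"
  unfolding fn_def gr_def by (intro bounded_linear_mulop pointwise_op_fst pointwise_op_snd)+

lemma rep_fn: "AE x in lebesgue. rep_l2 (fn X) x = fst (rep_l2 X x)"
  and rep_gr: "AE x in lebesgue. rep_l2 (gr X) x = snd (rep_l2 X x)"
  unfolding fn_def gr_def by (intro rep_mulop pointwise_op_fst pointwise_op_snd)+

lemma sq_integrable_fst: "sq_integrable lebesgue f \<Longrightarrow> sq_integrable lebesgue (\<lambda>x. fst (f x))"
  and sq_integrable_snd: "sq_integrable lebesgue f \<Longrightarrow> sq_integrable lebesgue (\<lambda>x. snd (f x))"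
  using pointwise_op_sq[OF pointwise_op_fst] pointwise_op_sq[OF pointwise_op_snd] by auto

lemma sq_integrable_Pair:
  assumes f: "sq_integrable lebesgue f" and g: "sq_integrable lebesgue g"
  shows "sq_integrable lebesgue (\<lambda>x. (f x, g x))"
  using f g by (auto simp: sq_integrable_def norm_Pair intro!: borel_measurable_Pair)

lemma fn_abs: "sq_integrable lebesgue f \<Longrightarrow> sq_integrable lebesgue g \<Longrightarrow> fn (abs_l2 (\<lambda>x. (f x, g x))) = abs_l2 f"
  and gr_abs: "sq_integrable lebesgue f \<Longrightarrow> sq_integrable lebesgue g \<Longrightarrow> gr (abs_l2 (\<lambda>x. (f x, g x))) = abs_l2 g"
  by (simp_all add: fn_def gr_def mulop_abs[OF pointwise_op_fst] mulop_abs[OF pointwise_op_snd] sq_integrable_Pair)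

lemma inner_fn_gr: "inner X Y = inner (fn X) (fn Y) + inner (gr X) (gr Y)"
proof -
  have "inner X Y = (LINT x|lebesgue. fst (rep_l2 X x) \<bullet> fst (rep_l2 Y x) + snd (rep_l2 X x) \<bullet> snd (rep_l2 Y x))"
    unfolding inner_l2_eq by (simp add: inner_prod_def)
  also have "\<dots> = (LINT x|lebesgue. fst (rep_l2 X x) \<bullet> fst (rep_l2 Y x)) + (LINT x|lebesgue. snd (rep_l2 X x) \<bullet> snd (rep_l2 Y x))"
    by (intro Bochner_Integration.integral_add integrable_inner_sq sq_integrable_fst sq_integrable_snd rep_l2_sq)
  also have "\<dots> = inner (fn X) (fn Y) + inner (gr X) (gr Y)"
    unfolding fn_def gr_def mulop_def
    by (simp add: inner_abs_l2 sq_integrable_fst sq_integrable_snd rep_l2_sq)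
  finally show ?thesis .
qed

lemma norm_fn_gr: "(norm X)\<^sup>2 = (norm (fn X))\<^sup>2 + (norm (gr X))\<^sup>2"
  by (simp add: power2_norm_eq_inner inner_fn_gr[of X X])

lemma norm_fn_le: "norm (fn X) \<le> norm X" and norm_gr_le: "norm (gr X) \<le> norm X"
  by (rule power2_le_imp_le; simp add: norm_fn_gr[of X])+

section \<open>Functions with zero boundary values\<close>

text \<open>\<open>H\<^sup>1\<^sub>0(\<Omega>)\<close> is represented by the closure of the pairs \<open>(\<phi>, \<nabla>\<phi>)\<close> in \<open>L\<^sup>2\<close> of the whole space, so that its
  elements carry their gradient along and no choice of a weak derivative is involved.\<close>

definition jet :: "(real^'n \<Rightarrow> real) \<Rightarrow> (real^'n, real \<times> (real^'n)) l2" where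
  "jet \<phi> = abs_l2 (\<lambda>x. (\<phi> x, grad \<phi> x))"

definition jets :: "(real^'n) set \<Rightarrow> (real^'n, real \<times> (real^'n)) l2 set" where
  "jets \<Omega> = jet ` test_functions \<Omega>"

lemma jet_sq: "\<phi> \<in> test_functions \<Omega> \<Longrightarrow> sq_integrable lebesgue (\<lambda>x. (\<phi> x, grad \<phi> x))"
  using test_function_grad_integrable by (blast intro: sq_integrable_Pair)

lemma rep_jet: "\<phi> \<in> test_functions \<Omega> \<Longrightarrow> AE x in lebesgue. rep_l2 (jet \<phi>) x = (\<phi> x, grad \<phi> x)"
  unfolding jet_def by (rule rep_l2_abs[OF jet_sq])

lemma fn_jet: "\<phi> \<in> test_functions \<Omega> \<Longrightarrow> fn (jet \<phi>) = abs_l2 \<phi>"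
  and gr_jet: "\<phi> \<in> test_functions \<Omega> \<Longrightarrow> gr (jet \<phi>) = abs_l2 (grad \<phi>)"
  unfolding jet_def using test_function_grad_integrable by (blast intro: fn_abs gr_abs)+

lemma jet_add:
  assumes "\<phi> \<in> test_functions \<Omega>" "\<psi> \<in> test_functions \<Omega>"
  shows "jet (\<lambda>x. \<phi> x + \<psi> x) = jet \<phi> + jet \<psi>"
  unfolding jet_def using assms[THEN test_function_smooth]
  by (simp add: abs_l2_add[OF jet_sq[OF assms(1)] jet_sq[OF assms(2)]] grad_add)

lemma jet_cmult:
  assumes "\<phi> \<in> test_functions \<Omega>"
  shows "jet (\<lambda>x. c * \<phi> x) = c *\<^sub>R jet \<phi>"
  unfolding jet_def using assms[THEN test_function_smooth]
  by (simp add: abs_l2_scaleR[OF jet_sq[OF assms(1)]] grad_cmult)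

lemma subspace_jets: "subspace (jets \<Omega>)"
  unfolding subspace_def
proof (intro conjI ballI allI)
  have "jet (\<lambda>x. 0) = 0" using jet_cmult[OF test_function_zero, where c=0] by simp
  then show "0 \<in> jets \<Omega>" unfolding jets_def by (metis imageI test_function_zero)
  show "X + Y \<in> jets \<Omega>" if "X \<in> jets \<Omega>" "Y \<in> jets \<Omega>" for X Y
    using that unfolding jets_def by (auto simp: jet_add[symmetric] intro!: imageI test_function_add)
  show "c *\<^sub>R X \<in> jets \<Omega>" if "X \<in> jets \<Omega>" for c X
    using that unfolding jets_def by (auto simp: jet_cmult[symmetric] intro!: imageI test_function_cmult)
qed

lemma subspace_closure_jets: "subspace (closure (jets \<Omega>))"
  unfolding subspace_def
proof (intro conjI ballI allI)
  show "0 \<in> closure (jets \<Omega>)" using subspace_0[OF subspace_jets] closure_subset by blast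
  show "X + Y \<in> closure (jets \<Omega>)" if X: "X \<in> closure (jets \<Omega>)" and Y: "Y \<in> closure (jets \<Omega>)" for X Y
  proof -
    obtain f g where f: "\<And>k::nat. f k \<in> jets \<Omega>" "f \<longlonglongrightarrow> X" and g: "\<And>k::nat. g k \<in> jets \<Omega>" "g \<longlonglongrightarrow> Y"
      using X Y unfolding closure_sequential by blast
    then have "(\<lambda>k. f k + g k) \<longlonglongrightarrow> X + Y" "\<And>k. f k + g k \<in> jets \<Omega>"
      by (auto intro: tendsto_add subspace_add[OF subspace_jets])
    then show ?thesis unfolding closure_sequential by (intro exI[of _ "\<lambda>k. f k + g k"]) simp
  qed
  show "c *\<^sub>R X \<in> closure (jets \<Omega>)" if X: "X \<in> closure (jets \<Omega>)" for c X
  proof -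
    obtain f where f: "\<And>k::nat. f k \<in> jets \<Omega>" "f \<longlonglongrightarrow> X"
      using X unfolding closure_sequential by blast
    then have "(\<lambda>k. c *\<^sub>R f k) \<longlonglongrightarrow> c *\<^sub>R X" "\<And>k. c *\<^sub>R f k \<in> jets \<Omega>"
      by (auto intro: tendsto_intros subspace_scale[OF subspace_jets])
    then show ?thesis unfolding closure_sequential by (intro exI[of _ "\<lambda>k. c *\<^sub>R f k"]) simp
  qed
qed

lemma closure_jetsE:
  assumes "X \<in> closure (jets \<Omega>)"
  obtains \<phi> where "\<And>k::nat. \<phi> k \<in> test_functions \<Omega>" "(\<lambda>k. jet (\<phi> k)) \<longlonglongrightarrow> X"
proof -
  obtain Y where Y: "\<And>k::nat. Y k \<in> jets \<Omega>" "Y \<longlonglongrightarrow> X"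
    using assms unfolding closure_sequential by blast
  then have "\<forall>k. \<exists>\<phi>\<in>test_functions \<Omega>. Y k = jet \<phi>" by (auto simp: jets_def)
  then obtain \<phi> where "\<And>k. \<phi> k \<in> test_functions \<Omega>" "\<And>k. Y k = jet (\<phi> k)" by metis
  moreover from this have "Y = (\<lambda>k. jet (\<phi> k))" by (simp add: fun_eq_iff)
  ultimately show thesis using that[of \<phi>] Y(2) by simp
qed

text \<open>The density argument used throughout: a closed condition has to be checked for test
  functions only.\<close>

lemma closure_jets_induct:
  assumes "X \<in> closure (jets \<Omega>)" "closed {X. P X}" "\<And>\<phi>. \<phi> \<in> test_functions \<Omega> \<Longrightarrow> P (jet \<phi>)"
  shows "P X"
proof -
  have "jets \<Omega> \<subseteq> {X. P X}" using assms(3) by (auto simp: jets_def)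
  then show ?thesis using assms(1,2) closure_minimal by blast
qed

text \<open>Integrating by parts the product of x_i \<phi> and \<phi> gives: the integral of
  \<phi>^2 equals -2 times that of x_i \<phi> D_i \<phi>, and |x_i| is at most \<open>R\<close> on
  the support.\<close>

lemma friedrichs_test:
  fixes \<phi> :: "real^'n \<Rightarrow> real"
  assumes \<phi>: "\<phi> \<in> test_functions \<Omega>" and R: "\<And>x. x \<in> \<Omega> \<Longrightarrow> norm x \<le> R"
  shows "(norm (fn (jet \<phi>)))\<^sup>2 \<le> 4 * R\<^sup>2 * (norm (gr (jet \<phi>)))\<^sup>2"
proof -
  \<comment> \<open>Any coordinate direction will do; index types are nonempty.\<close>
  obtain i :: 'n where True by simp
  note [simp] = test_function_smooth[OF \<phi>] test_function_grad_integrable[OF \<phi>]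
  let ?\<psi> = "\<lambda>x. (axis i 1 \<bullet> x) * \<phi> x"
  have sm: "smooth ?\<psi>" by (intro smooth_mult smooth_inner) simp
  have int1: "integrable lebesgue (\<lambda>x. (\<phi> x)\<^sup>2)" and int2: "integrable lebesgue (\<lambda>x. (norm (grad \<phi> x))\<^sup>2)"
    using test_function_grad_integrable(2,3)[OF \<phi>, THEN sq_integrableD(2)] by auto
  have pd: "partial_deriv i ?\<psi> x = \<phi> x + (axis i 1 \<bullet> x) * partial_deriv i \<phi> x" for x
    by (simp add: partial_deriv_grad grad_mult[OF smooth_inner] inner_axis)
  let ?a = "\<lambda>x. (axis i 1 \<bullet> x) * \<phi> x * partial_deriv i \<phi> x"
  \<comment> \<open>Young's inequality with weight 1/4: after the factor 2 of the identity, half of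
    the integral of \<phi>^2 is absorbed, which leaves the constant 4 R^2.\<close>
  have pw: "\<bar>?a x\<bar> \<le> (\<phi> x)\<^sup>2 / 4 + R\<^sup>2 * (norm (grad \<phi> x))\<^sup>2" for x
  proof (cases "x \<in> \<Omega>")
    case True
    have 1: "\<bar>axis i 1 \<bullet> x\<bar> \<le> R"
      using R[OF True] component_le_norm_cart[of x i] by (simp add: inner_axis')
    have 2: "\<bar>partial_deriv i \<phi> x\<bar> \<le> norm (grad \<phi> x)"
      using component_le_norm_cart[of "grad \<phi> x" i] by (simp add: partial_deriv_grad)
    have "\<bar>?a x\<bar> = \<bar>\<phi> x\<bar> * (\<bar>axis i 1 \<bullet> x\<bar> * \<bar>partial_deriv i \<phi> x\<bar>)" by (simp add: abs_mult)
    also have "\<dots> \<le> \<bar>\<phi> x\<bar> * (R * norm (grad \<phi> x))"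
      using 1 2 by (intro mult_left_mono mult_mono) auto
    also have "\<dots> \<le> (\<phi> x)\<^sup>2 / 4 + R\<^sup>2 * (norm (grad \<phi> x))\<^sup>2"
      using sum_squares_bound[of "\<bar>\<phi> x\<bar> / 2" "R * norm (grad \<phi> x)"]
      by (simp add: power_mult_distrib power_divide)
    finally show ?thesis .
  qed (simp add: test_function_outside[OF \<phi>])
  have a_int: "integrable lebesgue ?a"
  proof (rule Bochner_Integration.integrable_bound[of _ "\<lambda>x. (\<phi> x)\<^sup>2 / 4 + R\<^sup>2 * (norm (grad \<phi> x))\<^sup>2"])
    show "integrable lebesgue (\<lambda>x. (\<phi> x)\<^sup>2 / 4 + R\<^sup>2 * (norm (grad \<phi> x))\<^sup>2)"
      using int1 int2 by auto
    show "?a \<in> borel_measurable lebesgue"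
      by (intro continuous_measurable_lebesgue smooth_continuous smooth_mult smooth_inner smooth_partial_deriv) auto
    show "AE x in lebesgue. norm (?a x) \<le> norm ((\<phi> x)\<^sup>2 / 4 + R\<^sup>2 * (norm (grad \<phi> x))\<^sup>2)"
      using pw by (intro AE_I2) (simp add: order.trans[OF _ abs_ge_self])
  qed
  have "(\<lambda>x. (\<phi> x + (axis i 1 \<bullet> x) * partial_deriv i \<phi> x) * \<phi> x) = (\<lambda>x. (\<phi> x)\<^sup>2 + ?a x)"
    by (simp add: fun_eq_iff algebra_simps power2_eq_square)
  then have "(LINT x|lebesgue. ?a x) = - (LINT x|lebesgue. (\<phi> x)\<^sup>2 + ?a x)"
    using integral_by_parts_test[OF \<phi> sm, of i] unfolding pd by simp
  also have "\<dots> = - (LINT x|lebesgue. (\<phi> x)\<^sup>2) - (LINT x|lebesgue. ?a x)"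
    using int1 a_int by simp
  finally have "(LINT x|lebesgue. (\<phi> x)\<^sup>2) = - 2 * (LINT x|lebesgue. ?a x)" by simp
  also have "\<dots> \<le> 2 * (LINT x|lebesgue. \<bar>?a x\<bar>)"
    using integral_abs_bound[of lebesgue ?a] by linarith
  also have "(LINT x|lebesgue. \<bar>?a x\<bar>) \<le> (LINT x|lebesgue. (\<phi> x)\<^sup>2 / 4 + R\<^sup>2 * (norm (grad \<phi> x))\<^sup>2)"
    using int1 int2 a_int pw by (intro integral_mono) auto
  also have "\<dots> = (LINT x|lebesgue. (\<phi> x)\<^sup>2) / 4 + R\<^sup>2 * (LINT x|lebesgue. (norm (grad \<phi> x))\<^sup>2)"
    using int1 int2 by simp
  finally show ?thesis
    unfolding fn_jet[OF \<phi>] gr_jet[OF \<phi>] by (simp add: norm_abs_l2_sq)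
qed

lemma friedrichs:
  fixes \<Omega> :: "(real^'n) set"
  assumes "bounded \<Omega>"
  obtains C where "0 < C" "\<And>X. X \<in> closure (jets \<Omega>) \<Longrightarrow> (norm X)\<^sup>2 \<le> C * (norm (gr X))\<^sup>2"
proof -
  obtain R where R: "\<And>x. x \<in> \<Omega> \<Longrightarrow> norm x \<le> R" using assms by (auto simp: bounded_iff)
  have "(norm X)\<^sup>2 \<le> (1 + 4 * R\<^sup>2) * (norm (gr X))\<^sup>2" if "X \<in> closure (jets \<Omega>)" for X
    using that
  proof (rule closure_jets_induct)
    show "closed {X::(real^'n, real \<times> (real^'n)) l2. (norm X)\<^sup>2 \<le> (1 + 4 * R\<^sup>2) * (norm (gr X))\<^sup>2}"
      by (intro closed_Collect_le continuous_intros linear_continuous_on bounded_linear_gr)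
    show "(norm (jet \<phi>))\<^sup>2 \<le> (1 + 4 * R\<^sup>2) * (norm (gr (jet \<phi>)))\<^sup>2" if "\<phi> \<in> test_functions \<Omega>" for \<phi>
      using friedrichs_test[OF that R] norm_fn_gr[of "jet \<phi>"] by (simp add: algebra_simps)
  qed
  moreover have "0 < 1 + 4 * R\<^sup>2" by (simp add: add_pos_nonneg)
  ultimately show thesis using that by blast
qed

text \<open>Vanishing under multiplication by the indicator of the complement is a closed condition,
  and it holds for test functions.\<close>

lemma closure_jets_outside:
  assumes \<Omega>: "open \<Omega>" and X: "X \<in> closure (jets \<Omega>)"
  shows "AE x in lebesgue. x \<notin> \<Omega> \<longrightarrow> rep_l2 X x = 0"
proof -
  let ?T = "\<lambda>x v. indicat_real (- \<Omega>) x *\<^sub>R v"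
  have [measurable]: "\<Omega> \<in> sets lebesgue" using \<Omega> by auto
  have T: "pointwise_op ?T"
    by (rule pointwise_op_scale[where C=1]) (auto simp: indicator_def)
  have "mulop ?T X = 0"
    using X
  proof (rule closure_jets_induct)
    show "closed {X. mulop ?T X = 0}"
      by (intro closed_Collect_eq linear_continuous_on bounded_linear_mulop T continuous_intros)
    fix \<phi> assume \<phi>: "\<phi> \<in> test_functions \<Omega>"
    have "(\<lambda>x. ?T x (\<phi> x, grad \<phi> x)) = (\<lambda>x. 0)"
      using test_function_outside[OF \<phi>] by (auto simp: indicator_def zero_prod_def fun_eq_iff)
    then show "mulop ?T (jet \<phi>) = 0"
      unfolding jet_def mulop_abs[OF T jet_sq[OF \<phi>]] by (simp add: abs_l2_zero)
  qed
  then have "AE x in lebesgue. rep_l2 (mulop ?T X) x = 0" using rep_l2_zero by simp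
  then show ?thesis
    using rep_mulop[OF T, of X] by eventually_elim (auto simp: indicator_def split: if_splits)
qed

text \<open>The sum of both integrals is the inner product of \<open>X\<close> with one fixed
  element, the pair (D_i \<phi>, \<phi> e_i); its vanishing is therefore closed in \<open>X\<close>.
  The support of \<phi> is unrelated to \<open>\<Omega>\<close> because elements of the closure are
  already extended by zero.\<close>

lemma closure_jets_by_parts:
  assumes X: "X \<in> closure (jets \<Omega>)" and \<phi>: "\<phi> \<in> test_functions \<Omega>'"
  shows "(LINT x|lebesgue. fst (rep_l2 X x) * partial_deriv i \<phi> x) = - (LINT x|lebesgue. snd (rep_l2 X x) $ i * \<phi> x)"
proof -
  note \<phi>' = test_function_smooth[OF \<phi>] test_function_grad_integrable[OF \<phi>]
  have s1: "sq_integrable lebesgue (partial_deriv i \<phi>)"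
  proof (rule sq_integrable_bound[OF \<phi>'(4), where C=1])
    show "partial_deriv i \<phi> \<in> borel_measurable lebesgue"
      by (intro continuous_measurable_lebesgue smooth_continuous smooth_partial_deriv \<phi>')
  qed (simp add: partial_deriv_grad component_le_norm_cart)
  have s2: "sq_integrable lebesgue (\<lambda>x. \<phi> x *\<^sub>R axis i 1 :: real^'a)"
  proof (rule sq_integrable_bound[OF \<phi>'(3), where C=1])
    show "(\<lambda>x. \<phi> x *\<^sub>R axis i 1 :: real^'a) \<in> borel_measurable lebesgue"
      using \<phi>'(3) by (intro borel_measurable_scaleR) auto
  qed simp
  let ?Y = "abs_l2 (\<lambda>x. (partial_deriv i \<phi> x, \<phi> x *\<^sub>R axis i 1 :: real^'a))"
  have Ysq: "sq_integrable lebesgue (\<lambda>x. (partial_deriv i \<phi> x, \<phi> x *\<^sub>R axis i 1 :: real^'a))"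
    by (rule sq_integrable_Pair[OF s1 s2])
  have eq: "inner X ?Y = (LINT x|lebesgue. fst (rep_l2 X x) * partial_deriv i \<phi> x) + (LINT x|lebesgue. snd (rep_l2 X x) $ i * \<phi> x)" for X
  proof -
    have "inner X ?Y = inner (abs_l2 (rep_l2 X)) ?Y" by simp
    also have "\<dots> = (LINT x|lebesgue. fst (rep_l2 X x) \<bullet> partial_deriv i \<phi> x + snd (rep_l2 X x) \<bullet> \<phi> x *\<^sub>R axis i 1)"
      by (subst inner_abs_l2[OF rep_l2_sq Ysq]) (simp add: inner_prod_def)
    also have "\<dots> = (LINT x|lebesgue. fst (rep_l2 X x) \<bullet> partial_deriv i \<phi> x) + (LINT x|lebesgue. snd (rep_l2 X x) \<bullet> \<phi> x *\<^sub>R axis i 1)"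
      by (intro Bochner_Integration.integral_add integrable_inner_sq sq_integrable_fst sq_integrable_snd rep_l2_sq s1 s2)
    finally show ?thesis by (simp add: inner_axis mult.commute)
  qed
  have "inner X ?Y = 0"
    using X
  proof (rule closure_jets_induct)
    show "closed {X. inner X ?Y = 0}" by (intro closed_Collect_eq continuous_intros)
    fix \<psi> assume \<psi>: "\<psi> \<in> test_functions \<Omega>"
    have [measurable]: "\<psi> \<in> borel_measurable lebesgue" "grad \<psi> \<in> borel_measurable lebesgue" 
       "partial_deriv i \<phi> \<in> borel_measurable lebesgue" "\<phi> \<in> borel_measurable lebesgue" 
      using test_function_grad_integrable[OF \<psi>] \<phi>' s1 by auto
    have m: "(\<lambda>x. grad \<psi> x $ i) \<in> borel_measurable lebesgue"
      unfolding partial_deriv_grad[symmetric]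
      by (intro continuous_measurable_lebesgue smooth_continuous smooth_partial_deriv test_function_smooth[OF \<psi>])
    have [measurable]: "(\<lambda>x. fst (rep_l2 (jet \<psi>) x)) \<in> borel_measurable lebesgue"
      by (rule sq_integrableD(1)[OF sq_integrable_fst[OF rep_l2_sq]])
    have "(LINT x|lebesgue. fst (rep_l2 (jet \<psi>) x) * partial_deriv i \<phi> x) = (LINT x|lebesgue. \<psi> x * partial_deriv i \<phi> x)"
      using rep_jet[OF \<psi>] by (intro integral_cong_AE) (auto elim!: eventually_mono)
    moreover have "(LINT x|lebesgue. snd (rep_l2 (jet \<psi>) x) $ i * \<phi> x) = (LINT x|lebesgue. partial_deriv i \<psi> x * \<phi> x)"
    proof (rule integral_cong_AE)
      show "(\<lambda>x. snd (rep_l2 (jet \<psi>) x) $ i * \<phi> x) \<in> borel_measurable lebesgue"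
        by (intro borel_measurable_times borel_measurable_vec_nth_I)
          (rule sq_integrableD(1)[OF sq_integrable_snd[OF rep_l2_sq]], measurable)
      show "(\<lambda>x. partial_deriv i \<psi> x * \<phi> x) \<in> borel_measurable lebesgue"
        using m by (simp add: partial_deriv_grad)
      show "AE x in lebesgue. snd (rep_l2 (jet \<psi>) x) $ i * \<phi> x = partial_deriv i \<psi> x * \<phi> x"
        using rep_jet[OF \<psi>] by eventually_elim (simp add: partial_deriv_grad)
    qed
    ultimately show "inner (jet \<psi>) ?Y = 0"
      using integral_by_parts_test[OF \<phi> test_function_smooth[OF \<psi>], of i] by (simp add: eq)
  qed
  then show ?thesis by (simp add: eq)
qed

subsection \<open>Difference quotients and local averages\<close>

text \<open>The Cauchy-Schwarz inequality against the constant 1, from the nonnegative integral of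
  (m f - I)^2 with total mass m.\<close>

lemma (in finite_measure) integral_sq_le:
  fixes f :: "'a \<Rightarrow> real"
  assumes f: "integrable M f" "integrable M (\<lambda>x. (f x)\<^sup>2)"
  shows "(LINT x|M. f x)\<^sup>2 \<le> measure M (space M) * (LINT x|M. (f x)\<^sup>2)"
proof -
  define m where "m = measure M (space M)"
  define I where "I = (LINT x|M. f x)"
  show ?thesis
  proof (cases "m = 0")
    case True
    then have "AE x in M. False" unfolding m_def
      by (intro AE_I[of _ _ "space M"]) (auto simp: emeasure_eq_measure)
    then have "(LINT x|M. f x) = (LINT x|M. 0)" using f by (intro integral_cong_AE) auto
    then show ?thesis by simp
  next
    case False
    then have "0 < m" unfolding m_def by (simp add: zero_less_measure_iff)
    have "0 \<le> (LINT x|M. (m * f x - I)\<^sup>2)" by simp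
    also have "(\<lambda>x. (m * f x - I)\<^sup>2) = (\<lambda>x. m\<^sup>2 * (f x)\<^sup>2 - 2 * m * I * f x + I\<^sup>2)"
      by (simp add: fun_eq_iff power2_eq_square algebra_simps)
    also have "(LINT x|M. m\<^sup>2 * (f x)\<^sup>2 - 2 * m * I * f x + I\<^sup>2) =
        m\<^sup>2 * (LINT x|M. (f x)\<^sup>2) - 2 * m * I * I + m * I\<^sup>2"
      using f by (simp add: I_def m_def)
    also have "\<dots> = m * (m * (LINT x|M. (f x)\<^sup>2) - I\<^sup>2)"
      by (simp add: power2_eq_square algebra_simps)
    finally show ?thesis
      using \<open>0 < m\<close> by (simp add: zero_le_mult_iff I_def m_def)
  qed
qed

lemma finite_measure_restrict_lborel:
  fixes S :: "'a::euclidean_space set"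
  assumes "bounded S" "S \<in> sets borel"
  shows "finite_measure (restrict_space lborel S)"
proof (rule finite_measureI)
  have "emeasure lborel S < \<infinity>" by (rule emeasure_bounded_finite[OF assms(1)])
  then show "emeasure (restrict_space lborel S) (space (restrict_space lborel S)) \<noteq> \<infinity>"
    using assms by (simp add: space_restrict_space emeasure_restrict_space)
qed

lemma nn_integral_translation:
  fixes f :: "'a::euclidean_space \<Rightarrow> ennreal"
  assumes "f \<in> borel_measurable borel"
  shows "(\<integral>\<^sup>+x. f (x + c) \<partial>lborel) = (\<integral>\<^sup>+x. f x \<partial>lborel)"
proof -
  have "(\<integral>\<^sup>+x. f x \<partial>lborel) = (\<integral>\<^sup>+x. f x \<partial>distr lborel borel ((+) c))"
    by (simp add: lborel_distr_plus)
  also have "\<dots> = (\<integral>\<^sup>+x. f (c + x) \<partial>lborel)"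
    using assms by (intro nn_integral_distr) auto
  finally show ?thesis by (simp add: add.commute)
qed

text \<open>The fundamental theorem along the segment, followed for p = 2 by Cauchy-Schwarz on the
  unit interval. The square serves the comparison of a function with its averages, the first power
  the comparison of two averages.\<close>

lemma line_integral_bound:
  fixes \<phi> :: "real^'n \<Rightarrow> real"
  assumes \<phi>: "smooth \<phi>" and p: "p = 1 \<or> p = (2::nat)"
  shows "ennreal (\<bar>\<phi> (x + v) - \<phi> x\<bar> ^ p) \<le>
    (\<integral>\<^sup>+t. indicator {0..1} t * ennreal ((norm v * norm (grad \<phi> (x + t *\<^sub>R v))) ^ p) \<partial>lborel)"
proof -
  define f where "f t = grad \<phi> (x + t *\<^sub>R v) \<bullet> v" for t
  define I where "I = restrict_space lborel {0..1::real}"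
  have fin: "finite_measure I" unfolding I_def by (rule finite_measure_restrict_lborel) auto
  interpret finite_measure I by (rule fin)
  have mI: "measure I (space I) = 1" by (simp add: I_def measure_restrict_space space_restrict_space)
  have cont_g: "continuous_on UNIV (\<lambda>t. grad \<phi> (x + t *\<^sub>R v))"
    by (intro continuous_on_compose2[OF smooth_grad_continuous[OF \<phi>, of UNIV]] continuous_intros) auto
  have cont: "continuous_on UNIV f" unfolding f_def by (intro continuous_intros cont_g)
  have int: "integrable I h" if "continuous_on UNIV h" for h :: "real \<Rightarrow> real"
  proof -
    have "set_integrable lborel {0..1} h"
      by (rule borel_integrable_atLeastAtMost') (rule continuous_on_subset[OF that], simp)
    then show ?thesis unfolding I_def set_integrable_def by (subst integrable_restrict_space) auto
  qed
  have "(LINT t|I. f t) = (LINT t|lborel. indicator {0..1} t *\<^sub>R f t)"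
    unfolding I_def by (subst integral_restrict_space) auto
  also have "\<dots> = \<phi> (x + 1 *\<^sub>R v) - \<phi> (x + 0 *\<^sub>R v)"
  proof (rule integral_FTC_atLeastAtMost)
    fix t :: real
    have "((\<lambda>t. \<phi> (x + t *\<^sub>R v)) has_derivative (\<lambda>s. grad \<phi> (x + t *\<^sub>R v) \<bullet> (s *\<^sub>R v))) (at t)"
      by (rule has_derivative_compose[of "\<lambda>t. x + t *\<^sub>R v" "\<lambda>t. t *\<^sub>R v"])
         (auto intro!: derivative_eq_intros has_derivative_grad smooth_differentiable \<phi>)
    then show "((\<lambda>t. \<phi> (x + t *\<^sub>R v)) has_vector_derivative f t) (at t within {0..1})"
      unfolding has_vector_derivative_def f_def by (simp add: has_derivative_at_withinI)
  qed (use cont continuous_on_subset in auto)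
  finally have d: "\<phi> (x + v) - \<phi> x = (LINT t|I. f t)" by simp
  have pw: "\<bar>f t\<bar> \<le> norm v * norm (grad \<phi> (x + t *\<^sub>R v))" for t
    unfolding f_def using Cauchy_Schwarz_ineq2[of "grad \<phi> (x + t *\<^sub>R v)" v] by (simp add: mult.commute)
  have "\<bar>\<phi> (x + v) - \<phi> x\<bar> ^ p \<le> (LINT t|I. \<bar>f t\<bar> ^ p)"
  proof (cases "p = 1")
    case True
    then show ?thesis unfolding d using integral_abs_bound[of I f] by simp
  next
    case False
    with p have "p = 2" by simp
    then show ?thesis
      unfolding d using integral_sq_le[of f] int[OF cont] int[of "\<lambda>t. (f t)\<^sup>2"] cont
      by (simp add: mI continuous_on_power)
  qed
  also have "\<dots> \<le> (LINT t|I. (norm v * norm (grad \<phi> (x + t *\<^sub>R v))) ^ p)"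
    by (intro integral_mono int power_mono pw) (auto intro!: continuous_intros cont cont_g)
  finally have "ennreal (\<bar>\<phi> (x + v) - \<phi> x\<bar> ^ p) \<le> ennreal \<dots>" by (rule ennreal_leI)
  also have "\<dots> = (\<integral>\<^sup>+t. ennreal ((norm v * norm (grad \<phi> (x + t *\<^sub>R v))) ^ p) \<partial>I)"
    by (intro nn_integral_eq_integral[symmetric] int) (auto intro!: continuous_intros cont_g)
  also have "\<dots> = (\<integral>\<^sup>+t. indicator {0..1} t * ennreal ((norm v * norm (grad \<phi> (x + t *\<^sub>R v))) ^ p) \<partial>lborel)"
    unfolding I_def by (subst nn_integral_restrict_space) (auto simp: mult.commute)
  finally show ?thesis .
qed

text \<open>Tonelli moves the line parameter outside; for each parameter the inner integral is a
  translate, and \<open>A'\<close> collects all points that the segments from \<open>A\<close>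
  reach.\<close>

lemma difference_bound:
  fixes \<phi> :: "real^'n \<Rightarrow> real"
  assumes \<phi>: "smooth \<phi>" and p: "p = 1 \<or> p = (2::nat)"
    and A [measurable]: "A \<in> sets borel" "A' \<in> sets borel"
    and sub: "\<And>x t. x \<in> A \<Longrightarrow> 0 \<le> t \<Longrightarrow> t \<le> 1 \<Longrightarrow> x + t *\<^sub>R v \<in> A'"
  shows "(\<integral>\<^sup>+x. indicator A x * ennreal (\<bar>\<phi> (x + v) - \<phi> x\<bar> ^ p) \<partial>lborel) \<le>
    ennreal (norm v ^ p) * (\<integral>\<^sup>+x. indicator A' x * ennreal (norm (grad \<phi> x) ^ p) \<partial>lborel)"
proof -
  define N where "N x = ennreal ((norm v * norm (grad \<phi> x)) ^ p)" for x
  have cN: "continuous_on UNIV (\<lambda>x. (norm v * norm (grad \<phi> x)) ^ p)"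
    by (intro continuous_intros smooth_grad_continuous \<phi>)
  have [measurable]: "N \<in> borel_measurable borel"
    unfolding N_def using borel_measurable_continuous_onI[OF cN] by measurable
  have [measurable]: "(\<lambda>z. N (fst z + snd z *\<^sub>R v)) \<in> borel_measurable (borel \<Otimes>\<^sub>M borel)" by measurable
  have "(\<integral>\<^sup>+x. indicator A x * ennreal (\<bar>\<phi> (x + v) - \<phi> x\<bar> ^ p) \<partial>lborel) \<le>
      (\<integral>\<^sup>+x. indicator A x * (\<integral>\<^sup>+t. indicator {0..1} t * N (x + t *\<^sub>R v) \<partial>lborel) \<partial>lborel)"
    unfolding N_def by (intro nn_integral_mono mult_left_mono line_integral_bound \<phi> p) simp
  also have "\<dots> = (\<integral>\<^sup>+x. \<integral>\<^sup>+t. indicator A x * (indicator {0..1} t * N (x + t *\<^sub>R v)) \<partial>lborel \<partial>lborel)"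
    by (intro nn_integral_cong nn_integral_cmult[symmetric]) measurable
  also have "\<dots> = (\<integral>\<^sup>+t. \<integral>\<^sup>+x. indicator A x * (indicator {0..1} t * N (x + t *\<^sub>R v)) \<partial>lborel \<partial>lborel)"
    by (rule lborel_pair.Fubini'[symmetric]) measurable
  also have "\<dots> \<le> (\<integral>\<^sup>+t. indicator {0..1::real} t * (\<integral>\<^sup>+x. indicator A' x * N x \<partial>lborel) \<partial>lborel)"
  proof (rule nn_integral_mono)
    fix t :: real
    have "(\<integral>\<^sup>+x. indicator A x * (indicator {0..1} t * N (x + t *\<^sub>R v)) \<partial>lborel)
        \<le> (\<integral>\<^sup>+x. indicator {0..1} t * (indicator A' (x + t *\<^sub>R v) * N (x + t *\<^sub>R v)) \<partial>lborel)"
      using sub by (intro nn_integral_mono) (auto simp: indicator_def)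
    also have "\<dots> = indicator {0..1} t * (\<integral>\<^sup>+x. indicator A' (x + t *\<^sub>R v) * N (x + t *\<^sub>R v) \<partial>lborel)"
      by (rule nn_integral_cmult) measurable
    also have "(\<integral>\<^sup>+x. indicator A' (x + t *\<^sub>R v) * N (x + t *\<^sub>R v) \<partial>lborel) = (\<integral>\<^sup>+x. indicator A' x * N x \<partial>lborel)"
      by (rule nn_integral_translation[of "\<lambda>x. indicator A' x * N x"]) measurable
    finally show "(\<integral>\<^sup>+x. indicator A x * (indicator {0..1} t * N (x + t *\<^sub>R v)) \<partial>lborel)
        \<le> indicator {0..1} t * (\<integral>\<^sup>+x. indicator A' x * N x \<partial>lborel)" .
  qed
  also have "\<dots> = (\<integral>\<^sup>+t. indicator {0..1::real} t \<partial>lborel) * (\<integral>\<^sup>+x. indicator A' x * N x \<partial>lborel)"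
    by (rule nn_integral_multc) measurable
  also have "\<dots> = (\<integral>\<^sup>+x. indicator A' x * N x \<partial>lborel)" by simp
  also have "\<dots> = (\<integral>\<^sup>+x. ennreal (norm v ^ p) * (indicator A' x * ennreal (norm (grad \<phi> x) ^ p)) \<partial>lborel)"
    unfolding N_def by (intro nn_integral_cong) (simp add: power_mult_distrib ennreal_mult'' ac_simps)
  also have "\<dots> = ennreal (norm v ^ p) * (\<integral>\<^sup>+x. indicator A' x * ennreal (norm (grad \<phi> x) ^ p) \<partial>lborel)"
    using borel_measurable_continuous_onI[OF smooth_grad_continuous[OF \<phi>]] by (intro nn_integral_cmult) measurable
  finally show ?thesis .
qed

text \<open>The ball is centred at the origin and \<phi> is translated instead, so that the domain
  of integration does not depend on \<open>x\<close> and Tonelli applies directly.\<close>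

definition avg :: "real \<Rightarrow> (real^'n \<Rightarrow> real) \<Rightarrow> real^'n \<Rightarrow> real" where
  "avg h \<phi> x = (LINT y|lborel. indicat_real (ball 0 h) y * \<phi> (x + y)) / measure lborel (ball (0::real^'n) h)"

lemma measure_ball_pos: "0 < h \<Longrightarrow> 0 < measure lborel (ball (x::real^'n) h)"
  using content_ball_pos[of h x] by simp

lemma finite_restrict_ball: "finite_measure (restrict_space lborel (ball (x::real^'n) h))"
  by (rule finite_measure_restrict_lborel) auto

lemma integrable_ball_continuous:
  fixes f :: "real^'n \<Rightarrow> real"
  assumes "continuous_on UNIV f"
  shows "integrable (restrict_space lborel (ball x h)) f"
proof -
  interpret finite_measure "restrict_space lborel (ball x h)" by (rule finite_restrict_ball)
  have "bounded (f ` cball x h)"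
    by (intro compact_imp_bounded compact_continuous_image continuous_on_subset[OF assms]) auto
  then obtain B where B0: "\<forall>z\<in>f ` cball x h. norm z \<le> B" unfolding bounded_iff by blast
  have B: "\<bar>f y\<bar> \<le> B" if "dist x y < h" for y
    using bspec[OF B0 imageI[of y]] that by simp
  show ?thesis
  proof (rule integrable_const_bound[of _ B])
    show "AE y in restrict_space lborel (ball x h). norm (f y) \<le> B"
      by (rule AE_I2) (use B in \<open>simp add: space_restrict_space\<close>)
    show "f \<in> borel_measurable (restrict_space lborel (ball x h))"
      using borel_measurable_continuous_onI[OF assms] by (simp add: measurable_restrict_space1)
  qed
qed

lemma avg_alt:
  fixes x :: "real^'n"
  shows "avg h \<phi> x = (LINT y|restrict_space lborel (ball 0 h). \<phi> (x + y)) / measure lborel (ball (0::real^'n) h)"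
  unfolding avg_def by (subst integral_restrict_space) auto

lemma continuous_on_shift: "continuous_on UNIV \<phi> \<Longrightarrow> continuous_on UNIV (\<lambda>y::real^'n. \<phi> (x + y) :: real)"
  by (rule continuous_on_compose2[of UNIV \<phi>]) (auto intro!: continuous_intros)

lemma nn_integral_ball_restrict:
  fixes f :: "real^'n \<Rightarrow> real"
  assumes "continuous_on UNIV f" "\<And>x. 0 \<le> f x"
  shows "ennreal (LINT y|restrict_space lborel (ball x h). f y) = (\<integral>\<^sup>+y. indicator (ball x h) y * ennreal (f y) \<partial>lborel)"
proof -
  have "ennreal (LINT y|restrict_space lborel (ball x h). f y) = (\<integral>\<^sup>+y. ennreal (f y) \<partial>restrict_space lborel (ball x h))"
    using assms by (intro nn_integral_eq_integral[symmetric] integrable_ball_continuous) auto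
  also have "\<dots> = (\<integral>\<^sup>+y. indicator (ball x h) y * ennreal (f y) \<partial>lborel)"
    by (subst nn_integral_restrict_space) (auto simp: mult.commute)
  finally show ?thesis .
qed

lemma avg_diff_sq:
  fixes \<phi> :: "real^'n \<Rightarrow> real"
  assumes \<phi>: "continuous_on UNIV \<phi>" and h: "0 < h"
  shows "ennreal ((\<phi> x - avg h \<phi> x)\<^sup>2) \<le>
    ennreal (1 / measure lborel (ball (0::real^'n) h)) * (\<integral>\<^sup>+y. indicator (ball 0 h) y * ennreal (\<bar>\<phi> (x + y) - \<phi> x\<bar> ^ 2) \<partial>lborel)"
proof -
  define V where "V = measure lborel (ball (0::real^'n) h)"
  have V: "0 < V" unfolding V_def using h by (rule measure_ball_pos)
  let ?R = "restrict_space lborel (ball (0::real^'n) h)"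
  interpret finite_measure ?R by (rule finite_restrict_ball)
  have mR: "measure ?R (ball 0 h) = V" by (simp add: V_def measure_restrict_space space_restrict_space)
  note c = continuous_on_shift[OF \<phi>, of x]
  let ?f = "\<lambda>y. \<phi> (x + y) - \<phi> x"
  have cf: "continuous_on UNIV ?f" by (intro continuous_intros c)
  have "(LINT y|?R. ?f y) = (LINT y|?R. \<phi> (x + y)) - V * \<phi> x"
    using integrable_ball_continuous[OF c] mR by simp
  then have *: "(LINT y|?R. \<phi> (x + y)) = (LINT y|?R. ?f y) + V * \<phi> x" by simp
  have "\<phi> x - avg h \<phi> x = - (LINT y|?R. ?f y) / V"
    unfolding avg_alt V_def[symmetric] * using V by (simp add: add_divide_distrib)
  then have "(\<phi> x - avg h \<phi> x)\<^sup>2 = (LINT y|?R. ?f y)\<^sup>2 / V\<^sup>2" by (simp add: power_divide)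
  also have "\<dots> \<le> (V * (LINT y|?R. (?f y)\<^sup>2)) / V\<^sup>2"
    using integral_sq_le[of ?f] integrable_ball_continuous[OF cf]
      integrable_ball_continuous[of "\<lambda>y. (?f y)\<^sup>2"] cf
    by (intro divide_right_mono) (simp_all add: mR continuous_on_power)
  also have "\<dots> = (1 / V) * (LINT y|?R. (?f y)\<^sup>2)" using V by (simp add: power2_eq_square)
  finally have "ennreal ((\<phi> x - avg h \<phi> x)\<^sup>2) \<le> ennreal ((1 / V) * (LINT y|?R. (?f y)\<^sup>2))" by (rule ennreal_leI)
  also have "\<dots> = ennreal (1 / V) * ennreal (LINT y|?R. (?f y)\<^sup>2)" using V by (intro ennreal_mult) auto
  also have "ennreal (LINT y|?R. (?f y)\<^sup>2) = (\<integral>\<^sup>+y. indicator (ball 0 h) y * ennreal ((?f y)\<^sup>2) \<partial>lborel)"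
    by (intro nn_integral_ball_restrict continuous_intros c) simp
  finally show ?thesis unfolding V_def by simp
qed

text \<open>By Cauchy-Schwarz the squared deviation from the average is at most the average of
  squared differences over shifts shorter than \<open>h\<close>; each shift contributes at most h^2
  times the gradient energy.\<close>

lemma avg_bound:
  fixes \<phi> :: "real^'n \<Rightarrow> real"
  assumes \<phi>: "smooth \<phi>" and h: "0 < h"
    and A [measurable]: "A \<in> sets borel" "A' \<in> sets borel"
    and sub: "\<And>x y. x \<in> A \<Longrightarrow> norm y < h \<Longrightarrow> x + y \<in> A'"
  shows "(\<integral>\<^sup>+x. indicator A x * ennreal ((\<phi> x - avg h \<phi> x)\<^sup>2) \<partial>lborel) \<le>
    ennreal (h\<^sup>2) * (\<integral>\<^sup>+x. indicator A' x * ennreal ((norm (grad \<phi> x))\<^sup>2) \<partial>lborel)"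
proof -
  define V where "V = measure lborel (ball (0::real^'n) h)"
  have V: "0 < V" unfolding V_def using h by (rule measure_ball_pos)
  define I where "I = (\<integral>\<^sup>+x. indicator A' x * ennreal ((norm (grad \<phi> x))\<^sup>2) \<partial>lborel)"
  have c: "continuous_on UNIV \<phi>" by (rule smooth_continuous[OF \<phi>])
  have [measurable]: "\<phi> \<in> borel_measurable borel" by (rule borel_measurable_continuous_onI[OF c])
  have [measurable]: "ball (0::real^'n) h \<in> sets borel" by simp
  let ?D = "\<lambda>x y. ennreal (\<bar>\<phi> (x + y) - \<phi> x\<bar> ^ 2)"
  let ?B = "ball (0::real^'n) h"
  have "(\<integral>\<^sup>+x. indicator A x * ennreal ((\<phi> x - avg h \<phi> x)\<^sup>2) \<partial>lborel) \<le>
     (\<integral>\<^sup>+x. indicator A x * (ennreal (1 / V) * (\<integral>\<^sup>+y. indicator ?B y * ?D x y \<partial>lborel)) \<partial>lborel)"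
    unfolding V_def by (intro nn_integral_mono mult_left_mono avg_diff_sq c h) simp
  also have "\<dots> = (\<integral>\<^sup>+x. ennreal (1 / V) * (\<integral>\<^sup>+y. indicator A x * (indicator ?B y * ?D x y) \<partial>lborel) \<partial>lborel)"
    by (intro nn_integral_cong, subst nn_integral_cmult) (measurable, simp add: ac_simps)
  also have "\<dots> = ennreal (1 / V) * (\<integral>\<^sup>+x. \<integral>\<^sup>+y. indicator A x * (indicator ?B y * ?D x y) \<partial>lborel \<partial>lborel)"
    by (rule nn_integral_cmult) measurable
  also have "(\<integral>\<^sup>+x. \<integral>\<^sup>+y. indicator A x * (indicator ?B y * ?D x y) \<partial>lborel \<partial>lborel) =
      (\<integral>\<^sup>+y. \<integral>\<^sup>+x. indicator A x * (indicator ?B y * ?D x y) \<partial>lborel \<partial>lborel)"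
    by (rule lborel_pair.Fubini'[symmetric]) measurable
  also have "\<dots> \<le> (\<integral>\<^sup>+y. ennreal (h\<^sup>2) * I * indicator ?B y \<partial>lborel)"
  proof (rule nn_integral_mono)
    fix y :: "real^'n"
    show "(\<integral>\<^sup>+x. indicator A x * (indicator ?B y * ?D x y) \<partial>lborel) \<le> ennreal (h\<^sup>2) * I * indicator ?B y"
    proof (cases "y \<in> ?B")
      case True
      then have y: "norm y < h" by simp
      have sub': "x + t *\<^sub>R y \<in> A'" if "x \<in> A" "0 \<le> t" "t \<le> 1" for x t
      proof -
        have "norm (t *\<^sub>R y) \<le> norm y" using that by (simp add: mult_left_le_one_le)
        then show ?thesis using sub[OF that(1)] y by auto
      qed
      have "(\<integral>\<^sup>+x. indicator A x * (indicator ?B y * ?D x y) \<partial>lborel) = (\<integral>\<^sup>+x. indicator A x * ?D x y \<partial>lborel)"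
        using True by simp
      also have "\<dots> \<le> ennreal (norm y ^ 2) * I"
        unfolding I_def by (rule difference_bound[OF \<phi> _ A sub']) auto
      also have "\<dots> \<le> ennreal (h\<^sup>2) * I"
        using y h by (intro mult_right_mono ennreal_leI power_mono) auto
      finally show ?thesis using True by simp
    qed simp
  qed
  also have "\<dots> = ennreal (h\<^sup>2) * I * emeasure lborel ?B"
    by (rule nn_integral_cmult_indicator) simp
  also have "emeasure lborel ?B = ennreal V"
    unfolding V_def using emeasure_lborel_ball_finite[of "0::real^'n" h]
    by (intro emeasure_eq_ennreal_measure) (auto simp: less_top)
  also have "ennreal (1 / V) * (ennreal (h\<^sup>2) * I * ennreal V) = ennreal (1 / V) * ennreal V * (ennreal (h\<^sup>2) * I)"
    by (simp add: ac_simps)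
  also have "ennreal (1 / V) * ennreal V = 1" using V by (simp add: ennreal_mult[symmetric])
  finally show ?thesis by (simp add: I_def mult_left_mono)
qed

text \<open>Only the first power of the gradient appears on the right. This is the source of the
  gain in the reverse Hoelder estimate: once averaged, a function oscillates no more than the mean
  of its gradient allows.\<close>

lemma avg_lipschitz:
  fixes \<phi> :: "real^'n \<Rightarrow> real"
  assumes \<phi>: "smooth \<phi>" and h: "0 < h"
    and A' [measurable]: "A' \<in> sets borel"
    and sub: "\<And>y t. norm y < h \<Longrightarrow> 0 \<le> t \<Longrightarrow> t \<le> 1 \<Longrightarrow> z + y + t *\<^sub>R (x - z) \<in> A'"
  shows "ennreal \<bar>avg h \<phi> x - avg h \<phi> z\<bar> \<le>
    ennreal (norm (x - z) / measure lborel (ball (0::real^'n) h)) * (\<integral>\<^sup>+x. indicator A' x * ennreal (norm (grad \<phi> x)) \<partial>lborel)"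
proof -
  define V where "V = measure lborel (ball (0::real^'n) h)"
  have V: "0 < V" unfolding V_def using h by (rule measure_ball_pos)
  let ?R = "restrict_space lborel (ball (0::real^'n) h)"
  have c: "continuous_on UNIV \<phi>" by (rule smooth_continuous[OF \<phi>])
  have cz: "continuous_on UNIV (\<lambda>y. \<phi> (z + y))" and cx: "continuous_on UNIV (\<lambda>y. \<phi> (x + y))"
    by (intro continuous_on_shift c)+
  note [measurable] = borel_measurable_continuous_onI[OF c]
  have [measurable]: "ball z h \<in> sets borel" by simp
  have "\<bar>avg h \<phi> x - avg h \<phi> z\<bar> = \<bar>LINT y|?R. \<phi> (x + y) - \<phi> (z + y)\<bar> / V"
    unfolding avg_alt V_def[symmetric] using V integrable_ball_continuous[OF cx] integrable_ball_continuous[OF cz]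
    by (simp add: diff_divide_distrib[symmetric] abs_divide)
  also have "\<dots> \<le> (1 / V) * (LINT y|?R. \<bar>\<phi> (x + y) - \<phi> (z + y)\<bar>)"
    using V integral_abs_bound[of ?R "\<lambda>y. \<phi> (x + y) - \<phi> (z + y)"] by (simp add: divide_right_mono)
  finally have "ennreal \<bar>avg h \<phi> x - avg h \<phi> z\<bar> \<le> ennreal ((1 / V) * (LINT y|?R. \<bar>\<phi> (x + y) - \<phi> (z + y)\<bar>))"
    by (rule ennreal_leI)
  also have "\<dots> = ennreal (1 / V) * ennreal (LINT y|?R. \<bar>\<phi> (x + y) - \<phi> (z + y)\<bar>)"
    using V by (intro ennreal_mult) auto
  also have "ennreal (LINT y|?R. \<bar>\<phi> (x + y) - \<phi> (z + y)\<bar>) =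
      (\<integral>\<^sup>+y. indicator (ball 0 h) y * ennreal \<bar>\<phi> (x + y) - \<phi> (z + y)\<bar> \<partial>lborel)"
    by (intro nn_integral_ball_restrict continuous_intros cx cz) simp
  also have "\<dots> = (\<integral>\<^sup>+y. indicator (ball z h) (y + z) * ennreal (\<bar>\<phi> ((y + z) + (x - z)) - \<phi> (y + z)\<bar> ^ 1) \<partial>lborel)"
    by (intro nn_integral_cong) (auto simp: indicator_def dist_norm algebra_simps)
  also have "\<dots> = (\<integral>\<^sup>+y. indicator (ball z h) y * ennreal (\<bar>\<phi> (y + (x - z)) - \<phi> y\<bar> ^ 1) \<partial>lborel)"
    by (rule nn_integral_translation[of "\<lambda>y. indicator (ball z h) y * ennreal (\<bar>\<phi> (y + (x - z)) - \<phi> y\<bar> ^ 1)"]) measurable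
  also have "\<dots> \<le> ennreal (norm (x - z) ^ 1) * (\<integral>\<^sup>+x. indicator A' x * ennreal (norm (grad \<phi> x) ^ 1) \<partial>lborel)"
  proof (rule difference_bound[OF \<phi> _ _ A'])
    fix y and t :: real assume "y \<in> ball z h" "0 \<le> t" "t \<le> 1"
    then show "y + t *\<^sub>R (x - z) \<in> A'" using sub[of "y - z" t] by (simp add: dist_norm norm_minus_commute)
  qed auto
  finally show ?thesis
    unfolding V_def[symmetric] using V
    by (simp add: mult_left_mono mult.assoc[symmetric] ennreal_mult[symmetric])
qed


lemma avg_measurable:
  fixes \<phi> :: "real^'n \<Rightarrow> real"
  assumes "continuous_on UNIV \<phi>"
  shows "avg h \<phi> \<in> borel_measurable borel"
proof -
  note [measurable] = borel_measurable_continuous_onI[OF assms]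
  have [measurable]: "ball (0::real^'n) h \<in> sets borel" by simp
  have "(\<lambda>x. LINT y|lborel. indicat_real (ball 0 h) y * \<phi> (x + y)) \<in> borel_measurable borel"
    by (rule lborel.borel_measurable_lebesgue_integral) measurable
  then show ?thesis unfolding avg_def by measurable
qed

lemma avg_eq:
  fixes \<phi> :: "real^'n \<Rightarrow> real"
  assumes "continuous_on UNIV \<phi>"
  shows "avg h \<phi> x = (LINT y|lebesgue. \<phi> y * indicat_real (ball x h) y) / measure lborel (ball (0::real^'n) h)"
proof -
  note [measurable] = borel_measurable_continuous_onI[OF assms]
  have [measurable]: "ball x h \<in> sets borel" by simp
  have "(\<lambda>y. indicat_real (ball 0 h) y * \<phi> (x + y)) = (\<lambda>y. \<phi> (y + x) * indicat_real (ball x h) (y + x))"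
    by (auto simp: fun_eq_iff indicator_def dist_norm add.commute)
  then have "(LINT y|lborel. indicat_real (ball 0 h) y * \<phi> (x + y)) = (LINT y|lebesgue. \<phi> (y + x) * indicat_real (ball x h) (y + x))"
    by (simp add: integral_completion)
  also have "\<dots> = (LINT y|lebesgue. \<phi> y * indicat_real (ball x h) y)"
    by (rule lebesgue_integral_translation[of "\<lambda>y. \<phi> y * indicat_real (ball x h) y"]) measurable
  finally show ?thesis by (simp add: avg_def)
qed

section \<open>Indicators, restriction and pointwise norm in the Hilbert space\<close>

definition ind :: "'a::euclidean_space set \<Rightarrow> ('a, real) l2" where
  "ind B = abs_l2 (indicat_real B)"

definition restr :: "'a::euclidean_space set \<Rightarrow> ('a, 'b::euclidean_space) l2 \<Rightarrow> ('a, 'b) l2" where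
  "restr B = mulop (\<lambda>x v. indicat_real B x *\<^sub>R v)"

definition nrm :: "('a::euclidean_space, 'b::euclidean_space) l2 \<Rightarrow> ('a, real) l2" where
  "nrm X = abs_l2 (\<lambda>x. norm (rep_l2 X x))"

lemma sq_integrable_ind: "B \<in> lmeasurable \<Longrightarrow> sq_integrable lebesgue (indicat_real B)"
proof -
  assume B: "B \<in> lmeasurable"
  have "(\<lambda>x. (norm (indicat_real B x))\<^sup>2) = indicat_real B" by (auto simp: indicator_def fun_eq_iff)
  then show ?thesis using B by (simp add: sq_integrable_def lmeasurable_iff_integrable)
qed

lemma pointwise_op_restr: "B \<in> sets lebesgue \<Longrightarrow> pointwise_op (\<lambda>x v. indicat_real B x *\<^sub>R v)"
  by (rule pointwise_op_scale[where C=1]) (auto simp: indicator_def)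

lemma bounded_linear_restr: "B \<in> sets lebesgue \<Longrightarrow> bounded_linear (restr B)"
  unfolding restr_def by (intro bounded_linear_mulop pointwise_op_restr)

lemma nrm_sq: "sq_integrable lebesgue (\<lambda>x. norm (rep_l2 X x))"
  by (rule sq_integrable_bound[OF rep_l2_sq[of X], where C=1]) auto

text \<open>\<open>nrm\<close> is not linear, so its continuity, needed to pass estimates to the
  closure of the jets, comes from the reverse triangle inequality.\<close>

lemma nrm_lipschitz: "norm (nrm X - nrm Y) \<le> norm (X - Y)"
proof (rule power2_le_imp_le)
  have "(norm (nrm X - nrm Y))\<^sup>2 = (LINT x|lebesgue. (norm (norm (rep_l2 X x) - norm (rep_l2 Y x)))\<^sup>2)"
    unfolding nrm_def abs_l2_diff[OF nrm_sq nrm_sq]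
    by (rule norm_abs_l2_sq[OF sq_integrable_diff[OF nrm_sq nrm_sq]])
  also have "\<dots> \<le> (LINT x|lebesgue. (norm (rep_l2 X x - rep_l2 Y x))\<^sup>2)"
  proof (rule integral_mono)
    show "integrable lebesgue (\<lambda>x. (norm (norm (rep_l2 X x) - norm (rep_l2 Y x)))\<^sup>2)"
      by (rule sq_integrableD(2)[OF sq_integrable_diff[OF nrm_sq nrm_sq]])
    show "integrable lebesgue (\<lambda>x. (norm (rep_l2 X x - rep_l2 Y x))\<^sup>2)"
      by (rule sq_integrableD(2)[OF sq_integrable_diff[OF rep_l2_sq rep_l2_sq]])
    show "(norm (norm (rep_l2 X x) - norm (rep_l2 Y x)))\<^sup>2 \<le> (norm (rep_l2 X x - rep_l2 Y x))\<^sup>2" for x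
      by (intro power_mono) (simp_all add: norm_triangle_ineq3)
  qed
  also have "\<dots> = (norm (X - Y))\<^sup>2"
    using norm_abs_l2_sq[OF sq_integrable_diff[OF rep_l2_sq rep_l2_sq], of X Y]
      abs_l2_diff[OF rep_l2_sq rep_l2_sq, of X Y] by simp
  finally show "(norm (nrm X - nrm Y))\<^sup>2 \<le> (norm (X - Y))\<^sup>2" .
qed simp

lemma continuous_on_nrm: "continuous_on S nrm"
proof (rule lipschitz_on_continuous_on)
  show "1-lipschitz_on S nrm" by (rule lipschitz_onI) (simp_all add: dist_norm nrm_lipschitz)
qed

lemma norm_abs_l2_nn:
  assumes "sq_integrable lebesgue f"
  shows "ennreal ((norm (abs_l2 f))\<^sup>2) = (\<integral>\<^sup>+x. ennreal ((norm (f x))\<^sup>2) \<partial>lebesgue)"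
  unfolding norm_abs_l2_sq[OF assms]
  by (rule nn_integral_eq_integral[symmetric]) (use sq_integrableD(2)[OF assms] in auto)

text \<open>The deviation from the average at \<open>z\<close> splits into the deviation from the
  local average, paid with the factor h^2 on the energy, and the oscillation of the averages, paid
  with the first power of the gradient. The radius 3 r accommodates 2 r + h.\<close>

lemma smoothing_test:
  fixes \<phi> :: "real^'n \<Rightarrow> real"
  assumes \<phi>: "\<phi> \<in> test_functions \<Omega>" and h: "0 < h" "h \<le> r"
  defines "V \<equiv> measure lborel (ball (0::real^'n) h)"
  shows "(\<integral>\<^sup>+x. indicator (ball z (2 * r)) x * ennreal ((\<phi> x - avg h \<phi> z)\<^sup>2) \<partial>lborel) \<le>
    ennreal (2 * h\<^sup>2) * (\<integral>\<^sup>+x. indicator (ball z (3 * r)) x * ennreal ((norm (grad \<phi> x))\<^sup>2) \<partial>lborel) +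
    ennreal (8 * r\<^sup>2 / V\<^sup>2 * measure lborel (ball z (2 * r)) * (LINT x|lebesgue. indicat_real (ball z (3 * r)) x * norm (grad \<phi> x))\<^sup>2)"
proof -
  note sm = test_function_smooth[OF \<phi>]
  note [measurable] = borel_measurable_continuous_onI[OF smooth_continuous[OF sm]]
    borel_measurable_continuous_onI[OF smooth_grad_continuous[OF sm]] avg_measurable[OF smooth_continuous[OF sm]]
  define A where "A = ball z (2 * r)"
  define A' where "A' = ball z (3 * r)"
  have [measurable]: "A \<in> sets borel" "A' \<in> sets borel" by (auto simp: A_def A'_def)
  have V: "0 < V" unfolding V_def using h(1) by (rule measure_ball_pos)
  have r: "0 < r" using h by simp
  define l where "l = (LINT x|lebesgue. indicat_real A' x * norm (grad \<phi> x))"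
  have int: "integrable lebesgue (\<lambda>x. indicat_real A' x * norm (grad \<phi> x))"
  proof -
    have "sq_integrable lebesgue (\<lambda>x. norm (grad \<phi> x))"
      by (rule sq_integrable_bound[OF test_function_grad_integrable(3)[OF \<phi>], where C=1])
         (use test_function_grad_integrable(3)[OF \<phi>] in auto)
    from integrable_inner_sq[OF sq_integrable_ind[of A'] this] show ?thesis
      by (simp add: A'_def lmeasurable_ball)
  qed
  have l: "ennreal l = (\<integral>\<^sup>+x. indicator A' x * ennreal (norm (grad \<phi> x)) \<partial>lborel)"
  proof -
    have "ennreal l = (\<integral>\<^sup>+x. ennreal (indicat_real A' x * norm (grad \<phi> x)) \<partial>lebesgue)"
      unfolding l_def by (rule nn_integral_eq_integral[symmetric, OF int]) simp
    also have "\<dots> = (\<integral>\<^sup>+x. ennreal (indicat_real A' x * norm (grad \<phi> x)) \<partial>lborel)"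
      by (simp add: nn_integral_completion)
    also have "\<dots> = (\<integral>\<^sup>+x. indicator A' x * ennreal (norm (grad \<phi> x)) \<partial>lborel)"
      by (intro nn_integral_cong) (simp add: indicator_def)
    finally show ?thesis .
  qed
  have l0: "0 \<le> l" unfolding l_def by (intro Bochner_Integration.integral_nonneg) simp
  \<comment> \<open>Points of \<open>A\<close> are at distance at most 2 r from \<open>z\<close>;
    twice the square of this bound, integrated over \<open>A\<close>, gives the constant 8 r^2 /
    V^2.\<close>
  have osc: "\<bar>avg h \<phi> x - avg h \<phi> z\<bar> \<le> 2 * r / V * l" if "x \<in> A" for x
  proof -
    have xz: "norm (x - z) \<le> 2 * r" using that by (simp add: A_def dist_norm norm_minus_commute)
    have "z + y + t *\<^sub>R (x - z) \<in> A'" if "norm y < h" "0 \<le> t" "t \<le> 1" for y t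
    proof -
      have "norm (t *\<^sub>R (x - z)) \<le> 2 * r"
        using mult_left_le_one_le[of "norm (x - z)" t] that xz by simp
      then have "norm (y + t *\<^sub>R (x - z)) < 3 * r"
        using norm_triangle_ineq[of y "t *\<^sub>R (x - z)"] that h by linarith
      moreover have "dist z (z + y + t *\<^sub>R (x - z)) = norm (y + t *\<^sub>R (x - z))"
        using dist_commute[of z "z + y + t *\<^sub>R (x - z)"] by (simp add: dist_norm add.assoc)
      ultimately show ?thesis by (simp add: A'_def)
    qed
    then have "ennreal \<bar>avg h \<phi> x - avg h \<phi> z\<bar> \<le> ennreal (norm (x - z) / V) * ennreal l"
      unfolding l V_def by (intro avg_lipschitz sm h) auto
    also have "\<dots> = ennreal (norm (x - z) / V * l)" using V l0 by (intro ennreal_mult[symmetric]) auto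
    finally have "\<bar>avg h \<phi> x - avg h \<phi> z\<bar> \<le> norm (x - z) / V * l" using V l0 by (subst (asm) ennreal_le_iff) auto
    also have "\<dots> \<le> 2 * r / V * l" using V l0 xz by (intro mult_right_mono divide_right_mono) auto
    finally show ?thesis .
  qed
  have pw: "ennreal ((\<phi> x - avg h \<phi> z)\<^sup>2) \<le> 2 * ennreal ((\<phi> x - avg h \<phi> x)\<^sup>2) + ennreal (2 * (2 * r / V * l)\<^sup>2)"
    if "x \<in> A" for x
  proof -
    have "(\<phi> x - avg h \<phi> z)\<^sup>2 \<le> 2 * (\<phi> x - avg h \<phi> x)\<^sup>2 + 2 * (avg h \<phi> x - avg h \<phi> z)\<^sup>2"
      using norm_add_sq_le[of "\<phi> x - avg h \<phi> x" "avg h \<phi> x - avg h \<phi> z"] by simp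
    also have "(avg h \<phi> x - avg h \<phi> z)\<^sup>2 \<le> (2 * r / V * l)\<^sup>2"
      using power_mono[OF osc[OF that], of 2] by simp
    finally have "ennreal ((\<phi> x - avg h \<phi> z)\<^sup>2) \<le> ennreal (2 * (\<phi> x - avg h \<phi> x)\<^sup>2 + 2 * (2 * r / V * l)\<^sup>2)"
      by (intro ennreal_leI) simp
    then show ?thesis by (simp add: ennreal_plus ennreal_mult)
  qed
  have "(\<integral>\<^sup>+x. indicator A x * ennreal ((\<phi> x - avg h \<phi> z)\<^sup>2) \<partial>lborel) \<le>
      (\<integral>\<^sup>+x. 2 * (indicator A x * ennreal ((\<phi> x - avg h \<phi> x)\<^sup>2)) + ennreal (2 * (2 * r / V * l)\<^sup>2) * indicator A x \<partial>lborel)"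
    using pw by (intro nn_integral_mono) (auto simp: indicator_def)
  also have "\<dots> = 2 * (\<integral>\<^sup>+x. indicator A x * ennreal ((\<phi> x - avg h \<phi> x)\<^sup>2) \<partial>lborel) + ennreal (2 * (2 * r / V * l)\<^sup>2) * emeasure lborel A"
    by (subst nn_integral_add) (auto simp: nn_integral_cmult nn_integral_cmult_indicator)
  also have "\<dots> \<le> 2 * (ennreal (h\<^sup>2) * (\<integral>\<^sup>+x. indicator A' x * ennreal ((norm (grad \<phi> x))\<^sup>2) \<partial>lborel)) + ennreal (2 * (2 * r / V * l)\<^sup>2) * emeasure lborel A"
  proof (intro add_right_mono mult_left_mono avg_bound sm h)
    show "x + y \<in> A'" if "x \<in> A" "norm y < h" for x y
    proof -
      have "dist z (x + y) \<le> dist z x + dist x (x + y)" by (rule dist_triangle)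
      then show ?thesis using that h by (simp add: A_def A'_def dist_norm)
    qed
  qed auto
  also have "emeasure lborel A = ennreal (measure lborel A)"
    unfolding A_def using emeasure_lborel_ball_finite[of z "2 * r"]
    by (intro emeasure_eq_ennreal_measure) (auto simp: less_top)
  also have "ennreal (2 * (2 * r / V * l)\<^sup>2) * ennreal (measure lborel A) = ennreal (8 * r\<^sup>2 / V\<^sup>2 * measure lborel A * l\<^sup>2)"
    by (simp add: ennreal_mult[symmetric] power_mult_distrib power_divide field_simps)
  finally show ?thesis
    unfolding A_def A'_def l_def by (simp add: ennreal_mult mult.assoc)
qed

text \<open>Both sides are continuous in \<open>X\<close>, so the estimate extends from test functions to the closure.\<close>

lemma smoothing:
  fixes X :: "(real^'n, real \<times> (real^'n)) l2"
  assumes X: "X \<in> closure (jets \<Omega>)" and h: "0 < h" "h \<le> r"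
  defines "V \<equiv> measure lborel (ball (0::real^'n) h)"
  shows "(norm (restr (ball z (2 * r)) (fn X) - (inner (fn X) (ind (ball z h)) / V) *\<^sub>R ind (ball z (2 * r))))\<^sup>2 \<le>
    2 * h\<^sup>2 * (norm (restr (ball z (3 * r)) (gr X)))\<^sup>2 +
    8 * r\<^sup>2 / V\<^sup>2 * measure lborel (ball z (2 * r)) * (inner (nrm (gr X)) (ind (ball z (3 * r))))\<^sup>2"
  using X
proof (rule closure_jets_induct)
  have c1: "continuous_on UNIV (\<lambda>X::(real^'n, real \<times> (real^'n)) l2. restr (ball z s) (fn X))" for s
    by (rule continuous_on_compose2[OF linear_continuous_on[OF bounded_linear_restr] linear_continuous_on[OF bounded_linear_fn]]) auto
  have c3: "continuous_on UNIV (\<lambda>X::(real^'n, real \<times> (real^'n)) l2. restr (ball z s) (gr X))" for s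
    by (rule continuous_on_compose2[OF linear_continuous_on[OF bounded_linear_restr] linear_continuous_on[OF bounded_linear_gr]]) auto
  have c2: "continuous_on UNIV (\<lambda>X. nrm (gr X))"
    by (rule continuous_on_compose2[OF continuous_on_nrm linear_continuous_on[OF bounded_linear_gr]]) auto
  show "closed {X :: (real^'n, real \<times> (real^'n)) l2. (norm (restr (ball z (2 * r)) (fn X) - (inner (fn X) (ind (ball z h)) / V) *\<^sub>R ind (ball z (2 * r))))\<^sup>2 \<le>
    2 * h\<^sup>2 * (norm (restr (ball z (3 * r)) (gr X)))\<^sup>2 +
    8 * r\<^sup>2 / V\<^sup>2 * measure lborel (ball z (2 * r)) * (inner (nrm (gr X)) (ind (ball z (3 * r))))\<^sup>2}"
    unfolding divide_inverse
    by (intro closed_Collect_le continuous_intros c1 c2 c3 linear_continuous_on[OF bounded_linear_fn])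
next
  fix \<phi> assume \<phi>: "\<phi> \<in> test_functions \<Omega>"
  note sm = test_function_smooth[OF \<phi>]
  note sq = test_function_grad_integrable(2,3)[OF \<phi>]
  note [measurable] = borel_measurable_continuous_onI[OF smooth_continuous[OF sm]]
    borel_measurable_continuous_onI[OF smooth_grad_continuous[OF sm]]
  define c where "c = avg h \<phi> z"
  have ib: "sq_integrable lebesgue (indicat_real (ball z s))" for s by (rule sq_integrable_ind[OF lmeasurable_ball])
  have bm: "ball z s \<in> sets lebesgue" for s by simp
  have c: "inner (fn (jet \<phi>)) (ind (ball z h)) / V = c"
    unfolding c_def fn_jet[OF \<phi>] ind_def inner_abs_l2[OF sq(1) ib] V_def
    by (simp add: avg_eq[OF smooth_continuous[OF sm]])
  have "restr (ball z (2 * r)) (fn (jet \<phi>)) - c *\<^sub>R ind (ball z (2 * r)) = abs_l2 (\<lambda>x. indicat_real (ball z (2 * r)) x *\<^sub>R \<phi> x - c *\<^sub>R indicat_real (ball z (2 * r)) x)"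
    unfolding fn_jet[OF \<phi>] restr_def ind_def mulop_abs[OF pointwise_op_restr[OF bm] sq(1)] abs_l2_scaleR[OF ib]
    by (rule abs_l2_diff[OF pointwise_op_sq[OF pointwise_op_restr[OF bm] sq(1)] sq_integrable_scaleR[OF ib]])
  moreover have "sq_integrable lebesgue (\<lambda>x. indicat_real (ball z (2 * r)) x *\<^sub>R \<phi> x - c *\<^sub>R indicat_real (ball z (2 * r)) x)"
    by (rule sq_integrable_diff[OF pointwise_op_sq[OF pointwise_op_restr[OF bm] sq(1)] sq_integrable_scaleR[OF ib]])
  ultimately have "ennreal ((norm (restr (ball z (2 * r)) (fn (jet \<phi>)) - c *\<^sub>R ind (ball z (2 * r))))\<^sup>2) =
      (\<integral>\<^sup>+x. ennreal ((norm (indicat_real (ball z (2 * r)) x *\<^sub>R \<phi> x - c *\<^sub>R indicat_real (ball z (2 * r)) x))\<^sup>2) \<partial>lebesgue)"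
    by (simp only: norm_abs_l2_nn)
  also have "\<dots> = (\<integral>\<^sup>+x. indicator (ball z (2 * r)) x * ennreal ((\<phi> x - c)\<^sup>2) \<partial>lebesgue)"
    by (intro nn_integral_cong) (simp add: indicator_def)
  also have "\<dots> = (\<integral>\<^sup>+x. indicator (ball z (2 * r)) x * ennreal ((\<phi> x - c)\<^sup>2) \<partial>lborel)"
    by (rule nn_integral_completion)
  also have "\<dots> \<le> ennreal (2 * h\<^sup>2) * (\<integral>\<^sup>+x. indicator (ball z (3 * r)) x * ennreal ((norm (grad \<phi> x))\<^sup>2) \<partial>lborel) +
    ennreal (8 * r\<^sup>2 / V\<^sup>2 * measure lborel (ball z (2 * r)) * (LINT x|lebesgue. indicat_real (ball z (3 * r)) x * norm (grad \<phi> x))\<^sup>2)"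
    unfolding c_def V_def by (rule smoothing_test[OF \<phi> h])
  also have "(\<integral>\<^sup>+x. indicator (ball z (3 * r)) x * ennreal ((norm (grad \<phi> x))\<^sup>2) \<partial>lborel) = ennreal ((norm (restr (ball z (3 * r)) (gr (jet \<phi>))))\<^sup>2)"
  proof -
    have "ennreal ((norm (restr (ball z (3 * r)) (gr (jet \<phi>))))\<^sup>2) =
        (\<integral>\<^sup>+x. ennreal ((norm (indicat_real (ball z (3 * r)) x *\<^sub>R grad \<phi> x))\<^sup>2) \<partial>lebesgue)"
      unfolding gr_jet[OF \<phi>] restr_def mulop_abs[OF pointwise_op_restr[OF bm] sq(2)]
      by (rule norm_abs_l2_nn[OF pointwise_op_sq[OF pointwise_op_restr[OF bm] sq(2)]])
    also have "\<dots> = (\<integral>\<^sup>+x. indicator (ball z (3 * r)) x * ennreal ((norm (grad \<phi> x))\<^sup>2) \<partial>lebesgue)"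
      by (intro nn_integral_cong) (simp add: indicator_def)
    also have "\<dots> = (\<integral>\<^sup>+x. indicator (ball z (3 * r)) x * ennreal ((norm (grad \<phi> x))\<^sup>2) \<partial>lborel)"
      by (rule nn_integral_completion)
    finally show ?thesis by simp
  qed
  also have "(LINT x|lebesgue. indicat_real (ball z (3 * r)) x * norm (grad \<phi> x)) = inner (nrm (gr (jet \<phi>))) (ind (ball z (3 * r)))"
  proof -
    have sqn: "sq_integrable lebesgue (\<lambda>x. norm (grad \<phi> x))"
      by (rule sq_integrable_bound[OF sq(2), where C=1]) (use sq(2) in auto)
    have "nrm (gr (jet \<phi>)) = abs_l2 (\<lambda>x. norm (grad \<phi> x))"
      unfolding nrm_def gr_jet[OF \<phi>]
      by (rule abs_l2_eqI[OF nrm_sq sqn]) (use rep_l2_abs[OF sq(2)] in eventually_elim, simp)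
    then show ?thesis unfolding ind_def by (simp add: inner_abs_l2[OF sqn ib] mult.commute)
  qed
  finally have "ennreal ((norm (restr (ball z (2 * r)) (fn (jet \<phi>)) - c *\<^sub>R ind (ball z (2 * r))))\<^sup>2) \<le>
    ennreal (2 * h\<^sup>2 * (norm (restr (ball z (3 * r)) (gr (jet \<phi>))))\<^sup>2 +
    8 * r\<^sup>2 / V\<^sup>2 * measure lborel (ball z (2 * r)) * (inner (nrm (gr (jet \<phi>))) (ind (ball z (3 * r))))\<^sup>2)"
    by (subst ennreal_plus) (auto simp: ennreal_mult)
  then show "(norm (restr (ball z (2 * r)) (fn (jet \<phi>)) - (inner (fn (jet \<phi>)) (ind (ball z h)) / V) *\<^sub>R ind (ball z (2 * r))))\<^sup>2 \<le>
    2 * h\<^sup>2 * (norm (restr (ball z (3 * r)) (gr (jet \<phi>))))\<^sup>2 +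
    8 * r\<^sup>2 / V\<^sup>2 * measure lborel (ball z (2 * r)) * (inner (nrm (gr (jet \<phi>))) (ind (ball z (3 * r))))\<^sup>2"
    unfolding c by (subst (asm) ennreal_le_iff) (auto intro!: add_nonneg_nonneg mult_nonneg_nonneg)
qed

subsection \<open>Compactness of the embedding into the square-integrable functions\<close>

text \<open>\<open>inl\<close> and \<open>inr\<close> are the adjoints of \<open>fn\<close> and
  \<open>gr\<close>; through them weak convergence of pairs passes to the components.\<close>

definition inl :: "('a::euclidean_space, 'b::euclidean_space) l2 \<Rightarrow> ('a, 'b \<times> 'c::euclidean_space) l2" where
  "inl z = abs_l2 (\<lambda>x. (rep_l2 z x, 0))"
definition inr :: "('a::euclidean_space, 'c::euclidean_space) l2 \<Rightarrow> ('a, 'b::euclidean_space \<times> 'c) l2" where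
  "inr z = abs_l2 (\<lambda>x. (0, rep_l2 z x))"

lemma inner_fn: "inner (fn X) z = inner X (inl z)" and inner_gr: "inner (gr X) w = inner X (inr w)"
  unfolding inner_fn_gr[of X] inl_def inr_def by (simp_all add: fn_abs gr_abs rep_l2_sq abs_l2_zero)

text \<open>At a fixed radius \<open>h\<close> the average at a point is the inner product with a
  fixed indicator, hence tends to zero under weak convergence and is uniformly bounded. The distance
  of a function from its averages is of order \<open>h\<close> uniformly in \<open>n\<close>. The
  differences from the limit are first replaced by test functions up to 1 / (n + 1).\<close>

lemma rellich:
  fixes \<Omega> :: "(real^'n) set"
  assumes \<Omega>: "open \<Omega>" "bounded \<Omega>"
    and X: "\<And>n. X n \<in> closure (jets \<Omega>)" "X0 \<in> closure (jets \<Omega>)" and C: "\<And>n. norm (X n) \<le> C"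
    and weak: "\<And>z. (\<lambda>n. inner (X n) z) \<longlonglongrightarrow> inner X0 z"
  shows "(\<lambda>n. fn (X n)) \<longlonglongrightarrow> fn X0"
proof -
  have "\<exists>\<phi>. \<phi> \<in> test_functions \<Omega> \<and> norm (X n - X0 - jet \<phi>) < inverse (real (Suc n))" for n
  proof -
    have "X n - X0 \<in> closure (jets \<Omega>)" by (rule subspace_diff[OF subspace_closure_jets X])
    from subspace_closure_approx[OF this, of "inverse (real (Suc n))"] show ?thesis
      by (auto simp: jets_def)
  qed
  then obtain \<phi> where \<phi>: "\<And>n. \<phi> n \<in> test_functions \<Omega>" and near: "\<And>n. norm (X n - X0 - jet (\<phi> n)) < inverse (real (Suc n))"
    by metis
  define D where "D = C + norm X0 + 1"
  have D: "norm (jet (\<phi> n)) \<le> D" for n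
  proof -
    have "inverse (real (Suc n)) \<le> 1" by (auto simp: inverse_le_1_iff)
    then have "norm (X n - X0 - jet (\<phi> n)) \<le> 1" using near[of n] by linarith
    moreover have "jet (\<phi> n) = X n - X0 - (X n - X0 - jet (\<phi> n))" by simp
    ultimately show ?thesis
      unfolding D_def
      using norm_triangle_ineq4[of "X n - X0" "X n - X0 - jet (\<phi> n)"] norm_triangle_ineq4[of "X n" X0] C[of n] by simp
  qed
  have D0: "0 \<le> D" using D[of 0] norm_ge_zero order_trans by blast
  have near0: "(\<lambda>n. X n - X0 - jet (\<phi> n)) \<longlonglongrightarrow> 0"
    by (rule Lim_null_comparison[OF _ LIMSEQ_inverse_real_of_nat]) (use near in \<open>auto intro!: always_eventually less_imp_le\<close>)
  have jw: "(\<lambda>n. inner (jet (\<phi> n)) z) \<longlonglongrightarrow> 0" for z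
  proof -
    have "(\<lambda>n. inner (X n) z - inner X0 z - inner (X n - X0 - jet (\<phi> n)) z) \<longlonglongrightarrow> inner X0 z - inner X0 z - inner 0 z"
      by (intro tendsto_intros weak near0)
    then show ?thesis by (simp add: inner_diff_left)
  qed
  have "(\<lambda>n. (norm (fn (jet (\<phi> n))))\<^sup>2) \<longlonglongrightarrow> 0"
  proof (rule LIMSEQ_I)
    fix e :: real assume e: "0 < e"
    \<comment> \<open>Chosen so that 2 h^2 D^2 is at most e / 2; the 1 next to D^2 guards against
      division by zero.\<close>
    define h where "h = sqrt (e / (4 * (D\<^sup>2 + 1)))"
    have D1: "0 < D\<^sup>2 + 1" by (simp add: add_nonneg_pos)
    have h: "0 < h" unfolding h_def using e D1 by simp
    have hD: "2 * h\<^sup>2 * D\<^sup>2 < e / 2 + e / 2 * 0 + 0 \<or> 2 * h\<^sup>2 * D\<^sup>2 \<le> e / 2"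
      unfolding h_def using e D1 by (simp add: field_simps)
    define V where "V = measure lborel (ball (0::real^'n) h)"
    have V: "0 < V" unfolding V_def using h by (rule measure_ball_pos)
    have ib: "sq_integrable lebesgue (indicat_real (ball x h))" for x :: "real^'n" by (rule sq_integrable_ind[OF lmeasurable_ball])
    have av: "avg h (\<phi> n) x = inner (fn (jet (\<phi> n))) (ind (ball x h)) / V" for n x
      unfolding fn_jet[OF \<phi>] ind_def V_def
      using inner_abs_l2[OF test_function_grad_integrable(2)[OF \<phi>[of n]] ib[of x]]
      by (simp add: avg_eq[OF smooth_continuous[OF test_function_smooth[OF \<phi>]]])
    have nib: "norm (ind (ball x h)) = sqrt V" for x :: "real^'n"
    proof -
      have "(norm (ind (ball x h)))\<^sup>2 = (LINT y|lebesgue. indicat_real (ball x h) y)"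
        unfolding ind_def norm_abs_l2_sq[OF ib] by (intro Bochner_Integration.integral_cong) (auto simp: indicator_def)
      also have "\<dots> = V" unfolding V_def using h by (simp add: content_ball)
      finally show ?thesis by (simp add: real_sqrt_unique)
    qed
    have av_le: "\<bar>avg h (\<phi> n) x\<bar> \<le> D * sqrt V / V" for n x
    proof -
      have "\<bar>inner (fn (jet (\<phi> n))) (ind (ball x h))\<bar> \<le> norm (fn (jet (\<phi> n))) * sqrt V"
        using Cauchy_Schwarz_ineq2[of "fn (jet (\<phi> n))" "ind (ball x h)"] by (simp add: nib)
      also have "\<dots> \<le> D * sqrt V"
        using norm_fn_le[of "jet (\<phi> n)"] D[of n] V by (intro mult_right_mono) auto
      finally show ?thesis unfolding av using V by (simp add: divide_right_mono)
    qed
    have av_lim: "(\<lambda>n. avg h (\<phi> n) x) \<longlonglongrightarrow> 0" for x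
      unfolding av inner_fn using tendsto_divide[OF jw tendsto_const[of V]] V by simp
    have mavg [measurable]: "avg h (\<phi> n) \<in> borel_measurable borel" for n
      by (rule avg_measurable[OF smooth_continuous[OF test_function_smooth[OF \<phi>]]])
    have [measurable]: "\<phi> n \<in> borel_measurable borel" for n
      by (rule borel_measurable_continuous_onI[OF smooth_continuous[OF test_function_smooth[OF \<phi>]]])
    have \<Omega>b [measurable]: "\<Omega> \<in> sets borel" using \<Omega> by simp
    \<comment> \<open>For fixed \<open>h\<close> the averages are small in the mean over the bounded
      set \<open>\<Omega>\<close> by dominated convergence; outside \<open>\<Omega>\<close> the test
      functions vanish anyway.\<close>
    define a where "a n = (LINT x|lborel. indicat_real \<Omega> x * (avg h (\<phi> n) x)\<^sup>2)" for n
    have \<Omega>i: "integrable lborel (indicat_real \<Omega>)"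
      using emeasure_bounded_finite[OF \<Omega>(2)] by (simp add: less_top)
    have dom: "norm (indicat_real \<Omega> x * (avg h (\<phi> n) x)\<^sup>2) \<le> indicat_real \<Omega> x * (D * sqrt V / V)\<^sup>2" for n x
      using power_mono[OF av_le[of n x], of 2] by (simp add: indicator_def)
    have "(\<lambda>n. a n) \<longlonglongrightarrow> (LINT x|lborel. indicat_real \<Omega> x * 0\<^sup>2 :: real)"
      unfolding a_def
    proof (rule integral_dominated_convergence[where w="\<lambda>x. indicat_real \<Omega> x * (D * sqrt V / V)\<^sup>2"])
      show "integrable lborel (\<lambda>x. indicat_real \<Omega> x * (D * sqrt V / V)\<^sup>2)"
        by (rule integrable_mult_left) (rule \<Omega>i)
      show "AE x in lborel. (\<lambda>n. indicat_real \<Omega> x * (avg h (\<phi> n) x)\<^sup>2) \<longlonglongrightarrow> indicat_real \<Omega> x * 0\<^sup>2"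
        by (intro AE_I2 tendsto_intros av_lim)
    qed (use dom in auto)
    then have a0: "a \<longlonglongrightarrow> 0" by simp
    have ai: "integrable lborel (\<lambda>x. indicat_real \<Omega> x * (avg h (\<phi> n) x)\<^sup>2)" for n
      by (rule Bochner_Integration.integrable_bound[OF integrable_mult_left[OF \<Omega>i, of "(D * sqrt V / V)\<^sup>2"]])
         (use dom in \<open>auto simp: abs_mult\<close>)
    have est: "(norm (fn (jet (\<phi> n))))\<^sup>2 \<le> 2 * h\<^sup>2 * D\<^sup>2 + 2 * a n" for n
    proof -
      note sm = test_function_smooth[OF \<phi>[of n]]
      note sq = test_function_grad_integrable(2,3)[OF \<phi>[of n]]
      have [measurable]: "grad (\<phi> n) \<in> borel_measurable borel"
        by (rule borel_measurable_continuous_onI[OF smooth_grad_continuous[OF sm]])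
      have "ennreal ((norm (fn (jet (\<phi> n))))\<^sup>2) = (\<integral>\<^sup>+x. ennreal ((norm (\<phi> n x))\<^sup>2) \<partial>lebesgue)"
        unfolding fn_jet[OF \<phi>] by (rule norm_abs_l2_nn[OF sq(1)])
      also have "\<dots> = (\<integral>\<^sup>+x. ennreal ((norm (\<phi> n x))\<^sup>2) \<partial>lborel)" by (rule nn_integral_completion)
      also have "\<dots> \<le> (\<integral>\<^sup>+x. 2 * (indicator \<Omega> x * ennreal ((\<phi> n x - avg h (\<phi> n) x)\<^sup>2)) + 2 * ennreal (indicat_real \<Omega> x * (avg h (\<phi> n) x)\<^sup>2) \<partial>lborel)"
      proof (rule nn_integral_mono)
        fix x
        show "ennreal ((norm (\<phi> n x))\<^sup>2) \<le> 2 * (indicator \<Omega> x * ennreal ((\<phi> n x - avg h (\<phi> n) x)\<^sup>2)) + 2 * ennreal (indicat_real \<Omega> x * (avg h (\<phi> n) x)\<^sup>2)"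
        proof (cases "x \<in> \<Omega>")
          case True
          have "ennreal ((norm (\<phi> n x))\<^sup>2) \<le> ennreal (2 * (\<phi> n x - avg h (\<phi> n) x)\<^sup>2 + 2 * (avg h (\<phi> n) x)\<^sup>2)"
            using norm_add_sq_le[of "\<phi> n x - avg h (\<phi> n) x" "avg h (\<phi> n) x"] by (intro ennreal_leI) simp
          then show ?thesis using True by (simp add: ennreal_plus ennreal_mult)
        qed (simp add: test_function_outside[OF \<phi>])
      qed
      also have "\<dots> = 2 * (\<integral>\<^sup>+x. indicator \<Omega> x * ennreal ((\<phi> n x - avg h (\<phi> n) x)\<^sup>2) \<partial>lborel) + 2 * (\<integral>\<^sup>+x. ennreal (indicat_real \<Omega> x * (avg h (\<phi> n) x)\<^sup>2) \<partial>lborel)"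
        by (subst nn_integral_add) (auto simp: nn_integral_cmult)
      also have "\<dots> \<le> 2 * (ennreal (h\<^sup>2) * (\<integral>\<^sup>+x. indicator UNIV x * ennreal ((norm (grad (\<phi> n) x))\<^sup>2) \<partial>lborel)) + 2 * (\<integral>\<^sup>+x. ennreal (indicat_real \<Omega> x * (avg h (\<phi> n) x)\<^sup>2) \<partial>lborel)"
        by (intro add_right_mono mult_left_mono avg_bound sm h) auto
      also have "(\<integral>\<^sup>+x. ennreal (indicat_real \<Omega> x * (avg h (\<phi> n) x)\<^sup>2) \<partial>lborel) = ennreal (a n)"
        unfolding a_def by (rule nn_integral_eq_integral[OF ai]) simp
      also have "(\<integral>\<^sup>+x. indicator UNIV x * ennreal ((norm (grad (\<phi> n) x))\<^sup>2) \<partial>lborel) = (\<integral>\<^sup>+x. ennreal ((norm (grad (\<phi> n) x))\<^sup>2) \<partial>lebesgue)"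
        by (simp add: nn_integral_completion)
      also have "\<dots> = ennreal ((norm (gr (jet (\<phi> n))))\<^sup>2)"
        unfolding gr_jet[OF \<phi>] by (rule norm_abs_l2_nn[OF sq(2), symmetric])
      finally have "ennreal ((norm (fn (jet (\<phi> n))))\<^sup>2) \<le> ennreal (2 * (h\<^sup>2 * (norm (gr (jet (\<phi> n))))\<^sup>2) + 2 * a n)"
        by (subst ennreal_plus) (auto simp: ennreal_mult a_def intro!: Bochner_Integration.integral_nonneg)
      then have "(norm (fn (jet (\<phi> n))))\<^sup>2 \<le> 2 * (h\<^sup>2 * (norm (gr (jet (\<phi> n))))\<^sup>2) + 2 * a n"
        by (subst (asm) ennreal_le_iff) (auto simp: a_def intro!: Bochner_Integration.integral_nonneg add_nonneg_nonneg)
      also have "(norm (gr (jet (\<phi> n))))\<^sup>2 \<le> D\<^sup>2"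
        using norm_gr_le[of "jet (\<phi> n)"] D[of n] by (intro power_mono) auto
      finally show ?thesis by (simp add: mult_left_mono)
    qed
    obtain N where N: "\<And>n. n \<ge> N \<Longrightarrow> \<bar>a n\<bar> < e / 4"
      using LIMSEQ_D[OF a0, of "e / 4"] e by auto
    have "norm ((norm (fn (jet (\<phi> n))))\<^sup>2 - 0) < e" if "n \<ge> N" for n
      using est[of n] N[OF that] hD by (auto simp: abs_less_iff)
    then show "\<exists>N. \<forall>n\<ge>N. norm ((norm (fn (jet (\<phi> n))))\<^sup>2 - 0) < e" by blast
  qed
  then have "(\<lambda>n. sqrt ((norm (fn (jet (\<phi> n))))\<^sup>2)) \<longlonglongrightarrow> sqrt 0" by (rule tendsto_real_sqrt)
  then have "(\<lambda>n. fn (jet (\<phi> n))) \<longlonglongrightarrow> 0" by (simp add: tendsto_norm_zero_iff)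
  moreover have "(\<lambda>n. fn (X n - X0 - jet (\<phi> n))) \<longlonglongrightarrow> 0"
    by (rule bounded_linear.tendsto_zero[OF bounded_linear_fn near0])
  ultimately have "(\<lambda>n. fn (X n - X0 - jet (\<phi> n)) + fn (jet (\<phi> n))) \<longlonglongrightarrow> 0 + 0" by (rule tendsto_add[rotated])
  moreover have "fn (X n - X0 - jet (\<phi> n)) + fn (jet (\<phi> n)) = fn (X n) - fn X0" for n
    unfolding linear_diff[OF bounded_linear.linear[OF bounded_linear_fn]] by simp
  ultimately have "(\<lambda>n. fn (X n) - fn X0) \<longlonglongrightarrow> 0" by simp
  then show ?thesis by (simp add: LIM_zero_iff)
qed

section \<open>Identification with the Sobolev spaces\<close>

definition emb :: "'a::euclidean_space set \<Rightarrow> ('a \<Rightarrow> 'b::euclidean_space) \<Rightarrow> ('a, 'b) l2" where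
  "emb \<Omega> f = abs_l2 (\<lambda>x. indicat_real \<Omega> x *\<^sub>R f x)"

lemma L2_iff_ext:
  fixes f :: "'a::euclidean_space \<Rightarrow> 'b::euclidean_space"
  assumes "\<Omega> \<in> sets lebesgue"
  shows "f \<in> L2 \<Omega> \<longleftrightarrow> sq_integrable lebesgue (\<lambda>x. indicat_real \<Omega> x *\<^sub>R f x)"
proof -
  have "f \<in> borel_measurable (lebesgue_on \<Omega>) \<longleftrightarrow> (\<lambda>x. indicat_real \<Omega> x *\<^sub>R f x) \<in> borel_measurable lebesgue"
    using assms by (simp add: borel_measurable_restrict_space_iff)
  moreover have "integrable (lebesgue_on \<Omega>) (\<lambda>x. (norm (f x))\<^sup>2) \<longleftrightarrow>
      integrable lebesgue (\<lambda>x. indicat_real \<Omega> x *\<^sub>R (norm (f x))\<^sup>2)"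
    using assms by (intro integrable_restrict_space) simp
  moreover have "(\<lambda>x. indicat_real \<Omega> x *\<^sub>R (norm (f x))\<^sup>2) = (\<lambda>x. (norm (indicat_real \<Omega> x *\<^sub>R f x))\<^sup>2)"
    by (auto simp: fun_eq_iff indicator_def)
  ultimately show ?thesis unfolding L2_iff sq_integrable_def by simp
qed

lemma lint_on_eq: "\<Omega> \<in> sets lebesgue \<Longrightarrow> (LINT x|lebesgue_on \<Omega>. f x :: real) = (LINT x|lebesgue. indicat_real \<Omega> x * f x)"
  by (subst integral_restrict_space) auto

lemma AE_on_iff: "\<Omega> \<in> sets lebesgue \<Longrightarrow> (AE x in lebesgue_on \<Omega>. P x) \<longleftrightarrow> (AE x in lebesgue. x \<in> \<Omega> \<longrightarrow> P x)"
  by (rule AE_restrict_space_iff) simp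

lemma L2_inner_ext:
  assumes "\<Omega> \<in> sets lebesgue"
  shows "L2_inner \<Omega> f g = (LINT x|lebesgue. (indicat_real \<Omega> x *\<^sub>R f x) \<bullet> (indicat_real \<Omega> x *\<^sub>R g x))"
  unfolding L2_inner_def lint_on_eq[OF assms]
  by (intro Bochner_Integration.integral_cong) (auto simp: indicator_def)

lemma inner_emb:
  assumes "\<Omega> \<in> sets lebesgue" "f \<in> L2 \<Omega>" "g \<in> L2 \<Omega>"
  shows "inner (emb \<Omega> f) (emb \<Omega> g) = L2_inner \<Omega> f g"
  using assms unfolding emb_def by (simp add: L2_inner_ext L2_iff_ext inner_abs_l2)

lemma emb_cong:
  assumes "\<Omega> \<in> sets lebesgue" "f \<in> L2 \<Omega>" "g \<in> L2 \<Omega>" "AE x in lebesgue_on \<Omega>. f x = g x"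
  shows "emb \<Omega> f = emb \<Omega> g"
  unfolding emb_def
proof (rule abs_l2_eqI)
  show "AE x in lebesgue. indicat_real \<Omega> x *\<^sub>R f x = indicat_real \<Omega> x *\<^sub>R g x"
    using assms(4) unfolding AE_on_iff[OF assms(1)] by eventually_elim (auto simp: indicator_def)
qed (use assms in \<open>auto simp: L2_iff_ext\<close>)

lemma L2_add: "f \<in> L2 \<Omega> \<Longrightarrow> g \<in> L2 \<Omega> \<Longrightarrow> (\<lambda>x. f x + g x) \<in> L2 \<Omega>"
  and L2_scaleR: "f \<in> L2 \<Omega> \<Longrightarrow> (\<lambda>x. c *\<^sub>R f x) \<in> L2 \<Omega>"
  unfolding L2_iff by (auto intro: sq_integrable_add sq_integrable_scaleR)

lemma emb_lin:
  assumes "\<Omega> \<in> sets lebesgue" "f \<in> L2 \<Omega>" "g \<in> L2 \<Omega>"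
  shows "emb \<Omega> (\<lambda>x. f x + c *\<^sub>R g x) = emb \<Omega> f + c *\<^sub>R emb \<Omega> g"
proof -
  have f: "sq_integrable lebesgue (\<lambda>x. indicat_real \<Omega> x *\<^sub>R f x)" and g: "sq_integrable lebesgue (\<lambda>x. indicat_real \<Omega> x *\<^sub>R g x)"
    using assms by (auto simp: L2_iff_ext)
  show ?thesis
    unfolding emb_def abs_l2_scaleR[OF g] abs_l2_add[OF f sq_integrable_scaleR[OF g]]
    by (intro arg_cong[of _ _ abs_l2]) (auto simp: fun_eq_iff indicator_def)
qed

lemma test_function_L2:
  assumes "\<Omega> \<in> sets lebesgue" "\<phi> \<in> test_functions \<Omega>'"
  shows "\<phi> \<in> L2 \<Omega>" "grad \<phi> \<in> L2 \<Omega>"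
  unfolding L2_iff_ext[OF assms(1)]
  by (rule pointwise_op_sq[OF pointwise_op_restr[OF assms(1)] test_function_grad_integrable(2)[OF assms(2)]],
      rule pointwise_op_sq[OF pointwise_op_restr[OF assms(1)] test_function_grad_integrable(3)[OF assms(2)]])

lemma L2_Pair: "u \<in> L2 \<Omega> \<Longrightarrow> G \<in> L2 \<Omega> \<Longrightarrow> (\<lambda>x. (u x, G x)) \<in> L2 \<Omega>"
  unfolding L2_iff sq_integrable_def by (auto simp: norm_Pair intro!: borel_measurable_Pair)

lemma lint_on_test:
  fixes G :: "real^'n \<Rightarrow> real^'n"
  assumes \<Omega>: "\<Omega> \<in> sets lebesgue" and G: "G \<in> L2 \<Omega>" and \<phi>: "\<phi> \<in> test_functions \<Omega>'"
  shows "integrable (lebesgue_on \<Omega>) (\<lambda>x. G x $ i * \<phi> x)"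
proof -
  have "sq_integrable (lebesgue_on \<Omega>) (\<lambda>x. \<phi> x *\<^sub>R axis i 1 :: real^'n)"
    using test_function_L2(1)[OF \<Omega> \<phi>] unfolding L2_iff
    by (rule sq_integrable_bound[where C=1]) (use test_function_L2(1)[OF \<Omega> \<phi>] in \<open>auto simp: L2_def\<close>)
  from integrable_inner_sq[OF G[unfolded L2_iff] this] show ?thesis by (simp add: inner_axis mult.commute)
qed

text \<open>This neutralises the arbitrary choice in \<open>weak_grad\<close>. Boundedness of
  \<open>\<Omega>\<close> makes the square-integrable difference integrable, as the fundamental
  lemma requires.\<close>

lemma weak_gradient_unique:
  fixes \<Omega> :: "(real^'n) set"
  assumes \<Omega>: "open \<Omega>" "bounded \<Omega>" and G: "G \<in> L2 \<Omega>" "has_weak_gradient \<Omega> u G"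
    and H: "H \<in> L2 \<Omega>" "has_weak_gradient \<Omega> u H"
  shows "AE x in lebesgue_on \<Omega>. G x = H x"
proof -
  have m: "\<Omega> \<in> sets lebesgue" using \<Omega> by auto
  have lm: "\<Omega> \<in> lmeasurable" using \<Omega> by (rule lmeasurable_open[rotated])
  have comp: "AE x in lebesgue. x \<in> \<Omega> \<longrightarrow> indicat_real \<Omega> x * (G x $ i - H x $ i) = 0" for i
  proof (rule fundamental_lemma[OF \<Omega>(1)])
    have D: "sq_integrable lebesgue (\<lambda>x. indicat_real \<Omega> x *\<^sub>R (G x + (-1) *\<^sub>R H x))"
      using L2_add[OF G(1) L2_scaleR[OF H(1), of "-1"]] unfolding L2_iff_ext[OF m] .
    have "sq_integrable lebesgue (\<lambda>x. indicat_real \<Omega> x *\<^sub>R (axis i 1 :: real^'n))"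
      by (rule sq_integrable_bound[OF sq_integrable_ind[OF lm], where C=1]) (use m in auto)
    from integrable_inner_sq[OF D this]
    show "integrable lebesgue (\<lambda>x. indicat_real \<Omega> x * (G x $ i - H x $ i))"
      by (rule Bochner_Integration.integrable_cong[THEN iffD1, rotated 2]) (auto simp: inner_axis indicator_def)
    fix \<phi> assume \<phi>: "\<phi> \<in> test_functions \<Omega>"
    have "(LINT x|lebesgue. indicat_real \<Omega> x * (G x $ i - H x $ i) * \<phi> x) = (LINT x|lebesgue_on \<Omega>. G x $ i * \<phi> x - H x $ i * \<phi> x)"
      unfolding lint_on_eq[OF m] by (simp add: algebra_simps)
    also have "\<dots> = (LINT x|lebesgue_on \<Omega>. G x $ i * \<phi> x) - (LINT x|lebesgue_on \<Omega>. H x $ i * \<phi> x)"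
      by (intro Bochner_Integration.integral_diff lint_on_test[OF m _ \<phi>] G H)
    also have "\<dots> = 0"
      using G(2) H(2) \<phi> unfolding has_weak_gradient_def by simp
    finally show "(LINT x|lebesgue. indicat_real \<Omega> x * (G x $ i - H x $ i) * \<phi> x) = 0" .
  qed
  have "AE x in lebesgue. \<forall>i. x \<in> \<Omega> \<longrightarrow> indicat_real \<Omega> x * (G x $ i - H x $ i) = 0"
    unfolding AE_all_countable by (intro allI comp)
  then show ?thesis unfolding AE_on_iff[OF m] by eventually_elim (auto simp: vec_eq_iff)
qed

definition jet_of :: "(real^'n) set \<Rightarrow> (real^'n \<Rightarrow> real) \<Rightarrow> (real^'n, real \<times> (real^'n)) l2" where
  "jet_of \<Omega> u = emb \<Omega> (\<lambda>x. (u x, weak_grad \<Omega> u x))"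

lemma weak_grad_H1: "u \<in> H1 \<Omega> \<Longrightarrow> weak_grad \<Omega> u \<in> L2 \<Omega> \<and> has_weak_gradient \<Omega> u (weak_grad \<Omega> u)"
  using someI_ex[of "\<lambda>G. G \<in> L2 \<Omega> \<and> has_weak_gradient \<Omega> u G"] unfolding weak_grad_def H1_def by blast

lemma H1_L2: "u \<in> H1 \<Omega> \<Longrightarrow> u \<in> L2 \<Omega>" by (simp add: H1_def)

text \<open>Any square-integrable weak gradient may stand in for the chosen one; every later
  identification of \<open>weak_grad\<close> goes through this lemma.\<close>

lemma jet_of_eq:
  fixes \<Omega> :: "(real^'n) set"
  assumes \<Omega>: "open \<Omega>" "bounded \<Omega>" and u: "u \<in> L2 \<Omega>" and G: "G \<in> L2 \<Omega>" "has_weak_gradient \<Omega> u G"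
  shows "u \<in> H1 \<Omega>" "AE x in lebesgue_on \<Omega>. weak_grad \<Omega> u x = G x" "jet_of \<Omega> u = emb \<Omega> (\<lambda>x. (u x, G x))"
proof -
  have m: "\<Omega> \<in> sets lebesgue" using \<Omega> by auto
  show H: "u \<in> H1 \<Omega>" using u G by (auto simp: H1_def)
  show ae: "AE x in lebesgue_on \<Omega>. weak_grad \<Omega> u x = G x"
    using weak_grad_H1[OF H] by (intro weak_gradient_unique[OF \<Omega> _ _ G]) auto
  show "jet_of \<Omega> u = emb \<Omega> (\<lambda>x. (u x, G x))"
    unfolding jet_of_def using weak_grad_H1[OF H] ae
    by (intro emb_cong m L2_Pair u G) (auto elim: eventually_mono)
qed

lemma has_weak_gradient_lin:
  fixes u v :: "real^'n \<Rightarrow> real"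
  assumes m: "\<Omega> \<in> sets lebesgue" and u: "u \<in> L2 \<Omega>" "G \<in> L2 \<Omega>" "has_weak_gradient \<Omega> u G"
    and v: "v \<in> L2 \<Omega>" "H \<in> L2 \<Omega>" "has_weak_gradient \<Omega> v H"
  shows "has_weak_gradient \<Omega> (\<lambda>x. u x + c * v x) (\<lambda>x. G x + c *\<^sub>R H x)"
  unfolding has_weak_gradient_def
proof (intro ballI allI)
  fix \<phi> i assume \<phi>: "\<phi> \<in> test_functions \<Omega>"
  have "sq_integrable (lebesgue_on \<Omega>) (\<lambda>x. partial_deriv i \<phi> x)"
  proof (rule sq_integrable_bound[where C=1])
    show "sq_integrable (lebesgue_on \<Omega>) (grad \<phi>)" using test_function_L2(2)[OF m \<phi>] by (simp add: L2_iff)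
    show "partial_deriv i \<phi> \<in> borel_measurable (lebesgue_on \<Omega>)"
      by (intro measurable_restrict_space1 continuous_measurable_lebesgue smooth_continuous smooth_partial_deriv test_function_smooth[OF \<phi>])
  qed (simp add: partial_deriv_grad component_le_norm_cart)
  then have i: "integrable (lebesgue_on \<Omega>) (\<lambda>x. w x * partial_deriv i \<phi> x)" if "w \<in> L2 \<Omega>" for w :: "real^'n \<Rightarrow> real"
    using integrable_inner_sq[OF that[unfolded L2_iff]] by simp
  have "(LINT x|lebesgue_on \<Omega>. (u x + c * v x) * partial_deriv i \<phi> x) =
      (LINT x|lebesgue_on \<Omega>. u x * partial_deriv i \<phi> x) + c * (LINT x|lebesgue_on \<Omega>. v x * partial_deriv i \<phi> x)"
    using i[OF u(1)] i[OF v(1)] by (simp add: distrib_right mult.assoc)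
  also have "\<dots> = - ((LINT x|lebesgue_on \<Omega>. G x $ i * \<phi> x) + c * (LINT x|lebesgue_on \<Omega>. H x $ i * \<phi> x))"
    using u(3) v(3) \<phi> unfolding has_weak_gradient_def by simp
  also have "(LINT x|lebesgue_on \<Omega>. G x $ i * \<phi> x) + c * (LINT x|lebesgue_on \<Omega>. H x $ i * \<phi> x) =
      (LINT x|lebesgue_on \<Omega>. (G x + c *\<^sub>R H x) $ i * \<phi> x)"
    using lint_on_test[OF m u(2) \<phi>, of i] lint_on_test[OF m v(2) \<phi>, of i] by (simp add: distrib_right mult.assoc)
  finally show "(LINT x|lebesgue_on \<Omega>. (u x + c * v x) * partial_deriv i \<phi> x) = - (LINT x|lebesgue_on \<Omega>. (G x + c *\<^sub>R H x) $ i * \<phi> x)" .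
qed

lemma jet_of_lin:
  fixes \<Omega> :: "(real^'n) set"
  assumes \<Omega>: "open \<Omega>" "bounded \<Omega>" and u: "u \<in> H1 \<Omega>" and v: "v \<in> H1 \<Omega>"
  shows "(\<lambda>x. u x + c * v x) \<in> H1 \<Omega>" "jet_of \<Omega> (\<lambda>x. u x + c * v x) = jet_of \<Omega> u + c *\<^sub>R jet_of \<Omega> v"
proof -
  have m: "\<Omega> \<in> sets lebesgue" using \<Omega> by auto
  note U = H1_L2[OF u] weak_grad_H1[OF u, THEN conjunct1] weak_grad_H1[OF u, THEN conjunct2]
  note V = H1_L2[OF v] weak_grad_H1[OF v, THEN conjunct1] weak_grad_H1[OF v, THEN conjunct2]
  have L: "(\<lambda>x. u x + c * v x) \<in> L2 \<Omega>" using L2_add[OF U(1) L2_scaleR[OF V(1), of c]] by simp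
  note e = jet_of_eq[OF \<Omega> L L2_add[OF U(2) L2_scaleR[OF V(2)]] has_weak_gradient_lin[OF m U V]]
  show "(\<lambda>x. u x + c * v x) \<in> H1 \<Omega>" by (rule e)
  show "jet_of \<Omega> (\<lambda>x. u x + c * v x) = jet_of \<Omega> u + c *\<^sub>R jet_of \<Omega> v"
    unfolding e(3) unfolding jet_of_def
    using emb_lin[OF m L2_Pair[OF U(1,2)] L2_Pair[OF V(1,2)], of c] by simp
qed

lemma H1_inner_eq:
  fixes \<Omega> :: "(real^'n) set"
  assumes m: "\<Omega> \<in> sets lebesgue" and u: "u \<in> H1 \<Omega>" and v: "v \<in> H1 \<Omega>"
  shows "H1_inner \<Omega> u v = inner (jet_of \<Omega> u) (jet_of \<Omega> v)"
proof -
  note U = H1_L2[OF u] weak_grad_H1[OF u, THEN conjunct1]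
  note V = H1_L2[OF v] weak_grad_H1[OF v, THEN conjunct1]
  have "inner (jet_of \<Omega> u) (jet_of \<Omega> v) = (LINT x|lebesgue_on \<Omega>. u x \<bullet> v x + weak_grad \<Omega> u x \<bullet> weak_grad \<Omega> v x)"
    unfolding jet_of_def inner_emb[OF m L2_Pair[OF U] L2_Pair[OF V]] L2_inner_def by (simp add: inner_prod_def)
  also have "\<dots> = H1_inner \<Omega> u v"
    unfolding H1_inner_def L2_inner_def
    by (intro Bochner_Integration.integral_add integrable_inner_sq U[unfolded L2_iff] V[unfolded L2_iff])
  finally show ?thesis by simp
qed

lemma H1_norm_eq: "\<Omega> \<in> sets lebesgue \<Longrightarrow> u \<in> H1 \<Omega> \<Longrightarrow> H1_norm \<Omega> u = norm (jet_of \<Omega> u)"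
  by (simp add: H1_norm_def H1_inner_eq norm_eq_sqrt_inner)

text \<open>The bridge from the Hilbert space to the Sobolev definitions: the second component of an
  element of the closure is a weak gradient of the first, by the integration by parts inherited from
  test functions.\<close>

lemma closure_jets_H1:
  fixes \<Omega> :: "(real^'n) set"
  assumes \<Omega>: "open \<Omega>" "bounded \<Omega>" and X: "X \<in> closure (jets \<Omega>)"
  defines "u \<equiv> (\<lambda>x. fst (rep_l2 X x))"
  shows "u \<in> H1 \<Omega>" "AE x in lebesgue_on \<Omega>. weak_grad \<Omega> u x = snd (rep_l2 X x)" "jet_of \<Omega> u = X"
proof -
  have m: "\<Omega> \<in> sets lebesgue" using \<Omega> by auto
  have Xsq: "sq_integrable lebesgue (\<lambda>x. indicat_real \<Omega> x *\<^sub>R rep_l2 X x)"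
    by (rule pointwise_op_sq[OF pointwise_op_restr[OF m] rep_l2_sq])
  have u: "u \<in> L2 \<Omega>" and G: "(\<lambda>x. snd (rep_l2 X x)) \<in> L2 \<Omega>"
    using sq_integrable_fst[OF Xsq] sq_integrable_snd[OF Xsq] by (auto simp: L2_iff_ext[OF m] u_def)
  have w: "has_weak_gradient \<Omega> u (\<lambda>x. snd (rep_l2 X x))"
    unfolding has_weak_gradient_def
  proof (intro ballI allI)
    fix \<phi> i assume \<phi>: "\<phi> \<in> test_functions \<Omega>"
    have "(\<lambda>x. indicat_real \<Omega> x * (u x * partial_deriv i \<phi> x)) = (\<lambda>x. fst (rep_l2 X x) * partial_deriv i \<phi> x)"
      using test_function_outside[OF \<phi>] by (auto simp: fun_eq_iff u_def partial_deriv_grad indicator_def)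
    moreover have "(\<lambda>x. indicat_real \<Omega> x * (snd (rep_l2 X x) $ i * \<phi> x)) = (\<lambda>x. snd (rep_l2 X x) $ i * \<phi> x)"
      using test_function_outside[OF \<phi>] by (auto simp: fun_eq_iff indicator_def)
    ultimately show "(LINT x|lebesgue_on \<Omega>. u x * partial_deriv i \<phi> x) = - (LINT x|lebesgue_on \<Omega>. snd (rep_l2 X x) $ i * \<phi> x)"
      unfolding lint_on_eq[OF m] using closure_jets_by_parts[OF X \<phi>, of i] by simp
  qed
  note e = jet_of_eq[OF \<Omega> u G w]
  show "u \<in> H1 \<Omega>" "AE x in lebesgue_on \<Omega>. weak_grad \<Omega> u x = snd (rep_l2 X x)" by (rule e)+
  have "emb \<Omega> (\<lambda>x. (u x, snd (rep_l2 X x))) = abs_l2 (rep_l2 X)"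
    unfolding emb_def
  proof (rule abs_l2_eqI)
    show "sq_integrable lebesgue (\<lambda>x. indicat_real \<Omega> x *\<^sub>R (u x, snd (rep_l2 X x)))"
      using Xsq by (simp add: u_def)
    show "AE x in lebesgue. indicat_real \<Omega> x *\<^sub>R (u x, snd (rep_l2 X x)) = rep_l2 X x"
      using closure_jets_outside[OF \<Omega>(1) X] by eventually_elim (auto simp: u_def indicator_def)
  qed (rule rep_l2_sq)
  then show "jet_of \<Omega> u = X" using e(3) by simp
qed

lemma jet_of_test:
  fixes \<Omega> :: "(real^'n) set"
  assumes \<Omega>: "open \<Omega>" "bounded \<Omega>" and \<phi>: "\<phi> \<in> test_functions \<Omega>"
  shows "\<phi> \<in> H1 \<Omega>" "AE x in lebesgue_on \<Omega>. weak_grad \<Omega> \<phi> x = grad \<phi> x" "jet_of \<Omega> \<phi> = jet \<phi>"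
proof -
  have m: "\<Omega> \<in> sets lebesgue" using \<Omega> by auto
  have w: "has_weak_gradient \<Omega> \<phi> (grad \<phi>)"
    unfolding has_weak_gradient_def
  proof (intro ballI allI)
    fix \<psi> i assume \<psi>: "\<psi> \<in> test_functions \<Omega>"
    have "(\<lambda>x. indicat_real \<Omega> x * (\<phi> x * partial_deriv i \<psi> x)) = (\<lambda>x. \<phi> x * partial_deriv i \<psi> x)"
      using test_function_outside[OF \<phi>] by (auto simp: fun_eq_iff indicator_def)
    moreover have "(\<lambda>x. indicat_real \<Omega> x * (grad \<phi> x $ i * \<psi> x)) = (\<lambda>x. partial_deriv i \<phi> x * \<psi> x)"
      using test_function_outside[OF \<phi>] by (auto simp: fun_eq_iff indicator_def partial_deriv_grad)
    ultimately show "(LINT x|lebesgue_on \<Omega>. \<phi> x * partial_deriv i \<psi> x) = - (LINT x|lebesgue_on \<Omega>. grad \<phi> x $ i * \<psi> x)"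
      unfolding lint_on_eq[OF m] using integral_by_parts_test[OF \<psi> test_function_smooth[OF \<phi>], of i] by simp
  qed
  note e = jet_of_eq[OF \<Omega> test_function_L2[OF m \<phi>] w]
  show "\<phi> \<in> H1 \<Omega>" "AE x in lebesgue_on \<Omega>. weak_grad \<Omega> \<phi> x = grad \<phi> x" by (rule e)+
  have "(\<lambda>x. indicat_real \<Omega> x *\<^sub>R (\<phi> x, grad \<phi> x)) = (\<lambda>x. (\<phi> x, grad \<phi> x))"
    using test_function_outside[OF \<phi>] by (auto simp: fun_eq_iff indicator_def)
  then show "jet_of \<Omega> \<phi> = jet \<phi>" unfolding e(3) emb_def jet_def by simp
qed

text \<open>On H^1 the norm is the Hilbert space norm of \<open>jet_of\<close>, so approximation by
  test functions means membership in the closure of their jets.\<close>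

lemma H10_iff:
  fixes \<Omega> :: "(real^'n) set"
  assumes \<Omega>: "open \<Omega>" "bounded \<Omega>"
  shows "v \<in> H10 \<Omega> \<longleftrightarrow> v \<in> H1 \<Omega> \<and> jet_of \<Omega> v \<in> closure (jets \<Omega>)"
proof -
  have m: "\<Omega> \<in> sets lebesgue" using \<Omega> by auto
  have n: "H1_norm \<Omega> (\<lambda>x. v x - \<phi> x) = norm (jet \<phi> - jet_of \<Omega> v)"
    if v: "v \<in> H1 \<Omega>" and \<phi>: "\<phi> \<in> test_functions \<Omega>" for \<phi>
  proof -
    note l = jet_of_lin[OF \<Omega> v jet_of_test(1)[OF \<Omega> \<phi>], of "-1"]
    have "H1_norm \<Omega> (\<lambda>x. v x + (-1) * \<phi> x) = norm (jet_of \<Omega> v + (-1) *\<^sub>R jet \<phi>)"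
      unfolding H1_norm_eq[OF m l(1)] l(2) jet_of_test(3)[OF \<Omega> \<phi>] ..
    then show ?thesis by (simp add: norm_minus_commute)
  qed
  show ?thesis
  proof
    assume v: "v \<in> H10 \<Omega>"
    then obtain \<phi> where \<phi>: "v \<in> H1 \<Omega>" "\<And>k::nat. \<phi> k \<in> test_functions \<Omega>"
      "(\<lambda>k. H1_norm \<Omega> (\<lambda>x. v x - \<phi> k x)) \<longlonglongrightarrow> 0" by (auto simp: H10_def)
    have "(\<lambda>k. jet (\<phi> k)) \<longlonglongrightarrow> jet_of \<Omega> v"
      using \<phi>(3) unfolding n[OF \<phi>(1,2)] by (simp add: tendsto_norm_zero_iff LIM_zero_iff)
    moreover have "jet (\<phi> k) \<in> jets \<Omega>" for k using \<phi>(2) by (simp add: jets_def)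
    ultimately show "v \<in> H1 \<Omega> \<and> jet_of \<Omega> v \<in> closure (jets \<Omega>)"
      using \<phi>(1) unfolding closure_sequential by (intro conjI exI[of _ "\<lambda>k. jet (\<phi> k)"]) auto
  next
    assume v: "v \<in> H1 \<Omega> \<and> jet_of \<Omega> v \<in> closure (jets \<Omega>)"
    then obtain \<phi> where \<phi>: "\<And>k::nat. \<phi> k \<in> test_functions \<Omega>" "(\<lambda>k. jet (\<phi> k)) \<longlonglongrightarrow> jet_of \<Omega> v"
      using closure_jetsE by blast
    have "(\<lambda>k. H1_norm \<Omega> (\<lambda>x. v x - \<phi> k x)) \<longlonglongrightarrow> 0"
      using \<phi>(2) v unfolding n[OF conjunct1[OF v] \<phi>(1)] by (simp add: tendsto_norm_zero_iff LIM_zero_iff)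
    then show "v \<in> H10 \<Omega>" using v \<phi>(1) by (auto simp: H10_def)
  qed
qed

lemma H10_lin:
  fixes \<Omega> :: "(real^'n) set"
  assumes \<Omega>: "open \<Omega>" "bounded \<Omega>" and u: "u \<in> H10 \<Omega>" and v: "v \<in> H10 \<Omega>"
  shows "(\<lambda>x. u x + c * v x) \<in> H10 \<Omega>"
  using u v unfolding H10_iff[OF \<Omega>]
  by (auto simp: jet_of_lin[OF \<Omega>] intro!: subspace_add subspace_scale subspace_closure_jets)

lemma zero_H10:
  fixes \<Omega> :: "(real^'n) set"
  assumes \<Omega>: "open \<Omega>" "bounded \<Omega>"
  shows "(\<lambda>x. 0) \<in> H10 \<Omega>" "jet_of \<Omega> (\<lambda>x. 0) = 0"
proof -
  note t = jet_of_test[OF \<Omega> test_function_zero]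
  have "jet (\<lambda>x. 0 * 0 :: real) = (0::real) *\<^sub>R jet (\<lambda>x::real^'n. 0)"
    by (rule jet_cmult[OF test_function_zero])
  then show "jet_of \<Omega> (\<lambda>x. 0) = 0" using t(3) by simp
  then show "(\<lambda>x. 0) \<in> H10 \<Omega>"
    using t(1) subspace_0[OF subspace_closure_jets] by (simp add: H10_iff[OF \<Omega>])
qed

lemma Hm1_inner:
  fixes \<Omega> :: "(real^'n) set"
  assumes \<Omega>: "open \<Omega>" "bounded \<Omega>" and f: "\<And>v. v \<in> H10 \<Omega> \<Longrightarrow> f v = inner F (gr (jet_of \<Omega> v))"
  shows "f \<in> Hm1 \<Omega>"
proof -
  have m: "\<Omega> \<in> sets lebesgue" using \<Omega> by auto
  have lin: "linear (gr :: (real^'n, real \<times> (real^'n)) l2 \<Rightarrow> _)" by (rule bounded_linear.linear[OF bounded_linear_gr])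
  have "f (\<lambda>x. u x + v x) = f u + f v" if "u \<in> H10 \<Omega>" "v \<in> H10 \<Omega>" for u v
    using H10_lin[OF \<Omega> that, of 1] jet_of_lin(2)[OF \<Omega>, of u v 1] that
    by (simp add: f H10_iff[OF \<Omega>] linear_add[OF lin] inner_add_right)
  moreover have "f (\<lambda>x. c * v x) = c * f v" if "v \<in> H10 \<Omega>" for c v
    using H10_lin[OF \<Omega> zero_H10(1)[OF \<Omega>] that, of c] jet_of_lin(2)[OF \<Omega>, of "\<lambda>x. 0" v c] that zero_H10[OF \<Omega>]
    by (simp add: f H10_iff[OF \<Omega>] linear_scale[OF lin])
  moreover have "\<bar>f v\<bar> \<le> norm F * H1_norm \<Omega> v" if "v \<in> H10 \<Omega>" for v
  proof -
    have "\<bar>f v\<bar> \<le> norm F * norm (gr (jet_of \<Omega> v))" unfolding f[OF that] by (rule Cauchy_Schwarz_ineq2)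
    also have "\<dots> \<le> norm F * norm (jet_of \<Omega> v)" by (intro mult_left_mono norm_gr_le) simp
    finally show ?thesis using that by (simp add: H1_norm_eq[OF m] H10_iff[OF \<Omega>])
  qed
  ultimately show ?thesis unfolding Hm1_def by blast
qed

text \<open>The solutions constructed later all produce one functional, so strong convergence in
  H^-1 becomes that of a constant sequence.\<close>

lemma Hm1_convergent_const:
  fixes \<Omega> :: "(real^'n) set"
  assumes \<Omega>: "open \<Omega>" "bounded \<Omega>"
    and f: "\<And>n v. v \<in> H10 \<Omega> \<Longrightarrow> f n v = inner F (gr (jet_of \<Omega> v))"
  shows "Hm1_convergent \<Omega> f"
proof -
  have m: "\<Omega> \<in> sets lebesgue" using \<Omega> by auto
  define g where "g v = inner F (gr (jet_of \<Omega> v))" for v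
  have "Hm1_norm \<Omega> (\<lambda>v. f n v - g v) = 0" for n
  proof -
    \<comment> \<open>The supremum must range over a nonempty set; the zero function shows that the
      image is exactly {0}.\<close>
    have "(\<lambda>v. \<bar>f n v - g v\<bar>) ` {v \<in> H10 \<Omega>. H1_norm \<Omega> v \<le> 1} = {0}"
    proof -
      have "(\<lambda>x. 0) \<in> {v \<in> H10 \<Omega>. H1_norm \<Omega> v \<le> 1}"
        using zero_H10[OF \<Omega>] by (simp add: H10_iff[OF \<Omega>] H1_norm_eq[OF m])
      moreover have "\<bar>f n v - g v\<bar> = 0" if "v \<in> {v \<in> H10 \<Omega>. H1_norm \<Omega> v \<le> 1}" for v
        using that f by (simp add: g_def)
      ultimately show ?thesis by (auto simp: image_iff)
    qed
    then show ?thesis unfolding Hm1_norm_def by simp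
  qed
  then have "(\<lambda>n. Hm1_norm \<Omega> (\<lambda>v. f n v - g v)) \<longlonglongrightarrow> 0" by simp
  moreover have "g \<in> Hm1 \<Omega>" by (rule Hm1_inner[OF \<Omega>, of _ F]) (simp add: g_def)
  moreover have "f n \<in> Hm1 \<Omega>" for n by (rule Hm1_inner[OF \<Omega> f])
  ultimately show ?thesis unfolding Hm1_convergent_def by blast
qed


section \<open>Solutions with oscillating coefficients\<close>

lemma norm_matrix_vector_le: "norm ((A :: real^'n^'m) *v x) \<le> norm A * norm x"
proof -
  have "norm (A *v x) = L2_set (\<lambda>i. norm ((A *v x) $ i)) UNIV" by (simp add: norm_vec_def)
  also have "\<dots> \<le> L2_set (\<lambda>i. norm (A $ i) * norm x) UNIV"
  proof (rule L2_set_mono)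
    show "norm ((A *v x) $ i) \<le> norm (A $ i) * norm x" for i
      by (simp add: matrix_vector_mul_component Cauchy_Schwarz_ineq2)
  qed simp
  also have "\<dots> = norm A * norm x" by (simp add: L2_set_left_distrib norm_vec_def)
  finally show ?thesis .
qed

lemma matrix_vector_measurable:
  fixes A :: "'a \<Rightarrow> real^'n^'m"
  assumes "A \<in> borel_measurable M" "f \<in> borel_measurable M"
  shows "(\<lambda>x. A x *v f x) \<in> borel_measurable M"
proof -
  have "continuous_on UNIV (\<lambda>p::(real^'n^'m) \<times> (real^'n). fst p *v snd p)"
    unfolding matrix_vector_mult_def
    by (intro continuous_on_vec_lambda continuous_intros)
  from borel_measurable_continuous_onI[OF this]
  have "(\<lambda>x. (\<lambda>p. fst p *v snd p) (A x, f x)) \<in> borel_measurable M"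
    by (rule measurable_compose[rotated]) (intro borel_measurable_Pair assms)
  then show ?thesis by simp
qed

lemma pointwise_op_matrix:
  fixes A :: "real^'n \<Rightarrow> real^'n^'n"
  assumes A: "A \<in> borel_measurable lebesgue" and K: "\<And>x. norm (A x) \<le> K"
  shows "pointwise_op (\<lambda>x v. A x *v v)"
proof (rule pointwise_opI[where C=K])
  show "norm (A x *v v) \<le> K * norm v" for x v
    using norm_matrix_vector_le[of "A x" v] mult_right_mono[OF K[of x], of "norm v"] by simp
  show "(\<lambda>x. A x *v f x) \<in> borel_measurable lebesgue" if "f \<in> borel_measurable lebesgue" for f
    by (rule matrix_vector_measurable[OF A that])
qed (rule matrix_vector_mul_linear)

text \<open>Membership in \<open>mat_class\<close> speaks of almost every point of
  \<open>\<Omega>\<close>, while multiplication operators need a bound at every point of the space;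
  truncation at a level above the essential bound changes a null set only.\<close>

lemma mat_class_bounded_version:
  fixes A :: "real^'n \<Rightarrow> real^'n^'n"
  assumes \<Omega>: "\<Omega> \<in> sets lebesgue" and A: "A \<in> mat_class \<alpha> \<beta> \<Omega>"
  obtains A' K where "A' \<in> borel_measurable lebesgue" "\<And>x. norm (A' x) \<le> K" "\<And>x. x \<notin> \<Omega> \<Longrightarrow> A' x = 0"
    "AE x in lebesgue. x \<in> \<Omega> \<longrightarrow> A' x = A x"
proof -
  \<comment> \<open>The operator bound \<beta> controls each entry through the image of a basis
    vector; rows, and then the whole matrix, are estimated by sums of n terms.\<close>
  define K where "K = real CARD('n) * (real CARD('n) * \<bar>\<beta>\<bar>)"
  have m: "(\<lambda>x. indicat_real \<Omega> x *\<^sub>R A x) \<in> borel_measurable lebesgue"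
    using A \<Omega> by (simp add: mat_class_def borel_measurable_restrict_space_iff)
  define A' where "A' x = (if norm (indicat_real \<Omega> x *\<^sub>R A x) \<le> K then indicat_real \<Omega> x *\<^sub>R A x else 0)" for x
  have "A' \<in> borel_measurable lebesgue" unfolding A'_def using m by measurable
  moreover have "norm (A' x) \<le> K" for x by (simp add: A'_def K_def)
  moreover have "A' x = 0" if "x \<notin> \<Omega>" for x using that by (simp add: A'_def)
  moreover have "AE x in lebesgue. x \<in> \<Omega> \<longrightarrow> A' x = A x"
  proof -
    have "AE x in lebesgue. x \<in> \<Omega> \<longrightarrow> (\<forall>\<xi>. norm (A x *v \<xi>) \<le> \<beta> * norm \<xi>)"
      using A unfolding mat_class_def AE_on_iff[OF \<Omega>, symmetric] by (auto elim: eventually_mono)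
    then show ?thesis
    proof eventually_elim
      case (elim x)
      show ?case
      proof
        assume "x \<in> \<Omega>"
        have "\<bar>A x $ i $ j\<bar> \<le> \<bar>\<beta>\<bar>" for i j
        proof -
          have "\<bar>A x $ i $ j\<bar> = \<bar>(A x *v axis j 1) $ i\<bar>"
            by (simp add: matrix_vector_mul_component inner_axis)
          also have "\<dots> \<le> norm (A x *v axis j 1)" by (rule component_le_norm_cart)
          also have "\<dots> \<le> \<beta> * norm (axis j 1 :: real^'n)" using elim \<open>x \<in> \<Omega>\<close> by blast
          finally show ?thesis by simp
        qed
        then have "norm (A x $ i) \<le> real CARD('n) * \<bar>\<beta>\<bar>" for i
          using norm_le_l1_cart[of "A x $ i"] sum_bounded_above[of UNIV "\<lambda>j. \<bar>A x $ i $ j\<bar>" "\<bar>\<beta>\<bar>"] by fastforce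
        then have "norm (A x) \<le> K"
          unfolding K_def norm_vec_def[of "A x"]
          using order.trans[OF L2_set_le_sum[of UNIV "\<lambda>i. norm (A x $ i)"] sum_bounded_above[of UNIV "\<lambda>i. norm (A x $ i)" "real CARD('n) * \<bar>\<beta>\<bar>"]]
          by simp
        then show "A' x = A x" using \<open>x \<in> \<Omega>\<close> by (simp add: A'_def)
      qed
    qed
  qed
  ultimately show thesis by (rule that)
qed

lemma scaled_energy:
  fixes a :: "'a::euclidean_space \<Rightarrow> real" and X :: "('a, 'b::euclidean_space) l2"
  assumes [measurable]: "a \<in> borel_measurable lebesgue" and a: "\<And>x. a1 \<le> a x" "\<And>x. a x \<le> a2" and a1: "0 < a1"
  shows "pointwise_op (\<lambda>x (v::'b). a x *\<^sub>R v)" "a1 * (norm X)\<^sup>2 \<le> inner (mulop (\<lambda>x v. a x *\<^sub>R v) X) X"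
    "inner (mulop (\<lambda>x v. a x *\<^sub>R v) X) Y = inner (mulop (\<lambda>x v. a x *\<^sub>R v) Y) X"
proof -
  have abs: "\<bar>a x\<bar> \<le> a2" for x using a[of x] a1 by simp
  show T: "pointwise_op (\<lambda>x (v::'b). a x *\<^sub>R v)" by (rule pointwise_op_scale[OF assms(1) abs])
  have eq: "inner (mulop (\<lambda>x v. a x *\<^sub>R v) X) Y = (LINT x|lebesgue. a x *\<^sub>R rep_l2 X x \<bullet> rep_l2 Y x)" for X Y :: "('a, 'b) l2"
    unfolding mulop_def using inner_abs_l2[OF pointwise_op_sq[OF T rep_l2_sq] rep_l2_sq, of X Y] by simp
  have "a1 * (norm X)\<^sup>2 = (LINT x|lebesgue. a1 * (norm (rep_l2 X x))\<^sup>2)" by (simp add: norm_l2_sq)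
  also have "\<dots> \<le> (LINT x|lebesgue. a x *\<^sub>R rep_l2 X x \<bullet> rep_l2 X x)"
  proof (rule integral_mono)
    show "integrable lebesgue (\<lambda>x. a1 * (norm (rep_l2 X x))\<^sup>2)"
      by (rule integrable_mult_right, rule sq_integrableD(2)[OF rep_l2_sq])
    show "integrable lebesgue (\<lambda>x. a x *\<^sub>R rep_l2 X x \<bullet> rep_l2 X x)"
      by (rule integrable_inner_sq[OF pointwise_op_sq[OF T rep_l2_sq] rep_l2_sq])
    show "a1 * (norm (rep_l2 X x))\<^sup>2 \<le> a x *\<^sub>R rep_l2 X x \<bullet> rep_l2 X x" for x
      unfolding inner_scaleR_left power2_norm_eq_inner by (intro mult_right_mono a) simp
  qed
  finally show "a1 * (norm X)\<^sup>2 \<le> inner (mulop (\<lambda>x v. a x *\<^sub>R v) X) X" by (simp add: eq)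
  show "inner (mulop (\<lambda>x v. a x *\<^sub>R v) X) Y = inner (mulop (\<lambda>x v. a x *\<^sub>R v) Y) X"
    unfolding eq by (simp add: inner_commute)
qed

text \<open>Lax-Milgram for a symmetric form, coercive by Friedrichs' inequality. The quantifier
  order matters: the bound depends on \<open>a1\<close>, the domain and \<open>F\<close>, but not on
  the coefficient.\<close>

lemma solution_exists:
  fixes \<Omega> :: "(real^'n) set" and F :: "(real^'n, real^'n) l2"
  assumes \<Omega>: "bounded \<Omega>" and a1: "0 < a1"
  shows "\<exists>C. \<forall>a\<in>borel_measurable lebesgue. (\<forall>x. a1 \<le> a x \<and> a x \<le> a2) \<longrightarrow>
    (\<exists>X\<in>closure (jets \<Omega>). norm X \<le> C \<and>
      (\<forall>Y\<in>closure (jets \<Omega>). inner (mulop (\<lambda>x v. a x *\<^sub>R v) (gr X)) (gr Y) = inner F (gr Y)))"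
proof -
  obtain P where P: "0 < P" "\<And>X. X \<in> closure (jets \<Omega>) \<Longrightarrow> (norm X)\<^sup>2 \<le> P * (norm (gr X))\<^sup>2"
    using friedrichs[OF \<Omega>] by blast
  define \<alpha> where "\<alpha> = a1 / P"
  have \<alpha>: "0 < \<alpha>" using a1 P by (simp add: \<alpha>_def)
  have "\<exists>X\<in>closure (jets \<Omega>). norm X \<le> norm F / \<alpha> \<and>
      (\<forall>Y\<in>closure (jets \<Omega>). inner (mulop (\<lambda>x v. a x *\<^sub>R v) (gr X)) (gr Y) = inner F (gr Y))"
    if am: "a \<in> borel_measurable lebesgue" and al: "\<And>x. a1 \<le> a x" and au: "\<And>x. a x \<le> a2" for a
  proof -
    let ?T = "mulop (\<lambda>x (v::real^'n). a x *\<^sub>R v)"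
    note E = scaled_energy[OF am al au a1]
    have bl: "bounded_linear (\<lambda>X. ?T (gr X))"
      by (rule bounded_linear_compose[OF bounded_linear_mulop[OF E(1)] bounded_linear_gr])
    have bb: "bounded_bilinear (\<lambda>X Y. inner (?T (gr X)) (gr Y))"
      by (rule bounded_bilinear.comp[OF bounded_bilinear_inner bl bounded_linear_gr])
    have coer: "\<alpha> * (norm X)\<^sup>2 \<le> inner (?T (gr X)) (gr X)" if X: "X \<in> closure (jets \<Omega>)" for X
    proof -
      have "\<alpha> * (norm X)\<^sup>2 \<le> \<alpha> * (P * (norm (gr X))\<^sup>2)" using P(2)[OF X] \<alpha> by (intro mult_left_mono) auto
      also have "\<dots> = a1 * (norm (gr X))\<^sup>2" using P(1) by (simp add: \<alpha>_def)
      also have "\<dots> \<le> inner (?T (gr X)) (gr X)" by (rule E(2))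
      finally show ?thesis .
    qed
    have lin: "linear (gr :: (real^'n, real \<times> (real^'n)) l2 \<Rightarrow> _)" by (rule bounded_linear.linear[OF bounded_linear_gr])
    have Fb: "\<bar>inner F (gr v)\<bar> \<le> norm F * norm v" for v :: "(real^'n, real \<times> (real^'n)) l2"
      by (rule order.trans[OF Cauchy_Schwarz_ineq2]) (intro mult_left_mono norm_gr_le norm_ge_zero)
    obtain X where X: "X \<in> closure (closure (jets \<Omega>))" "\<And>Y. Y \<in> closure (jets \<Omega>) \<Longrightarrow> inner (?T (gr X)) (gr Y) = inner F (gr Y)"
    proof (rule coercive_minimiser[OF bb _ subspace_closure_jets[of \<Omega>] \<alpha>, where F="\<lambda>Y. inner F (gr Y)" and C="norm F"])
      show "inner (?T (gr u)) (gr v) = inner (?T (gr v)) (gr u)" for u v :: "(real^'n, real \<times> (real^'n)) l2" by (rule E(3))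
    qed (auto simp: linear_add[OF lin] linear_scale[OF lin] inner_add_right Fb coer)
    have Xc: "X \<in> closure (jets \<Omega>)" using X(1) by simp
    have "\<alpha> * (norm X)\<^sup>2 \<le> norm F * norm X"
      using coer[OF Xc] X(2)[OF Xc] Fb[of X] by linarith
    then have "norm X \<le> norm F / \<alpha>"
    proof (cases "norm X = 0")
      case False
      then show ?thesis using \<open>\<alpha> * (norm X)\<^sup>2 \<le> norm F * norm X\<close> \<alpha> by (simp add: power2_eq_square field_simps)
    qed (use \<alpha> in simp)
    then show ?thesis using Xc X(2) by blast
  qed
  then show ?thesis by (intro exI[of _ "norm F / \<alpha>"] ballI impI) blast
qed


text \<open>If convergence failed, a subsequence would stay away from the limit; a weakly convergent
  further subsequence contradicts the identification of all subsequential limits.\<close>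

lemma weak_limit_unique_subseq:
  fixes X :: "nat \<Rightarrow> 'a::{real_inner,complete_space}"
  assumes C: "\<And>n. norm (X n) \<le> C"
    and sub: "\<And>r Y. strict_mono r \<Longrightarrow> Y \<in> closure (span (range X)) \<Longrightarrow> (\<And>z. (\<lambda>n. inner (X (r n)) z) \<longlonglongrightarrow> inner Y z) \<Longrightarrow> Y = X0"
  shows "(\<lambda>n. inner (X n) z) \<longlonglongrightarrow> inner X0 z"
proof (rule ccontr)
  assume "\<not> ?thesis"
  then obtain e where e: "0 < e" "\<And>N. \<exists>n\<ge>N. e \<le> norm (inner (X n) z - inner X0 z)"
    unfolding LIMSEQ_iff by (auto simp: not_less)
  define S where "S = {n. e \<le> norm (inner (X n) z - inner X0 z)}"
  have "infinite S" unfolding infinite_nat_iff_unbounded_le S_def using e(2) by auto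
  then obtain r0 :: "nat \<Rightarrow> nat" where r0: "strict_mono r0" "\<And>n. r0 n \<in> S"
    using infinite_enumerate[of S] by blast
  obtain r Y where r: "strict_mono r" "Y \<in> closure (span (range (X \<circ> r0)))" "\<And>z. (\<lambda>n. inner ((X \<circ> r0) (r n)) z) \<longlonglongrightarrow> inner Y z"
    using bounded_weakly_convergent_subseq[of "X \<circ> r0" C] C by auto
  have "closure (span (range (X \<circ> r0))) \<subseteq> closure (span (range X))"
    by (intro closure_mono span_mono) auto
  then have "Y = X0"
    using r by (intro sub[OF strict_mono_o[OF r0(1) r(1)]]) (auto simp: o_def)
  then have "(\<lambda>n. inner (X (r0 (r n))) z - inner X0 z) \<longlonglongrightarrow> 0"
    using r(3)[of z] by (simp add: LIM_zero)
  then obtain n where "norm (inner (X (r0 (r n))) z - inner X0 z) < e"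
    using LIMSEQ_D[OF _ e(1)] by fastforce
  moreover have "r0 (r n) \<in> S" by (rule r0(2))
  ultimately show False by (simp add: S_def)
qed

text \<open>Weak convergence of pairs is weak convergence in H^1, and the equation says that the
  divergence functional is given by \<open>F\<close> for every index.\<close>

lemma test_sequence_solutions:
  fixes \<Omega> :: "(real^'n) set"
  assumes \<Omega>: "open \<Omega>" "bounded \<Omega>"
    and a: "\<And>n. a n \<in> borel_measurable lebesgue" "\<And>n x. \<bar>a n x\<bar> \<le> a2"
    and X: "\<And>n. X n \<in> closure (jets \<Omega>)" "X0 \<in> closure (jets \<Omega>)"
    and weak: "\<And>z. (\<lambda>n. inner (X n) z) \<longlonglongrightarrow> inner X0 z"
    and sol: "\<And>n Y. Y \<in> closure (jets \<Omega>) \<Longrightarrow> inner (mulop (\<lambda>x v. a n x *\<^sub>R v) (gr (X n))) (gr Y) = inner F (gr Y)"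
  shows "test_sequence \<Omega> (\<lambda>n x. a n x *\<^sub>R mat 1) (\<lambda>n x. fst (rep_l2 (X n) x)) (\<lambda>x. fst (rep_l2 X0 x))"
proof -
  have m: "\<Omega> \<in> sets lebesgue" using \<Omega> by auto
  have "H1_weakly_converges \<Omega> (\<lambda>n x. fst (rep_l2 (X n) x)) (\<lambda>x. fst (rep_l2 X0 x))"
    unfolding H1_weakly_converges_def
    using closure_jets_H1[OF \<Omega> X(1)] closure_jets_H1[OF \<Omega> X(2)] weak by (simp add: H1_inner_eq[OF m])
  moreover have "Hm1_convergent \<Omega> (\<lambda>n. neg_div \<Omega> (\<lambda>x. (a n x *\<^sub>R mat 1) *v weak_grad \<Omega> (\<lambda>x. fst (rep_l2 (X n) x)) x))"
  proof (rule Hm1_convergent_const[OF \<Omega>])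
    fix n v assume v: "v \<in> H10 \<Omega>"
    then have v1: "v \<in> H1 \<Omega>" and vc: "jet_of \<Omega> v \<in> closure (jets \<Omega>)" by (auto simp: H10_iff[OF \<Omega>])
    let ?W = "weak_grad \<Omega> (\<lambda>x. fst (rep_l2 (X n) x))"
    have T: "pointwise_op (\<lambda>x (v::real^'n). a n x *\<^sub>R v)" by (rule pointwise_op_scale[OF a])
    have wv: "sq_integrable lebesgue (\<lambda>x. indicat_real \<Omega> x *\<^sub>R weak_grad \<Omega> v x)"
      using weak_grad_H1[OF v1] by (simp add: L2_iff_ext[OF m])
    have rv: "AE x in lebesgue. rep_l2 (gr (jet_of \<Omega> v)) x = indicat_real \<Omega> x *\<^sub>R weak_grad \<Omega> v x"
    proof -
      have "sq_integrable lebesgue (\<lambda>x. indicat_real \<Omega> x *\<^sub>R (v x, weak_grad \<Omega> v x))"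
        using L2_Pair[OF H1_L2[OF v1] weak_grad_H1[OF v1, THEN conjunct1]] by (simp only: L2_iff_ext[OF m])
      from rep_l2_abs[OF this] have "AE x in lebesgue. rep_l2 (jet_of \<Omega> v) x = indicat_real \<Omega> x *\<^sub>R (v x, weak_grad \<Omega> v x)"
        by (simp add: jet_of_def emb_def)
      then show ?thesis using rep_gr[of "jet_of \<Omega> v"] by eventually_elim simp
    qed
    have W: "AE x in lebesgue. x \<in> \<Omega> \<longrightarrow> ?W x = rep_l2 (gr (X n)) x"
      using closure_jets_H1(2)[OF \<Omega> X(1), of n] rep_gr[of "X n"] unfolding AE_on_iff[OF m]
      by eventually_elim simp
    have eq: "AE x in lebesgue. indicat_real \<Omega> x * (((a n x *\<^sub>R mat 1) *v ?W x) \<bullet> weak_grad \<Omega> v x) =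
       rep_l2 (mulop (\<lambda>x v. a n x *\<^sub>R v) (gr (X n))) x \<bullet> rep_l2 (gr (jet_of \<Omega> v)) x"
      using rv W rep_mulop[OF T, of "gr (X n)"]
      by eventually_elim (auto simp: indicator_def scaleR_matrix_vector_assoc[symmetric])
    have "neg_div \<Omega> (\<lambda>x. (a n x *\<^sub>R mat 1) *v ?W x) v = (LINT x|lebesgue. indicat_real \<Omega> x * (((a n x *\<^sub>R mat 1) *v ?W x) \<bullet> weak_grad \<Omega> v x))"
      unfolding neg_div_def L2_inner_def lint_on_eq[OF m] ..
    also have "\<dots> = inner (mulop (\<lambda>x v. a n x *\<^sub>R v) (gr (X n))) (gr (jet_of \<Omega> v))"
      unfolding inner_l2_eq
    proof (rule integral_cong_AE[OF _ _ eq])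
      show "(\<lambda>x. indicat_real \<Omega> x * (((a n x *\<^sub>R mat 1) *v ?W x) \<bullet> weak_grad \<Omega> v x)) \<in> borel_measurable lebesgue"
      proof -
        have "?W \<in> L2 \<Omega>" using weak_grad_H1 closure_jets_H1(1)[OF \<Omega> X(1)] by blast
        then have [measurable]: "(\<lambda>x. indicat_real \<Omega> x *\<^sub>R ?W x) \<in> borel_measurable lebesgue"
          by (auto simp: L2_iff_ext[OF m])
        note [measurable] = sq_integrableD(1)[OF wv] a(1)
        have "(\<lambda>x. a n x *\<^sub>R (indicat_real \<Omega> x *\<^sub>R ?W x) \<bullet> (indicat_real \<Omega> x *\<^sub>R weak_grad \<Omega> v x)) \<in> borel_measurable lebesgue"
          by measurable
        moreover have "(\<lambda>x. a n x *\<^sub>R (indicat_real \<Omega> x *\<^sub>R ?W x) \<bullet> (indicat_real \<Omega> x *\<^sub>R weak_grad \<Omega> v x)) =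
          (\<lambda>x. indicat_real \<Omega> x * (((a n x *\<^sub>R mat 1) *v ?W x) \<bullet> weak_grad \<Omega> v x))"
          by (auto simp: fun_eq_iff indicator_def scaleR_matrix_vector_assoc[symmetric])
        ultimately show ?thesis by simp
      qed
    qed measurable
    also have "\<dots> = inner F (gr (jet_of \<Omega> v))" by (rule sol[OF vc])
    finally show "neg_div \<Omega> (\<lambda>x. (a n x *\<^sub>R mat 1) *v ?W x) v = inner F (gr (jet_of \<Omega> v))" .
  qed
  ultimately show ?thesis unfolding test_sequence_def by blast
qed

definition phase :: "real \<Rightarrow> real \<Rightarrow> 'a set \<Rightarrow> 'a \<Rightarrow> real" where
  "phase a1 a2 \<omega> x = a1 * indicat_real \<omega> x + a2 * (1 - indicat_real \<omega> x)"

lemma two_phase_phase: "two_phase a1 a2 \<omega> = (\<lambda>x. phase a1 a2 \<omega> x *\<^sub>R mat 1)"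
  by (simp add: fun_eq_iff two_phase_def phase_def)

lemma phase_bounds:
  assumes "a1 \<le> a2"
  shows "a1 \<le> phase a1 a2 \<omega> x" "phase a1 a2 \<omega> x \<le> a2"
  using assms by (auto simp: phase_def indicator_def)

lemma phase_measurable:
  assumes [measurable]: "\<omega> \<in> sets lebesgue"
  shows "phase a1 a2 \<omega> \<in> borel_measurable lebesgue"
  unfolding phase_def by measurable

text \<open>Translates a flux written with the chosen weak gradient on \<open>\<Omega>\<close> into
  an inner product with the bounded representative of the coefficient; both agree almost everywhere
  in \<open>\<Omega>\<close>, and the gradient vanishes outside.\<close>

lemma flux_inner:
  fixes \<Omega> :: "(real^'n) set" and B B' :: "real^'n \<Rightarrow> real^'n^'n"
  assumes \<Omega>: "open \<Omega>" "bounded \<Omega>" and X: "X \<in> closure (jets \<Omega>)"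
    and T: "pointwise_op (\<lambda>x v. B' x *v v)" and B: "B \<in> borel_measurable (lebesgue_on \<Omega>)"
    and BB: "AE x in lebesgue. x \<in> \<Omega> \<longrightarrow> B' x = B x"
  shows "L2_inner \<Omega> (\<lambda>x. B x *v weak_grad \<Omega> (\<lambda>x. fst (rep_l2 X x)) x) (rep_l2 G) = inner (mulop (\<lambda>x v. B' x *v v) (gr X)) G"
proof -
  have m: "\<Omega> \<in> sets lebesgue" using \<Omega> by auto
  let ?W = "weak_grad \<Omega> (\<lambda>x. fst (rep_l2 X x))"
  let ?R = "\<lambda>x. rep_l2 (mulop (\<lambda>x v. B' x *v v) (gr X)) x \<bullet> rep_l2 G x"
  have out: "AE x in lebesgue. x \<notin> \<Omega> \<longrightarrow> rep_l2 (gr X) x = 0"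
    using closure_jets_outside[OF \<Omega>(1) X] rep_gr[of X] by eventually_elim simp
  have W: "AE x in lebesgue. x \<in> \<Omega> \<longrightarrow> ?W x = rep_l2 (gr X) x"
    using closure_jets_H1(2)[OF \<Omega> X] rep_gr[of X] unfolding AE_on_iff[OF m] by eventually_elim simp
  have wm: "?W \<in> borel_measurable (lebesgue_on \<Omega>)"
    using weak_grad_H1[OF closure_jets_H1(1)[OF \<Omega> X]] by (auto simp: L2_def)
  have "L2_inner \<Omega> (\<lambda>x. B x *v ?W x) (rep_l2 G) = (LINT x|lebesgue_on \<Omega>. ?R x)"
    unfolding L2_inner_def
  proof (rule integral_cong_AE)
    show "(\<lambda>x. (B x *v ?W x) \<bullet> rep_l2 G x) \<in> borel_measurable (lebesgue_on \<Omega>)"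
      by (intro borel_measurable_inner matrix_vector_measurable B wm measurable_restrict_space1 rep_l2_measurable)
    show "?R \<in> borel_measurable (lebesgue_on \<Omega>)"
      by (intro borel_measurable_inner measurable_restrict_space1 rep_l2_measurable)
    show "AE x in lebesgue_on \<Omega>. (B x *v ?W x) \<bullet> rep_l2 G x = ?R x"
      unfolding AE_on_iff[OF m] using W BB rep_mulop[OF T, of "gr X"] by eventually_elim simp
  qed
  also have "\<dots> = (LINT x|lebesgue. ?R x)"
    unfolding lint_on_eq[OF m]
  proof (rule integral_cong_AE)
    show "?R \<in> borel_measurable lebesgue" by measurable
    then show "(\<lambda>x. indicat_real \<Omega> x * ?R x) \<in> borel_measurable lebesgue"
      using m by (intro borel_measurable_times) auto
    show "AE x in lebesgue. indicat_real \<Omega> x * ?R x = ?R x"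
      using out rep_mulop[OF T, of "gr X"] by eventually_elim (auto simp: indicator_def)
  qed
  finally show ?thesis by (simp add: inner_l2_eq)
qed

text \<open>Before the weak limit is known only subsequences converge, and this is where
  H-convergence along subsequences is used. It identifies the limit flux along each of them;
  ellipticity of \<open>Astar\<close> then leaves \<open>jet \<phi>\<close> as the only possible
  limit.\<close>

lemma oscillating_solutions:
  fixes \<Omega> :: "(real^'n) set" and \<omega> :: "nat \<Rightarrow> (real^'n) set"
  assumes \<Omega>: "open \<Omega>" "bounded \<Omega>" and a: "0 < a1" "a1 < a2" and \<omega>: "\<And>n. \<omega> n \<in> sets lebesgue"
    and H: "H_converges \<Omega> (\<lambda>n. two_phase a1 a2 (\<omega> n)) Astar"
    and A': "A' \<in> borel_measurable lebesgue" "\<And>x. norm (A' x) \<le> K" "\<And>x. x \<notin> \<Omega> \<Longrightarrow> A' x = 0"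
      "AE x in lebesgue. x \<in> \<Omega> \<longrightarrow> A' x = Astar x"
    and \<phi>: "\<phi> \<in> test_functions \<Omega>"
  defines "F \<equiv> mulop (\<lambda>x v. A' x *v v) (gr (jet \<phi>))"
  obtains X C where "\<And>n. X n \<in> closure (jets \<Omega>)" "\<And>n. norm (X n) \<le> C"
    "\<And>z. (\<lambda>n. inner (X n) z) \<longlonglongrightarrow> inner (jet \<phi>) z"
    "\<And>n Y. Y \<in> closure (jets \<Omega>) \<Longrightarrow> inner (mulop (\<lambda>x v. phase a1 a2 (\<omega> n) x *\<^sub>R v) (gr (X n))) (gr Y) = inner F (gr Y)"
    "test_sequence \<Omega> (\<lambda>n. two_phase a1 a2 (\<omega> n)) (\<lambda>n x. fst (rep_l2 (X n) x)) (\<lambda>x. fst (rep_l2 (jet \<phi>) x))"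
    "\<And>G. (\<lambda>n. inner (mulop (\<lambda>x v. phase a1 a2 (\<omega> n) x *\<^sub>R v) (gr (X n))) G) \<longlonglongrightarrow> inner F G"
proof -
  have m: "\<Omega> \<in> sets lebesgue" using \<Omega> by auto
  define p where "p n = phase a1 a2 (\<omega> n)" for n
  have pm: "p n \<in> borel_measurable lebesgue" for n unfolding p_def by (rule phase_measurable[OF \<omega>])
  have pb: "a1 \<le> p n x" "p n x \<le> a2" for n x using phase_bounds[of a1 a2] a by (auto simp: p_def)
  have pabs: "\<bar>p n x\<bar> \<le> a2" for n x using pb[of n x] a by simp
  have tp: "two_phase a1 a2 (\<omega> n) = (\<lambda>x. p n x *\<^sub>R mat 1)" for n unfolding p_def by (rule two_phase_phase)
  define S where "S n = mulop (\<lambda>x (v::real^'n). p n x *\<^sub>R v)" for n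
  have Sv: "S n = mulop (\<lambda>x v. (p n x *\<^sub>R mat 1) *v v)" for n
    unfolding S_def by (intro arg_cong[of _ _ mulop]) (simp add: fun_eq_iff scaleR_matrix_vector_assoc[symmetric])
  have Sp: "pointwise_op (\<lambda>x v. (p n x *\<^sub>R mat 1 :: real^'n^'n) *v v)" for n
    using pointwise_op_scale[OF pm pabs, of n] by (simp add: scaleR_matrix_vector_assoc[symmetric])
  define T where "T = mulop (\<lambda>x v. A' x *v v)"
  have Tp: "pointwise_op (\<lambda>x v. A' x *v v)" by (rule pointwise_op_matrix[OF A'(1,2)])
  note H1 = H[unfolded H_converges_def, THEN conjunct1] and H2 = H[unfolded H_converges_def, THEN conjunct2]
  obtain \<alpha> \<beta> where AB: "0 < \<alpha>" "Astar \<in> mat_class \<alpha> \<beta> \<Omega>" using H1 by blast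
  obtain P where P: "0 < P" "\<And>X. X \<in> closure (jets \<Omega>) \<Longrightarrow> (norm X)\<^sup>2 \<le> P * (norm (gr X))\<^sup>2"
    using friedrichs[OF \<Omega>(2)] by metis
  have j\<phi>: "jet \<phi> \<in> closure (jets \<Omega>)" 
    using imageI[OF \<phi>, of jet] closure_subset[of "jets \<Omega>"] unfolding jets_def by (rule subsetD[rotated])
  note ex = solution_exists[OF \<Omega>(2) a(1), where F=F and ?a2.0=a2]
  obtain C where C: "\<And>p. p \<in> borel_measurable lebesgue \<Longrightarrow> \<forall>x. a1 \<le> p x \<and> p x \<le> a2 \<Longrightarrow>
    \<exists>X. X \<in> closure (jets \<Omega>) \<and> norm X \<le> C \<and>
      (\<forall>Y\<in>closure (jets \<Omega>). inner (mulop (\<lambda>x v. p x *\<^sub>R v) (gr X)) (gr Y) = inner F (gr Y))"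
  proof -
    obtain C where "\<forall>a\<in>borel_measurable lebesgue. (\<forall>x. a1 \<le> a x \<and> a x \<le> a2) \<longrightarrow>
      (\<exists>X\<in>closure (jets \<Omega>). norm X \<le> C \<and>
        (\<forall>Y\<in>closure (jets \<Omega>). inner (mulop (\<lambda>x v. a x *\<^sub>R v) (gr X)) (gr Y) = inner F (gr Y)))"
      using ex by (rule exE)
    from that[OF this[THEN bspec, THEN mp, unfolded Bex_def]] show ?thesis .
  qed
  have "\<forall>n. \<exists>X. X \<in> closure (jets \<Omega>) \<and> norm X \<le> C \<and> (\<forall>Y\<in>closure (jets \<Omega>). inner (S n (gr X)) (gr Y) = inner F (gr Y))"
  proof
    fix n
    have "\<forall>x. a1 \<le> p n x \<and> p n x \<le> a2" using pb by simp
    from C[OF pm this]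
    show "\<exists>X. X \<in> closure (jets \<Omega>) \<and> norm X \<le> C \<and> (\<forall>Y\<in>closure (jets \<Omega>). inner (S n (gr X)) (gr Y) = inner F (gr Y))"
      unfolding S_def .
  qed
  then obtain X where X: "\<And>n. X n \<in> closure (jets \<Omega>)" "\<And>n. norm (X n) \<le> C"
    and sol: "\<And>n Y. Y \<in> closure (jets \<Omega>) \<Longrightarrow> inner (S n (gr (X n))) (gr Y) = inner F (gr Y)" by metis
  \<comment> \<open>Stated for an arbitrary weakly convergent subsequence with unknown limit
    \<open>Y\<close>, and used again with the identity once the limit is known.\<close>
  have flux: "(\<lambda>k. inner (S (r k) (gr (X (r k)))) G) \<longlonglongrightarrow> inner (T (gr Y)) G"
    and ts: "test_sequence \<Omega> (\<lambda>k. two_phase a1 a2 (\<omega> (r k))) (\<lambda>k x. fst (rep_l2 (X (r k)) x)) (\<lambda>x. fst (rep_l2 Y x))"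
    if r: "strict_mono r" and Y: "Y \<in> closure (jets \<Omega>)" and w: "\<And>z. (\<lambda>n. inner (X (r n)) z) \<longlonglongrightarrow> inner Y z" for r Y G
  proof -
    show t: "test_sequence \<Omega> (\<lambda>k. two_phase a1 a2 (\<omega> (r k))) (\<lambda>k x. fst (rep_l2 (X (r k)) x)) (\<lambda>x. fst (rep_l2 Y x))"
      unfolding tp
      by (rule test_sequence_solutions[OF \<Omega> pm pabs X(1) Y w]) (use sol in \<open>auto simp: S_def\<close>)
    have "L2_weakly_converges \<Omega> (\<lambda>k x. two_phase a1 a2 (\<omega> (r k)) x *v weak_grad \<Omega> (\<lambda>x. fst (rep_l2 (X (r k)) x)) x)
         (\<lambda>x. Astar x *v weak_grad \<Omega> (\<lambda>x. fst (rep_l2 Y x)) x)"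
      by (rule H2[rule_format, OF r t])
    note L = this[unfolded L2_weakly_converges_def, THEN conjunct2, THEN conjunct2, THEN bspec]
    have "rep_l2 G \<in> L2 \<Omega>"
      unfolding L2_iff_ext[OF m] by (rule pointwise_op_sq[OF pointwise_op_restr[OF m] rep_l2_sq])
    note L[OF this]
    moreover have "L2_inner \<Omega> (\<lambda>x. Astar x *v weak_grad \<Omega> (\<lambda>x. fst (rep_l2 Y x)) x) (rep_l2 G) = inner (T (gr Y)) G"
      unfolding T_def using AB(2) by (intro flux_inner[OF \<Omega> Y Tp _ A'(4)]) (simp add: mat_class_def)
    moreover have "L2_inner \<Omega> (\<lambda>x. two_phase a1 a2 (\<omega> (r k)) x *v weak_grad \<Omega> (\<lambda>x. fst (rep_l2 (X (r k)) x)) x) (rep_l2 G)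
       = inner (S (r k) (gr (X (r k)))) G" for k
      unfolding Sv tp
    proof (rule flux_inner[OF \<Omega> X(1) Sp])
      show "(\<lambda>x. p (r k) x *\<^sub>R mat 1 :: real^'n^'n) \<in> borel_measurable (lebesgue_on \<Omega>)"
        by (intro borel_measurable_scaleR measurable_restrict_space1 pm borel_measurable_const)
    qed simp
    ultimately show "(\<lambda>k. inner (S (r k) (gr (X (r k)))) G) \<longlonglongrightarrow> inner (T (gr Y)) G" by simp
  qed
  have coer: "\<alpha> * (norm (gr D))\<^sup>2 \<le> inner (T (gr D)) (gr D)" if D: "D \<in> closure (jets \<Omega>)" for D
  proof -
    have "\<alpha> * (norm (gr D))\<^sup>2 = (LINT x|lebesgue. \<alpha> * (norm (rep_l2 (gr D) x))\<^sup>2)" by (simp add: norm_l2_sq)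
    also have "\<dots> \<le> (LINT x|lebesgue. rep_l2 (T (gr D)) x \<bullet> rep_l2 (gr D) x)"
    proof (rule integral_mono_AE)
      show "integrable lebesgue (\<lambda>x. \<alpha> * (norm (rep_l2 (gr D) x))\<^sup>2)"
        by (rule integrable_mult_right, rule sq_integrableD(2)[OF rep_l2_sq])
      show "integrable lebesgue (\<lambda>x. rep_l2 (T (gr D)) x \<bullet> rep_l2 (gr D) x)"
        by (rule integrable_inner_sq[OF rep_l2_sq rep_l2_sq])
      have "AE x in lebesgue. x \<in> \<Omega> \<longrightarrow> (\<forall>\<xi>. (Astar x *v \<xi>) \<bullet> \<xi> \<ge> \<alpha> * (norm \<xi>)\<^sup>2)"
        using AB(2) unfolding mat_class_def AE_on_iff[OF m, symmetric] by (auto elim: eventually_mono)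
      then show "AE x in lebesgue. \<alpha> * (norm (rep_l2 (gr D) x))\<^sup>2 \<le> rep_l2 (T (gr D)) x \<bullet> rep_l2 (gr D) x"
        using A'(4) closure_jets_outside[OF \<Omega>(1) D] rep_gr[of D] rep_mulop[OF Tp, of "gr D"]
        by eventually_elim (auto simp: T_def)
    qed
    finally show ?thesis by (simp add: inner_l2_eq)
  qed
  have lin: "linear (gr :: (real^'n, real \<times> (real^'n)) l2 \<Rightarrow> _)" by (rule bounded_linear.linear[OF bounded_linear_gr])
  have FT: "F = T (gr (jet \<phi>))" by (simp only: F_def T_def)
  have Tlin: "linear T" using bounded_linear.linear[OF bounded_linear_mulop[OF Tp]] by (simp only: T_def)
  have weak: "(\<lambda>n. inner (X n) z) \<longlonglongrightarrow> inner (jet \<phi>) z" for z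
  proof (rule weak_limit_unique_subseq[OF X(2)])
    fix r Y assume r: "strict_mono r" and Y0: "Y \<in> closure (span (range X))"
      and w: "\<And>z. (\<lambda>n. inner (X (r n)) z) \<longlonglongrightarrow> inner Y z"
    have "span (range X) \<subseteq> closure (jets \<Omega>)"
      using X(1) by (intro span_minimal subspace_closure_jets) auto
    then have "closure (span (range X)) \<subseteq> closure (jets \<Omega>)" by (rule closure_minimal) simp
    with Y0 have Y: "Y \<in> closure (jets \<Omega>)" by blast
    \<comment> \<open>Against gradients the oscillating flux equals \<open>F\<close> for every
      index, while its limit is \<open>T (gr Y)\<close>; tested with the difference
      \<open>D\<close>, coercivity yields \<open>gr D = 0\<close>, and Friedrichs' inequality
      \<open>D = 0\<close>.\<close>
    have eq: "inner F (gr Z) = inner (T (gr Y)) (gr Z)" if "Z \<in> closure (jets \<Omega>)" for Z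
      using flux[OF r Y w, of "gr Z"] sol[OF that] by (simp add: LIMSEQ_const_iff)
    define D where "D = Y - jet \<phi>"
    have D: "D \<in> closure (jets \<Omega>)" unfolding D_def by (rule subspace_diff[OF subspace_closure_jets Y j\<phi>])
    have "gr D = gr Y - gr (jet \<phi>)" unfolding D_def by (rule linear_diff[OF lin])
    then have "T (gr D) = T (gr Y) - F" by (simp only: linear_diff[OF Tlin] FT)
    then have "inner (T (gr D)) (gr D) = 0" using eq[OF D] by (simp add: inner_diff_left)
    then have "\<alpha> * (norm (gr D))\<^sup>2 \<le> 0" using coer[OF D] by simp
    then have "(norm (gr D))\<^sup>2 \<le> 0" using AB(1) by (simp add: mult_le_0_iff)
    then have "(norm D)\<^sup>2 \<le> 0" using P(2)[OF D] P(1) by simp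
    then show "Y = jet \<phi>" by (simp add: D_def)
  qed
  show thesis
  proof (rule that[OF X weak])
    show "inner (mulop (\<lambda>x v. phase a1 a2 (\<omega> n) x *\<^sub>R v) (gr (X n))) (gr Y) = inner F (gr Y)" if "Y \<in> closure (jets \<Omega>)" for n Y
      using sol[OF that, of n] by (simp add: S_def p_def)
    show "test_sequence \<Omega> (\<lambda>n. two_phase a1 a2 (\<omega> n)) (\<lambda>n x. fst (rep_l2 (X n) x)) (\<lambda>x. fst (rep_l2 (jet \<phi>) x))"
      using ts[of "\<lambda>n. n", OF strict_mono_id[unfolded id_def] j\<phi> weak] by simp
    show "(\<lambda>n. inner (mulop (\<lambda>x v. phase a1 a2 (\<omega> n) x *\<^sub>R v) (gr (X n))) G) \<longlonglongrightarrow> inner F G" for G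
      using flux[of "\<lambda>n. n", OF strict_mono_id[unfolded id_def] j\<phi> weak, of G] by (simp add: S_def p_def F_def T_def)
  qed
qed

section \<open>The Caccioppoli inequality\<close>

text \<open>Multiplication by \<psi> at the level of pairs: the second component is the product
  rule.\<close>

definition times_op :: "(real^'n \<Rightarrow> real) \<Rightarrow> real^'n \<Rightarrow> real \<times> (real^'n) \<Rightarrow> real \<times> (real^'n)" where
  "times_op \<psi> x v = (\<psi> x * fst v, \<psi> x *\<^sub>R snd v + fst v *\<^sub>R grad \<psi> x)"

lemma pointwise_op_times:
  assumes \<psi>: "\<psi> \<in> test_functions \<Omega>"
  shows "pointwise_op (times_op \<psi>)"
proof -
  obtain B where B: "\<And>x. \<bar>\<psi> x\<bar> \<le> B" "\<And>x. norm (grad \<psi> x) \<le> B"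
    using test_function_grad_integrable(4)[OF \<psi>] by blast
  note [measurable] = sq_integrableD(1)[OF test_function_grad_integrable(2)[OF \<psi>]] sq_integrableD(1)[OF test_function_grad_integrable(3)[OF \<psi>]]
  show ?thesis
  proof (rule pointwise_opI[where C="3 * B"])
    show "linear (times_op \<psi> x)" for x
      by (rule linearI) (simp_all add: times_op_def algebra_simps)
    show "(\<lambda>x. times_op \<psi> x (f x)) \<in> borel_measurable lebesgue" if [measurable]: "f \<in> borel_measurable lebesgue" for f
    proof -
      have [measurable]: "(\<lambda>x. fst (f x)) \<in> borel_measurable lebesgue" "(\<lambda>x. snd (f x)) \<in> borel_measurable lebesgue"
        using pointwise_opD(2)[OF pointwise_op_fst that] pointwise_opD(2)[OF pointwise_op_snd that] by auto
      show ?thesis unfolding times_op_def by (intro borel_measurable_Pair) measurable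
    qed
    show "norm (times_op \<psi> x v) \<le> 3 * B * norm v" for x v
    proof -
      have B0: "0 \<le> B" using B(1)[of x] by linarith
      have "norm (times_op \<psi> x v) \<le> norm (\<psi> x * fst v) + norm (\<psi> x *\<^sub>R snd v + fst v *\<^sub>R grad \<psi> x)"
        unfolding times_op_def by (rule norm_Pair_le)
      also have "\<dots> \<le> \<bar>\<psi> x\<bar> * \<bar>fst v\<bar> + (\<bar>\<psi> x\<bar> * norm (snd v) + \<bar>fst v\<bar> * norm (grad \<psi> x))"
        using norm_triangle_ineq[of "\<psi> x *\<^sub>R snd v" "fst v *\<^sub>R grad \<psi> x"] by (simp add: abs_mult)
      also have "\<dots> \<le> B * norm v + (B * norm v + norm v * B)"
        using B0 norm_fst_le[of "fst v" "snd v"] norm_snd_le[of "snd v" "fst v"]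
        by (intro add_mono mult_mono B) auto
      finally show ?thesis by (simp add: algebra_simps)
    qed
  qed
qed

lemma times_closure_jets:
  assumes \<psi>: "\<psi> \<in> test_functions \<Omega>'" and X: "X \<in> closure (jets \<Omega>)"
  shows "mulop (times_op \<psi>) X \<in> closure (jets \<Omega>)"
  using X
proof (rule closure_jets_induct)
  have "closed ((mulop (times_op \<psi>)) -` closure (jets \<Omega>))"
    by (intro continuous_closed_vimage closed_closure linear_continuous_at bounded_linear_mulop pointwise_op_times[OF \<psi>])
  then show "closed {X. mulop (times_op \<psi>) X \<in> closure (jets \<Omega>)}" by (simp add: vimage_def)
  fix \<phi> assume \<phi>: "\<phi> \<in> test_functions \<Omega>"
  have "times_op \<psi> x (\<phi> x, grad \<phi> x) = (\<psi> x * \<phi> x, grad (\<lambda>x. \<psi> x * \<phi> x) x)" for x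
    by (simp add: times_op_def grad_mult test_function_smooth[OF \<phi>] test_function_smooth[OF \<psi>])
  then have "mulop (times_op \<psi>) (jet \<phi>) = jet (\<lambda>x. \<psi> x * \<phi> x)"
    unfolding jet_def mulop_abs[OF pointwise_op_times[OF \<psi>] jet_sq[OF \<phi>]] by simp
  then show "mulop (times_op \<psi>) (jet \<phi>) \<in> closure (jets \<Omega>)"
    using imageI[OF test_function_mult[OF \<phi> test_function_smooth[OF \<psi>]], of jet] closure_subset[of "jets \<Omega>"]
    by (auto simp: jets_def)
qed

text \<open>An explicit profile with explicit constants. It does not reach 1 on the inner ball; the
  lower bound 1/2 is enough and costs a factor 4 in the energy.\<close>

lemma cutoff_exists:
  fixes z :: "real^'n"
  assumes r: "0 < r" and sub: "cball z (2 * r) \<subseteq> \<Omega>"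
  obtains \<eta> where "\<eta> \<in> test_functions \<Omega>" "\<And>x. 0 \<le> \<eta> x" "\<And>x. \<eta> x \<le> 1" "\<And>x. x \<in> ball z r \<Longrightarrow> 1 / 2 \<le> \<eta> x"
    "\<And>x. x \<notin> ball z (2 * r) \<Longrightarrow> \<eta> x = 0" "\<And>x. norm (grad \<eta> x) \<le> 8 / r * indicat_real (ball z (2 * r)) x"
proof -
  \<comment> \<open>\<open>P\<close> is at least 3 on the inner ball and nonpositive outside the
    ball of radius 2 r, so \<open>\<eta>\<close> = exp(-1/P) is flat exactly where it must
    vanish.\<close>
  define P where "P x = 4 - (1 / r\<^sup>2) * (norm (x - z))\<^sup>2" for x :: "real^'n"
  have sP: "smooth P" unfolding P_def by (intro smooth_diff smooth_mult smooth_norm_sq smooth_const)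
  define \<eta> where "\<eta> x = flat_exp 1 (P x)" for x
  have s\<eta>: "smooth \<eta>" unfolding \<eta>_def by (rule smooth_flat_exp_compose[OF sP])
  have Pneg: "P x \<le> 0" if "x \<notin> ball z (2 * r)" for x
  proof -
    have "(2 * r)\<^sup>2 \<le> (norm (x - z))\<^sup>2"
      using that r by (intro power_mono) (auto simp: dist_norm norm_minus_commute)
    then show ?thesis using r by (simp add: P_def field_simps power_mult_distrib)
  qed
  have out: "\<eta> x = 0" if "x \<notin> ball z (2 * r)" for x using Pneg[OF that] by (simp add: \<eta>_def flat_exp_def)
  have gP: "grad P x = (- 2 / r\<^sup>2) *\<^sub>R (x - z)" for x
  proof -
    define c where "c = 1 / r\<^sup>2"
    have "grad P x = (- (2 * c)) *\<^sub>R (x - z)"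
    proof (rule grad_eqI)
      show "(P has_derivative (\<lambda>h. (- (2 * c)) *\<^sub>R (x - z) \<bullet> h)) (at x)"
        unfolding P_def c_def[symmetric] power2_norm_eq_inner
        by (auto intro!: derivative_eq_intros simp: inner_commute algebra_simps)
    qed
    then show ?thesis by (simp add: c_def)
  qed
  have g\<eta>: "grad \<eta> x = flat_exp [:0, 0, 1:] (P x) *\<^sub>R grad P x" for x
  proof (rule grad_eqI)
    from has_derivative_compose[OF has_derivative_grad[OF smooth_differentiable[OF sP]] flat_exp_deriv[of 1, unfolded has_field_derivative_def]]
    show "(\<eta> has_derivative (\<lambda>h. (flat_exp [:0, 0, 1:] (P x) *\<^sub>R grad P x) \<bullet> h)) (at x)"
      unfolding \<eta>_def by (simp add: pderiv_1 mult.commute)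
  qed
  \<comment> \<open>The derivative of exp(-1/t) is s^2 exp(-s) with s = 1/t, and s^2 / 2 \<le> exp
    s. Together with a gradient of \<open>P\<close> of norm at most 4 / r this gives 8 / r.\<close>
  have fe: "\<bar>flat_exp [:0, 0, 1:] t\<bar> \<le> 2" for t
  proof (cases "0 < t")
    case True
    define s where "s = inverse t"
    have "0 < s" using True by (simp add: s_def)
    then have "s\<^sup>2 \<le> 2 * exp s" using exp_lower_Taylor_quadratic[of s] by simp
    then have "s\<^sup>2 * exp (- s) \<le> 2" by (simp add: exp_minus field_simps)
    then show ?thesis using True by (simp add: flat_exp_def s_def power2_eq_square abs_mult)
  qed (simp add: flat_exp_def)
  show thesis
  proof
    show "\<eta> \<in> test_functions \<Omega>"
      by (rule test_functionI[OF s\<eta> compact_cball sub]) (use out in auto)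
    show "0 \<le> \<eta> x" "\<eta> x \<le> 1" for x by (auto simp: \<eta>_def flat_exp_def)
    show "\<eta> x = 0" if "x \<notin> ball z (2 * r)" for x by (rule out[OF that])
    show "1 / 2 \<le> \<eta> x" if "x \<in> ball z r" for x
    proof -
      have "(norm (x - z))\<^sup>2 \<le> r\<^sup>2"
        using that by (intro power_mono) (auto simp: dist_norm norm_minus_commute)
      then have P3: "3 \<le> P x" using r by (simp add: P_def field_simps)
      then have "inverse (P x) \<le> 1 / 2" by (simp add: field_simps)
      then have "1 / 2 \<le> exp (- inverse (P x))"
        using exp_ge_add_one_self[of "- inverse (P x)"] by linarith
      then show ?thesis using P3 by (simp add: \<eta>_def flat_exp_def)
    qed
    show "norm (grad \<eta> x) \<le> 8 / r * indicat_real (ball z (2 * r)) x" for x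
    proof (cases "x \<in> ball z (2 * r)")
      case True
      then have xz: "norm (x - z) \<le> 2 * r" by (simp add: dist_norm norm_minus_commute)
      have "norm (grad \<eta> x) = \<bar>flat_exp [:0, 0, 1:] (P x)\<bar> * (2 / r\<^sup>2 * norm (x - z))"
        by (simp add: g\<eta> gP abs_mult)
      also have "\<dots> \<le> 2 * (2 / r\<^sup>2 * (2 * r))"
        using r xz by (intro mult_mono fe divide_right_mono) auto
      also have "\<dots> = 8 / r" using r by (simp add: power2_eq_square)
      finally show ?thesis using True by simp
    next
      case False
      then show ?thesis using Pneg[OF False] by (simp add: g\<eta> flat_exp_def)
    qed
  qed
qed

text \<open>The integrand of the equation tested with the squared cutoff times (u - c): here
  \<open>G\<close> is the gradient of u, \<open>h\<close> the cutoff, \<open>e\<close> its gradient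
  and \<open>w\<close> = u - c.\<close>

lemma caccioppoli_pointwise:
  fixes G F e :: "'v::real_inner" and a a1 a2 h w K :: real
  assumes a: "0 < a1" "a1 \<le> a" "a \<le> a2" and h: "0 \<le> h" and F: "norm F \<le> K"
  shows "a1 / 2 * (h\<^sup>2 * (norm G)\<^sup>2) - (8 * a2\<^sup>2 / a1 + 2 / a1 + 2) * (w\<^sup>2 * (norm e)\<^sup>2 + K\<^sup>2 * h\<^sup>2)
    \<le> (a *\<^sub>R G - F) \<bullet> (h\<^sup>2 *\<^sub>R G + w *\<^sub>R ((2 * h) *\<^sub>R e))"
proof -
  define A where "A = h * norm G"
  define B where "B = \<bar>w\<bar> * norm e"
  define D where "D = K * h"
  have K: "0 \<le> K" using F norm_ge_zero order_trans by blast
  have nn: "0 \<le> A" "0 \<le> B" "0 \<le> D" using h K by (auto simp: A_def B_def D_def)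
  have e1: "(a *\<^sub>R G - F) \<bullet> (h\<^sup>2 *\<^sub>R G + w *\<^sub>R ((2 * h) *\<^sub>R e)) =
      a * (h\<^sup>2 * (norm G)\<^sup>2) + 2 * a * h * w * (G \<bullet> e) - h\<^sup>2 * (F \<bullet> G) - 2 * h * w * (F \<bullet> e)"
    by (simp add: inner_diff_left inner_add_right power2_norm_eq_inner algebra_simps)
  have t1: "\<bar>2 * a * h * w * (G \<bullet> e)\<bar> \<le> 2 * a2 * A * B"
  proof -
    have "\<bar>2 * a * h * w * (G \<bullet> e)\<bar> = 2 * a * h * \<bar>w\<bar> * \<bar>G \<bullet> e\<bar>" using a h by (simp add: abs_mult)
    also have "\<dots> \<le> 2 * a2 * h * \<bar>w\<bar> * (norm G * norm e)"
      using a h by (intro mult_mono Cauchy_Schwarz_ineq2) auto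
    finally show ?thesis by (simp add: A_def B_def mult_ac)
  qed
  have t2: "\<bar>h\<^sup>2 * (F \<bullet> G)\<bar> \<le> D * A"
  proof -
    have "\<bar>F \<bullet> G\<bar> \<le> K * norm G" using Cauchy_Schwarz_ineq2[of F G] mult_right_mono[OF F, of "norm G"] by simp
    then have "h\<^sup>2 * \<bar>F \<bullet> G\<bar> \<le> h\<^sup>2 * (K * norm G)" by (intro mult_left_mono) auto
    then show ?thesis by (simp add: abs_mult A_def D_def power2_eq_square mult_ac)
  qed
  have t3: "\<bar>2 * h * w * (F \<bullet> e)\<bar> \<le> 2 * D * B"
  proof -
    have "\<bar>F \<bullet> e\<bar> \<le> K * norm e" using Cauchy_Schwarz_ineq2[of F e] mult_right_mono[OF F, of "norm e"] by simp
    then have "2 * h * \<bar>w\<bar> * \<bar>F \<bullet> e\<bar> \<le> 2 * h * \<bar>w\<bar> * (K * norm e)" using h by (intro mult_left_mono) auto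
    then show ?thesis using h by (simp add: abs_mult B_def D_def mult_ac)
  qed
  have t0: "a1 * A\<^sup>2 \<le> a * (h\<^sup>2 * (norm G)\<^sup>2)" using a by (simp add: A_def power_mult_distrib mult_right_mono)
  \<comment> \<open>Young's inequality with weight a1 / 8, here and in \<open>y2\<close>: together
    they consume a quarter of the leading term, and half of it is what remains to be kept.\<close>
  have y1: "2 * a2 * A * B \<le> a1 / 8 * A\<^sup>2 + 8 * a2\<^sup>2 / a1 * B\<^sup>2"
  proof -
    have "0 \<le> (a1 * A - 8 * a2 * B)\<^sup>2 / (8 * a1)" using a by simp
    also have "\<dots> = a1 / 8 * A\<^sup>2 - 2 * a2 * A * B + 8 * a2\<^sup>2 / a1 * B\<^sup>2"
      using a by (simp add: power2_eq_square field_simps)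
    finally show ?thesis by simp
  qed
  have y2: "D * A \<le> a1 / 8 * A\<^sup>2 + 2 / a1 * D\<^sup>2"
  proof -
    have "0 \<le> (a1 * A - 4 * D)\<^sup>2 / (8 * a1)" using a by simp
    also have "\<dots> = a1 / 8 * A\<^sup>2 - D * A + 2 / a1 * D\<^sup>2"
      using a by (simp add: power2_eq_square field_simps)
    finally show ?thesis by simp
  qed
  have y3: "2 * D * B \<le> D\<^sup>2 + B\<^sup>2" using sum_squares_bound[of D B] by simp
  define c where "c = 8 * a2\<^sup>2 / a1 + 2 / a1 + 2"
  have cB: "(8 * a2\<^sup>2 / a1 + 1) * B\<^sup>2 \<le> c * B\<^sup>2" and cD: "(2 / a1 + 1) * D\<^sup>2 \<le> c * D\<^sup>2"
    unfolding c_def using a by (auto intro!: mult_right_mono)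
  have "a1 / 2 * A\<^sup>2 - c * (B\<^sup>2 + D\<^sup>2) \<le> a1 * A\<^sup>2 - 2 * a2 * A * B - D * A - 2 * D * B"
  proof -
    have "0 \<le> a1 / 4 * A\<^sup>2" using a by simp
    then show ?thesis using y1 y2 y3 cB cD by (simp add: algebra_simps)
  qed
  also have "\<dots> \<le> (a *\<^sub>R G - F) \<bullet> (h\<^sup>2 *\<^sub>R G + w *\<^sub>R ((2 * h) *\<^sub>R e))"
    unfolding e1 using t0 t1 t2 t3 by linarith
  finally show ?thesis unfolding c_def[symmetric] by (simp add: A_def B_def D_def power_mult_distrib)
qed

text \<open>512 = 8 * 64: the pointwise factor a1 / 2 is reduced to a1 / 8 because the cutoff is
  only at least 1/2, and 64 is the square of the constant in the gradient bound 8 / r.\<close>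

definition caccioppoli_const :: "real \<Rightarrow> real \<Rightarrow> real" where
  "caccioppoli_const a1 a2 = 512 / a1 * (8 * a2\<^sup>2 / a1 + 2 / a1 + 2)"

text \<open>Since \<open>F\<close> enters only through its pointwise bound, the constants do not see
  the solution; \<open>c\<close> stays free, to be chosen as a local average.\<close>

lemma caccioppoli:
  fixes \<Omega> :: "(real^'n) set" and X :: "(real^'n, real \<times> (real^'n)) l2"
  assumes a: "0 < a1" "a \<in> borel_measurable lebesgue" "\<And>x. a1 \<le> a x" "\<And>x. a x \<le> a2"
    and X: "X \<in> closure (jets \<Omega>)" and F: "AE x in lebesgue. norm (rep_l2 F x) \<le> K"
    and eq: "\<And>Y. Y \<in> closure (jets \<Omega>) \<Longrightarrow> inner (mulop (\<lambda>x v. a x *\<^sub>R v) (gr X)) (gr Y) = inner F (gr Y)"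
    and r: "0 < r" "cball z (2 * r) \<subseteq> \<Omega>"
  shows "(norm (restr (ball z r) (gr X)))\<^sup>2 \<le> caccioppoli_const a1 a2 *
    ((norm (restr (ball z (2 * r)) (fn X) - c *\<^sub>R ind (ball z (2 * r))))\<^sup>2 / r\<^sup>2 + K\<^sup>2 * measure lborel (ball z (2 * r)))"
proof -
  obtain \<eta> where \<eta>: "\<eta> \<in> test_functions \<Omega>" "\<And>x. 0 \<le> \<eta> x" "\<And>x. \<eta> x \<le> 1" "\<And>x. x \<in> ball z r \<Longrightarrow> 1 / 2 \<le> \<eta> x"
    "\<And>x. x \<notin> ball z (2 * r) \<Longrightarrow> \<eta> x = 0" "\<And>x. norm (grad \<eta> x) \<le> 8 / r * indicat_real (ball z (2 * r)) x"
    using cutoff_exists[OF r] by metis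
  define C1 where "C1 = 8 * a2\<^sup>2 / a1 + 2 / a1 + 2"
  have C1: "0 \<le> C1" using a(1) by (simp add: C1_def)
  let ?\<psi> = "\<lambda>x. \<eta> x * \<eta> x"
  have s\<eta>: "smooth \<eta>" by (rule test_function_smooth[OF \<eta>(1)])
  have \<psi>: "?\<psi> \<in> test_functions \<Omega>" by (rule test_function_mult[OF \<eta>(1) s\<eta>])
  have g\<psi>: "grad ?\<psi> x = (2 * \<eta> x) *\<^sub>R grad \<eta> x" for x
    using grad_mult[OF s\<eta> s\<eta>, of x] by (simp flip: scaleR_2)
  \<comment> \<open>The test element is the squared cutoff times (u - c). The constant
    \<open>c\<close> by itself is not in the closure of the jets, but its product with the cutoff
    is.\<close>
  define Y where "Y = mulop (times_op ?\<psi>) X - c *\<^sub>R jet ?\<psi>"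
  have j\<psi>: "jet ?\<psi> \<in> closure (jets \<Omega>)"
    using imageI[OF \<psi>, of jet] closure_subset[of "jets \<Omega>"] unfolding jets_def by (rule subsetD[rotated])
  have Y: "Y \<in> closure (jets \<Omega>)"
    unfolding Y_def
    by (rule subspace_diff[OF subspace_closure_jets times_closure_jets[OF \<psi> X] subspace_scale[OF subspace_closure_jets j\<psi>]])
  have rY: "AE x in lebesgue. rep_l2 (gr Y) x =
      (\<eta> x)\<^sup>2 *\<^sub>R rep_l2 (gr X) x + (rep_l2 (fn X) x - c) *\<^sub>R ((2 * \<eta> x) *\<^sub>R grad \<eta> x)"
    using rep_gr[of Y] rep_l2_diff[of "mulop (times_op ?\<psi>) X" "c *\<^sub>R jet ?\<psi>"] rep_l2_scaleR[of c "jet ?\<psi>"]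
      rep_jet[OF \<psi>] rep_mulop[OF pointwise_op_times[OF \<psi>], of X] rep_gr[of X] rep_fn[of X]
    by eventually_elim (simp add: Y_def times_op_def g\<psi> power2_eq_square algebra_simps)
  define S where "S = mulop (\<lambda>x (v::real^'n). a x *\<^sub>R v)"
  have Sp: "pointwise_op (\<lambda>x (v::real^'n). a x *\<^sub>R v)"
    by (rule scaled_energy(1)[OF a(2,3,4,1)])
  define W where "W = restr (ball z (2 * r)) (fn X) - c *\<^sub>R ind (ball z (2 * r))"
  have b: "ball z s \<in> sets lebesgue" for s by simp
  have rW: "AE x in lebesgue. rep_l2 W x = indicat_real (ball z (2 * r)) x * (rep_l2 (fn X) x - c)"
    using rep_l2_diff[of "restr (ball z (2 * r)) (fn X)" "c *\<^sub>R ind (ball z (2 * r))"] rep_l2_scaleR[of c "ind (ball z (2 * r))"]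
      rep_mulop[OF pointwise_op_restr[OF b], of "2 * r" "fn X"] rep_l2_abs[OF sq_integrable_ind[OF lmeasurable_ball], of z "2 * r"]
    by eventually_elim (simp add: W_def restr_def ind_def algebra_simps)
  have rB: "AE x in lebesgue. rep_l2 (restr (ball z r) (gr X)) x = indicat_real (ball z r) x *\<^sub>R rep_l2 (gr X) x"
    unfolding restr_def by (rule rep_mulop[OF pointwise_op_restr[OF b]])
  define L where "L x = a1 / 8 * (norm (rep_l2 (restr (ball z r) (gr X)) x))\<^sup>2 -
     C1 * (64 / r\<^sup>2 * (norm (rep_l2 W x))\<^sup>2 + K\<^sup>2 * indicat_real (ball z (2 * r)) x)" for x
  have i1: "integrable lebesgue (\<lambda>x. (norm (rep_l2 Z x))\<^sup>2)" for Z :: "(real^'n, 'b::euclidean_space) l2"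
    by (rule sq_integrableD(2)[OF rep_l2_sq])
  have i2: "integrable lebesgue (indicat_real (ball z (2 * r)))"
    using lmeasurable_ball by (simp add: lmeasurable_iff_integrable)
  have iL: "integrable lebesgue L"
    unfolding L_def by (intro Bochner_Integration.integrable_diff Bochner_Integration.integrable_add integrable_mult_right i1 i2)
  have "(LINT x|lebesgue. L x) = a1 / 8 * (norm (restr (ball z r) (gr X)))\<^sup>2 - C1 * (64 / r\<^sup>2 * (norm W)\<^sup>2 + K\<^sup>2 * measure lborel (ball z (2 * r)))"
  proof -
    have "(LINT x|lebesgue. 64 / r\<^sup>2 * (norm (rep_l2 W x))\<^sup>2 + K\<^sup>2 * indicat_real (ball z (2 * r)) x) =
        64 / r\<^sup>2 * (norm W)\<^sup>2 + K\<^sup>2 * measure lborel (ball z (2 * r))"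
      using i1[of W] i2 by (simp add: norm_l2_sq)
    moreover have "integrable lebesgue (\<lambda>x. 64 / r\<^sup>2 * (norm (rep_l2 W x))\<^sup>2 + K\<^sup>2 * indicat_real (ball z (2 * r)) x)"
      by (intro Bochner_Integration.integrable_add integrable_mult_right i1 i2)
    ultimately show ?thesis
      unfolding L_def using i1[of "restr (ball z r) (gr X)"] by (simp add: norm_l2_sq)
  qed
  moreover have "(LINT x|lebesgue. L x) \<le> (LINT x|lebesgue. rep_l2 (S (gr X) - F) x \<bullet> rep_l2 (gr Y) x)"
  proof (rule integral_mono_AE[OF iL])
    show "integrable lebesgue (\<lambda>x. rep_l2 (S (gr X) - F) x \<bullet> rep_l2 (gr Y) x)"
      by (rule integrable_inner_sq[OF rep_l2_sq rep_l2_sq])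
    show "AE x in lebesgue. L x \<le> rep_l2 (S (gr X) - F) x \<bullet> rep_l2 (gr Y) x"
      using rY rW rB F rep_l2_diff[of "S (gr X)" F] rep_mulop[OF Sp, of "gr X"]
    proof eventually_elim
      case (elim x)
      let ?G = "rep_l2 (gr X) x" and ?w = "rep_l2 (fn X) x - c" and ?e = "grad \<eta> x" and ?i = "indicat_real (ball z (2 * r)) x"
      have p: "a1 / 2 * ((\<eta> x)\<^sup>2 * (norm ?G)\<^sup>2) - C1 * (?w\<^sup>2 * (norm ?e)\<^sup>2 + K\<^sup>2 * (\<eta> x)\<^sup>2) \<le> rep_l2 (S (gr X) - F) x \<bullet> rep_l2 (gr Y) x"
        using caccioppoli_pointwise[OF a(1,3,4) \<eta>(2) elim(4), of x ?G ?w ?e] elim by (simp add: S_def C1_def)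
      have q1: "1 / 4 * (norm (indicat_real (ball z r) x *\<^sub>R ?G))\<^sup>2 \<le> (\<eta> x)\<^sup>2 * (norm ?G)\<^sup>2"
      proof (cases "x \<in> ball z r")
        case True
        have "(1 / 2)\<^sup>2 \<le> (\<eta> x)\<^sup>2" using \<eta>(4)[OF True] by (intro power_mono) auto
        then have "1 / 4 * (norm ?G)\<^sup>2 \<le> (\<eta> x)\<^sup>2 * (norm ?G)\<^sup>2"
          by (intro mult_right_mono) (auto simp: power2_eq_square)
        then show ?thesis using True by simp
      qed simp
      have q2: "?w\<^sup>2 * (norm ?e)\<^sup>2 \<le> 64 / r\<^sup>2 * (norm (?i * ?w))\<^sup>2"
      proof -
        have "(norm ?e)\<^sup>2 \<le> (8 / r * ?i)\<^sup>2" using \<eta>(6)[of x] by (intro power_mono) auto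
        then have "?w\<^sup>2 * (norm ?e)\<^sup>2 \<le> ?w\<^sup>2 * (8 / r * ?i)\<^sup>2" by (intro mult_left_mono) auto
        also have "\<dots> = 64 / r\<^sup>2 * (norm (?i * ?w))\<^sup>2"
          by (simp add: power_mult_distrib power_divide)
        finally show ?thesis .
      qed
      have q3: "K\<^sup>2 * (\<eta> x)\<^sup>2 \<le> K\<^sup>2 * ?i"
      proof (cases "x \<in> ball z (2 * r)")
        case True
        have "(\<eta> x)\<^sup>2 \<le> 1" using \<eta>(2,3)[of x] by (simp add: power_le_one)
        then show ?thesis using True by (simp add: mult_left_le)
      qed (simp add: \<eta>(5))
      have "a1 / 8 * (norm (indicat_real (ball z r) x *\<^sub>R ?G))\<^sup>2 \<le> a1 / 2 * ((\<eta> x)\<^sup>2 * (norm ?G)\<^sup>2)"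
        using mult_left_mono[OF q1, of "a1 / 2"] a(1) by simp
      moreover have "C1 * (?w\<^sup>2 * (norm ?e)\<^sup>2 + K\<^sup>2 * (\<eta> x)\<^sup>2) \<le> C1 * (64 / r\<^sup>2 * (norm (?i * ?w))\<^sup>2 + K\<^sup>2 * ?i)"
        by (intro mult_left_mono add_mono q2 q3 C1)
      ultimately have "a1 / 8 * (norm (indicat_real (ball z r) x *\<^sub>R ?G))\<^sup>2 - C1 * (64 / r\<^sup>2 * (norm (?i * ?w))\<^sup>2 + K\<^sup>2 * ?i) \<le> rep_l2 (S (gr X) - F) x \<bullet> rep_l2 (gr Y) x"
        using p by linarith
      then show ?case unfolding L_def elim(2) elim(3) .
    qed
  qed
  moreover have "(LINT x|lebesgue. rep_l2 (S (gr X) - F) x \<bullet> rep_l2 (gr Y) x) = 0"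
    using eq[OF Y] unfolding inner_l2_eq[symmetric] by (simp add: inner_diff_left S_def)
  ultimately have "a1 / 8 * (norm (restr (ball z r) (gr X)))\<^sup>2 \<le> C1 * (64 / r\<^sup>2 * (norm W)\<^sup>2 + K\<^sup>2 * measure lborel (ball z (2 * r)))"
    by linarith
  also have "\<dots> \<le> C1 * (64 * ((norm W)\<^sup>2 / r\<^sup>2 + K\<^sup>2 * measure lborel (ball z (2 * r))))"
    using C1 by (intro mult_left_mono) auto
  finally have "(norm (restr (ball z r) (gr X)))\<^sup>2 \<le> 8 / a1 * (C1 * (64 * ((norm W)\<^sup>2 / r\<^sup>2 + K\<^sup>2 * measure lborel (ball z (2 * r)))))"
    using a(1) by (simp add: field_simps)
  also have "8 / a1 * (C1 * (64 * q)) = 512 / a1 * C1 * q" for q by simp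
  finally show ?thesis unfolding caccioppoli_const_def C1_def[symmetric] W_def .
qed

lemma ball_scale:
  assumes "0 \<le> r" "0 \<le> k"
  shows "measure lborel (ball (z::real^'n) (k * r)) = k ^ CARD('n) * measure lborel (ball (z'::real^'n) r)"
  using assms by (simp add: content_ball power_mult_distrib)

text \<open>On a ball where the mean energy exceeds \<open>\<lambda>\<^sup>2\<close> but on the larger ball does not, the Caccioppoli
  inequality and the smoothing estimate with a small ratio \<open>h / r\<close> absorb the energy of the larger ball:
  only the mean of \<open>|\<nabla>u|\<close> survives on the right.\<close>

lemma reverse_hoelder_stopping:
  fixes a1 a2 :: real
  assumes a: "0 < a1"
  shows "\<exists>D \<kappa>. 0 < D \<and> 0 < \<kappa> \<and> (\<forall>(\<Omega> :: (real^'n) set) X a F K z r l.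
    a \<in> borel_measurable lebesgue \<longrightarrow> (\<forall>x. a1 \<le> a x \<and> a x \<le> a2) \<longrightarrow> X \<in> closure (jets \<Omega>) \<longrightarrow>
    (AE x in lebesgue. norm (rep_l2 F x) \<le> K) \<longrightarrow>
    (\<forall>Y\<in>closure (jets \<Omega>). inner (mulop (\<lambda>x v. a x *\<^sub>R v) (gr X)) (gr Y) = inner F (gr Y)) \<longrightarrow>
    0 < r \<longrightarrow> cball z (2 * r) \<subseteq> \<Omega> \<longrightarrow> 0 < l \<longrightarrow> \<kappa> * K\<^sup>2 \<le> l\<^sup>2 \<longrightarrow>
    l\<^sup>2 * measure lborel (ball z r) < (norm (restr (ball z r) (gr X)))\<^sup>2 \<longrightarrow>
    (norm (restr (ball z (3 * r)) (gr X)))\<^sup>2 \<le> l\<^sup>2 * measure lborel (ball z (3 * r)) \<longrightarrow>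
    l * measure lborel (ball z r) \<le> D * inner (nrm (gr X)) (ind (ball z (3 * r))))"
proof -
  define n where "n = CARD('n)"
  define C0 where "C0 = caccioppoli_const a1 a2"
  have C0: "0 < C0" unfolding C0_def caccioppoli_const_def using a by (intro mult_pos_pos add_nonneg_pos) auto
  \<comment> \<open>The ratio of averaging radius to \<open>r\<close>, so small that the energy of
    the tripled ball enters with a factor at most 1/4 after multiplication by \<open>C0\<close> and
    3^n.\<close>
  define \<epsilon> where "\<epsilon> = min 1 (sqrt (1 / (8 * C0 * 3 ^ n)))"
  have \<epsilon>: "0 < \<epsilon>" "\<epsilon> \<le> 1" using C0 by (auto simp: \<epsilon>_def)
  have \<epsilon>2: "2 * C0 * \<epsilon>\<^sup>2 * 3 ^ n \<le> 1 / 4"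
  proof -
    have "\<epsilon>\<^sup>2 \<le> (sqrt (1 / (8 * C0 * 3 ^ n)))\<^sup>2" using \<epsilon> by (intro power_mono) (auto simp: \<epsilon>_def)
    also have "\<dots> = 1 / (8 * C0 * 3 ^ n)" using C0 by simp
    finally have "2 * C0 * 3 ^ n * \<epsilon>\<^sup>2 \<le> 2 * C0 * 3 ^ n * (1 / (8 * C0 * 3 ^ n))" using C0 by (intro mult_left_mono) auto
    also have "\<dots> = 1 / 4" using C0 by simp
    finally show ?thesis by (simp add: mult_ac)
  qed
  \<comment> \<open>The coefficient 8 / V^2 of the smoothing estimate, with the averaging ball of
    volume \<epsilon>^n B and the doubled ball of volume 2^n B.\<close>
  define De where "De = 8 * 2 ^ n / (\<epsilon> ^ n)\<^sup>2"
  have De: "0 < De" using \<epsilon> by (simp add: De_def)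
  define D where "D = sqrt (2 * C0 * De)"
  \<comment> \<open>With this \<open>\<kappa>\<close> the contribution of \<open>F\<close> is at
    most l^2 B / 4. With another quarter from the tripled ball, half of l^2 B is absorbed, whence
    the 2 under the root in \<open>D\<close>.\<close>
  define \<kappa> where "\<kappa> = 4 * C0 * 2 ^ n"
  have D: "0 < D" "0 < \<kappa>" using C0 De by (auto simp: D_def \<kappa>_def)
  have "l * measure lborel (ball z r) \<le> D * inner (nrm (gr X)) (ind (ball z (3 * r)))"
    if am: "a \<in> borel_measurable lebesgue" and ab: "\<forall>x. a1 \<le> a x \<and> a x \<le> a2" and X: "X \<in> closure (jets \<Omega>)"
      and F: "AE x in lebesgue. norm (rep_l2 F x) \<le> K"
      and eq: "\<forall>Y\<in>closure (jets \<Omega>). inner (mulop (\<lambda>x v. a x *\<^sub>R v) (gr X)) (gr Y) = inner F (gr Y)"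
      and r: "0 < r" "cball z (2 * r) \<subseteq> \<Omega>" and l: "0 < l" "\<kappa> * K\<^sup>2 \<le> l\<^sup>2"
      and big: "l\<^sup>2 * measure lborel (ball z r) < (norm (restr (ball z r) (gr X)))\<^sup>2"
      and small: "(norm (restr (ball z (3 * r)) (gr X)))\<^sup>2 \<le> l\<^sup>2 * measure lborel (ball z (3 * r))"
    for \<Omega> :: "(real^'n) set" and X a F K z r l
  proof -
    define B where "B = measure lborel (ball z r)"
    define I where "I = inner (nrm (gr X)) (ind (ball z (3 * r)))"
    have B: "0 < B" unfolding B_def by (rule measure_ball_pos[OF r(1)])
    have m2: "measure lborel (ball z (2 * r)) = 2 ^ n * B" and m3: "measure lborel (ball z (3 * r)) = 3 ^ n * B"
      and mh: "measure lborel (ball (0::real^'n) (\<epsilon> * r)) = \<epsilon> ^ n * B"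
      unfolding B_def n_def using r \<epsilon> by (auto intro!: ball_scale)
    have I: "0 \<le> I"
      unfolding I_def nrm_def ind_def inner_abs_l2[OF nrm_sq sq_integrable_ind[OF lmeasurable_ball]]
      by (intro Bochner_Integration.integral_nonneg) simp
    \<comment> \<open>The free constant is the average over the small ball, as the smoothing
      estimate prescribes.\<close>
    define c where "c = inner (fn X) (ind (ball z (\<epsilon> * r))) / measure lborel (ball (0::real^'n) (\<epsilon> * r))"
    define W where "W = (norm (restr (ball z (2 * r)) (fn X) - c *\<^sub>R ind (ball z (2 * r))))\<^sup>2"
    define G3 where "G3 = (norm (restr (ball z (3 * r)) (gr X)))\<^sup>2"
    have er: "0 < \<epsilon> * r" "\<epsilon> * r \<le> r" using \<epsilon> r by (auto simp: mult_left_le_one_le)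
    have sm: "W \<le> 2 * (\<epsilon> * r)\<^sup>2 * G3 + 8 * r\<^sup>2 / (\<epsilon> ^ n * B)\<^sup>2 * (2 ^ n * B) * I\<^sup>2"
      using smoothing[OF X er, of z] unfolding c_def[symmetric] unfolding W_def[symmetric] G3_def[symmetric] I_def[symmetric] mh m2 .
    have "W / r\<^sup>2 \<le> (2 * (\<epsilon> * r)\<^sup>2 * G3 + 8 * r\<^sup>2 / (\<epsilon> ^ n * B)\<^sup>2 * (2 ^ n * B) * I\<^sup>2) / r\<^sup>2"
      using sm by (rule divide_right_mono) simp
    also have "\<dots> = 2 * \<epsilon>\<^sup>2 * G3 + De * I\<^sup>2 / B"
      unfolding De_def using r B \<epsilon> by (simp add: power2_eq_square field_simps)
    also have "\<dots> \<le> 2 * \<epsilon>\<^sup>2 * (l\<^sup>2 * (3 ^ n * B)) + De * I\<^sup>2 / B"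
      using small unfolding G3_def[symmetric] m3 by (intro add_right_mono mult_left_mono) auto
    finally have W: "W / r\<^sup>2 \<le> 2 * \<epsilon>\<^sup>2 * (l\<^sup>2 * (3 ^ n * B)) + De * I\<^sup>2 / B" .
    have "l\<^sup>2 * B < C0 * (W / r\<^sup>2 + K\<^sup>2 * (2 ^ n * B))"
      using big caccioppoli[OF a am _ _ X F _ r, of a2 c] ab eq
      unfolding C0_def[symmetric] W_def[symmetric] m2 B_def[symmetric] by auto
    also have "\<dots> \<le> C0 * (2 * \<epsilon>\<^sup>2 * (l\<^sup>2 * (3 ^ n * B)) + De * I\<^sup>2 / B + K\<^sup>2 * (2 ^ n * B))"
      using W C0 by (intro mult_left_mono add_right_mono) auto
    also have "\<dots> = (2 * C0 * \<epsilon>\<^sup>2 * 3 ^ n) * (l\<^sup>2 * B) + C0 * De * I\<^sup>2 / B + (\<kappa> * K\<^sup>2) * B / 4"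
      unfolding \<kappa>_def by (simp add: algebra_simps)
    also have "\<dots> \<le> 1 / 4 * (l\<^sup>2 * B) + C0 * De * I\<^sup>2 / B + l\<^sup>2 * B / 4"
      using \<epsilon>2 l B De C0 by (intro add_mono mult_right_mono divide_right_mono) auto
    finally have "l\<^sup>2 * B < 2 * (C0 * De * I\<^sup>2 / B)" by linarith
    then have "(l * B)\<^sup>2 < 2 * C0 * De * I\<^sup>2"
      using B by (simp add: power2_eq_square field_simps)
    also have "\<dots> = (D * I)\<^sup>2" using C0 De by (simp add: D_def power_mult_distrib)
    finally have "l * B \<le> D * I" by (rule power2_le_imp_le[OF less_imp_le]) (use D I in simp)
    then show ?thesis by (simp add: B_def I_def)
  qed
  note * = this
  show ?thesis
  proof (rule exI[of _ D], rule exI[of _ \<kappa>], intro conjI D allI impI)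
    fix \<Omega> :: "(real^'n) set" and X a F K z r l
    assume h: "a \<in> borel_measurable lebesgue" "\<forall>x. a1 \<le> a x \<and> a x \<le> a2" "X \<in> closure (jets \<Omega>)"
      "AE x in lebesgue. norm (rep_l2 F x) \<le> K"
      "\<forall>Y\<in>closure (jets \<Omega>). inner (mulop (\<lambda>x v. a x *\<^sub>R v) (gr X)) (gr Y) = inner F (gr Y)"
      "0 < r" "cball z (2 * r) \<subseteq> \<Omega>" "0 < l" "\<kappa> * K\<^sup>2 \<le> l\<^sup>2"
      "l\<^sup>2 * measure lborel (ball z r) < (norm (restr (ball z r) (gr X)))\<^sup>2"
      "(norm (restr (ball z (3 * r)) (gr X)))\<^sup>2 \<le> l\<^sup>2 * measure lborel (ball z (3 * r))"
    show "l * measure lborel (ball z r) \<le> D * inner (nrm (gr X)) (ind (ball z (3 * r)))"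
      by (rule *[where \<Omega>=\<Omega> and X=X and a=a and F=F and K=K and z=z and r=r and l=l]) (fact h)+
  qed
qed

section \<open>Higher integrability from a stopping argument\<close>

text \<open>Countable subadditivity as an integral over the counting measure: constants can be
  pulled out and the same integral recombines disjoint families, without enumerating
  \<open>C\<close>.\<close>

lemma emeasure_UN_le_count:
  assumes "countable C" "\<And>i. i \<in> C \<Longrightarrow> X i \<in> sets M"
  shows "emeasure M (\<Union>i\<in>C. X i) \<le> (\<integral>\<^sup>+i. emeasure M (X i) \<partial>count_space C)"
proof -
  have U: "(\<Union>i\<in>C. X i) \<in> sets M" using assms by (intro sets.countable_UN'') auto
  have "emeasure M (\<Union>i\<in>C. X i) = (\<integral>\<^sup>+x. indicator (\<Union>i\<in>C. X i) x \<partial>M)"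
    by (rule nn_integral_indicator[OF U, symmetric])
  also have "\<dots> \<le> (\<integral>\<^sup>+x. \<integral>\<^sup>+i. indicator (X i) x \<partial>count_space C \<partial>M)"
  proof (rule nn_integral_mono)
    fix x
    show "indicator (\<Union>i\<in>C. X i) x \<le> (\<integral>\<^sup>+i. indicator (X i) x \<partial>count_space C :: ennreal)"
    proof (cases "x \<in> (\<Union>i\<in>C. X i)")
      case True
      then obtain i where i: "i \<in> C" "x \<in> X i" by blast
      have "(1::ennreal) = (\<integral>\<^sup>+j. indicator {i} j \<partial>count_space C)" using i by simp
      also have "\<dots> \<le> (\<integral>\<^sup>+j. indicator (X j) x \<partial>count_space C)"
        using i by (intro nn_integral_mono) (auto simp: indicator_def)
      finally show ?thesis using True by simp
    qed simp
  qed
  also have "\<dots> = (\<integral>\<^sup>+i. \<integral>\<^sup>+x. indicator (X i) x \<partial>M \<partial>count_space C)"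
    using assms by (intro nn_integral_count_space_nn_integral) auto
  also have "\<dots> = (\<integral>\<^sup>+i. emeasure M (X i) \<partial>count_space C)"
    using assms by (intro nn_integral_cong) auto
  finally show ?thesis .
qed

lemma emeasure_ball_eq: "emeasure lebesgue (ball (x::'a::euclidean_space) r) = ennreal (measure lebesgue (ball x r))"
  using emeasure_lborel_ball_finite[of x r] by (intro emeasure_eq_ennreal_measure) (auto simp: less_top)

text \<open>A weak form of the differentiation theorem: where all means of \<open>g\<^sup>2\<close> are at most \<open>\<lambda>\<^sup>2\<close>,
  the Vitali covering theorem gives \<open>\<integral> g\<^sup>2 \<le> \<lambda>\<^sup>2 |N|\<close>.\<close>

lemma AE_exceeds_some_average:
  fixes g :: "'a::euclidean_space \<Rightarrow> real"
  assumes g: "sq_integrable lebesgue g" and l: "0 < l"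
  defines "\<mu> \<equiv> density lebesgue (\<lambda>x. ennreal ((g x)\<^sup>2))"
  shows "AE x in lebesgue. l < g x \<longrightarrow> (\<exists>r>0. ennreal (l\<^sup>2 * measure lebesgue (ball x r)) < emeasure \<mu> (ball x r))"
proof -
  have [measurable]: "g \<in> borel_measurable lebesgue" using g by auto
  have sets_\<mu> [simp]: "sets \<mu> = sets lebesgue" by (simp add: \<mu>_def)
  define Q where "Q = {x. \<exists>r>0. ennreal (l\<^sup>2 * measure lebesgue (ball x r)) < emeasure \<mu> (ball x r)}"
  \<comment> \<open>A strict inequality survives a slight enlargement of the radius, and the
    enlarged balls about nearby centres contain the original one. Openness makes \<open>Q\<close>
    measurable.\<close>
  have "open Q"
    unfolding open_contains_ball
  proof
    fix x assume "x \<in> Q"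
    then obtain r where r: "0 < r" "ennreal (l\<^sup>2 * measure lebesgue (ball x r)) < emeasure \<mu> (ball x r)" by (auto simp: Q_def)
    let ?v = "unit_ball_vol (real DIM('a))"
    have m: "measure lebesgue (ball y s) = ?v * s ^ DIM('a)" if "0 \<le> s" for y :: 'a and s using that by (simp add: content_ball)
    have "((\<lambda>s. ennreal (l\<^sup>2 * (?v * (r + s) ^ DIM('a)))) \<longlongrightarrow> ennreal (l\<^sup>2 * (?v * (r + 0) ^ DIM('a)))) (at_right 0)"
      by (intro tendsto_intros)
    then have "\<forall>\<^sub>F s in at_right 0. ennreal (l\<^sup>2 * (?v * (r + s) ^ DIM('a))) < emeasure \<mu> (ball x r)"
      using r m[of r x] by (intro order_tendstoD(2)) simp_all
    then obtain d where d: "0 < d" "\<And>s. 0 < s \<Longrightarrow> s < d \<Longrightarrow> ennreal (l\<^sup>2 * (?v * (r + s) ^ DIM('a))) < emeasure \<mu> (ball x r)"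
      unfolding eventually_at_right_field by auto
    have "ball x (d / 2) \<subseteq> Q"
    proof
      fix y assume y: "y \<in> ball x (d / 2)"
      have sub: "ball x r \<subseteq> ball y (r + d / 2)"
      proof
        fix w assume "w \<in> ball x r"
        then show "w \<in> ball y (r + d / 2)" using y dist_triangle[of y w x] by (simp add: dist_commute)
      qed
      have "ennreal (l\<^sup>2 * measure lebesgue (ball y (r + d / 2))) < emeasure \<mu> (ball x r)"
        using d(2)[of "d / 2"] d(1) r(1) m[of "r + d / 2" y] by simp
      also have "\<dots> \<le> emeasure \<mu> (ball y (r + d / 2))" by (rule emeasure_mono[OF sub]) simp
      finally show "y \<in> Q" unfolding Q_def using r(1) d(1) by (auto intro!: exI[of _ "r + d / 2"])
    qed
    then show "\<exists>e>0. ball x e \<subseteq> Q" using d(1) by (intro exI[of _ "d / 2"]) auto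
  qed
  then have [measurable]: "Q \<in> sets lebesgue" by auto
  \<comment> \<open>The exceptional set, cut into bounded pieces so that its measure is finite; each
    piece is shown to be null.\<close>
  define N where "N k = {x. l < g x} \<inter> (- Q) \<inter> ball 0 (real k)" for k
  have meas: "{x. l < g x} \<in> sets lebesgue"
    using measurable_sets[of g lebesgue borel "{l<..}"] by (simp add: vimage_def)
  have Ns: "N k \<in> sets lebesgue" for k unfolding N_def using meas \<open>open Q\<close> by (intro sets.Int) auto
  have Nl: "N k \<in> lmeasurable" for k
    by (rule bounded_set_imp_lmeasurable[OF _ Ns]) (auto simp: N_def intro: bounded_subset[OF bounded_ball])
  have null: "AE x in lebesgue. x \<notin> N k" for k
  proof -
    \<comment> \<open>Disjoint small balls with centres in \<open>N k\<close>, inside an open set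
      only slightly larger, cover \<open>N k\<close> up to a null set. Their centres avoid
      \<open>Q\<close>, so each ball has mean at most l^2.\<close>
    have le: "emeasure \<mu> (N k) \<le> ennreal (l\<^sup>2 * (measure lebesgue (N k) + e))" if e: "0 < e" for e
    proof -
      obtain U where U0: "open U" "N k \<subseteq> U" "U - N k \<in> lmeasurable" "emeasure lebesgue (U - N k) < ennreal e"
        by (rule sets_lebesgue_outer_open[OF Ns[of k] e]) (rule that)
      have Ueq: "U = N k \<union> (U - N k)" using U0(2) by blast
      have U3: "U \<in> lmeasurable" by (subst Ueq) (rule fmeasurable.Un[OF Nl U0(3)])
      have "measure lebesgue U \<le> measure lebesgue (N k) + measure lebesgue (U - N k)"
        using measure_Un_le[OF Ns[of k] fmeasurableD[OF U0(3)]] unfolding Ueq[symmetric] .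
      moreover have "measure lebesgue (U - N k) < e"
        using U0(4) U0(3) e by (simp add: emeasure_eq_measure2 ennreal_less_iff)
      ultimately have U4: "measure lebesgue U < measure lebesgue (N k) + e" by simp
      note U = U0(1,2) U3 U4
      define K where "K = {(x, r). x \<in> N k \<and> 0 < r \<and> ball x r \<subseteq> U}"
      have fine: "\<exists>i. i \<in> K \<and> x \<in> ball (fst i) (snd i) \<and> snd i < d" if x: "x \<in> N k" "0 < d" for x d
      proof -
        have "x \<in> U" using U(2) x(1) by blast
        then obtain s where s: "0 < s" "ball x s \<subseteq> U" using U(1) unfolding open_contains_ball by blast
        have "ball x (min s (d / 2)) \<subseteq> U" using s(2) by auto
        then have "(x, min s (d / 2)) \<in> K" using x s(1) by (simp add: K_def)
        then show ?thesis using x(2) s(1) by (intro exI[of _ "(x, min s (d / 2))"]) simp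
      qed
      obtain C where C: "countable C" "C \<subseteq> K"
        "pairwise (\<lambda>i j. disjnt (ball (fst i) (snd i)) (ball (fst j) (snd j))) C"
        "negligible (N k - (\<Union>i\<in>C. ball (fst i) (snd i)))"
        by (rule Vitali_covering_theorem_balls[of "N k" K fst snd, OF fine]) (assumption, assumption, rule that)
      let ?V = "\<Union>i\<in>C. ball (fst i) (snd i)"
      have Vs: "?V \<in> sets lebesgue" by (intro sets.countable_UN'' C(1)) auto
      have "AE x in lebesgue. x \<notin> N k - ?V" using C(4) unfolding negligible_iff_null_sets by (rule AE_not_in)
      then have "AE x in \<mu>. x \<in> N k \<longrightarrow> x \<in> ?V"
        unfolding \<mu>_def by (subst AE_density) (auto elim!: eventually_mono)
      then have "emeasure \<mu> (N k) \<le> emeasure \<mu> ?V" by (rule emeasure_mono_AE) (use Vs in simp)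
      also have "\<dots> \<le> (\<integral>\<^sup>+i. emeasure \<mu> (ball (fst i) (snd i)) \<partial>count_space C)"
        by (rule emeasure_UN_le_count[OF C(1)]) simp
      also have "\<dots> \<le> (\<integral>\<^sup>+i. ennreal (l\<^sup>2) * emeasure lebesgue (ball (fst i) (snd i)) \<partial>count_space C)"
      proof (rule nn_integral_mono)
        fix i assume "i \<in> space (count_space C)"
        then have "i \<in> K" using C(2) by auto
        then have "fst i \<notin> Q" "0 < snd i" by (auto simp: K_def N_def)
        then have "\<not> ennreal (l\<^sup>2 * measure lebesgue (ball (fst i) (snd i))) < emeasure \<mu> (ball (fst i) (snd i))"
          unfolding Q_def by blast
        then have "emeasure \<mu> (ball (fst i) (snd i)) \<le> ennreal (l\<^sup>2 * measure lebesgue (ball (fst i) (snd i)))"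
          by (simp only: not_less)
        then show "emeasure \<mu> (ball (fst i) (snd i)) \<le> ennreal (l\<^sup>2) * emeasure lebesgue (ball (fst i) (snd i))"
          by (simp only: emeasure_ball_eq ennreal_mult[OF zero_le_power2 measure_nonneg])
      qed
      also have "\<dots> = ennreal (l\<^sup>2) * (\<integral>\<^sup>+i. emeasure lebesgue (ball (fst i) (snd i)) \<partial>count_space C)"
        by (rule nn_integral_cmult) simp
      also have "(\<integral>\<^sup>+i. emeasure lebesgue (ball (fst i) (snd i)) \<partial>count_space C) = emeasure lebesgue ?V"
        using C(3) by (intro emeasure_UN_countable[symmetric] C(1)) (auto simp: disjoint_family_on_def pairwise_def disjnt_def)
      also have "emeasure lebesgue ?V \<le> emeasure lebesgue U"
      proof (rule emeasure_mono)
        show "?V \<subseteq> U"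
        proof (rule UN_least)
          fix i assume "i \<in> C"
          then have "i \<in> K" using C(2) by blast
          then show "ball (fst i) (snd i) \<subseteq> U" by (cases i) (simp add: K_def)
        qed
      qed (use U(3) in auto)
      also have "\<dots> = ennreal (measure lebesgue U)"
        using U(3) by (simp add: emeasure_eq_measure2 fmeasurableD2 emeasure_eq_ennreal_measure)
      also have "ennreal (l\<^sup>2) * ennreal (measure lebesgue U) = ennreal (l\<^sup>2 * measure lebesgue U)"
        by (simp add: ennreal_mult)
      also have "\<dots> \<le> ennreal (l\<^sup>2 * (measure lebesgue (N k) + e))"
        using U(4) by (intro ennreal_leI mult_left_mono) auto
      finally show ?thesis by (simp add: mult_left_mono)
    qed
    have i1: "integrable lebesgue (\<lambda>x. indicat_real (N k) x * (g x)\<^sup>2)"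
      by (rule Bochner_Integration.integrable_bound[OF sq_integrableD(2)[OF g]])
         (use Ns in \<open>auto simp: indicator_def\<close>)
    have i2: "integrable lebesgue (indicat_real (N k))" using Nl by (simp add: lmeasurable_iff_integrable)
    define J where "J = (LINT x|lebesgue. indicat_real (N k) x * (g x)\<^sup>2)"
    have J: "emeasure \<mu> (N k) = ennreal J"
    proof -
      have "emeasure \<mu> (N k) = (\<integral>\<^sup>+x. ennreal ((g x)\<^sup>2) * indicator (N k) x \<partial>lebesgue)"
        unfolding \<mu>_def using Ns by (intro emeasure_density) auto
      also have "\<dots> = (\<integral>\<^sup>+x. ennreal (indicat_real (N k) x * (g x)\<^sup>2) \<partial>lebesgue)"
        by (intro nn_integral_cong) (simp add: indicator_def)
      also have "\<dots> = ennreal J" unfolding J_def by (rule nn_integral_eq_integral[OF i1]) simp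
      finally show ?thesis .
    qed
    have Je: "J \<le> l\<^sup>2 * measure lebesgue (N k) + l\<^sup>2 * e" if "0 < e" for e
      using le[OF that] that unfolding J by (subst (asm) ennreal_le_iff) (auto simp: distrib_left)
    have "J \<le> l\<^sup>2 * measure lebesgue (N k)"
    proof (rule field_le_epsilon)
      fix e :: real assume "0 < e"
      then show "J \<le> l\<^sup>2 * measure lebesgue (N k) + e"
        using Je[of "e / l\<^sup>2"] l by simp
    qed
    \<comment> \<open>On \<open>N k\<close> the integrand g^2 - l^2 is positive, yet its integral is
      not; hence it vanishes almost everywhere, leaving \<open>N k\<close> null.\<close>
    then have "(LINT x|lebesgue. indicat_real (N k) x * (g x)\<^sup>2 - l\<^sup>2 * indicat_real (N k) x) \<le> 0"
      using i1 i2 Nl by (simp add: J_def)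
    moreover have nn: "0 \<le> indicat_real (N k) x * (g x)\<^sup>2 - l\<^sup>2 * indicat_real (N k) x" for x
      using l power_mono[of l "g x" 2] by (auto simp: indicator_def N_def)
    ultimately have "(LINT x|lebesgue. indicat_real (N k) x * (g x)\<^sup>2 - l\<^sup>2 * indicat_real (N k) x) = 0"
      by (intro antisym Bochner_Integration.integral_nonneg) auto
    then have "AE x in lebesgue. indicat_real (N k) x * (g x)\<^sup>2 - l\<^sup>2 * indicat_real (N k) x = 0"
      using nn i1 i2 by (subst (asm) integral_nonneg_eq_0_iff_AE) auto
    then show ?thesis
    proof eventually_elim
      case (elim x)
      show ?case
      proof
        assume "x \<in> N k"
        then have "l\<^sup>2 < (g x)\<^sup>2" using l by (intro power_strict_mono) (auto simp: N_def)
        then show False using elim \<open>x \<in> N k\<close> by simp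
      qed
    qed
  qed
  have "AE x in lebesgue. \<forall>k. x \<notin> N k" using null by (simp add: AE_all_countable)
  then show ?thesis
  proof eventually_elim
    case (elim x)
    obtain k where "norm x < real k" using reals_Archimedean2 by blast
    then have "x \<in> ball 0 (real k)" by simp
    then show ?case using elim[rule_format, of k] by (auto simp: N_def Q_def)
  qed
qed

text \<open>A Calderon-Zygmund stopping argument with balls. Around almost every point of
  \<open>S\<close> with g > l there is a ball at which the mean of g^2 has just exceeded l^2;
  \<open>H\<close> compares it with the first power of \<open>g\<close>, and Vitali's covering lemma
  sums over disjoint balls.\<close>

lemma stopping_level:
  fixes g :: "'a::euclidean_space \<Rightarrow> real"
  assumes g: "sq_integrable lebesgue g" "\<And>x. 0 \<le> g x" and S: "S \<in> sets lebesgue" and D: "0 < D" and R0: "0 < R0"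
    and E: "emeasure (density lebesgue (\<lambda>x. ennreal ((g x)\<^sup>2))) UNIV \<le> ennreal (l\<^sup>2 * measure lebesgue (ball (0::'a) R0))"
    and l: "0 < l"
    and H: "\<And>z r. z \<in> S \<Longrightarrow> 0 < r \<Longrightarrow> r < R0 \<Longrightarrow>
        ennreal (l\<^sup>2 * measure lebesgue (ball z r)) < emeasure (density lebesgue (\<lambda>x. ennreal ((g x)\<^sup>2))) (ball z r) \<Longrightarrow>
        emeasure (density lebesgue (\<lambda>x. ennreal ((g x)\<^sup>2))) (ball z (3 * r)) \<le> ennreal (l\<^sup>2 * measure lebesgue (ball z (3 * r))) \<Longrightarrow>
        ennreal (l * measure lebesgue (ball z r)) \<le> ennreal D * emeasure (density lebesgue (\<lambda>x. ennreal (g x))) (ball z (3 * r))"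
  shows "emeasure (density lebesgue (\<lambda>x. ennreal ((g x)\<^sup>2))) (S \<inter> {x. l < g x}) \<le>
    ennreal (2 * 15 ^ DIM('a) * D * l) * emeasure (density lebesgue (\<lambda>x. ennreal (g x))) {x. l / (2 * D * 3 ^ DIM('a)) < g x}"
proof -
  define n where "n = DIM('a)"
  define \<mu> where "\<mu> = density lebesgue (\<lambda>x. ennreal ((g x)\<^sup>2))"
  define \<nu> where "\<nu> = density lebesgue (\<lambda>x. ennreal (g x))"
  define v where "v = measure lebesgue (ball (0::'a) 1)"
  have [measurable]: "g \<in> borel_measurable lebesgue" using g by auto
  have sets [simp]: "sets \<mu> = sets lebesgue" "sets \<nu> = sets lebesgue" by (auto simp: \<mu>_def \<nu>_def)
  have v: "0 < v" unfolding v_def using content_ball_pos[of 1 "0::'a"] by simp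
  have m: "measure lebesgue (ball z r) = v * r ^ n" if "0 \<le> r" for z :: 'a and r
    using that unfolding v_def n_def by (simp add: content_ball)
  define Rad where "Rad z = {r. 0 < r \<and> ennreal (l\<^sup>2 * measure lebesgue (ball z r)) < emeasure \<mu> (ball z r)}" for z
  \<comment> \<open>By \<open>E\<close> even the total energy is at most l^2 times the volume of a
    ball of radius \<open>R0\<close>, so no ball at least that large can exceed the mean
    l^2.\<close>
  have Rad_lt: "r < R0" if "r \<in> Rad z" for r z
  proof (rule ccontr)
    assume "\<not> r < R0"
    then have r: "R0 \<le> r" by simp
    have "ennreal (l\<^sup>2 * (v * r ^ n)) < emeasure \<mu> (ball z r)" using that m[of r z] by (auto simp: Rad_def)
    also have "\<dots> \<le> emeasure \<mu> UNIV" by (rule emeasure_mono) auto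
    also have "\<dots> \<le> ennreal (l\<^sup>2 * (v * R0 ^ n))" using E m[of R0 0] R0 by (simp add: \<mu>_def)
    also have "\<dots> \<le> ennreal (l\<^sup>2 * (v * r ^ n))"
      using r R0 v by (intro ennreal_leI mult_left_mono power_mono) auto
    finally show False by simp
  qed
  define M where "M = {z\<in>S. Rad z \<noteq> {}}"
  \<comment> \<open>A radius above half the supremum: it is still exceptional, while every radius
    from its double onwards is not. The multiples 3 and 15 used below are therefore safe, and no
    maximal radius has to be attained.\<close>
  have ch: "\<exists>r. r \<in> Rad z \<and> (\<forall>s\<ge>2 * r. s \<notin> Rad z)" if "z \<in> M" for z
  proof -
    have ne: "Rad z \<noteq> {}" using that by (simp add: M_def)
    have bd: "bdd_above (Rad z)" using Rad_lt by (intro bdd_aboveI[of _ R0]) (auto intro: less_imp_le)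
    define s where "s = Sup (Rad z)"
    obtain r0 where r0: "r0 \<in> Rad z" using ne by blast
    then have "0 < s" using cSup_upper[OF r0 bd] by (auto simp: Rad_def s_def)
    then have "s / 2 < Sup (Rad z)" by (simp add: s_def)
    then obtain r where r: "r \<in> Rad z" "s / 2 < r" using less_cSup_iff[OF ne bd] by blast
    have "t \<notin> Rad z" if "t \<ge> 2 * r" for t
      using cSup_upper[OF _ bd, of t] r that by (auto simp: s_def)
    then show ?thesis using r by blast
  qed
  then have "\<forall>z\<in>M. \<exists>r. r \<in> Rad z \<and> (\<forall>s\<ge>2 * r. s \<notin> Rad z)" by (rule ballI)
  from bchoice[OF this] obtain \<rho> where \<rho>': "\<forall>z\<in>M. \<rho> z \<in> Rad z \<and> (\<forall>s\<ge>2 * \<rho> z. s \<notin> Rad z)" ..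
  have \<rho>: "\<rho> z \<in> Rad z" "2 * \<rho> z \<le> s \<Longrightarrow> s \<notin> Rad z" if "z \<in> M" for z s
    using bspec[OF \<rho>' that] by simp_all
  have \<rho>0: "0 < \<rho> z" "\<rho> z < R0" if "z \<in> M" for z using \<rho>(1)[OF that] Rad_lt[of "\<rho> z" z] by (auto simp: Rad_def)
  have big: "emeasure \<mu> (ball z s) \<le> ennreal (l\<^sup>2 * measure lebesgue (ball z s))" if "z \<in> M" "2 * \<rho> z \<le> s" for z s
    using \<rho>(2)[OF that] \<rho>0(1)[OF that(1)] that(2) by (auto simp: Rad_def not_less)
  \<comment> \<open>The balls made disjoint are the tripled ones, because the right-hand side of
    \<open>H\<close> lives there; the factor 5 of the covering lemma then gives radius 15
    \<rho>.\<close>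
  obtain C where C: "countable C" "C \<subseteq> M" "pairwise (\<lambda>i j. disjnt (ball i (3 * \<rho> i)) (ball j (3 * \<rho> j))) C"
    "M \<subseteq> (\<Union>i\<in>C. ball i (5 * (3 * \<rho> i)))"
  proof (rule Vitali_covering_lemma_balls[where S=M and K=M and a="\<lambda>i. i" and r="\<lambda>i. 3 * \<rho> i" and B="3 * R0"])
    show "M \<subseteq> (\<Union>i\<in>M. ball i (3 * \<rho> i))" using \<rho>0 by force
    show "0 < 3 * \<rho> i \<and> 3 * \<rho> i \<le> 3 * R0" if "i \<in> M" for i using \<rho>0[OF that] by simp
  qed (rule that)
  \<comment> \<open>Below height \<open>c\<close> the function contributes at most c times the
    volume of the tripled ball; multiplied by \<open>D\<close> this is half of the left-hand side of
    \<open>H\<close>, hence absorbed.\<close>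
  define c where "c = l / (2 * D * 3 ^ n)"
  define L where "L = {x. c < g x}"
  have Ls: "L \<in> sets lebesgue"
    unfolding L_def using measurable_sets[of g lebesgue borel "{c<..}"] by (simp add: vimage_def)
  have single: "emeasure \<mu> (ball z (15 * \<rho> z)) \<le> ennreal (2 * 15 ^ n * D * l) * emeasure \<nu> (ball z (3 * \<rho> z) \<inter> L)"
    if z: "z \<in> M" for z
  proof -
    let ?r = "\<rho> z"
    note r = \<rho>0[OF z]
    have zS: "z \<in> S" using z by (simp add: M_def)
    have 1: "ennreal (l * measure lebesgue (ball z ?r)) \<le> ennreal D * emeasure \<nu> (ball z (3 * ?r))"
      unfolding \<nu>_def
    proof (rule H[OF zS r])
      show "ennreal (l\<^sup>2 * measure lebesgue (ball z ?r)) < emeasure (density lebesgue (\<lambda>x. ennreal ((g x)\<^sup>2))) (ball z ?r)"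
        using \<rho>(1)[OF z] by (simp add: Rad_def \<mu>_def)
      show "emeasure (density lebesgue (\<lambda>x. ennreal ((g x)\<^sup>2))) (ball z (3 * ?r)) \<le> ennreal (l\<^sup>2 * measure lebesgue (ball z (3 * ?r)))"
        using big[OF z, of "3 * ?r"] r by (simp add: \<mu>_def)
    qed
    have "emeasure \<nu> (ball z (3 * ?r)) = emeasure \<nu> (ball z (3 * ?r) \<inter> L) + emeasure \<nu> (ball z (3 * ?r) - L)"
      using Ls by (subst plus_emeasure) (auto intro!: arg_cong[of _ _ "emeasure \<nu>"])
    also have "emeasure \<nu> (ball z (3 * ?r) - L) \<le> ennreal (c * (v * (3 * ?r) ^ n))"
    proof -
      have "emeasure \<nu> (ball z (3 * ?r) - L) = (\<integral>\<^sup>+x. ennreal (g x) * indicator (ball z (3 * ?r) - L) x \<partial>lebesgue)"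
        unfolding \<nu>_def using Ls by (intro emeasure_density) auto
      also have "\<dots> \<le> (\<integral>\<^sup>+x. ennreal c * indicator (ball z (3 * ?r)) x \<partial>lebesgue)"
        by (intro nn_integral_mono) (auto simp: indicator_def L_def not_less intro: ennreal_leI)
      also have "\<dots> = ennreal c * ennreal (v * (3 * ?r) ^ n)"
        using r m[of "3 * ?r" z] by (simp add: nn_integral_cmult_indicator emeasure_ball_eq)
      also have "\<dots> = ennreal (c * (v * (3 * ?r) ^ n))"
        using l D v r by (intro ennreal_mult[symmetric]) (auto simp: c_def)
      finally show ?thesis .
    qed
    finally have 2: "emeasure \<nu> (ball z (3 * ?r)) \<le> emeasure \<nu> (ball z (3 * ?r) \<inter> L) + ennreal (c * (v * (3 * ?r) ^ n))"
      by (simp add: add_left_mono)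
    \<comment> \<open>Finiteness permits the passage to real numbers, where the absorbed half can be
      subtracted.\<close>
    have fin: "emeasure \<nu> (ball z (3 * ?r) \<inter> L) < \<infinity>"
    proof -
      have "emeasure \<nu> (ball z (3 * ?r) \<inter> L) \<le> emeasure \<nu> (ball z (3 * ?r))" by (rule emeasure_mono) auto
      also have "\<dots> = (\<integral>\<^sup>+x. ennreal (g x * indicat_real (ball z (3 * ?r)) x) \<partial>lebesgue)"
        unfolding \<nu>_def by (subst emeasure_density) (auto intro!: nn_integral_cong simp: indicator_def)
      also have "\<dots> = ennreal (LINT x|lebesgue. g x * indicat_real (ball z (3 * ?r)) x)"
        using integrable_inner_sq[OF g(1) sq_integrable_ind[OF lmeasurable_ball], of z "3 * ?r"] g(2)
        by (intro nn_integral_eq_integral) auto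
      finally show ?thesis by (rule le_less_trans) simp
    qed
    define q where "q = enn2real (emeasure \<nu> (ball z (3 * ?r) \<inter> L))"
    have q: "emeasure \<nu> (ball z (3 * ?r) \<inter> L) = ennreal q" "0 \<le> q"
      unfolding q_def using fin by (simp_all add: less_top)
    have "ennreal (l * (v * ?r ^ n)) \<le> ennreal D * (ennreal q + ennreal (c * (v * (3 * ?r) ^ n)))"
      using order.trans[OF 1 mult_left_mono[OF 2, of "ennreal D"]] r m[of ?r z] by (simp add: q)
    also have "\<dots> = ennreal (D * (q + c * (v * (3 * ?r) ^ n)))"
      using D q(2) l v r by (simp add: ennreal_mult c_def)
    finally have "l * (v * ?r ^ n) \<le> D * (q + c * (v * (3 * ?r) ^ n))"
      using D q(2) l v r by (subst (asm) ennreal_le_iff) (auto simp: c_def)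
    also have "D * (q + c * (v * (3 * ?r) ^ n)) = D * q + l * (v * ?r ^ n) / 2"
      using D by (simp add: c_def power_mult_distrib field_simps)
    finally have 3: "l * (v * ?r ^ n) \<le> 2 * D * q" by simp
    have "emeasure \<mu> (ball z (15 * ?r)) \<le> ennreal (l\<^sup>2 * (v * (15 * ?r) ^ n))"
      using big[OF z, of "15 * ?r"] r m[of "15 * ?r" z] by simp
    also have "l\<^sup>2 * (v * (15 * ?r) ^ n) = 15 ^ n * l * (l * (v * ?r ^ n))"
      by (simp add: power_mult_distrib power2_eq_square)
    also have "ennreal \<dots> \<le> ennreal (15 ^ n * l * (2 * D * q))"
      using 3 l by (intro ennreal_leI mult_left_mono) auto
    also have "15 ^ n * l * (2 * D * q) = (2 * 15 ^ n * D * l) * q" by simp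
    also have "ennreal \<dots> = ennreal (2 * 15 ^ n * D * l) * ennreal q"
      using D l q by (intro ennreal_mult) auto
    finally show ?thesis by (simp add: q)
  qed
  have "AE x in lebesgue. x \<in> S \<inter> {x. l < g x} \<longrightarrow> x \<in> M"
    using AE_exceeds_some_average[OF g(1) l] by eventually_elim (auto simp: M_def Rad_def \<mu>_def)
  then have "AE x in lebesgue. 0 < ennreal ((g x)\<^sup>2) \<longrightarrow> x \<in> S \<inter> {x. l < g x} \<longrightarrow> x \<in> (\<Union>i\<in>C. ball i (5 * (3 * \<rho> i)))"
    by (rule eventually_mono) (use C(4) in blast)
  moreover have "(\<lambda>x. ennreal ((g x)\<^sup>2)) \<in> borel_measurable lebesgue" by measurable
  ultimately have "AE x in \<mu>. x \<in> S \<inter> {x. l < g x} \<longrightarrow> x \<in> (\<Union>i\<in>C. ball i (5 * (3 * \<rho> i)))"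
    unfolding \<mu>_def by (simp only: AE_density)
  then have "emeasure \<mu> (S \<inter> {x. l < g x}) \<le> emeasure \<mu> (\<Union>i\<in>C. ball i (5 * (3 * \<rho> i)))"
    by (rule emeasure_mono_AE) (use C(1) in \<open>auto intro!: sets.countable_UN''\<close>)
  also have "\<dots> \<le> (\<integral>\<^sup>+i. emeasure \<mu> (ball i (15 * \<rho> i)) \<partial>count_space C)"
    using emeasure_UN_le_count[OF C(1), of "\<lambda>i. ball i (5 * (3 * \<rho> i))" \<mu>] by simp
  also have "\<dots> \<le> (\<integral>\<^sup>+i. ennreal (2 * 15 ^ n * D * l) * emeasure \<nu> (ball i (3 * \<rho> i) \<inter> L) \<partial>count_space C)"
    using single C(2) by (intro nn_integral_mono) auto
  also have "\<dots> = ennreal (2 * 15 ^ n * D * l) * (\<integral>\<^sup>+i. emeasure \<nu> (ball i (3 * \<rho> i) \<inter> L) \<partial>count_space C)"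
    by (rule nn_integral_cmult) simp
  also have "(\<integral>\<^sup>+i. emeasure \<nu> (ball i (3 * \<rho> i) \<inter> L) \<partial>count_space C) = emeasure \<nu> (\<Union>i\<in>C. ball i (3 * \<rho> i) \<inter> L)"
    using C(3) Ls by (intro emeasure_UN_countable[symmetric] C(1)) (auto simp: disjoint_family_on_def pairwise_def disjnt_def)
  also have "emeasure \<nu> (\<Union>i\<in>C. ball i (3 * \<rho> i) \<inter> L) \<le> emeasure \<nu> L"
    using Ls by (intro emeasure_mono) auto
  finally show ?thesis
    unfolding n_def[symmetric] \<mu>_def[symmetric] \<nu>_def[symmetric] L_def c_def by (simp add: mult_left_mono)
qed

text \<open>The nonzero terms form an initial segment of a geometric sequence, so the sum is at most
  twice its last one, which is below y / c.\<close>

lemma dyadic_sum_le: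
  fixes y c l :: real
  assumes "0 < c" "0 < l" "0 \<le> y"
  shows "(\<Sum>j<J. if c * (l * 2 ^ j) < y then l * 2 ^ j else 0) \<le> 2 * y / c"
proof (induction J)
  case 0
  then show ?case using assms by simp
next
  case (Suc J)
  show ?case
  proof (cases "c * (l * 2 ^ J) < y")
    case True
    have "(\<Sum>j<Suc J. if c * (l * 2 ^ j) < y then l * 2 ^ j else 0) \<le> (\<Sum>j<Suc J. l * 2 ^ j)"
      using assms by (intro sum_mono) auto
    also have "\<dots> = l * (2 ^ Suc J - 1)"
      unfolding sum_distrib_left[symmetric] by (subst geometric_sum) auto
    also have "\<dots> \<le> 2 * (l * 2 ^ J)" using assms by (simp add: algebra_simps)
    also have "\<dots> \<le> 2 * y / c" using True assms by (simp add: field_simps)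
    finally show ?thesis .
  next
    case False
    then show ?thesis using Suc by simp
  qed
qed

text \<open>Summing the level estimate over dyadic levels gives an \<open>L log L\<close> bound for \<open>g\<^sup>2\<close>.\<close>

lemma level_decay:
  fixes g :: "'a::euclidean_space \<Rightarrow> real"
  assumes g: "g \<in> borel_measurable lebesgue" "\<And>x. 0 \<le> g x" and S: "S \<in> sets lebesgue" and c: "0 < c" and C: "0 \<le> C" and l: "0 < l1"
    and level: "\<And>l. l1 \<le> l \<Longrightarrow> emeasure (density lebesgue (\<lambda>x. ennreal ((g x)\<^sup>2))) (S \<inter> {x. l < g x}) \<le>
      ennreal (C * l) * emeasure (density lebesgue (\<lambda>x. ennreal (g x))) {x. c * l < g x}"
  shows "of_nat J * emeasure (density lebesgue (\<lambda>x. ennreal ((g x)\<^sup>2))) (S \<inter> {x. l1 * 2 ^ J < g x}) \<le>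
    ennreal (2 * C / c) * (\<integral>\<^sup>+x. ennreal ((g x)\<^sup>2) \<partial>lebesgue)"
proof -
  note [measurable] = g(1)
  let ?\<mu> = "density lebesgue (\<lambda>x. ennreal ((g x)\<^sup>2))"
  let ?\<nu> = "density lebesgue (\<lambda>x. ennreal (g x))"
  have lev: "{x. t < g x} \<in> sets lebesgue" for t
    using measurable_sets[OF g(1), of "{t<..}"] by (simp add: vimage_def)
  \<comment> \<open>The superlevel set at the top level lies in each lower one, so \<open>J\<close>
    copies of its measure are bounded by the sum of the level estimates; this produces the factor
    \<open>J\<close>.\<close>
  have step: "emeasure ?\<mu> (S \<inter> {x. l1 * 2 ^ J < g x}) \<le>
      (\<integral>\<^sup>+x. ennreal (C * g x * (if c * (l1 * 2 ^ j) < g x then l1 * 2 ^ j else 0)) \<partial>lebesgue)" if "j < J" for j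
  proof -
    have jl: "l1 \<le> l1 * 2 ^ j" using l by simp
    have "l1 * 2 ^ j \<le> l1 * 2 ^ J" using that l by (intro mult_left_mono power_increasing) auto
    then have "emeasure ?\<mu> (S \<inter> {x. l1 * 2 ^ J < g x}) \<le> emeasure ?\<mu> (S \<inter> {x. l1 * 2 ^ j < g x})"
      using S lev by (intro emeasure_mono) auto
    also have "\<dots> \<le> ennreal (C * (l1 * 2 ^ j)) * emeasure ?\<nu> {x. c * (l1 * 2 ^ j) < g x}" by (rule level[OF jl])
    also have "emeasure ?\<nu> {x. c * (l1 * 2 ^ j) < g x} = (\<integral>\<^sup>+x. ennreal (g x) * indicator {x. c * (l1 * 2 ^ j) < g x} x \<partial>lebesgue)"
      using lev by (intro emeasure_density) auto
    also have "ennreal (C * (l1 * 2 ^ j)) * (\<integral>\<^sup>+x. ennreal (g x) * indicator {x. c * (l1 * 2 ^ j) < g x} x \<partial>lebesgue) =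
        (\<integral>\<^sup>+x. ennreal (C * (l1 * 2 ^ j)) * (ennreal (g x) * indicator {x. c * (l1 * 2 ^ j) < g x} x) \<partial>lebesgue)"
      using lev by (intro nn_integral_cmult[symmetric]) auto
    also have "\<dots> = (\<integral>\<^sup>+x. ennreal (C * g x * (if c * (l1 * 2 ^ j) < g x then l1 * 2 ^ j else 0)) \<partial>lebesgue)"
      using C l g(2) by (intro nn_integral_cong) (auto simp: indicator_def ennreal_mult[symmetric] mult_ac)
    finally show ?thesis .
  qed
  have "of_nat J * emeasure ?\<mu> (S \<inter> {x. l1 * 2 ^ J < g x}) = (\<Sum>j<J. emeasure ?\<mu> (S \<inter> {x. l1 * 2 ^ J < g x}))" by simp
  also have "\<dots> \<le> (\<Sum>j<J. \<integral>\<^sup>+x. ennreal (C * g x * (if c * (l1 * 2 ^ j) < g x then l1 * 2 ^ j else 0)) \<partial>lebesgue)"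
    by (rule sum_mono) (use step in auto)
  also have "\<dots> = (\<integral>\<^sup>+x. (\<Sum>j<J. ennreal (C * g x * (if c * (l1 * 2 ^ j) < g x then l1 * 2 ^ j else 0))) \<partial>lebesgue)"
    by (rule nn_integral_sum[symmetric]) measurable
  also have "\<dots> \<le> (\<integral>\<^sup>+x. ennreal (2 * C / c) * ennreal ((g x)\<^sup>2) \<partial>lebesgue)"
  proof (rule nn_integral_mono)
    fix x
    have "(\<Sum>j<J. ennreal (C * g x * (if c * (l1 * 2 ^ j) < g x then l1 * 2 ^ j else 0))) =
        ennreal (\<Sum>j<J. C * g x * (if c * (l1 * 2 ^ j) < g x then l1 * 2 ^ j else 0))"
      using C l g(2)[of x] by (intro sum_ennreal) auto
    also have "(\<Sum>j<J. C * g x * (if c * (l1 * 2 ^ j) < g x then l1 * 2 ^ j else 0)) =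
        C * g x * (\<Sum>j<J. if c * (l1 * 2 ^ j) < g x then l1 * 2 ^ j else 0)" by (rule sum_distrib_left[symmetric])
    also have "ennreal \<dots> \<le> ennreal (C * g x * (2 * g x / c))"
      using C g(2)[of x] by (intro ennreal_leI mult_left_mono dyadic_sum_le c l) auto
    also have "C * g x * (2 * g x / c) = 2 * C / c * (g x)\<^sup>2" by (simp add: power2_eq_square)
    also have "ennreal \<dots> = ennreal (2 * C / c) * ennreal ((g x)\<^sup>2)" using C c by (intro ennreal_mult) auto
    finally show "(\<Sum>j<J. ennreal (C * g x * (if c * (l1 * 2 ^ j) < g x then l1 * 2 ^ j else 0))) \<le> ennreal (2 * C / c) * ennreal ((g x)\<^sup>2)" .
  qed
  also have "\<dots> = ennreal (2 * C / c) * (\<integral>\<^sup>+x. ennreal ((g x)\<^sup>2) \<partial>lebesgue)" by (rule nn_integral_cmult) measurable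
  finally show ?thesis .
qed

section \<open>Local equi-integrability of the squared gradients of solutions\<close>

lemma density_sq_ball:
  "emeasure (density lebesgue (\<lambda>x. ennreal ((norm (rep_l2 G x))\<^sup>2))) (ball z r) = ennreal ((norm (restr (ball z r) G))\<^sup>2)"
proof -
  have b: "ball z r \<in> sets lebesgue" by simp
  have "ennreal ((norm (restr (ball z r) G))\<^sup>2) = (\<integral>\<^sup>+x. ennreal ((norm (rep_l2 (restr (ball z r) G) x))\<^sup>2) \<partial>lebesgue)"
    by (rule norm_l2_sq_nn)
  also have "\<dots> = (\<integral>\<^sup>+x. ennreal ((norm (rep_l2 G x))\<^sup>2) * indicator (ball z r) x \<partial>lebesgue)"
  proof (rule nn_integral_cong_AE)
    show "AE x in lebesgue. ennreal ((norm (rep_l2 (restr (ball z r) G) x))\<^sup>2) = ennreal ((norm (rep_l2 G x))\<^sup>2) * indicator (ball z r) x"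
      using rep_mulop[OF pointwise_op_restr[OF b], of G] unfolding restr_def
      by eventually_elim (simp add: indicator_def)
  qed
  also have "\<dots> = emeasure (density lebesgue (\<lambda>x. ennreal ((norm (rep_l2 G x))\<^sup>2))) (ball z r)"
    by (rule emeasure_density[symmetric]) auto
  finally show ?thesis by simp
qed

lemma density_norm_ball:
  "emeasure (density lebesgue (\<lambda>x. ennreal (norm (rep_l2 G x)))) (ball z r) = ennreal (inner (nrm G) (ind (ball z r)))"
proof -
  note sq = nrm_sq[of G] sq_integrable_ind[OF lmeasurable_ball, of z r]
  have "emeasure (density lebesgue (\<lambda>x. ennreal (norm (rep_l2 G x)))) (ball z r) =
      (\<integral>\<^sup>+x. ennreal (norm (rep_l2 G x)) * indicator (ball z r) x \<partial>lebesgue)"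
    by (rule emeasure_density) auto
  also have "\<dots> = (\<integral>\<^sup>+x. ennreal (norm (rep_l2 G x) \<bullet> indicat_real (ball z r) x) \<partial>lebesgue)"
    by (intro nn_integral_cong) (simp add: indicator_def)
  also have "\<dots> = ennreal (LINT x|lebesgue. norm (rep_l2 G x) \<bullet> indicat_real (ball z r) x)"
    by (rule nn_integral_eq_integral[OF integrable_inner_sq[OF sq]]) simp
  also have "(LINT x|lebesgue. norm (rep_l2 G x) \<bullet> indicat_real (ball z r) x) = inner (nrm G) (ind (ball z r))"
    unfolding nrm_def ind_def by (rule inner_abs_l2[OF sq, symmetric])
  finally show ?thesis .
qed

text \<open>Every constant of the stopping argument depends on the solutions only through
  \<open>C\<close> and \<open>K\<close>, so the threshold l1 2^J is the same for all
  \<open>k\<close>; the energy above it is of order 1 / J.\<close>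

lemma solutions_equi_integrable:
  fixes \<Omega> :: "(real^'n) set" and X :: "nat \<Rightarrow> (real^'n, real \<times> (real^'n)) l2"
  assumes \<Omega>: "open \<Omega>" and S: "compact S" "S \<subseteq> \<Omega>" and a1: "0 < a1"
    and a: "\<And>k. a k \<in> borel_measurable lebesgue" "\<And>k x. a1 \<le> a k x" "\<And>k x. a k x \<le> a2"
    and X: "\<And>k. X k \<in> closure (jets \<Omega>)" "\<And>k. norm (X k) \<le> C" and F: "AE x in lebesgue. norm (rep_l2 F x) \<le> K"
    and eq: "\<And>k Y. Y \<in> closure (jets \<Omega>) \<Longrightarrow> inner (mulop (\<lambda>x v. a k x *\<^sub>R v) (gr (X k))) (gr Y) = inner F (gr Y)"
    and e: "0 < e"
  shows "\<exists>T\<ge>0. \<forall>k. (\<integral>\<^sup>+x. ennreal ((norm (rep_l2 (gr (X k)) x))\<^sup>2) * indicator (S \<inter> {x. T < norm (rep_l2 (gr (X k)) x)}) x \<partial>lebesgue) \<le> ennreal e"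
proof -
  from reverse_hoelder_stopping[where 'n='n, OF a1, of a2] obtain D \<kappa> where D: "0 < D" "0 < \<kappa>" and
    RH: "\<forall>(\<Omega> :: (real^'n) set) X a F K z r l.
    a \<in> borel_measurable lebesgue \<longrightarrow> (\<forall>x. a1 \<le> a x \<and> a x \<le> a2) \<longrightarrow> X \<in> closure (jets \<Omega>) \<longrightarrow>
    (AE x in lebesgue. norm (rep_l2 F x) \<le> K) \<longrightarrow>
    (\<forall>Y\<in>closure (jets \<Omega>). inner (mulop (\<lambda>x v. a x *\<^sub>R v) (gr X)) (gr Y) = inner F (gr Y)) \<longrightarrow>
    0 < r \<longrightarrow> cball z (2 * r) \<subseteq> \<Omega> \<longrightarrow> 0 < l \<longrightarrow> \<kappa> * K\<^sup>2 \<le> l\<^sup>2 \<longrightarrow>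
    l\<^sup>2 * measure lborel (ball z r) < (norm (restr (ball z r) (gr X)))\<^sup>2 \<longrightarrow>
    (norm (restr (ball z (3 * r)) (gr X)))\<^sup>2 \<le> l\<^sup>2 * measure lborel (ball z (3 * r)) \<longrightarrow>
    l * measure lborel (ball z r) \<le> D * inner (nrm (gr X)) (ind (ball z (3 * r)))"
    by (elim exE conjE)
  obtain d where d: "0 < d" "(\<Union>x\<in>S. ball x d) \<subseteq> \<Omega>"
    by (rule compact_subset_open_imp_ball_epsilon_subset[OF S(1) \<Omega> S(2)])
  \<comment> \<open>Half the distance margin \<open>d\<close>: for z in \<open>S\<close> and r < R0
    the ball of radius 2 r needed by Caccioppoli's inequality stays in
    \<open>\<Omega>\<close>.\<close>
  define R0 where "R0 = d / 2"
  have R0: "0 < R0" using d by (simp add: R0_def)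
  define V where "V = measure lborel (ball (0::real^'n) R0)"
  have V: "0 < V" unfolding V_def by (rule measure_ball_pos[OF R0])
  \<comment> \<open>The three summands ensure, for l \<ge> l1, that the level is positive, that it
    dominates the right-hand side, and that the total energy C^2 is at most l^2 V, which keeps
    stopping radii below \<open>R0\<close>.\<close>
  define l1 where "l1 = 1 + sqrt (\<kappa> * K\<^sup>2) + sqrt (C\<^sup>2 / V)"
  have nn: "0 \<le> \<kappa> * K\<^sup>2" "0 \<le> C\<^sup>2 / V" using D V by auto
  have l1: "0 < l1" "sqrt (\<kappa> * K\<^sup>2) \<le> l1" "sqrt (C\<^sup>2 / V) \<le> l1" unfolding l1_def using nn by (auto simp: add_pos_nonneg add_nonneg_nonneg)
  define c where "c = 1 / (2 * D * 3 ^ CARD('n))"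
  define C' where "C' = 2 * 15 ^ CARD('n) * D"
  have c: "0 < c" "0 \<le> C'" using D by (auto simp: c_def C'_def)
  have Sl: "S \<in> sets lebesgue" using S(1) by (simp add: compact_imp_closed)
  have level: "emeasure (density lebesgue (\<lambda>x. ennreal ((norm (rep_l2 (gr (X k)) x))\<^sup>2))) (S \<inter> {x. l < norm (rep_l2 (gr (X k)) x)}) \<le>
      ennreal (C' * l) * emeasure (density lebesgue (\<lambda>x. ennreal (norm (rep_l2 (gr (X k)) x)))) {x. c * l < norm (rep_l2 (gr (X k)) x)}"
    if l: "l1 \<le> l" for k l
  proof -
    have l0: "0 < l" using l l1 by simp
    have lK: "\<kappa> * K\<^sup>2 \<le> l\<^sup>2"
      using power_mono[of "sqrt (\<kappa> * K\<^sup>2)" l 2] l l1 nn by simp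
    have lC: "C\<^sup>2 \<le> l\<^sup>2 * V"
      using power_mono[of "sqrt (C\<^sup>2 / V)" l 2] l l1 nn V by (simp add: field_simps)
    have "(norm (gr (X k)))\<^sup>2 \<le> C\<^sup>2"
      using norm_gr_le[of "X k"] X(2)[of k] by (intro power_mono) auto
    then have "ennreal ((norm (gr (X k)))\<^sup>2) \<le> ennreal (l\<^sup>2 * V)" using lC by (intro ennreal_leI) simp
    then have E: "emeasure (density lebesgue (\<lambda>x. ennreal ((norm (rep_l2 (gr (X k)) x))\<^sup>2))) UNIV \<le> ennreal (l\<^sup>2 * measure lebesgue (ball (0::real^'n) R0))"
      unfolding norm_l2_sq_nn V_def by (subst emeasure_density) auto
    have "emeasure (density lebesgue (\<lambda>x. ennreal ((norm (rep_l2 (gr (X k)) x))\<^sup>2))) (S \<inter> {x. l < norm (rep_l2 (gr (X k)) x)}) \<le>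
      ennreal (2 * 15 ^ DIM(real^'n) * D * l) * emeasure (density lebesgue (\<lambda>x. ennreal (norm (rep_l2 (gr (X k)) x)))) {x. l / (2 * D * 3 ^ DIM(real^'n)) < norm (rep_l2 (gr (X k)) x)}"
    proof (rule stopping_level[OF nrm_sq norm_ge_zero Sl D(1) R0 E l0], goal_cases)
      case (1 z r)
      have sub: "cball z (2 * r) \<subseteq> \<Omega>"
      proof -
        have "cball z (2 * r) \<subseteq> ball z d" using 1(3) by (auto simp: R0_def)
        also have "\<dots> \<subseteq> \<Omega>" using d(2) 1(1) by blast
        finally show ?thesis .
      qed
      have b1: "l\<^sup>2 * measure lborel (ball z r) < (norm (restr (ball z r) (gr (X k))))\<^sup>2"
        using 1(4) unfolding density_sq_ball by (subst (asm) ennreal_less_iff) auto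
      have b2: "(norm (restr (ball z (3 * r)) (gr (X k))))\<^sup>2 \<le> l\<^sup>2 * measure lborel (ball z (3 * r))"
        using 1(5) unfolding density_sq_ball by (subst (asm) ennreal_le_iff) auto
      have ab: "\<forall>x. a1 \<le> a k x \<and> a k x \<le> a2" using a by simp
      have eqk: "\<forall>Y\<in>closure (jets \<Omega>). inner (mulop (\<lambda>x v. a k x *\<^sub>R v) (gr (X k))) (gr Y) = inner F (gr Y)" using eq by simp
      have "l * measure lborel (ball z r) \<le> D * inner (nrm (gr (X k))) (ind (ball z (3 * r)))"
        using RH[THEN spec[of _ \<Omega>], THEN spec[of _ "X k"], THEN spec[of _ "a k"], THEN spec[of _ F], THEN spec[of _ K],
            THEN spec[of _ z], THEN spec[of _ r], THEN spec[of _ l]] a(1) ab X(1) F eqk 1(2) sub l0 lK b1 b2 by simp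
      then have "ennreal (l * measure lborel (ball z r)) \<le> ennreal (D * inner (nrm (gr (X k))) (ind (ball z (3 * r))))" by (rule ennreal_leI)
      also have "\<dots> = ennreal D * ennreal (inner (nrm (gr (X k))) (ind (ball z (3 * r))))" using D(1) by (intro ennreal_mult') simp
      finally show ?case unfolding density_norm_ball by simp
    qed
    then show ?thesis by (simp add: c_def C'_def)
  qed
  \<comment> \<open>Enough dyadic levels to bring the constant of the decay estimate, divided by
    \<open>J\<close>, below \<open>e\<close>.\<close>
  obtain J :: nat where J: "2 * C' / c * C\<^sup>2 / e < real J" using reals_Archimedean2 by blast
  have J0: "0 < real J" using J c e by (intro le_less_trans[OF _ J]) auto
  show ?thesis
  proof (intro exI[of _ "l1 * 2 ^ J"] conjI allI)
    show "0 \<le> l1 * 2 ^ J" using l1 by simp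
    fix k
    let ?I = "emeasure (density lebesgue (\<lambda>x. ennreal ((norm (rep_l2 (gr (X k)) x))\<^sup>2))) (S \<inter> {x. l1 * 2 ^ J < norm (rep_l2 (gr (X k)) x)})"
    have gm: "(\<lambda>x. norm (rep_l2 (gr (X k)) x)) \<in> borel_measurable lebesgue" by measurable
    have "of_nat J * ?I \<le> ennreal (2 * C' / c) * (\<integral>\<^sup>+x. ennreal ((norm (rep_l2 (gr (X k)) x))\<^sup>2) \<partial>lebesgue)"
      by (rule level_decay[OF gm norm_ge_zero Sl c l1(1) level])
    also have "\<dots> = ennreal (2 * C' / c * (norm (gr (X k)))\<^sup>2)"
      unfolding norm_l2_sq_nn[symmetric] using c by (intro ennreal_mult[symmetric]) auto
    also have "\<dots> \<le> ennreal (2 * C' / c * C\<^sup>2)"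
      using norm_gr_le[of "X k"] X(2)[of k] c by (intro ennreal_leI mult_left_mono power_mono) auto
    also have "\<dots> \<le> ennreal (real J * e)"
    proof (rule ennreal_leI)
      have "2 * C' / c * C\<^sup>2 < real J * e" using J e by (simp only: pos_divide_less_eq)
      then show "2 * C' / c * C\<^sup>2 \<le> real J * e" by simp
    qed
    also have "\<dots> = of_nat J * ennreal e" using e by (simp add: ennreal_mult ennreal_of_nat_eq_real_of_nat)
    finally have le: "of_nat J * ?I \<le> of_nat J * ennreal e" .
    have "?I \<le> ennreal e"
      using le J0 by (subst (asm) ennreal_mult_le_mult_iff) simp_all
    moreover have "?I = (\<integral>\<^sup>+x. ennreal ((norm (rep_l2 (gr (X k)) x))\<^sup>2) * indicator (S \<inter> {x. l1 * 2 ^ J < norm (rep_l2 (gr (X k)) x)}) x \<partial>lebesgue)"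
    proof (rule emeasure_density)
      have "{x. l1 * 2 ^ J < norm (rep_l2 (gr (X k)) x)} \<in> sets lebesgue"
        using measurable_sets[OF gm, of "{l1 * 2 ^ J<..}"] by (simp add: vimage_def)
      then show "S \<inter> {x. l1 * 2 ^ J < norm (rep_l2 (gr (X k)) x)} \<in> sets lebesgue" using Sl by auto
    qed auto
    ultimately show "(\<integral>\<^sup>+x. ennreal ((norm (rep_l2 (gr (X k)) x))\<^sup>2) * indicator (S \<inter> {x. l1 * 2 ^ J < norm (rep_l2 (gr (X k)) x)}) x \<partial>lebesgue) \<le> ennreal e"
      by simp
  qed
qed

text \<open>The weight is approximated almost everywhere by smooth functions; equi-integrability controls the
  error uniformly in \<open>k\<close>.\<close>

lemma distributional_imp_weak_L1:
  fixes z :: "real^'n" and G :: "nat \<Rightarrow> (real^'n, real^'n) l2"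
  assumes R: "0 < R" "cball z R \<subseteq> \<Omega>" and m: "\<And>k. m k \<in> borel_measurable lebesgue" "\<And>k x. \<bar>m k x\<bar> \<le> B"
    and h: "integrable lebesgue h"
    and lim: "\<And>\<phi>. \<phi> \<in> test_functions \<Omega> \<Longrightarrow>
      (\<lambda>k. LINT x|lebesgue. m k x * (norm (rep_l2 (G k) x))\<^sup>2 * \<phi> x) \<longlonglongrightarrow> (LINT x|lebesgue. h x * \<phi> x)"
    and equi: "\<And>e. 0 < e \<Longrightarrow> \<exists>T\<ge>0. \<forall>k. (\<integral>\<^sup>+x. ennreal ((norm (rep_l2 (G k) x))\<^sup>2) * indicator (cball z R \<inter> {x. T < norm (rep_l2 (G k) x)}) x \<partial>lebesgue) \<le> ennreal e"
    and w: "w \<in> borel_measurable lebesgue" "\<And>x. \<bar>w x\<bar> \<le> C"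
  shows "(\<lambda>k. LINT x|lebesgue. m k x * (norm (rep_l2 (G k) x))\<^sup>2 * (w x * bump z R x)) \<longlonglongrightarrow> (LINT x|lebesgue. h x * (w x * bump z R x))"
proof (rule LIMSEQ_I)
  fix e :: real assume e: "0 < e"
  have B: "0 \<le> B" using m(2)[of 0 z] by linarith
  have C: "0 \<le> C" using w(2)[of z] by linarith
  let ?\<psi> = "bump z R"
  let ?K = "cball z R"
  note [measurable] = m(1) w(1)
  have \<psi>m [measurable]: "?\<psi> \<in> borel_measurable lebesgue"
    by (intro continuous_measurable_lebesgue smooth_continuous smooth_bump)
  have hm [measurable]: "h \<in> borel_measurable lebesgue" using h by auto
  have out: "?\<psi> x = 0" if "x \<notin> ?K" for x using that bump_eq_0[OF R(1), of x z] by auto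
  obtain p where p: "\<And>j. smooth (p j)" "\<And>j x. x \<in> ?K \<Longrightarrow> \<bar>p j x\<bar> \<le> C + 1"
    "AE x in lebesgue. x \<in> ?K \<longrightarrow> (\<lambda>j. p j x) \<longlonglongrightarrow> w x"
    by (rule smooth_approx_bounded_measurable[OF w compact_cball[of z R]]) (rule that)
  have pm [measurable]: "p j \<in> borel_measurable lebesgue" for j
    by (intro continuous_measurable_lebesgue smooth_continuous p)
  \<comment> \<open>The error of replacing the weight by an admissible one. It does not depend on
    \<open>k\<close>, is bounded, and tends to zero almost everywhere.\<close>
  define s where "s j x = \<bar>w x - p j x\<bar> * ?\<psi> x" for j x
  have sm [measurable]: "s j \<in> borel_measurable lebesgue" for j unfolding s_def by measurable
  have s0: "0 \<le> s j x" for j x by (simp add: s_def bump_nonneg)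
  have s1: "s j x \<le> (2 * C + 1) * indicat_real ?K x" for j x
  proof (cases "x \<in> ?K")
    case True
    have "\<bar>w x - p j x\<bar> \<le> 2 * C + 1" using w(2)[of x] p(2)[OF True, of j] by linarith
    then have "s j x \<le> (2 * C + 1) * 1" unfolding s_def using C by (intro mult_mono bump_le1 bump_nonneg) auto
    then show ?thesis using True by simp
  qed (simp add: s_def out)
  have slim: "AE x in lebesgue. (\<lambda>j. s j x) \<longlonglongrightarrow> 0"
    using p(3)
  proof eventually_elim
    case (elim x)
    show ?case
    proof (cases "x \<in> ?K")
      case True
      then have "(\<lambda>j. \<bar>w x - p j x\<bar> * ?\<psi> x) \<longlonglongrightarrow> \<bar>w x - w x\<bar> * ?\<psi> x" using elim by (intro tendsto_intros) auto
      then show ?thesis by (simp add: s_def)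
    qed (simp add: s_def out)
  qed
  have sC: "s j x \<le> 2 * C + 1" for j x
  proof (cases "x \<in> ?K")
    case True
    then show ?thesis using s1[of j x] by simp
  next
    case False
    then show ?thesis using s1[of j x] C by simp
  qed
  have Ki: "integrable lebesgue (indicat_real ?K)" using lmeasurable_cball by (simp add: lmeasurable_iff_integrable)
  have si: "integrable lebesgue (s j)" for j
    by (rule Bochner_Integration.integrable_bound[OF integrable_mult_right[OF Ki, of "2 * C + 1"]])
       (use s0 s1 C in \<open>auto intro!: order.trans[OF s1]\<close>)
  have L1: "(\<lambda>j. LINT x|lebesgue. s j x) \<longlonglongrightarrow> integral\<^sup>L (lebesgue :: (real^'n) measure) (\<lambda>x. 0::real)"
    by (rule integral_dominated_convergence[where w="\<lambda>x. (2 * C + 1) * indicat_real ?K x"])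
       (use slim s0 s1 Ki in auto)
  have L2: "(\<lambda>j. LINT x|lebesgue. \<bar>h x\<bar> * s j x) \<longlonglongrightarrow> integral\<^sup>L (lebesgue :: (real^'n) measure) (\<lambda>x. 0::real)"
  proof (rule integral_dominated_convergence[where w="\<lambda>x. (2 * C + 1) * \<bar>h x\<bar>"])
    show "AE x in lebesgue. (\<lambda>j. \<bar>h x\<bar> * s j x) \<longlonglongrightarrow> 0"
      using slim by eventually_elim (rule tendsto_mult_right_zero)
    show "AE x in lebesgue. norm (\<bar>h x\<bar> * s j x) \<le> (2 * C + 1) * \<bar>h x\<bar>" for j
      using mult_left_mono[OF sC] s0 by (intro AE_I2) (simp add: abs_mult mult.commute)
    show "integrable lebesgue (\<lambda>x. (2 * C + 1) * \<bar>h x\<bar>)" using h by simp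
  qed auto
  \<comment> \<open>The constants are fixed in the order e1, T, j, N. The part above
    \<open>T\<close> and the part below it each receive e / (8 (B + 1)); the 1 keeps the
    denominators positive when B = 0.\<close>
  define e1 where "e1 = e / (8 * (B + 1) * (2 * C + 1))"
  have e1: "0 < e1" using e B C by (simp add: e1_def)
  obtain T where T: "0 \<le> T" "\<And>k. (\<integral>\<^sup>+x. ennreal ((norm (rep_l2 (G k) x))\<^sup>2) * indicator (?K \<inter> {x. T < norm (rep_l2 (G k) x)}) x \<partial>lebesgue) \<le> ennreal e1"
    using equi[OF e1] by blast
  have "0 < e / (8 * (B + 1) * (T\<^sup>2 + 1))" using e B by (simp add: add_nonneg_pos)
  then obtain j1 where j1: "\<And>j. j \<ge> j1 \<Longrightarrow> norm ((LINT x|lebesgue. s j x) - (integral\<^sup>L (lebesgue :: (real^'n) measure) (\<lambda>x. 0::real))) < e / (8 * (B + 1) * (T\<^sup>2 + 1))"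
    using LIMSEQ_D[OF L1] by blast
  obtain j2 where j2: "\<And>j. j \<ge> j2 \<Longrightarrow> norm ((LINT x|lebesgue. \<bar>h x\<bar> * s j x) - (integral\<^sup>L (lebesgue :: (real^'n) measure) (\<lambda>x. 0::real))) < e / 4"
    using LIMSEQ_D[OF L2, of "e / 4"] e by auto
  define j where "j = max j1 j2"
  have sj: "(LINT x|lebesgue. s j x) \<le> e / (8 * (B + 1) * (T\<^sup>2 + 1))" and hj: "(LINT x|lebesgue. \<bar>h x\<bar> * s j x) \<le> e / 4"
    using j1[of j] j2[of j] by (auto simp: j_def)
  let ?q = "\<lambda>k x. (norm (rep_l2 (G k) x))\<^sup>2"
  have qi: "integrable lebesgue (?q k)" for k by (rule sq_integrableD(2)[OF rep_l2_sq])
  have qsi: "integrable lebesgue (\<lambda>x. ?q k x * s j x)" for k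
  proof (rule Bochner_Integration.integrable_bound[OF integrable_mult_left[OF qi[of k], of "2 * C + 1"]])
    show "AE x in lebesgue. norm (?q k x * s j x) \<le> norm (?q k x * (2 * C + 1))"
      using mult_left_mono[OF sC] s0 C by (intro AE_I2) (simp add: abs_mult)
  qed measurable
  \<comment> \<open>Above the threshold the error is merely bounded, and equi-integrability gives
    smallness; below it the squared gradient is at most T^2, and the integral of \<open>s j\<close>
    gives smallness.\<close>
  have qs: "(LINT x|lebesgue. ?q k x * s j x) \<le> e / (4 * (B + 1))" for k
  proof -
    let ?L = "?K \<inter> {x. T < norm (rep_l2 (G k) x)}"
    have "{x. T < norm (rep_l2 (G k) x)} \<in> sets lebesgue"
      using measurable_sets[of "\<lambda>x. norm (rep_l2 (G k) x)" lebesgue borel "{T<..}"] by (simp add: vimage_def)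
    then have Ls: "?L \<in> sets lebesgue" by auto
    have Li: "integrable lebesgue (\<lambda>x. ?q k x * indicat_real ?L x)"
    proof (rule Bochner_Integration.integrable_bound[OF qi[of k]])
      show "(\<lambda>x. ?q k x * indicat_real ?L x) \<in> borel_measurable lebesgue"
        by (intro borel_measurable_times borel_measurable_indicator Ls) measurable
      show "AE x in lebesgue. norm (?q k x * indicat_real ?L x) \<le> norm (?q k x)"
        by (intro AE_I2) (simp add: abs_mult mult_left_le indicator_le_1)
    qed
    have "ennreal (LINT x|lebesgue. ?q k x * indicat_real ?L x) = (\<integral>\<^sup>+x. ennreal (?q k x * indicat_real ?L x) \<partial>lebesgue)"
      by (rule nn_integral_eq_integral[symmetric, OF Li]) simp
    also have "\<dots> = (\<integral>\<^sup>+x. ennreal (?q k x) * indicator ?L x \<partial>lebesgue)" by (intro nn_integral_cong) (simp add: indicator_def)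
    also have "\<dots> \<le> ennreal e1" by (rule T(2))
    finally have Le: "(LINT x|lebesgue. ?q k x * indicat_real ?L x) \<le> e1" using e1 by (subst (asm) ennreal_le_iff) auto
    have "(LINT x|lebesgue. ?q k x * s j x) \<le> (LINT x|lebesgue. (2 * C + 1) * (?q k x * indicat_real ?L x) + T\<^sup>2 * s j x)"
    proof (rule integral_mono[OF qsi])
      show "integrable lebesgue (\<lambda>x. (2 * C + 1) * (?q k x * indicat_real ?L x) + T\<^sup>2 * s j x)"
        by (intro Bochner_Integration.integrable_add integrable_mult_right Li si)
      show "?q k x * s j x \<le> (2 * C + 1) * (?q k x * indicat_real ?L x) + T\<^sup>2 * s j x" for x
      proof (cases "x \<in> ?L")
        case True
        have "?q k x * s j x \<le> ?q k x * (2 * C + 1)" using s1[of j x] True by (intro mult_left_mono) auto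
        moreover have "0 \<le> T\<^sup>2 * s j x" using s0 by simp
        ultimately show ?thesis using True by (simp add: mult.commute)
      next
        case False
        show ?thesis
        proof (cases "x \<in> ?K")
          case True
          then have "norm (rep_l2 (G k) x) \<le> T" using False by simp
          then have "?q k x \<le> T\<^sup>2" by (intro power_mono) auto
          then have "?q k x * s j x \<le> T\<^sup>2 * s j x" using s0 by (intro mult_right_mono) auto
          then show ?thesis using False by simp
        qed (simp add: s_def out)
      qed
    qed
    also have "\<dots> = (2 * C + 1) * (LINT x|lebesgue. ?q k x * indicat_real ?L x) + T\<^sup>2 * (LINT x|lebesgue. s j x)"
      using Li si by simp
    also have "\<dots> \<le> (2 * C + 1) * e1 + (T\<^sup>2 + 1) * (e / (8 * (B + 1) * (T\<^sup>2 + 1)))"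
    proof (intro add_mono mult_left_mono Le)
      have "T\<^sup>2 * (LINT x|lebesgue. s j x) \<le> (T\<^sup>2 + 1) * (LINT x|lebesgue. s j x)"
        using s0 by (intro mult_right_mono Bochner_Integration.integral_nonneg) auto
      also have "\<dots> \<le> (T\<^sup>2 + 1) * (e / (8 * (B + 1) * (T\<^sup>2 + 1)))" by (intro mult_left_mono sj) simp
      finally show "T\<^sup>2 * (LINT x|lebesgue. s j x) \<le> (T\<^sup>2 + 1) * (e / (8 * (B + 1) * (T\<^sup>2 + 1)))" .
    qed (use C in simp)
    also have "(2 * C + 1) * e1 = e / (8 * (B + 1))" using C by (simp add: e1_def)
    also have "(T\<^sup>2 + 1) * (e / (8 * (B + 1) * (T\<^sup>2 + 1))) = e / (8 * (B + 1))"
    proof -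
      have "T\<^sup>2 + 1 \<noteq> 0" by (metis add_nonneg_pos zero_le_power2 zero_less_one less_irrefl)
      then show ?thesis by simp
    qed
    also have "e / (8 * (B + 1)) + e / (8 * (B + 1)) = e / (4 * (B + 1))"
    proof -
      have "e / (8 * \<beta>) + e / (8 * \<beta>) = e / (4 * \<beta>)" for \<beta> :: real
        by (cases "\<beta> = 0") (auto simp: field_simps)
      then show ?thesis .
    qed
    finally show ?thesis .
  qed
  have test: "(\<lambda>x. p j x * ?\<psi> x) \<in> test_functions \<Omega>" by (intro test_function_mult test_function_bump R p)
  obtain N where N: "\<And>k. k \<ge> N \<Longrightarrow> norm ((LINT x|lebesgue. m k x * ?q k x * (p j x * ?\<psi> x)) - (LINT x|lebesgue. h x * (p j x * ?\<psi> x))) < e / 4"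
    using LIMSEQ_D[OF lim[OF test], of "e / 4"] e by auto
  have wb: "\<bar>w x * ?\<psi> x\<bar> \<le> C + 1" and pb: "\<bar>p j x * ?\<psi> x\<bar> \<le> C + 1" for x
  proof -
    show "\<bar>w x * ?\<psi> x\<bar> \<le> C + 1"
      using mult_mono[OF w(2)[of x] bump_le1[of z R x] C bump_nonneg] by (simp add: abs_mult bump_nonneg)
    show "\<bar>p j x * ?\<psi> x\<bar> \<le> C + 1"
    proof (cases "x \<in> ?K")
      case True
      have "\<bar>p j x\<bar> * ?\<psi> x \<le> (C + 1) * 1"
        using C by (intro mult_mono p(2)[OF True] bump_le1 bump_nonneg) auto
      then show ?thesis by (simp add: abs_mult bump_nonneg)
    qed (use C in \<open>simp add: out\<close>)
  qed
  have mi: "integrable lebesgue (\<lambda>x. m k x * ?q k x * f x)" if [measurable]: "f \<in> borel_measurable lebesgue" and fb: "\<And>x. \<bar>f x\<bar> \<le> C + 1" for f k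
  proof (rule Bochner_Integration.integrable_bound[OF integrable_mult_left[OF qi[of k], of "B * (C + 1)"]])
    have "\<bar>m k x\<bar> * \<bar>f x\<bar> * ?q k x \<le> B * (C + 1) * ?q k x" for x
      using B C by (intro mult_right_mono mult_mono m fb) auto
    then show "AE x in lebesgue. norm (m k x * ?q k x * f x) \<le> norm (?q k x * (B * (C + 1)))"
      using B C by (intro AE_I2) (simp add: abs_mult mult_ac)
  qed measurable
  have hi: "integrable lebesgue (\<lambda>x. h x * f x)" if [measurable]: "f \<in> borel_measurable lebesgue" and fb: "\<And>x. \<bar>f x\<bar> \<le> C + 1" for f
  proof (rule Bochner_Integration.integrable_bound[OF integrable_mult_left[OF h, of "C + 1"]])
    show "AE x in lebesgue. norm (h x * f x) \<le> norm (h x * (C + 1))"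
      using C mult_left_mono[OF fb, of "\<bar>h _\<bar>"] by (intro AE_I2) (simp add: abs_mult)
  qed measurable
  have wm: "(\<lambda>x. w x * ?\<psi> x) \<in> borel_measurable lebesgue" and ppm: "(\<lambda>x. p j x * ?\<psi> x) \<in> borel_measurable lebesgue" by measurable
  have d1: "\<bar>(LINT x|lebesgue. m k x * ?q k x * (w x * ?\<psi> x)) - (LINT x|lebesgue. m k x * ?q k x * (p j x * ?\<psi> x))\<bar> \<le> e / 4" for k
  proof -
    have "(LINT x|lebesgue. m k x * ?q k x * (w x * ?\<psi> x)) - (LINT x|lebesgue. m k x * ?q k x * (p j x * ?\<psi> x)) =
        (LINT x|lebesgue. m k x * ?q k x * (w x * ?\<psi> x) - m k x * ?q k x * (p j x * ?\<psi> x))"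
      by (rule Bochner_Integration.integral_diff[symmetric, OF mi[OF wm wb] mi[OF ppm pb]])
    then have "\<bar>(LINT x|lebesgue. m k x * ?q k x * (w x * ?\<psi> x)) - (LINT x|lebesgue. m k x * ?q k x * (p j x * ?\<psi> x))\<bar> =
        \<bar>LINT x|lebesgue. m k x * ?q k x * (w x * ?\<psi> x) - m k x * ?q k x * (p j x * ?\<psi> x)\<bar>" by (simp only:)
    also have "\<dots> \<le> (LINT x|lebesgue. \<bar>m k x * ?q k x * (w x * ?\<psi> x) - m k x * ?q k x * (p j x * ?\<psi> x)\<bar>)"
      by (rule integral_abs_bound)
    also have "\<dots> \<le> (LINT x|lebesgue. B * (?q k x * s j x))"
    proof (rule integral_mono)
      show "integrable lebesgue (\<lambda>x. \<bar>m k x * ?q k x * (w x * ?\<psi> x) - m k x * ?q k x * (p j x * ?\<psi> x)\<bar>)"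
        by (rule integrable_abs[OF Bochner_Integration.integrable_diff[OF mi[OF wm wb] mi[OF ppm pb]]])
      show "integrable lebesgue (\<lambda>x. B * (?q k x * s j x))" by (rule integrable_mult_right) (rule qsi)
      fix x
      have "m k x * ?q k x * (w x * ?\<psi> x) - m k x * ?q k x * (p j x * ?\<psi> x) = m k x * (?q k x * ((w x - p j x) * ?\<psi> x))"
        by (simp add: algebra_simps)
      then have "\<bar>m k x * ?q k x * (w x * ?\<psi> x) - m k x * ?q k x * (p j x * ?\<psi> x)\<bar> = \<bar>m k x\<bar> * (?q k x * s j x)"
        by (simp add: abs_mult s_def bump_nonneg)
      also have "\<dots> \<le> B * (?q k x * s j x)" by (rule mult_right_mono[OF m(2)]) (simp add: s0)
      finally show "\<bar>m k x * ?q k x * (w x * ?\<psi> x) - m k x * ?q k x * (p j x * ?\<psi> x)\<bar> \<le> B * (?q k x * s j x)" .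
    qed
    also have "\<dots> \<le> B * (e / (4 * (B + 1)))" 
      unfolding integral_mult_right_zero by (rule mult_left_mono[OF qs B])
    also have "\<dots> \<le> e / 4" using B e by (simp add: field_simps)
    finally show ?thesis .
  qed
  have d2: "\<bar>(LINT x|lebesgue. h x * (w x * ?\<psi> x)) - (LINT x|lebesgue. h x * (p j x * ?\<psi> x))\<bar> \<le> e / 4"
  proof -
    have "(LINT x|lebesgue. h x * (w x * ?\<psi> x)) - (LINT x|lebesgue. h x * (p j x * ?\<psi> x)) =
        (LINT x|lebesgue. h x * (w x * ?\<psi> x) - h x * (p j x * ?\<psi> x))"
      by (rule Bochner_Integration.integral_diff[symmetric, OF hi[OF wm wb] hi[OF ppm pb]])
    then have "\<bar>(LINT x|lebesgue. h x * (w x * ?\<psi> x)) - (LINT x|lebesgue. h x * (p j x * ?\<psi> x))\<bar> =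
        \<bar>LINT x|lebesgue. h x * (w x * ?\<psi> x) - h x * (p j x * ?\<psi> x)\<bar>" by (simp only:)
    also have "\<dots> \<le> (LINT x|lebesgue. \<bar>h x * (w x * ?\<psi> x) - h x * (p j x * ?\<psi> x)\<bar>)"
      by (rule integral_abs_bound)
    also have "(\<lambda>x. \<bar>h x * (w x * ?\<psi> x) - h x * (p j x * ?\<psi> x)\<bar>) = (\<lambda>x. \<bar>h x\<bar> * s j x)"
    proof
      fix x
      have "h x * (w x * ?\<psi> x) - h x * (p j x * ?\<psi> x) = h x * ((w x - p j x) * ?\<psi> x)" by (simp add: algebra_simps)
      then show "\<bar>h x * (w x * ?\<psi> x) - h x * (p j x * ?\<psi> x)\<bar> = \<bar>h x\<bar> * s j x"
        by (simp add: abs_mult s_def bump_nonneg)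
    qed
    finally show ?thesis using hj by linarith
  qed
  show "\<exists>N. \<forall>k\<ge>N. norm ((LINT x|lebesgue. m k x * ?q k x * (w x * ?\<psi> x)) - (LINT x|lebesgue. h x * (w x * ?\<psi> x))) < e"
  proof (intro exI[of _ N] allI impI)
    fix k assume "k \<ge> N"
    from N[OF this] d1[of k] d2 e
    show "norm ((LINT x|lebesgue. m k x * ?q k x * (w x * ?\<psi> x)) - (LINT x|lebesgue. h x * (w x * ?\<psi> x))) < e"
      unfolding real_norm_def by linarith
  qed
qed

section \<open>Passage to the limit in the quadratic inequality\<close>

lemma rep_gr_jet:
  assumes "\<phi> \<in> test_functions \<Omega>"
  shows "AE x in lebesgue. rep_l2 (gr (jet \<phi>)) x = grad \<phi> x"
  using rep_gr[of "jet \<phi>"] rep_jet[OF assms] by eventually_elim simp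

lemma inner_mulop:
  assumes "pointwise_op T" "pointwise_op S"
  shows "inner (mulop T X) (mulop S Y) = (LINT x|lebesgue. T x (rep_l2 X x) \<bullet> S x (rep_l2 Y x))"
  unfolding mulop_def by (rule inner_abs_l2[OF pointwise_op_sq[OF assms(1) rep_l2_sq] pointwise_op_sq[OF assms(2) rep_l2_sq]])

lemma inner_mulop_left:
  assumes "pointwise_op T"
  shows "inner (mulop T X) Y = (LINT x|lebesgue. T x (rep_l2 X x) \<bullet> rep_l2 Y x)"
  using inner_abs_l2[OF pointwise_op_sq[OF assms rep_l2_sq[of X]] rep_l2_sq[of Y]] by (simp add: mulop_def)

lemma inner_mulop_scale_commute:
  fixes X Y :: "('a::euclidean_space, 'b::euclidean_space) l2"
  assumes "pointwise_op (\<lambda>x (v::'b). \<phi> x *\<^sub>R v)"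
  shows "inner (mulop (\<lambda>x v. \<phi> x *\<^sub>R v) X) Y = inner X (mulop (\<lambda>x v. \<phi> x *\<^sub>R v) Y)"
proof -
  have "inner (mulop (\<lambda>x v. \<phi> x *\<^sub>R v) X) Y = inner (mulop (\<lambda>x v. \<phi> x *\<^sub>R v) Y) X"
    unfolding inner_mulop_left[OF assms] by (simp add: inner_commute)
  also have "\<dots> = inner X (mulop (\<lambda>x v. \<phi> x *\<^sub>R v) Y)" by (rule inner_commute)
  finally show ?thesis .
qed

lemma weak_strong_inner_tendsto:
  fixes u v :: "nat \<Rightarrow> 'a::real_inner"
  assumes u: "\<And>z. (\<lambda>n. inner (u n) z) \<longlonglongrightarrow> inner u0 z" "\<And>n. norm (u n) \<le> C" and v: "v \<longlonglongrightarrow> v0"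
  shows "(\<lambda>n. inner (u n) (v n)) \<longlonglongrightarrow> inner u0 v0"
proof -
  have "(\<lambda>n. C * norm (v n - v0)) \<longlonglongrightarrow> C * norm (v0 - v0)" by (intro tendsto_intros v)
  then have z: "(\<lambda>n. C * norm (v n - v0)) \<longlonglongrightarrow> 0" by simp
  have "norm (inner (u n) (v n - v0)) \<le> C * norm (v n - v0)" for n
    using Cauchy_Schwarz_ineq2[of "u n" "v n - v0"] mult_right_mono[OF u(2)[of n], of "norm (v n - v0)"] by simp
  then have "(\<lambda>n. inner (u n) (v n - v0)) \<longlonglongrightarrow> 0"
    by (intro Lim_null_comparison[OF _ z] always_eventually) simp
  from tendsto_add[OF this u(1)[of v0]] show ?thesis by (simp add: inner_diff_right)
qed

text \<open>The div-curl argument. Testing the equation with \<phi> times the solution trades the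
  quadratic energy for terms linear in the gradient and one product of the flux with u times the
  gradient of \<phi>; by Rellich's theorem that product pairs weak with strong convergence.\<close>

lemma energy_converges:
  fixes \<Omega> :: "(real^'n) set" and X :: "nat \<Rightarrow> (real^'n, real \<times> (real^'n)) l2"
  assumes \<Omega>: "open \<Omega>" "bounded \<Omega>" and p: "\<And>n. p n \<in> borel_measurable lebesgue" "\<And>n x. \<bar>p n x\<bar> \<le> a2"
    and X: "\<And>n. X n \<in> closure (jets \<Omega>)" "\<And>n. norm (X n) \<le> C" "X0 \<in> closure (jets \<Omega>)"
    and weak: "\<And>z. (\<lambda>n. inner (X n) z) \<longlonglongrightarrow> inner X0 z"
    and eq: "\<And>n Y. Y \<in> closure (jets \<Omega>) \<Longrightarrow> inner (mulop (\<lambda>x v. p n x *\<^sub>R v) (gr (X n))) (gr Y) = inner F (gr Y)"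
    and flux: "\<And>G. (\<lambda>n. inner (mulop (\<lambda>x v. p n x *\<^sub>R v) (gr (X n))) G) \<longlonglongrightarrow> inner F G"
    and \<phi>: "\<phi> \<in> test_functions \<Omega>"
  shows "(\<lambda>n. LINT x|lebesgue. p n x * (norm (rep_l2 (gr (X n)) x))\<^sup>2 * \<phi> x) \<longlonglongrightarrow>
    (LINT x|lebesgue. (rep_l2 F x \<bullet> rep_l2 (gr X0) x) * \<phi> x)"
proof -
  obtain B where B: "\<And>x. \<bar>\<phi> x\<bar> \<le> B" "\<And>x. norm (grad \<phi> x) \<le> B"
    using test_function_grad_integrable(4)[OF \<phi>] by blast
  note [measurable] = sq_integrableD(1)[OF test_function_grad_integrable(2)[OF \<phi>]] sq_integrableD(1)[OF test_function_grad_integrable(3)[OF \<phi>]]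
  have Np: "pointwise_op (\<lambda>x (v::real^'n). \<phi> x *\<^sub>R v)" by (rule pointwise_op_scale[OF _ B(1)]) measurable
  have Sp: "pointwise_op (\<lambda>x (v::real^'n). p n x *\<^sub>R v)" for n by (rule pointwise_op_scale[OF p])
  have Wp: "pointwise_op (\<lambda>x (t::real). t *\<^sub>R grad \<phi> x)"
  proof (rule pointwise_opI[where C=B])
    show "norm (v *\<^sub>R grad \<phi> x) \<le> B * norm v" for x v
      using mult_left_mono[OF B(2)[of x], of "\<bar>v\<bar>"] by (simp add: mult.commute)
    show "linear (\<lambda>t. t *\<^sub>R grad \<phi> x)" for x by (rule linearI) (simp_all add: algebra_simps)
    show "(\<lambda>x. f x *\<^sub>R grad \<phi> x) \<in> borel_measurable lebesgue" if "f \<in> borel_measurable lebesgue" for f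
      by (rule borel_measurable_scaleR[OF that sq_integrableD(1)[OF test_function_grad_integrable(3)[OF \<phi>]]])
  qed
  define N where "N = mulop (\<lambda>x (v::real^'n). \<phi> x *\<^sub>R v)"
  define W where "W = mulop (\<lambda>x (t::real). t *\<^sub>R grad \<phi> x)"
  define S where "S n = mulop (\<lambda>x (v::real^'n). p n x *\<^sub>R v) (gr (X n))" for n
  have split: "gr (mulop (times_op \<phi>) Y) = N (gr Y) + W (fn Y)" for Y
  proof (rule l2_eqI)
    show "AE x in lebesgue. rep_l2 (gr (mulop (times_op \<phi>) Y)) x = rep_l2 (N (gr Y) + W (fn Y)) x"
      using rep_gr[of "mulop (times_op \<phi>) Y"] rep_mulop[OF pointwise_op_times[OF \<phi>], of Y]
        rep_l2_add[of "N (gr Y)" "W (fn Y)"] rep_mulop[OF Np, of "gr Y"] rep_mulop[OF Wp, of "fn Y"] rep_gr[of Y] rep_fn[of Y]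
      by eventually_elim (simp add: times_op_def N_def W_def)
  qed
  have fnlim: "(\<lambda>n. fn (X n)) \<longlonglongrightarrow> fn X0" by (rule rellich[OF \<Omega> X(1,3,2) weak])
  have Wlim: "(\<lambda>n. W (fn (X n))) \<longlonglongrightarrow> W (fn X0)"
    unfolding W_def by (rule bounded_linear.tendsto[OF bounded_linear_mulop[OF Wp] fnlim])
  have a2: "0 \<le> a2" using p(2)[of 0 0] by linarith
  have Sb: "norm (S n) \<le> a2 * C" for n
  proof -
    have "norm (S n) \<le> a2 * norm (gr (X n))"
      unfolding S_def by (rule norm_mulop_le[OF Sp _ a2]) (simp add: mult_right_mono p)
    also have "\<dots> \<le> a2 * C" using norm_gr_le[of "X n"] X(2)[of n] a2 by (intro mult_left_mono) auto
    finally show ?thesis .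
  qed
  \<comment> \<open>In the limit the last two terms become equal and cancel, which leaves the
    pairing of \<open>F\<close> with the limit gradient.\<close>
  have e: "inner (S n) (N (gr (X n))) = inner (gr (X n)) (N F) + inner F (W (fn (X n))) - inner (S n) (W (fn (X n)))" for n
  proof -
    have "inner (S n) (N (gr (X n))) + inner (S n) (W (fn (X n))) = inner F (gr (mulop (times_op \<phi>) (X n)))"
      unfolding inner_add_right[symmetric] split[symmetric] S_def by (rule eq[OF times_closure_jets[OF \<phi> X(1)]])
    also have "\<dots> = inner F (N (gr (X n))) + inner F (W (fn (X n)))" by (simp add: split inner_add_right)
    also have "inner F (N (gr (X n))) = inner (gr (X n)) (N F)"
      unfolding N_def inner_mulop_scale_commute[OF Np, of F "gr (X n)", symmetric]
      unfolding inner_commute[of F] inner_mulop_scale_commute[OF Np] ..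
    finally show ?thesis by simp
  qed
  have lim: "(\<lambda>n. inner (S n) (N (gr (X n)))) \<longlonglongrightarrow> inner (gr X0) (N F) + inner F (W (fn X0)) - inner F (W (fn X0))"
    unfolding e
  proof (intro tendsto_diff tendsto_add)
    show "(\<lambda>n. inner (gr (X n)) (N F)) \<longlonglongrightarrow> inner (gr X0) (N F)" unfolding inner_gr by (rule weak)
    show "(\<lambda>n. inner F (W (fn (X n)))) \<longlonglongrightarrow> inner F (W (fn X0))" by (intro tendsto_intros Wlim)
    show "(\<lambda>n. inner (S n) (W (fn (X n)))) \<longlonglongrightarrow> inner F (W (fn X0))"
      by (rule weak_strong_inner_tendsto[OF _ Sb Wlim]) (unfold S_def, rule flux)
  qed
  have "inner (S n) (N (gr (X n))) = (LINT x|lebesgue. p n x * (norm (rep_l2 (gr (X n)) x))\<^sup>2 * \<phi> x)" for n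
    unfolding S_def N_def inner_mulop[OF Sp Np] by (simp add: power2_norm_eq_inner mult_ac)
  moreover have "inner (gr X0) (N F) = (LINT x|lebesgue. (rep_l2 F x \<bullet> rep_l2 (gr X0) x) * \<phi> x)"
    unfolding N_def inner_commute[of "gr X0"] inner_mulop_left[OF Np] by (simp add: mult.commute)
  ultimately show ?thesis using lim by simp
qed

lemma quadratic_lint_on:
  fixes \<Omega> :: "(real^'n) set" and B B' :: "real^'n \<Rightarrow> real^'n^'n"
  assumes \<Omega>: "open \<Omega>" "bounded \<Omega>" and X: "X \<in> closure (jets \<Omega>)"
    and B': "B' \<in> borel_measurable lebesgue" and B: "B \<in> borel_measurable (lebesgue_on \<Omega>)"
    and BB: "AE x in lebesgue. x \<in> \<Omega> \<longrightarrow> B' x = B x" and \<phi>: "\<phi> \<in> test_functions \<Omega>"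
  defines "W \<equiv> weak_grad \<Omega> (\<lambda>x. fst (rep_l2 X x))"
  shows "(LINT x|lebesgue_on \<Omega>. (B x *v W x) \<bullet> W x * \<phi> x) =
    (LINT x|lebesgue. (B' x *v rep_l2 (gr X) x) \<bullet> rep_l2 (gr X) x * \<phi> x)"
proof -
  have m: "\<Omega> \<in> sets lebesgue" using \<Omega> by auto
  let ?R = "\<lambda>x. (B' x *v rep_l2 (gr X) x) \<bullet> rep_l2 (gr X) x * \<phi> x"
  have W: "AE x in lebesgue. x \<in> \<Omega> \<longrightarrow> W x = rep_l2 (gr X) x"
    using closure_jets_H1(2)[OF \<Omega> X] rep_gr[of X] unfolding AE_on_iff[OF m] W_def by eventually_elim simp
  have wm: "W \<in> borel_measurable (lebesgue_on \<Omega>)"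
    using weak_grad_H1[OF closure_jets_H1(1)[OF \<Omega> X]] by (auto simp: L2_def W_def)
  have \<phi>m: "\<phi> \<in> borel_measurable lebesgue" by (rule sq_integrableD(1)[OF test_function_grad_integrable(2)[OF \<phi>]])
  have Rm: "?R \<in> borel_measurable lebesgue"
    by (intro borel_measurable_times borel_measurable_inner matrix_vector_measurable B' rep_l2_measurable \<phi>m)
  have "(LINT x|lebesgue_on \<Omega>. (B x *v W x) \<bullet> W x * \<phi> x) = (LINT x|lebesgue_on \<Omega>. ?R x)"
  proof (rule integral_cong_AE)
    show "(\<lambda>x. (B x *v W x) \<bullet> W x * \<phi> x) \<in> borel_measurable (lebesgue_on \<Omega>)"
      by (intro borel_measurable_times borel_measurable_inner matrix_vector_measurable B wm measurable_restrict_space1 \<phi>m)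
    show "?R \<in> borel_measurable (lebesgue_on \<Omega>)" by (rule measurable_restrict_space1[OF Rm])
    show "AE x in lebesgue_on \<Omega>. (B x *v W x) \<bullet> W x * \<phi> x = ?R x"
      unfolding AE_on_iff[OF m] using W BB by eventually_elim simp
  qed
  also have "\<dots> = (LINT x|lebesgue. ?R x)"
    unfolding lint_on_eq[OF m]
    by (intro Bochner_Integration.integral_cong) (auto simp: indicator_def test_function_outside[OF \<phi>])
  finally show ?thesis .
qed

lemma Linf_bounded_version:
  fixes f :: "'a::euclidean_space \<Rightarrow> 'b::euclidean_space"
  assumes \<Omega>: "\<Omega> \<in> sets lebesgue" and f: "f \<in> Linf \<Omega>"
  obtains f' K where "f' \<in> borel_measurable lebesgue" "\<And>x. norm (f' x) \<le> K"
    "\<And>x. x \<notin> \<Omega> \<Longrightarrow> f' x = 0" "AE x in lebesgue. x \<in> \<Omega> \<longrightarrow> f' x = f x"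
proof -
  obtain K where K: "AE x in lebesgue_on \<Omega>. norm (f x) \<le> K" using f by (auto simp: Linf_def)
  have m: "(\<lambda>x. indicat_real \<Omega> x *\<^sub>R f x) \<in> borel_measurable lebesgue"
    using f \<Omega> by (simp add: Linf_def borel_measurable_restrict_space_iff)
  define f' where "f' x = (if norm (indicat_real \<Omega> x *\<^sub>R f x) \<le> \<bar>K\<bar> then indicat_real \<Omega> x *\<^sub>R f x else 0)" for x
  have "f' \<in> borel_measurable lebesgue" unfolding f'_def using m by measurable
  moreover have "norm (f' x) \<le> \<bar>K\<bar>" for x by (simp add: f'_def)
  moreover have "f' x = 0" if "x \<notin> \<Omega>" for x using that by (simp add: f'_def)
  moreover have "AE x in lebesgue. x \<in> \<Omega> \<longrightarrow> f' x = f x"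
    using K unfolding AE_on_iff[OF \<Omega>] by eventually_elim (auto simp: f'_def)
  ultimately show ?thesis by (rule that)
qed

text \<open>The decisive weight is the indicator of the set where \<open>Q\<close> is negative. It
  is only measurable, and this is why limits against smooth weights do not suffice.\<close>

lemma AE_nonneg_on_ball:
  fixes Q :: "real^'n \<Rightarrow> real"
  assumes R: "0 < R" and Q: "Q \<in> borel_measurable lebesgue"
    and int: "\<And>w. w \<in> borel_measurable lebesgue \<Longrightarrow> (\<And>x. 0 \<le> w x) \<Longrightarrow> (\<And>x. w x \<le> 1) \<Longrightarrow>
      integrable lebesgue (\<lambda>x. Q x * (w x * bump z R x)) \<and> 0 \<le> (LINT x|lebesgue. Q x * (w x * bump z R x))"
  shows "AE x in lebesgue. x \<in> ball z R \<longrightarrow> 0 \<le> Q x"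
proof -
  define w where "w x = (if Q x < 0 then 1 else 0 :: real)" for x
  note [measurable] = Q
  have wm: "w \<in> borel_measurable lebesgue" unfolding w_def by measurable
  have i: "integrable lebesgue (\<lambda>x. Q x * (w x * bump z R x))" and p: "0 \<le> (LINT x|lebesgue. Q x * (w x * bump z R x))"
    using int[OF wm] by (auto simp: w_def)
  have n: "0 \<le> - (Q x * (w x * bump z R x))" for x
    using bump_nonneg[of z R x] by (auto simp: w_def mult_nonpos_nonneg)
  have "(LINT x|lebesgue. - (Q x * (w x * bump z R x))) = 0"
    using p Bochner_Integration.integral_nonneg[of lebesgue "\<lambda>x. - (Q x * (w x * bump z R x))", OF n] by simp
  then have "AE x in lebesgue. - (Q x * (w x * bump z R x)) = 0"
    using integral_nonneg_eq_0_iff_AE[OF integrable_minus[OF i] AE_I2[OF n]] by simp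
  then show ?thesis
  proof eventually_elim
    case (elim x)
    show ?case
    proof
      assume "x \<in> ball z R"
      then have "0 < bump z R x" using bump_pos_iff[OF R] by blast
      then show "0 \<le> Q x" using elim by (auto simp: w_def split: if_splits)
    qed
  qed
qed

text \<open>The limit of the integrals of g (s p + t) |G - \<eta>|^2, expanded. The mixed terms
  converge by weak convergence of gradients and fluxes, the constant term by weak* convergence of
  the coefficients; the two terms quadratic in \<open>G n\<close> need the upgraded distributional
  limits.\<close>

lemma limit_quadratic_nonneg:
  fixes z \<eta> :: "real^'n" and G :: "nat \<Rightarrow> (real^'n, real^'n) l2"
  assumes R: "0 < R" "cball z R \<subseteq> \<Omega>"
    and p: "\<And>n. p n \<in> borel_measurable lebesgue" "\<And>n x. \<bar>p n x\<bar> \<le> a2"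
    and b: "b \<in> borel_measurable lebesgue" "\<And>x. 0 \<le> b x" "\<And>x. b x \<le> K"
    and \<pi>: "\<pi> \<in> borel_measurable lebesgue" "\<And>x. \<bar>\<pi> x\<bar> \<le> L"
    and h: "integrable lebesgue h" and k: "integrable lebesgue k"
    and limp: "\<And>\<phi>. \<phi> \<in> test_functions \<Omega> \<Longrightarrow>
      (\<lambda>n. LINT x|lebesgue. p n x * (norm (rep_l2 (G n) x))\<^sup>2 * \<phi> x) \<longlonglongrightarrow> (LINT x|lebesgue. h x * \<phi> x)"
    and limb: "\<And>\<phi>. \<phi> \<in> test_functions \<Omega> \<Longrightarrow>
      (\<lambda>n. LINT x|lebesgue. b x * (norm (rep_l2 (G n) x))\<^sup>2 * \<phi> x) \<longlonglongrightarrow> (LINT x|lebesgue. k x * \<phi> x)"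
    and equi: "\<And>e. 0 < e \<Longrightarrow> \<exists>T\<ge>0. \<forall>n. (\<integral>\<^sup>+x. ennreal ((norm (rep_l2 (G n) x))\<^sup>2) * indicator (cball z R \<inter> {x. T < norm (rep_l2 (G n) x)}) x \<partial>lebesgue) \<le> ennreal e"
    and weak: "\<And>H. (\<lambda>n. inner (G n) H) \<longlonglongrightarrow> inner G0 H"
    and flux: "\<And>H. (\<lambda>n. inner (mulop (\<lambda>x v. p n x *\<^sub>R v) (G n)) H) \<longlonglongrightarrow> inner F H"
    and weakstar: "\<And>g. integrable lebesgue g \<Longrightarrow> (\<lambda>n. LINT x|lebesgue. p n x * g x) \<longlonglongrightarrow> (LINT x|lebesgue. \<pi> x * g x)"
    and st: "\<And>n x. 0 \<le> s * p n x + t"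
  shows "AE x in lebesgue. x \<in> ball z R \<longrightarrow>
    0 \<le> s * (b x * h x) + t * k x - 2 * (b x * ((s *\<^sub>R rep_l2 F x + t *\<^sub>R rep_l2 G0 x) \<bullet> \<eta>)) + b x * (s * \<pi> x + t) * (norm \<eta>)\<^sup>2"
    (is "AE x in lebesgue. x \<in> ball z R \<longrightarrow> 0 \<le> ?Q x")
proof (rule AE_nonneg_on_ball[OF R(1)])
  note [measurable] = p(1) b(1) \<pi>(1)
  have [measurable]: "h \<in> borel_measurable lebesgue" "k \<in> borel_measurable lebesgue" using h k by auto
  show "?Q \<in> borel_measurable lebesgue" by measurable
  fix w :: "real^'n \<Rightarrow> real" assume wm [measurable]: "w \<in> borel_measurable lebesgue" and w: "\<And>x. 0 \<le> w x" "\<And>x. w x \<le> 1"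
  let ?\<psi> = "bump z R"
  have test: "?\<psi> \<in> test_functions \<Omega>" by (rule test_function_bump[OF R])
  have \<psi>m [measurable]: "?\<psi> \<in> borel_measurable lebesgue" by (rule sq_integrableD(1)[OF test_function_grad_integrable(2)[OF test]])
  have K0: "0 \<le> K" using b(2,3)[of z] by linarith
  \<comment> \<open>The full weight: the given \<open>b\<close>, the arbitrary measurable
    \<open>w\<close> and the cutoff.\<close>
  define g where "g x = b x * w x * ?\<psi> x" for x
  have gm [measurable]: "g \<in> borel_measurable lebesgue" unfolding g_def by measurable
  have g0: "0 \<le> g x" for x by (simp add: g_def b w bump_nonneg)
  have g\<psi>: "g x \<le> K * ?\<psi> x" for x
  proof -
    have "b x * w x \<le> K * 1" using b w K0 by (intro mult_mono) auto
    then show ?thesis unfolding g_def using mult_right_mono[OF _ bump_nonneg[of z R x]] by fastforce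
  qed
  have gK: "g x \<le> K" for x using g\<psi>[of x] mult_left_mono[OF bump_le1[of z R x] K0] by linarith
  have gi: "integrable lebesgue g"
    by (rule Bochner_Integration.integrable_bound[OF integrable_mult_right[OF test_function_grad_integrable(1)[OF test], of K] gm])
       (use g0 g\<psi> K0 in \<open>simp add: abs_mult bump_nonneg\<close>)
  have Hsq: "sq_integrable lebesgue (\<lambda>x. g x *\<^sub>R \<eta>)"
  proof (rule sq_integrable_bound[OF test_function_grad_integrable(2)[OF test], where C="K * norm \<eta>"])
    show "AE x in lebesgue. norm (g x *\<^sub>R \<eta>) \<le> K * norm \<eta> * norm (?\<psi> x)"
    proof (rule AE_I2)
      fix x show "norm (g x *\<^sub>R \<eta>) \<le> K * norm \<eta> * norm (?\<psi> x)"
        using mult_right_mono[OF g\<psi>[of x], of "norm \<eta>"] g0[of x] by (simp add: bump_nonneg mult_ac)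
    qed
  qed measurable
  define H where "H = abs_l2 (\<lambda>x. g x *\<^sub>R \<eta>)"
  have Sp: "pointwise_op (\<lambda>x (v::real^'n). p n x *\<^sub>R v)" for n by (rule pointwise_op_scale[OF p])
  have innerH: "inner Y H = (LINT x|lebesgue. g x * (rep_l2 Y x \<bullet> \<eta>))" "integrable lebesgue (\<lambda>x. g x * (rep_l2 Y x \<bullet> \<eta>))" for Y
    using inner_abs_l2[OF rep_l2_sq[of Y] Hsq] integrable_inner_sq[OF rep_l2_sq[of Y] Hsq] by (simp_all add: H_def)
  have innerS: "inner (mulop (\<lambda>x v. p n x *\<^sub>R v) (G n)) H = (LINT x|lebesgue. p n x * (g x * (rep_l2 (G n) x \<bullet> \<eta>)))" for n
    using inner_abs_l2[OF pointwise_op_sq[OF Sp rep_l2_sq[of "G n"]] Hsq, of n] by (simp add: H_def mulop_def mult_ac)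
  have pint: "integrable lebesgue (\<lambda>x. p n x * f x)" if f: "integrable lebesgue f" for f n
  proof (rule Bochner_Integration.integrable_bound[OF integrable_mult_right[OF f, of a2]])
    have [measurable]: "f \<in> borel_measurable lebesgue" using f by auto
    show "(\<lambda>x. p n x * f x) \<in> borel_measurable lebesgue" by measurable
    show "AE x in lebesgue. norm (p n x * f x) \<le> norm (a2 * f x)"
    proof (rule AE_I2)
      fix x have "\<bar>p n x\<bar> \<le> \<bar>a2\<bar>" using p(2)[of n x] by linarith
      then show "norm (p n x * f x) \<le> norm (a2 * f x)" by (simp add: abs_mult mult_right_mono)
    qed
  qed
  have \<pi>int: "integrable lebesgue (\<lambda>x. \<pi> x * g x)"
  proof (rule Bochner_Integration.integrable_bound[OF integrable_mult_right[OF gi, of L]])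
    show "AE x in lebesgue. norm (\<pi> x * g x) \<le> norm (L * g x)"
    proof (rule AE_I2)
      fix x have "\<bar>\<pi> x\<bar> \<le> \<bar>L\<bar>" using \<pi>(2)[of x] by linarith
      then show "norm (\<pi> x * g x) \<le> norm (L * g x)" by (simp add: abs_mult mult_right_mono)
    qed
  qed measurable
  let ?q = "\<lambda>n x. (norm (rep_l2 (G n) x))\<^sup>2"
  have qi: "integrable lebesgue (?q n)" for n by (rule sq_integrableD(2)[OF rep_l2_sq])
  have gq: "integrable lebesgue (\<lambda>x. g x * ?q n x)" for n
  proof (rule Bochner_Integration.integrable_bound[OF integrable_mult_right[OF qi[of n], of K]])
    show "AE x in lebesgue. norm (g x * ?q n x) \<le> norm (K * ?q n x)"
      using g0 gK K0 by (intro AE_I2) (simp add: abs_mult mult_right_mono)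
  qed measurable
  have bw: "(\<lambda>x. b x * w x) \<in> borel_measurable lebesgue" "\<And>x. \<bar>b x * w x\<bar> \<le> K * 1"
  proof -
    show "(\<lambda>x. b x * w x) \<in> borel_measurable lebesgue" by measurable
    fix x
    have "b x * w x \<le> K * 1" using b w K0 by (intro mult_mono) auto
    then show "\<bar>b x * w x\<bar> \<le> K * 1" using b w by (simp add: abs_mult)
  qed
  have bK: "\<And>n x. \<bar>b x\<bar> \<le> K" and w1: "\<And>x. \<bar>w x\<bar> \<le> 1" using b w by auto
  \<comment> \<open>Here \<open>b\<close> is part of the measurable weight, since the energy density
    with coefficient \<open>p n\<close> converges without it.\<close>
  have l1: "(\<lambda>n. LINT x|lebesgue. p n x * (g x * ?q n x)) \<longlonglongrightarrow> (LINT x|lebesgue. h x * g x)"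
    using distributional_imp_weak_L1[OF R p h limp equi bw] by (simp add: g_def mult_ac)
  \<comment> \<open>Here \<open>b\<close> belongs to the convergent density, whose limit is
    \<open>k\<close>, and only \<open>w\<close> is the weight. Therefore \<open>k\<close> carries no
    factor \<open>b\<close> in the limit expression.\<close>
  have l2: "(\<lambda>n. LINT x|lebesgue. g x * ?q n x) \<longlonglongrightarrow> (LINT x|lebesgue. k x * (w x * ?\<psi> x))"
    using distributional_imp_weak_L1[OF R b(1) bK k limb equi wm w1] by (simp add: g_def mult_ac)
  have l3: "(\<lambda>n. LINT x|lebesgue. p n x * (g x * (rep_l2 (G n) x \<bullet> \<eta>))) \<longlonglongrightarrow> (LINT x|lebesgue. g x * (rep_l2 F x \<bullet> \<eta>))"
    using flux[of H] unfolding innerS unfolding innerH(1) .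
  have l4: "(\<lambda>n. LINT x|lebesgue. g x * (rep_l2 (G n) x \<bullet> \<eta>)) \<longlonglongrightarrow> (LINT x|lebesgue. g x * (rep_l2 G0 x \<bullet> \<eta>))"
    using weak[of H] by (simp add: innerH)
  note l5 = weakstar[OF gi]
  let ?I = "\<lambda>n. s * (LINT x|lebesgue. p n x * (g x * ?q n x)) + t * (LINT x|lebesgue. g x * ?q n x)
      - 2 * (s * (LINT x|lebesgue. p n x * (g x * (rep_l2 (G n) x \<bullet> \<eta>))) + t * (LINT x|lebesgue. g x * (rep_l2 (G n) x \<bullet> \<eta>)))
      + (s * (LINT x|lebesgue. p n x * g x) + t * (LINT x|lebesgue. g x)) * (norm \<eta>)\<^sup>2"
  let ?J = "s * (LINT x|lebesgue. h x * g x) + t * (LINT x|lebesgue. k x * (w x * ?\<psi> x))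
      - 2 * (s * (LINT x|lebesgue. g x * (rep_l2 F x \<bullet> \<eta>)) + t * (LINT x|lebesgue. g x * (rep_l2 G0 x \<bullet> \<eta>)))
      + (s * (LINT x|lebesgue. \<pi> x * g x) + t * (LINT x|lebesgue. g x)) * (norm \<eta>)\<^sup>2"
  have lim: "?I \<longlonglongrightarrow> ?J" by (intro tendsto_intros l1 l2 l3 l4 l5)
  have I0: "0 \<le> ?I n" for n
  proof -
    have "?I n = (LINT x|lebesgue. s * (p n x * (g x * ?q n x)) + t * (g x * ?q n x)
      - 2 * (s * (p n x * (g x * (rep_l2 (G n) x \<bullet> \<eta>))) + t * (g x * (rep_l2 (G n) x \<bullet> \<eta>)))
      + (s * (p n x * g x) + t * g x) * (norm \<eta>)\<^sup>2)"
      using pint[OF gq[of n], of n] gq[of n] pint[OF innerH(2)[of "G n"], of n] innerH(2)[of "G n"] pint[OF gi, of n] gi by simp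
    also have "\<dots> = (LINT x|lebesgue. g x * (s * p n x + t) * (norm (rep_l2 (G n) x - \<eta>))\<^sup>2)"
      by (intro Bochner_Integration.integral_cong refl)
         (simp add: power2_norm_eq_inner algebra_simps inner_commute)
    also have "0 \<le> \<dots>" by (intro Bochner_Integration.integral_nonneg mult_nonneg_nonneg g0 st) simp
    finally show ?thesis .
  qed
  have J0: "0 \<le> ?J" by (rule LIMSEQ_le_const[OF lim]) (use I0 in blast)
  have hg: "integrable lebesgue (\<lambda>x. h x * g x)"
  proof (rule Bochner_Integration.integrable_bound[OF integrable_mult_right[OF h, of K]])
    show "AE x in lebesgue. norm (h x * g x) \<le> norm (K * h x)"
      using g0 gK K0 by (intro AE_I2) (simp add: abs_mult mult_right_mono mult.commute)
  qed measurable
  have kw: "integrable lebesgue (\<lambda>x. k x * (w x * ?\<psi> x))"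
  proof (rule Bochner_Integration.integrable_bound[OF k])
    show "AE x in lebesgue. norm (k x * (w x * ?\<psi> x)) \<le> norm (k x)"
    proof (rule AE_I2)
      fix x have "w x * ?\<psi> x \<le> 1" by (intro mult_le_one w bump_nonneg bump_le1)
      then show "norm (k x * (w x * ?\<psi> x)) \<le> norm (k x)"
        by (simp add: abs_mult w bump_nonneg mult_left_le)
    qed
  qed measurable
  have Qeq: "?Q x * (w x * ?\<psi> x) = s * (h x * g x) + t * (k x * (w x * ?\<psi> x))
      - 2 * (s * (g x * (rep_l2 F x \<bullet> \<eta>)) + t * (g x * (rep_l2 G0 x \<bullet> \<eta>)))
      + (s * (\<pi> x * g x) + t * g x) * (norm \<eta>)\<^sup>2" for x
    by (simp add: g_def inner_add_left) (simp add: algebra_simps)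
  show "integrable lebesgue (\<lambda>x. ?Q x * (w x * ?\<psi> x)) \<and> 0 \<le> (LINT x|lebesgue. ?Q x * (w x * ?\<psi> x))"
    unfolding Qeq using hg kw innerH(2) \<pi>int gi J0 by simp
qed

section \<open>The pointwise inequality\<close>

text \<open>The limit density of b (s a + t) |u' - \<eta>|^2, where a is the oscillating
  coefficient, u' the oscillating gradient with limit \<xi>, and \<pi> the weak* limit of a. The
  matrix \<open>B\<close> already contains the factor b.\<close>

definition quad :: "real \<Rightarrow> real \<Rightarrow> real \<Rightarrow> real \<Rightarrow> real^'n^'n \<Rightarrow> real^'n^'n \<Rightarrow> real^'n \<Rightarrow> real^'n \<Rightarrow> real" where
  "quad s t \<beta> \<pi> A B \<xi> \<eta> = s * (\<beta> * ((A *v \<xi>) \<bullet> \<xi>)) + t * ((B *v \<xi>) \<bullet> \<xi>)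
    - 2 * (\<beta> * ((s *\<^sub>R (A *v \<xi>) + t *\<^sub>R \<xi>) \<bullet> \<eta>)) + \<beta> * (s * \<pi> + t) * (norm \<eta>)\<^sup>2"

lemma mat_class_scalar_ge:
  assumes "(\<lambda>x. b x *\<^sub>R mat 1 :: real^'n^'n) \<in> mat_class b1 b2 \<Omega>"
  shows "AE x in lebesgue_on \<Omega>. b1 \<le> b x"
proof -
  have "AE x in lebesgue_on \<Omega>. \<forall>\<xi>::real^'n. ((b x *\<^sub>R mat 1) *v \<xi>) \<bullet> \<xi> \<ge> b1 * (norm \<xi>)\<^sup>2"
    using assms unfolding mat_class_def by (auto elim: eventually_mono)
  then show ?thesis
  proof eventually_elim
    case (elim x)
    \<comment> \<open>Any unit vector reduces the matrix inequality to the scalar one.\<close>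
    from elim[THEN spec, of "axis undefined 1"] show ?case
      by (simp add: scaleR_matrix_vector_assoc[symmetric] power2_norm_eq_inner inner_axis_axis)
  qed
qed

text \<open>Outside \<open>\<Omega>\<close> the coefficients equal \<open>a2\<close>, which matches
  the zero extension of the volume fraction; the convergence therefore holds against integrable
  functions on the whole space.\<close>

lemma phase_weak_star:
  fixes \<Omega> :: "(real^'n) set"
  assumes m: "\<Omega> \<in> sets lebesgue" and \<omega>: "\<And>n. \<omega> n \<in> sets lebesgue" "\<And>n. \<omega> n \<subseteq> \<Omega>"
    and ws: "Linf_weak_star_converges \<Omega> (\<lambda>n. indicat_real (\<omega> n)) \<theta>"
    and \<theta>': "\<theta>' \<in> borel_measurable lebesgue" "\<And>x. norm (\<theta>' x) \<le> K" "\<And>x. x \<notin> \<Omega> \<Longrightarrow> \<theta>' x = 0"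
      "AE x in lebesgue. x \<in> \<Omega> \<longrightarrow> \<theta>' x = \<theta> x"
    and g: "integrable lebesgue g"
  shows "(\<lambda>n. LINT x|lebesgue. phase a1 a2 (\<omega> n) x * g x) \<longlonglongrightarrow> (LINT x|lebesgue. (a2 - (a2 - a1) * \<theta>' x) * g x)"
proof -
  have gm [measurable]: "g \<in> borel_measurable lebesgue" using g by auto
  note [measurable] = \<theta>'(1)
  have "integrable lebesgue (\<lambda>x. indicat_real \<Omega> x *\<^sub>R g x)" by (rule integrable_mult_indicator[OF m g])
  then have "integrable (lebesgue_on \<Omega>) g" using m by (simp add: integrable_restrict_space)
  then have "g \<in> L1 \<Omega>" by (simp add: L1_def)
  then have L: "(\<lambda>n. LINT x|lebesgue_on \<Omega>. indicat_real (\<omega> n) x * g x) \<longlonglongrightarrow> (LINT x|lebesgue_on \<Omega>. \<theta> x * g x)"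
    using ws[unfolded Linf_weak_star_converges_def, THEN conjunct2, THEN conjunct2] by blast
  have \<theta>m: "\<theta> \<in> borel_measurable (lebesgue_on \<Omega>)"
    using ws[unfolded Linf_weak_star_converges_def, THEN conjunct2, THEN conjunct1] by (simp add: Linf_def)
  have e1: "(LINT x|lebesgue_on \<Omega>. indicat_real (\<omega> n) x * g x) = (LINT x|lebesgue. indicat_real (\<omega> n) x * g x)" for n
    unfolding lint_on_eq[OF m] using \<omega>(2)[of n]
    by (intro Bochner_Integration.integral_cong) (auto simp: indicator_def)
  have "(LINT x|lebesgue_on \<Omega>. \<theta> x * g x) = (LINT x|lebesgue_on \<Omega>. \<theta>' x * g x)"
  proof (rule integral_cong_AE)
    show "(\<lambda>x. \<theta> x * g x) \<in> borel_measurable (lebesgue_on \<Omega>)"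
      by (rule borel_measurable_times[OF \<theta>m measurable_restrict_space1[OF gm]])
    show "(\<lambda>x. \<theta>' x * g x) \<in> borel_measurable (lebesgue_on \<Omega>)"
      by (rule borel_measurable_times[OF measurable_restrict_space1[OF \<theta>'(1)] measurable_restrict_space1[OF gm]])
    show "AE x in lebesgue_on \<Omega>. \<theta> x * g x = \<theta>' x * g x"
      unfolding AE_on_iff[OF m] using \<theta>'(4) by eventually_elim simp
  qed
  also have "\<dots> = (LINT x|lebesgue. \<theta>' x * g x)"
    unfolding lint_on_eq[OF m] by (intro Bochner_Integration.integral_cong) (auto simp: indicator_def \<theta>'(3))
  finally have e2: "(LINT x|lebesgue_on \<Omega>. \<theta> x * g x) = (LINT x|lebesgue. \<theta>' x * g x)" .
  have i1: "integrable lebesgue (\<lambda>x. indicat_real (\<omega> n) x * g x)" for n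
    using integrable_mult_indicator[OF \<omega>(1) g, of n] by simp
  have i2: "integrable lebesgue (\<lambda>x. \<theta>' x * g x)"
  proof (rule Bochner_Integration.integrable_bound[OF integrable_mult_right[OF g, of K]])
    show "AE x in lebesgue. norm (\<theta>' x * g x) \<le> norm (K * g x)"
    proof (rule AE_I2)
      fix x have "\<bar>\<theta>' x\<bar> \<le> \<bar>K\<bar>" using \<theta>'(2)[of x] by simp
      then show "norm (\<theta>' x * g x) \<le> norm (K * g x)" by (simp add: abs_mult mult_right_mono)
    qed
  qed measurable
  have "(\<lambda>n. a2 * (LINT x|lebesgue. g x) - (a2 - a1) * (LINT x|lebesgue. indicat_real (\<omega> n) x * g x)) \<longlonglongrightarrow>
      a2 * (LINT x|lebesgue. g x) - (a2 - a1) * (LINT x|lebesgue. \<theta>' x * g x)"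
    using L unfolding e1 e2 by (intro tendsto_intros)
  moreover have "a2 * (LINT x|lebesgue. g x) - (a2 - a1) * (LINT x|lebesgue. indicat_real (\<omega> n) x * g x) =
      (LINT x|lebesgue. phase a1 a2 (\<omega> n) x * g x)" for n
  proof -
    have "a2 * (LINT x|lebesgue. g x) - (a2 - a1) * (LINT x|lebesgue. indicat_real (\<omega> n) x * g x) =
        (LINT x|lebesgue. a2 * g x - (a2 - a1) * (indicat_real (\<omega> n) x * g x))"
      using g i1 by simp
    also have "\<dots> = (LINT x|lebesgue. phase a1 a2 (\<omega> n) x * g x)"
      by (intro Bochner_Integration.integral_cong refl) (simp add: phase_def algebra_simps)
    finally show ?thesis .
  qed
  moreover have "a2 * (LINT x|lebesgue. g x) - (a2 - a1) * (LINT x|lebesgue. \<theta>' x * g x) =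
      (LINT x|lebesgue. (a2 - (a2 - a1) * \<theta>' x) * g x)"
  proof -
    have "a2 * (LINT x|lebesgue. g x) - (a2 - a1) * (LINT x|lebesgue. \<theta>' x * g x) =
        (LINT x|lebesgue. a2 * g x - (a2 - a1) * (\<theta>' x * g x))"
      using g i2 by simp
    also have "\<dots> = (LINT x|lebesgue. (a2 - (a2 - a1) * \<theta>' x) * g x)"
      by (intro Bochner_Integration.integral_cong refl) (simp add: algebra_simps)
    finally show ?thesis .
  qed
  ultimately show ?thesis by simp
qed

text \<open>The oscillating solutions with limit \<open>\<phi>0\<close> deliver all convergences
  required. At this stage the exceptional null set may depend on \<open>\<phi>0\<close> and
  \<open>\<eta>\<close>.\<close>

lemma quad_nonneg_test:
  fixes \<Omega> :: "(real^'n) set" and Astar Bsharp :: "real^'n \<Rightarrow> real^'n^'n"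
  assumes \<Omega>: "open \<Omega>" "bounded \<Omega>" and a: "0 < a1" "a1 < a2" and b1: "0 < b1"
    and \<omega>: "\<And>n. \<omega> n \<in> sets lebesgue" "\<And>n. \<omega> n \<subseteq> \<Omega>"
    and ws: "Linf_weak_star_converges \<Omega> (\<lambda>n. indicat_real (\<omega> n)) \<theta>"
    and H: "H_converges \<Omega> (\<lambda>n. two_phase a1 a2 (\<omega> n)) Astar"
    and b: "b \<in> Linf \<Omega>" "(\<lambda>x. b x *\<^sub>R mat 1 :: real^'n^'n) \<in> mat_class b1 b2 \<Omega>"
    and rel: "converges_relative \<Omega> (\<lambda>n. two_phase a1 a2 (\<omega> n)) (\<lambda>n x. b x *\<^sub>R mat 1) Bsharp"
    and st: "0 \<le> s * a1 + t" "0 \<le> s * a2 + t"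
    and R: "0 < R" "cball z R \<subseteq> \<Omega>" and \<phi>0: "\<phi>0 \<in> test_functions \<Omega>"
  shows "AE x in lebesgue. x \<in> ball z R \<longrightarrow>
    0 \<le> quad s t (b x) (a2 - (a2 - a1) * \<theta> x) (Astar x) (Bsharp x) (grad \<phi>0 x) \<eta>"
proof -
  have m: "\<Omega> \<in> sets lebesgue" using \<Omega> by auto
  from H[unfolded H_converges_def, THEN conjunct1] obtain \<alpha> \<beta> where Am: "Astar \<in> mat_class \<alpha> \<beta> \<Omega>" by blast
  obtain A' KA where A': "A' \<in> borel_measurable lebesgue" "\<And>x. norm (A' x) \<le> KA" "\<And>x. x \<notin> \<Omega> \<Longrightarrow> A' x = 0"
    "AE x in lebesgue. x \<in> \<Omega> \<longrightarrow> A' x = Astar x" by (rule mat_class_bounded_version[OF m Am]) (rule that)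
  have BL: "Bsharp \<in> Linf \<Omega>" using rel[unfolded converges_relative_def, THEN conjunct1] .
  obtain B' KB where B': "B' \<in> borel_measurable lebesgue" "\<And>x. norm (B' x) \<le> KB" "\<And>x. x \<notin> \<Omega> \<Longrightarrow> B' x = 0"
    "AE x in lebesgue. x \<in> \<Omega> \<longrightarrow> B' x = Bsharp x" by (rule Linf_bounded_version[OF m BL]) (rule that)
  obtain b0 Kb where b0: "b0 \<in> borel_measurable lebesgue" "\<And>x. norm (b0 x) \<le> Kb" "\<And>x. x \<notin> \<Omega> \<Longrightarrow> b0 x = 0"
    "AE x in lebesgue. x \<in> \<Omega> \<longrightarrow> b0 x = b x" by (rule Linf_bounded_version[OF m b(1)]) (rule that)
  have \<theta>L: "\<theta> \<in> Linf \<Omega>" using ws[unfolded Linf_weak_star_converges_def, THEN conjunct2, THEN conjunct1] .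
  obtain \<theta>' K\<theta> where \<theta>': "\<theta>' \<in> borel_measurable lebesgue" "\<And>x. norm (\<theta>' x) \<le> K\<theta>" "\<And>x. x \<notin> \<Omega> \<Longrightarrow> \<theta>' x = 0"
    "AE x in lebesgue. x \<in> \<Omega> \<longrightarrow> \<theta>' x = \<theta> x" by (rule Linf_bounded_version[OF m \<theta>L]) (rule that)
  \<comment> \<open>The limit passage needs a weight nonnegative everywhere; since b \<ge> b1 > 0
    almost everywhere in \<open>\<Omega>\<close>, the positive part is still a representative of
    \<open>b\<close> there.\<close>
  define b' where "b' x = max 0 (b0 x)" for x
  have b'm: "b' \<in> borel_measurable lebesgue" unfolding b'_def using b0(1) by measurable
  have b'0: "0 \<le> b' x" for x by (simp add: b'_def)
  have b'K: "b' x \<le> Kb" for x using b0(2)[of x] by (auto simp: b'_def)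
  have b'b: "AE x in lebesgue. x \<in> \<Omega> \<longrightarrow> b' x = b x"
    using b0(4) mat_class_scalar_ge[OF b(2)] unfolding AE_on_iff[OF m]
    by eventually_elim (use b1 in \<open>auto simp: b'_def\<close>)
  define p where "p n = phase a1 a2 (\<omega> n)" for n
  have pm: "p n \<in> borel_measurable lebesgue" for n unfolding p_def by (rule phase_measurable[OF \<omega>(1)])
  have pb: "a1 \<le> p n x" "p n x \<le> a2" for n x using phase_bounds[of a1 a2] a by (auto simp: p_def)
  have pabs: "\<bar>p n x\<bar> \<le> a2" for n x using pb[of n x] a by simp
  define F where "F = mulop (\<lambda>x v. A' x *v v) (gr (jet \<phi>0))"
  obtain X C where X: "\<And>n. X n \<in> closure (jets \<Omega>)" "\<And>n. norm (X n) \<le> C"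
    and weak: "\<And>z. (\<lambda>n. inner (X n) z) \<longlonglongrightarrow> inner (jet \<phi>0) z"
    and eq: "\<And>n Y. Y \<in> closure (jets \<Omega>) \<Longrightarrow> inner (mulop (\<lambda>x v. p n x *\<^sub>R v) (gr (X n))) (gr Y) = inner F (gr Y)"
    and test: "test_sequence \<Omega> (\<lambda>n. two_phase a1 a2 (\<omega> n)) (\<lambda>n x. fst (rep_l2 (X n) x)) (\<lambda>x. fst (rep_l2 (jet \<phi>0) x))"
    and flux: "\<And>G. (\<lambda>n. inner (mulop (\<lambda>x v. p n x *\<^sub>R v) (gr (X n))) G) \<longlonglongrightarrow> inner F G"
    by (rule oscillating_solutions[OF \<Omega> a \<omega>(1) H A' \<phi>0, folded p_def F_def]) (assumption, rule that)
  have X0: "jet \<phi>0 \<in> closure (jets \<Omega>)" using \<phi>0 closure_subset[of "jets \<Omega>"] by (auto simp: jets_def)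
  let ?G0 = "gr (jet \<phi>0)"
  have Ap: "pointwise_op (\<lambda>x v. A' x *v v)" by (rule pointwise_op_matrix[OF A'(1,2)])
  have Bp: "pointwise_op (\<lambda>x v. B' x *v v)" by (rule pointwise_op_matrix[OF B'(1,2)])
  have h: "integrable lebesgue (\<lambda>x. rep_l2 F x \<bullet> rep_l2 ?G0 x)" by (rule integrable_inner_sq[OF rep_l2_sq rep_l2_sq])
  have k: "integrable lebesgue (\<lambda>x. (B' x *v rep_l2 ?G0 x) \<bullet> rep_l2 ?G0 x)"
    by (rule integrable_inner_sq[OF pointwise_op_sq[OF Bp rep_l2_sq] rep_l2_sq])
  have limb: "(\<lambda>n. LINT x|lebesgue. b' x * (norm (rep_l2 (gr (X n)) x))\<^sup>2 * \<phi> x) \<longlonglongrightarrow>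
      (LINT x|lebesgue. ((B' x *v rep_l2 ?G0 x) \<bullet> rep_l2 ?G0 x) * \<phi> x)" if \<phi>: "\<phi> \<in> test_functions \<Omega>" for \<phi>
  proof -
    let ?B = "\<lambda>x. b x *\<^sub>R mat 1 :: real^'n^'n" and ?B' = "\<lambda>x. b' x *\<^sub>R mat 1 :: real^'n^'n"
    let ?W = "\<lambda>X. weak_grad \<Omega> (\<lambda>x. fst (rep_l2 X x))"
    have D: "distr_converges \<Omega> (\<lambda>n x. (?B x *v ?W (X n) x) \<bullet> ?W (X n) x) (\<lambda>x. (Bsharp x *v ?W (jet \<phi>0) x) \<bullet> ?W (jet \<phi>0) x)"
      using rel[unfolded converges_relative_def, THEN conjunct2, THEN conjunct2, THEN spec, THEN spec, THEN mp, OF test] .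
    have L: "(\<lambda>n. LINT x|lebesgue_on \<Omega>. (?B x *v ?W (X n) x) \<bullet> ?W (X n) x * \<phi> x) \<longlonglongrightarrow>
        (LINT x|lebesgue_on \<Omega>. (Bsharp x *v ?W (jet \<phi>0) x) \<bullet> ?W (jet \<phi>0) x * \<phi> x)"
      using D[unfolded distr_converges_def, THEN conjunct2, THEN conjunct2, rule_format, OF \<phi>] .
    have Bm: "?B \<in> borel_measurable (lebesgue_on \<Omega>)" using b(2) by (simp add: mat_class_def)
    have B'm: "?B' \<in> borel_measurable lebesgue" by (intro borel_measurable_scaleR b'm borel_measurable_const)
    have BB: "AE x in lebesgue. x \<in> \<Omega> \<longrightarrow> ?B' x = ?B x" using b'b by eventually_elim simp
    have Bsm: "Bsharp \<in> borel_measurable (lebesgue_on \<Omega>)" using BL by (simp add: Linf_def)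
    have "(LINT x|lebesgue_on \<Omega>. (?B x *v ?W (X n) x) \<bullet> ?W (X n) x * \<phi> x) =
        (LINT x|lebesgue. b' x * (norm (rep_l2 (gr (X n)) x))\<^sup>2 * \<phi> x)" for n
      unfolding quadratic_lint_on[OF \<Omega> X(1) B'm Bm BB \<phi>]
      by (simp add: scaleR_matrix_vector_assoc[symmetric] power2_norm_eq_inner)
    then show ?thesis using L unfolding quadratic_lint_on[OF \<Omega> X0 B'(1) Bsm B'(4) \<phi>] by simp
  qed
  obtain L0 where L0: "\<And>x. norm (grad \<phi>0 x) \<le> L0" using test_function_grad_integrable(4)[OF \<phi>0] by blast
  have KA0: "0 \<le> KA" using A'(2)[of 0] norm_ge_zero order_trans by blast
  \<comment> \<open>The right-hand side is bounded because the limit is a test function with bounded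
    gradient; this is the \<open>K\<close> of Caccioppoli's inequality.\<close>
  have Fb: "AE x in lebesgue. norm (rep_l2 F x) \<le> KA * L0"
    using rep_mulop[OF Ap, of ?G0] rep_gr_jet[OF \<phi>0]
  proof eventually_elim
    case (elim x)
    have "norm (A' x *v grad \<phi>0 x) \<le> norm (A' x) * norm (grad \<phi>0 x)" by (rule norm_matrix_vector_le)
    also have "\<dots> \<le> KA * L0" by (intro mult_mono A' L0 KA0) simp
    finally show ?case using elim by (simp add: F_def)
  qed
  have equi: "\<exists>T\<ge>0. \<forall>n. (\<integral>\<^sup>+x. ennreal ((norm (rep_l2 (gr (X n)) x))\<^sup>2) * indicator (cball z R \<inter> {x. T < norm (rep_l2 (gr (X n)) x)}) x \<partial>lebesgue) \<le> ennreal e"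
    if "0 < e" for e
    by (rule solutions_equi_integrable[OF \<Omega>(1) compact_cball R(2) a(1) pm pb X Fb eq that])
  have weakG: "(\<lambda>n. inner (gr (X n)) G) \<longlonglongrightarrow> inner ?G0 G" for G unfolding inner_gr by (rule weak)
  have stp: "0 \<le> s * p n x + t" for n x
  proof -
    have "p n x = a1 \<or> p n x = a2" by (simp add: p_def phase_def indicator_def)
    then show ?thesis using st by auto
  qed
  have \<pi>m: "(\<lambda>x. a2 - (a2 - a1) * \<theta>' x) \<in> borel_measurable lebesgue" using \<theta>'(1) by measurable
  have \<pi>b: "\<bar>a2 - (a2 - a1) * \<theta>' x\<bar> \<le> a2 + (a2 - a1) * K\<theta>" for x
  proof -
    have "\<bar>a2 - (a2 - a1) * \<theta>' x\<bar> \<le> \<bar>a2\<bar> + \<bar>(a2 - a1) * \<theta>' x\<bar>" by (rule abs_triangle_ineq4)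
    moreover have "\<bar>(a2 - a1) * \<theta>' x\<bar> \<le> (a2 - a1) * K\<theta>"
      using mult_left_mono[OF \<theta>'(2)[of x], of "a2 - a1"] a by (simp add: abs_mult)
    ultimately show ?thesis using a by simp
  qed
  have limp: "(\<lambda>n. LINT x|lebesgue. p n x * (norm (rep_l2 (gr (X n)) x))\<^sup>2 * \<phi> x) \<longlonglongrightarrow>
      (LINT x|lebesgue. (rep_l2 F x \<bullet> rep_l2 ?G0 x) * \<phi> x)" if "\<phi> \<in> test_functions \<Omega>" for \<phi>
    by (rule energy_converges[OF \<Omega> pm pabs X X0 weak eq flux that])
  have wst: "(\<lambda>n. LINT x|lebesgue. p n x * g x) \<longlonglongrightarrow> (LINT x|lebesgue. (a2 - (a2 - a1) * \<theta>' x) * g x)"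
    if "integrable lebesgue g" for g
    unfolding p_def by (rule phase_weak_star[OF m \<omega> ws \<theta>' that])
  have sub: "ball z R \<subseteq> \<Omega>" using R(2) ball_subset_cball by blast
  have Q: "AE x in lebesgue. x \<in> ball z R \<longrightarrow>
      0 \<le> s * (b' x * (rep_l2 F x \<bullet> rep_l2 ?G0 x)) + t * ((B' x *v rep_l2 ?G0 x) \<bullet> rep_l2 ?G0 x)
        - 2 * (b' x * ((s *\<^sub>R rep_l2 F x + t *\<^sub>R rep_l2 ?G0 x) \<bullet> \<eta>)) + b' x * (s * (a2 - (a2 - a1) * \<theta>' x) + t) * (norm \<eta>)\<^sup>2"
    by (rule limit_quadratic_nonneg[OF R pm pabs b'm b'0 b'K \<pi>m \<pi>b h k limp limb equi weakG flux wst stp])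
  show ?thesis
    using Q
      rep_mulop[OF Ap, of ?G0] rep_gr_jet[OF \<phi>0] A'(4) B'(4) b'b \<theta>'(4)
  proof eventually_elim
    case (elim x)
    show ?case
    proof
      assume x: "x \<in> ball z R"
      then have "x \<in> \<Omega>" using sub by blast
      then show "0 \<le> quad s t (b x) (a2 - (a2 - a1) * \<theta> x) (Astar x) (Bsharp x) (grad \<phi>0 x) \<eta>"
        using elim x by (simp add: quad_def F_def)
    qed
  qed
qed

lemma quad_continuous:
  fixes A B :: "real^'n^'n"
  assumes "continuous_on S f" "continuous_on S g"
  shows "continuous_on S (\<lambda>y. quad s t \<beta> \<pi> A B (f y) (g y))"
proof -
  have "continuous_on S (\<lambda>y. C *v f y)" for C :: "real^'n^'n"
    by (rule bounded_linear.continuous_on[OF matrix_vector_mul_bounded_linear assms(1)])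
  then show ?thesis unfolding quad_def by (intro continuous_intros assms)
qed

text \<open>One null set for all vectors: the inequality is imposed for a countable dense set of
  parameters and extended at each fixed point by continuity in the parameter.\<close>

lemma quad_nonneg_ball:
  fixes \<Omega> :: "(real^'n) set" and Astar Bsharp :: "real^'n \<Rightarrow> real^'n^'n"
  assumes R: "0 < R" "cball z R \<subseteq> \<Omega>"
    and test: "\<And>\<phi> \<eta>. \<phi> \<in> test_functions \<Omega> \<Longrightarrow> AE x in lebesgue. x \<in> ball z R \<longrightarrow>
      0 \<le> quad s t (\<beta> x) (\<pi> x) (A x) (B x) (grad \<phi> x) \<eta>"
  shows "AE x in lebesgue. x \<in> ball z R \<longrightarrow> (\<forall>\<xi> \<eta>. 0 \<le> quad s t (\<beta> x) (\<pi> x) (A x) (B x) \<xi> \<eta>)"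
proof -
  let ?\<psi> = "bump z R"
  \<comment> \<open>The gradient at x of the bump times an affine function. The middle parameter is
    the offset of the affine function; it allows the term with the gradient of the bump to be
    removed at any prescribed point.\<close>
  define dir where "dir x d = ?\<psi> x *\<^sub>R fst d + (fst d \<bullet> x - fst (snd d)) *\<^sub>R grad ?\<psi> x" for x and d :: "(real^'n) \<times> real \<times> (real^'n)"
  define f where "f x d = quad s t (\<beta> x) (\<pi> x) (A x) (B x) (dir x d) (snd (snd d))" for x d
  have cont: "continuous_on UNIV (f x)" for x
    unfolding f_def dir_def by (intro quad_continuous continuous_intros)
  obtain D :: "((real^'n) \<times> real \<times> (real^'n)) set" where D: "countable D" "\<And>U. open U \<Longrightarrow> U \<noteq> {} \<Longrightarrow> \<exists>d\<in>D. d \<in> U"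
    using countable_dense_setE by blast
  have one: "AE x in lebesgue. x \<in> ball z R \<longrightarrow> 0 \<le> f x d" for d
  proof -
    define \<phi> where "\<phi> x = (fst d \<bullet> x - fst (snd d)) * ?\<psi> x" for x
    have sm: "smooth (\<lambda>x. fst d \<bullet> x - fst (snd d))" by (intro smooth_diff smooth_inner smooth_const)
    have "\<phi> \<in> test_functions \<Omega>"
      unfolding \<phi>_def by (rule test_function_mult[OF test_function_bump[OF R] sm])
    moreover have "grad \<phi> x = dir x d" for x
      unfolding \<phi>_def dir_def grad_mult[OF sm smooth_bump] grad_diff[OF smooth_inner smooth_const] by simp
    ultimately show ?thesis using test[of \<phi> "snd (snd d)"] by (simp add: f_def)
  qed
  have "AE x in lebesgue. \<forall>d\<in>D. x \<in> ball z R \<longrightarrow> 0 \<le> f x d"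
    unfolding AE_ball_countable[OF D(1)] using one by blast
  then show ?thesis
  proof eventually_elim
    case (elim x)
    show ?case
    proof (intro impI allI)
      fix \<xi> \<eta> assume x: "x \<in> ball z R"
      have all: "0 \<le> f x d" for d
      proof (rule ccontr)
        assume "\<not> 0 \<le> f x d"
        then have "d \<in> {d. f x d < 0}" by (simp only: mem_Collect_eq not_le)
        then have "{d. f x d < 0} \<noteq> {}" by blast
        moreover have "open {d. f x d < 0}" by (rule open_Collect_less[OF cont continuous_on_const])
        ultimately obtain d' where "d' \<in> D" "f x d' < 0" using D(2) by blast
        then show False using elim x by force
      qed
      have "0 < ?\<psi> x" using bump_pos_iff[OF R(1)] x by blast
      \<comment> \<open>At this point the affine function vanishes, and dividing by the bump makes
        the gradient exactly \<xi>.\<close>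
      then have "dir x (\<xi> /\<^sub>R ?\<psi> x, (\<xi> /\<^sub>R ?\<psi> x) \<bullet> x, \<eta>) = \<xi>" by (simp add: dir_def)
      then show "0 \<le> quad s t (\<beta> x) (\<pi> x) (A x) (B x) \<xi> \<eta>"
        using all[of "(\<xi> /\<^sub>R ?\<psi> x, (\<xi> /\<^sub>R ?\<psi> x) \<bullet> x, \<eta>)"] by (simp add: f_def)
    qed
  qed
qed

section \<open>Linear algebra at a single point\<close>

lemma symmetric_matrix_inner:
  fixes A :: "real^'n^'n"
  assumes "transpose A = A"
  shows "(A *v x) \<bullet> y = x \<bullet> (A *v y)"
  using dot_lmul_matrix[of x A y] transpose_matrix_vector[of A x] assms by simp

text \<open>Symmetry of \<open>A\<close> passes to \<open>P\<close>, so each diagonal entry of P W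
  P, with W the inverse of \<open>M\<close>, is the form of W at the vector \<open>P e\<close>; the
  basis vector e itself serves as \<eta>.\<close>

lemma trace_bound_of_quad:
  fixes A B :: "real^'n^'n"
  assumes A: "transpose A = A" and a: "0 < a1" "a1 < a2" and \<beta>: "0 < \<beta>" and \<theta>: "0 \<le> \<theta>" "\<theta> \<le> 1"
    and Q1: "\<And>\<xi> \<eta>. 0 \<le> quad (- 1) a2 \<beta> (a2 - (a2 - a1) * \<theta>) A B \<xi> \<eta>"
    and Q2: "\<And>\<xi> \<eta>. 0 \<le> quad 1 (- a1) \<beta> (a2 - (a2 - a1) * \<theta>) A B \<xi> \<eta>"
  shows "trace (\<beta> *\<^sub>R ((a2 *\<^sub>R mat 1 - A) ** matrix_inv (a2 *\<^sub>R B - \<beta> *\<^sub>R A) ** (a2 *\<^sub>R mat 1 - A)))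
    \<le> real CARD('n) * \<theta> * (a2 - a1)"
proof -
  define P where "P = a2 *\<^sub>R mat 1 - A"
  define M where "M = a2 *\<^sub>R B - \<beta> *\<^sub>R A"
  have Pv: "P *v \<xi> = a2 *\<^sub>R \<xi> - A *v \<xi>" for \<xi>
    by (simp add: P_def matrix_vector_mult_diff_rdistrib scaleR_matrix_vector_assoc[symmetric])
  have Mv: "M *v \<xi> = a2 *\<^sub>R (B *v \<xi>) - \<beta> *\<^sub>R (A *v \<xi>)" for \<xi>
    by (simp add: M_def matrix_vector_mult_diff_rdistrib scaleR_matrix_vector_assoc[symmetric])
  have I: "0 \<le> (M *v \<xi>) \<bullet> \<xi> - 2 * \<beta> * ((P *v \<xi>) \<bullet> \<eta>) + \<beta> * \<theta> * (a2 - a1) * (norm \<eta>)\<^sup>2" for \<xi> \<eta>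
    using Q1[of \<xi> \<eta>] by (simp add: quad_def Mv Pv inner_diff_left algebra_simps)
  show ?thesis
  proof (cases "\<theta> = 0")
    case True
    have "P *v \<xi> = 0" for \<xi>
    proof (rule ccontr)
      assume n: "P *v \<xi> \<noteq> 0"
      define u where "u = (P *v \<xi>) \<bullet> (P *v \<xi>)"
      have u: "0 < u" using n by (simp add: u_def)
      \<comment> \<open>For \<theta> = 0 the inequality is affine in \<eta>; this multiple of
        \<open>P \<xi>\<close> makes its right-hand side equal to -1.\<close>
      define \<tau> where "\<tau> = ((M *v \<xi>) \<bullet> \<xi> + 1) / (2 * \<beta> * u)"
      have "2 * \<beta> * (\<tau> * u) = (M *v \<xi>) \<bullet> \<xi> + 1" using u \<beta> by (simp add: \<tau>_def)
      then show False using I[of \<xi> "\<tau> *\<^sub>R (P *v \<xi>)"] True by (simp add: u_def)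
    qed
    then have "P = 0" by (simp add: matrix_eq)
    then have "a2 *\<^sub>R mat 1 - A = 0" by (simp add: P_def)
    \<comment> \<open>With P = 0 the product vanishes whatever \<open>matrix_inv\<close> returns,
      even when \<open>M\<close> is singular.\<close>
    then have "trace (\<beta> *\<^sub>R ((a2 *\<^sub>R mat 1 - A) ** matrix_inv (a2 *\<^sub>R B - \<beta> *\<^sub>R A) ** (a2 *\<^sub>R mat 1 - A))) = 0"
      by (simp add: trace_def matrix_matrix_mult_def)
    then show ?thesis using True by simp
  next
    case False
    then have \<theta>0: "0 < \<theta>" using \<theta> by simp
    \<comment> \<open>A null vector of \<open>M\<close> is killed by \<open>P\<close> because the
      first inequality loses its \<xi>-term. Then A \<xi> = a2 \<xi> and B \<xi> = \<beta> \<xi>,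
      and the second inequality at \<eta> = \<xi> becomes - \<beta> \<theta> (a2 - a1) |\<xi>|^2
      \<ge> 0.\<close>
    have ker: "\<xi> = 0" if M0: "M *v \<xi> = 0" for \<xi>
    proof -
      have "- 2 * \<beta> * ((P *v \<xi>) \<bullet> (P *v \<xi>)) = 0"
      proof (rule linear_le_quadratic_imp_zero)
        fix \<tau>
        show "0 \<le> \<tau> * (- 2 * \<beta> * ((P *v \<xi>) \<bullet> (P *v \<xi>))) + \<tau>\<^sup>2 * (\<beta> * \<theta> * (a2 - a1) * (norm (P *v \<xi>))\<^sup>2)"
          using I[of \<xi> "\<tau> *\<^sub>R (P *v \<xi>)"] M0 by (simp add: power_mult_distrib algebra_simps)
      qed
      then have P0: "P *v \<xi> = 0" using \<beta> by simp
      have A\<xi>: "A *v \<xi> = a2 *\<^sub>R \<xi>" using P0 Pv[of \<xi>] by simp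
      have "a2 *\<^sub>R (B *v \<xi>) = a2 *\<^sub>R (\<beta> *\<^sub>R \<xi>)" using M0 Mv[of \<xi>] A\<xi> by simp
      then have B\<xi>: "B *v \<xi> = \<beta> *\<^sub>R \<xi>" by (rule scaleR_left_imp_eq[rotated]) (use a in simp)
      have "quad 1 (- a1) \<beta> (a2 - (a2 - a1) * \<theta>) A B \<xi> \<xi> = - (\<beta> * \<theta> * (a2 - a1) * (\<xi> \<bullet> \<xi>))"
        unfolding quad_def A\<xi> B\<xi> by (simp add: power2_norm_eq_inner inner_diff_left algebra_simps)
      then have "\<beta> * \<theta> * (a2 - a1) * (\<xi> \<bullet> \<xi>) \<le> 0" using Q2[of \<xi> \<xi>] by simp
      moreover have "0 < \<beta> * \<theta> * (a2 - a1)" using \<beta> \<theta>0 a by simp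
      ultimately have "\<xi> \<bullet> \<xi> \<le> 0" by (meson mult_pos_pos not_le)
      then show "\<xi> = 0" using inner_gt_zero_iff[of \<xi>] by linarith
    qed
    then have inv: "invertible M" using matrix_left_invertible_ker[of M] invertible_left_inverse[of M] by blast
    define W where "W = matrix_inv M"
    have MW: "M *v (W *v v) = v" for v
    proof -
      have "M ** W = mat 1"
        using someI_ex[OF inv[unfolded invertible_def]] by (simp add: W_def matrix_inv_def)
      then show ?thesis by (simp add: matrix_vector_mul_assoc)
    qed
    have sym: "transpose P = P" using A by (simp add: P_def transpose_def mat_def vec_eq_iff)
    have diag: "\<beta> * ((P ** W ** P) $ i $ i) \<le> \<theta> * (a2 - a1)" for i
    proof -
      let ?e = "axis i 1 :: real^'n"
      let ?v = "P *v ?e"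
      have "(P ** W ** P) $ i $ i = ?e \<bullet> ((P ** W ** P) *v ?e)"
        by (simp add: inner_axis' matrix_vector_mult_basis column_def)
      also have "\<dots> = ?e \<bullet> (P *v (W *v ?v))" by (simp add: matrix_vector_mul_assoc matrix_mul_assoc)
      also have "\<dots> = ?v \<bullet> (W *v ?v)" by (rule symmetric_matrix_inner[OF sym, symmetric])
      finally have e: "(P ** W ** P) $ i $ i = ?v \<bullet> (W *v ?v)" .
      have W\<beta>: "W *v (\<beta> *\<^sub>R ?v) = \<beta> *\<^sub>R (W *v ?v)" by (rule matrix_vector_mult_scaleR)
      have "(P *v (W *v ?v)) \<bullet> ?e = (W *v ?v) \<bullet> ?v" by (rule symmetric_matrix_inner[OF sym])
      \<comment> \<open>The minimiser in \<xi> for \<eta> = e: the linear term doubles the form of W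
        and the quadratic one restores it once, up to the common factor \<beta>.\<close>
      then have "0 \<le> \<beta> * (\<theta> * (a2 - a1) - \<beta> * (?v \<bullet> (W *v ?v)))"
        using I[of "W *v (\<beta> *\<^sub>R ?v)" ?e] unfolding MW
        unfolding W\<beta> matrix_vector_mult_scaleR
        by (simp add: inner_commute[of "W *v ?v"] algebra_simps)
      then show ?thesis using \<beta> by (simp add: e zero_le_mult_iff)
    qed
    have "trace (\<beta> *\<^sub>R (P ** W ** P)) = (\<Sum>i\<in>UNIV. \<beta> * ((P ** W ** P) $ i $ i))" by (simp add: trace_def)
    also have "\<dots> \<le> (\<Sum>i\<in>(UNIV::'n set). \<theta> * (a2 - a1))" by (intro sum_mono diag)
    also have "\<dots> = real CARD('n) * \<theta> * (a2 - a1)" by simp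
    finally show ?thesis by (simp add: P_def W_def M_def)
  qed
qed

theorem mainTheorem2:
  fixes \<Omega> :: "(real^'n) set"
    and a1 a2 b1 b2 :: real
    and \<omega> :: "nat \<Rightarrow> (real^'n) set"
    and \<theta> b :: "real^'n \<Rightarrow> real"
    and Astar Bsharp :: "real^'n \<Rightarrow> real^'n^'n"
  assumes "open \<Omega>" and "bounded \<Omega>"
    and "0 < a1" and "a1 < a2"
    and "0 < b1" and "b1 \<le> b2"
    and "\<And>n. \<omega> n \<in> sets lebesgue" and "\<And>n. \<omega> n \<subseteq> \<Omega>"
    and "AE x in lebesgue_on \<Omega>. 0 \<le> \<theta> x \<and> \<theta> x \<le> 1"
    and "Linf_weak_star_converges \<Omega> (\<lambda>n. indicat_real (\<omega> n)) \<theta>"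
    and "H_converges \<Omega> (\<lambda>n. two_phase a1 a2 (\<omega> n)) Astar"
    and "b \<in> Linf \<Omega>"
    and "(\<lambda>x. b x *\<^sub>R mat 1) \<in> mat_class b1 b2 \<Omega>"
    and "converges_relative \<Omega> (\<lambda>n. two_phase a1 a2 (\<omega> n)) (\<lambda>n x. b x *\<^sub>R mat 1) Bsharp"
  shows "AE x in lebesgue_on \<Omega>.
           trace (b x *\<^sub>R ((a2 *\<^sub>R mat 1 - Astar x)
                    ** matrix_inv (a2 *\<^sub>R Bsharp x - b x *\<^sub>R Astar x)
                    ** (a2 *\<^sub>R mat 1 - Astar x)))
           \<le> real CARD('n) * \<theta> x * (a2 - a1)"
proof -
  have m: "\<Omega> \<in> sets lebesgue" using assms(1) by auto
  \<comment> \<open>The factor s a + t is affine in the coefficient, so its sign at the two phases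
    decides.\<close>
  have quad: "AE x in lebesgue. x \<in> \<Omega> \<longrightarrow> (\<forall>\<xi> \<eta>. 0 \<le> quad s t (b x) (a2 - (a2 - a1) * \<theta> x) (Astar x) (Bsharp x) \<xi> \<eta>)"
    if st: "0 \<le> s * a1 + t" "0 \<le> s * a2 + t" for s t
  proof (rule AE_open_from_balls[OF assms(1)])
    fix z R assume R: "0 < R" "cball z R \<subseteq> \<Omega>"
    show "AE x in lebesgue. x \<in> ball z R \<longrightarrow> (\<forall>\<xi> \<eta>. 0 \<le> quad s t (b x) (a2 - (a2 - a1) * \<theta> x) (Astar x) (Bsharp x) \<xi> \<eta>)"
      by (rule quad_nonneg_ball[OF R]) (rule quad_nonneg_test[OF assms(1-5,7,8,10-14) st R])
  qed
  from assms(11)[unfolded H_converges_def, THEN conjunct1] obtain \<alpha> \<beta> where Am: "Astar \<in> mat_class \<alpha> \<beta> \<Omega>" by blast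
  have sym: "AE x in lebesgue_on \<Omega>. transpose (Astar x) = Astar x"
    using Am unfolding mat_class_def by (auto elim: eventually_mono)
  \<comment> \<open>The pairs vanish at one phase each: the factor is a2 - a here and a - a1 in
    \<open>q2\<close>.\<close>
  have q1: "AE x in lebesgue. x \<in> \<Omega> \<longrightarrow> (\<forall>\<xi> \<eta>. 0 \<le> quad (- 1) a2 (b x) (a2 - (a2 - a1) * \<theta> x) (Astar x) (Bsharp x) \<xi> \<eta>)"
    by (rule quad) (use assms(4) in auto)
  have q2: "AE x in lebesgue. x \<in> \<Omega> \<longrightarrow> (\<forall>\<xi> \<eta>. 0 \<le> quad 1 (- a1) (b x) (a2 - (a2 - a1) * \<theta> x) (Astar x) (Bsharp x) \<xi> \<eta>)"
    by (rule quad) (use assms(4) in auto)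
  show ?thesis
    using sym mat_class_scalar_ge[OF assms(13)] assms(9) q1 q2 unfolding AE_on_iff[OF m]
  proof eventually_elim
    case (elim x)
    show ?case
    proof
      assume x: "x \<in> \<Omega>"
      show "trace (b x *\<^sub>R ((a2 *\<^sub>R mat 1 - Astar x) ** matrix_inv (a2 *\<^sub>R Bsharp x - b x *\<^sub>R Astar x) ** (a2 *\<^sub>R mat 1 - Astar x)))
          \<le> real CARD('n) * \<theta> x * (a2 - a1)"
        by (rule trace_bound_of_quad[OF _ assms(3,4)]) (use elim x assms(5) in auto)
    qed
  qed
qed

end
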